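(* For every $k\ge1$, the map sending $1\otimes J$ to $(J,J)^\infty\in\mathcal T^\infty_{4k-2}$, for rooted trees $J$ of order $k-1$, defines an isomorphism $$\mathbb Z_2\otimes\mathsf L_k\;\cong\;\ker\bigl(\eta_{4k-2}:\mathcal T^\infty_{4k-2}\to\mathsf D_{4k-2}\bigr).$$
   Context: Trees. Fix $m\ge 1$. A tree is a finite unitrivalent tree with a cyclic ordering of the edges at each trivalent vertex (its orientation) and univalent vertices labeled by elements of $\{1,\dots,m\}$, up to isomorphism; its order is its number of trivalent vertices. A rooted tree has in addition one unlabeled univalent vertex, the root. For rooted trees $I,J$, the rooted product $(I,J)$ glues the two roots to a new trivalent vertex with a new root edge, oriented according to the order $I,J$; the inner product $\langle I,J\rangle$ is the unrooted tree obtained by gluing the two roots to a single non-vertex point. AS relations: reversing the cyclic order at one trivalent vertex changes the sign. IHX relations: $I-H+X=0$ for trees identical except that $I,H,X$ contain the rooted subtrees $((A,B),C)$, $(A,(B,C))$, $(B,(A,C))$ respectively. For a rooted tree $J$, the $\infty$-tree $J^\infty$ is obtained by labeling the root with the twist symbol $\infty$. $\mathcal T^\infty_{2n}$ is the free abelian group on order $2n$ trees and order $n$ $\infty$-trees modulo: AS and IHX relations on order $2n$ trees; $(-J)^\infty=J^\infty$, where $-J$ differs from $J$ by reversing the cyclic order at an odd number of vertices; $I^\infty=H^\infty+X^\infty-\langle H,X\rangle$ for order $n$ rooted trees $I,H,X$ identical except for containing the subtrees $((A,B),C)$, $(A,(B,C))$, $(B,(A,C))$ respectively; and $2\cdot J^\infty=\langle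 J,J\rangle$. $\mathsf L_n$ is the degree $n$ part of the free Lie $\mathbb Z$-algebra on degree 1 generators $X_1,\dots,X_m$; rooted trees of order $n-1$ are identified with brackets, giving elements of $\mathsf L_n$ (so $\mathsf L_n$ is generated by rooted trees of order $n-1$ modulo IHX and the relations $[X,X]=0$). $\mathsf D_n=\ker(\mathsf L_1\otimes\mathsf L_{n+1}\to\mathsf L_{n+2})$ is the kernel of the bracket map. The homomorphism $\eta_n:\mathcal T^\infty_n\to\mathsf D_n$ is defined on a tree $t$ by $\eta_n(t)=\sum_v X_{\ell(v)}\otimes T_v(t)$, summing over univalent vertices $v$ with label $\ell(v)$, $T_v(t)$ being the rooted tree obtained by replacing $v$ with a root, and on $\infty$-trees by $\eta_n(J^\infty)=\frac12\eta_n(\langle J,J\rangle)$ (all coefficients of $\eta_n(\langle J,J\rangle)$ are even). *)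

theory Defs
  imports "HOL-Algebra.Free_Abelian_Groups"
begin

section \<open>Rooted trees\<close>

text \<open>
  The root gives every trivalent vertex a preferred incident edge, so that a cyclic ordering of
  the three edges amounts to a linear ordering of the two edges pointing away from the root. Rooted
  oriented labeled trees up to isomorphism are thus the bracketings of labels: \<open>Leaf l\<close> is
  the single edge from the root to a vertex labeled \<open>l\<close>, and \<open>Br I J\<close> is the
  rooted product \<open>(I, J)\<close>, with cyclic ordering root edge, \<open>I\<close>, \<open>J\<close> at
  the new vertex.
\<close>

datatype rtree = Leaf nat | Br rtree rtree

primrec labels :: "rtree \<Rightarrow> nat set" where
  "labels (Leaf l) = {l}"
| "labels (Br I J) = labels I \<union> labels J"

primrec order_rt :: "rtree \<Rightarrow> nat" where
  "order_rt (Leaf l) = 0"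
| "order_rt (Br I J) = Suc (order_rt I + order_rt J)"

definition rtrees :: "nat \<Rightarrow> rtree set" where
  "rtrees m = {J. labels J \<subseteq> {1..m}}"

text \<open>\<open>reorient r J J'\<close>: \<open>J'\<close> arises from \<open>J\<close> by reversing the
  cyclic ordering at exactly \<open>r\<close> trivalent vertices.\<close>

inductive reorient :: "nat \<Rightarrow> rtree \<Rightarrow> rtree \<Rightarrow> bool" where
  "reorient 0 (Leaf l) (Leaf l)"
| "reorient a I I' \<Longrightarrow> reorient b J J' \<Longrightarrow> reorient (a + b) (Br I J) (Br I' J')"
| "reorient a I I' \<Longrightarrow> reorient b J J' \<Longrightarrow> reorient (Suc (a + b)) (Br I J) (Br J' I')"

inductive ihx_rooted :: "rtree \<Rightarrow> rtree \<Rightarrow> rtree \<Rightarrow> bool" where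
  "ihx_rooted (Br (Br A B) C) (Br A (Br B C)) (Br B (Br A C))"
| "ihx_rooted I H X \<Longrightarrow> ihx_rooted (Br I K) (Br H K) (Br X K)"
| "ihx_rooted I H X \<Longrightarrow> ihx_rooted (Br K I) (Br K H) (Br K X)"


section \<open>Unrooted trees\<close>

text \<open>
  Every finite tree is isomorphic to one whose vertices are natural numbers. As trees are simple
  graphs, the edges at a vertex correspond to its neighbours: \<open>nxt G v u\<close> is the neighbour
  of \<open>v\<close> following \<open>u\<close> in the cyclic ordering at the trivalent vertex
  \<open>v\<close>. The fields \<open>nxt\<close> and \<open>lab\<close> carry no information away from
  trivalent and univalent vertices, respectively.
\<close>

record pretree =
  verts :: "nat set"
  adj :: "(nat \<times> nat) set"
  nxt :: "nat \<Rightarrow> nat \<Rightarrow> nat"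
  lab :: "nat \<Rightarrow> nat"

definition nbrs :: "pretree \<Rightarrow> nat \<Rightarrow> nat set" where
  "nbrs G v = {u. (v, u) \<in> adj G}"

definition univalent :: "pretree \<Rightarrow> nat set" where
  "univalent G = {v \<in> verts G. card (nbrs G v) = 1}"

definition trivalent :: "pretree \<Rightarrow> nat set" where
  "trivalent G = {v \<in> verts G. card (nbrs G v) = 3}"

definition is_cycle :: "pretree \<Rightarrow> nat list \<Rightarrow> bool" where
  "is_cycle G p \<longleftrightarrow> length p \<ge> 3 \<and> distinct p \<and>
     successively (\<lambda>u v. (u, v) \<in> adj G) p \<and> (last p, hd p) \<in> adj G"

text \<open>A map on a three element set without fixed points whose third iterate is the identity
  is a cyclic permutation of that set.\<close>

definition is_tree :: "nat \<Rightarrow> pretree \<Rightarrow> bool" where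
  "is_tree m G \<longleftrightarrow>
     finite (verts G) \<and> verts G \<noteq> {} \<and>
     adj G \<subseteq> verts G \<times> verts G \<and> sym (adj G) \<and> irrefl (adj G) \<and>
     (\<forall>u\<in>verts G. \<forall>v\<in>verts G. (u, v) \<in> (adj G)\<^sup>*) \<and> (\<nexists>p. is_cycle G p) \<and>
     verts G = univalent G \<union> trivalent G \<and>
     (\<forall>v\<in>trivalent G. \<forall>u\<in>nbrs G v.
        nxt G v u \<in> nbrs G v \<and> nxt G v u \<noteq> u \<and> nxt G v (nxt G v (nxt G v u)) = u) \<and>
     (\<forall>v\<in>univalent G. lab G v \<in> {1..m})"

definition tree_iso :: "pretree \<Rightarrow> pretree \<Rightarrow> bool" where
  "tree_iso G H \<longleftrightarrow> (\<exists>f. bij_betw f (verts G) (verts H) \<and>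
     (\<forall>u\<in>verts G. \<forall>v\<in>verts G. (u, v) \<in> adj G \<longleftrightarrow> (f u, f v) \<in> adj H) \<and>
     (\<forall>v\<in>trivalent G. \<forall>u\<in>nbrs G v. f (nxt G v u) = nxt H (f v) (f u)) \<and>
     (\<forall>v\<in>univalent G. lab H (f v) = lab G v))"

definition iso_class :: "nat \<Rightarrow> pretree \<Rightarrow> pretree set" where
  "iso_class m G = {H. is_tree m H \<and> tree_iso G H}"

definition trees :: "nat \<Rightarrow> nat \<Rightarrow> pretree set" where
  "trees m N = {G. is_tree m G \<and> card (trivalent G) = N}"

text \<open>The inverse of a 3-cycle is its square.\<close>

definition reverse_at :: "nat \<Rightarrow> pretree \<Rightarrow> pretree" where
  "reverse_at v G = G\<lparr>nxt := (nxt G)(v := (\<lambda>u. nxt G v (nxt G v u)))\<rparr>"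

text \<open>\<open>branch G u w J\<close>: cutting \<open>G\<close> at an interior point of the edge from
  \<open>u\<close> to \<open>w\<close>, the part containing \<open>w\<close>, rooted at the cut point, is
  \<open>J\<close>. For univalent \<open>u\<close> this is also the rooted tree obtained by replacing
  \<open>u\<close> with a root.\<close>

inductive branch :: "pretree \<Rightarrow> nat \<Rightarrow> nat \<Rightarrow> rtree \<Rightarrow> bool" for G where
  "(u, w) \<in> adj G \<Longrightarrow> w \<in> univalent G \<Longrightarrow> branch G u w (Leaf (lab G w))"
| "(u, w) \<in> adj G \<Longrightarrow> w \<in> trivalent G \<Longrightarrow>
   branch G w (nxt G w u) I \<Longrightarrow> branch G w (nxt G w (nxt G w u)) J \<Longrightarrow> branch G u w (Br I J)"

definition rooted_at :: "pretree \<Rightarrow> nat \<Rightarrow> rtree" where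
  "rooted_at G v = (THE T. \<exists>w. branch G v w T)"

text \<open>The inner product as an isomorphism class: a tree is the result of gluing the roots of
  \<open>I\<close> and \<open>J\<close> to a non-vertex point iff cutting it at an interior point of some
  edge yields \<open>I\<close> and \<open>J\<close>.\<close>

definition inner_prod :: "nat \<Rightarrow> rtree \<Rightarrow> rtree \<Rightarrow> pretree set" where
  "inner_prod m I J = {G. is_tree m G \<and> (\<exists>u w. branch G w u I \<and> branch G u w J)}"


section \<open>Presentations of abelian groups and tensor products\<close>

text \<open>The extension of a map \<open>g\<close> on a basis to a homomorphism from the free abelian
  group to the abelian group \<open>H\<close>, and the map it induces on cosets.\<close>

definition free_ext :: "('b, 'c) monoid_scheme \<Rightarrow> ('a \<Rightarrow> 'b) \<Rightarrow> ('a \<Rightarrow>\<^sub>0 int) \<Rightarrow> 'b" where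
  "free_ext H g x = (\<Otimes>\<^bsub>H\<^esub>a\<in>Poly_Mapping.keys x. g a [^]\<^bsub>H\<^esub> Poly_Mapping.lookup x a)"

definition coset_ext :: "('b, 'c) monoid_scheme \<Rightarrow> ('a \<Rightarrow> 'b) \<Rightarrow> ('a \<Rightarrow>\<^sub>0 int) set \<Rightarrow> 'b" where
  "coset_ext H g X = the_elem (free_ext H g ` X)"

definition tensor_rels ::
  "('a, 'c) monoid_scheme \<Rightarrow> ('b, 'd) monoid_scheme \<Rightarrow> ('a \<times> 'b \<Rightarrow>\<^sub>0 int) set" where
  "tensor_rels A B = generate (free_Abelian_group (carrier A \<times> carrier B))
     ({frag_of (a \<otimes>\<^bsub>A\<^esub> a', b) - frag_of (a, b) - frag_of (a', b) | a a' b.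
         a \<in> carrier A \<and> a' \<in> carrier A \<and> b \<in> carrier B} \<union>
      {frag_of (a, b \<otimes>\<^bsub>B\<^esub> b') - frag_of (a, b) - frag_of (a, b') | a b b'.
         a \<in> carrier A \<and> b \<in> carrier B \<and> b' \<in> carrier B})"

definition tensor ::
  "('a, 'c) monoid_scheme \<Rightarrow> ('b, 'd) monoid_scheme \<Rightarrow> ('a \<times> 'b \<Rightarrow>\<^sub>0 int) set monoid" where
  "tensor A B = free_Abelian_group (carrier A \<times> carrier B) Mod tensor_rels A B"

definition pure_tensor ::
  "('a, 'c) monoid_scheme \<Rightarrow> ('b, 'd) monoid_scheme \<Rightarrow> 'a \<Rightarrow> 'b \<Rightarrow> ('a \<times> 'b \<Rightarrow>\<^sub>0 int) set" where
  "pure_tensor A B a b =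
     tensor_rels A B #>\<^bsub>free_Abelian_group (carrier A \<times> carrier B)\<^esub> frag_of (a, b)"


section \<open>The free Lie algebra over the integers\<close>

text \<open>The free nonassociative algebra on generators \<open>1, \<dots>, m\<close> is the free abelian group on
  \<open>rtrees m\<close> with the bilinear extension of \<open>Br\<close> as product.\<close>

definition br :: "(rtree \<Rightarrow>\<^sub>0 int) \<Rightarrow> (rtree \<Rightarrow>\<^sub>0 int) \<Rightarrow> (rtree \<Rightarrow>\<^sub>0 int)" where
  "br x y = frag_extend (\<lambda>I. frag_extend (\<lambda>J. frag_of (Br I J)) y) x"

abbreviation free_alg :: "nat \<Rightarrow> (rtree \<Rightarrow>\<^sub>0 int) monoid" where
  "free_alg m \<equiv> free_Abelian_group (rtrees m)"

text \<open>The two-sided ideal generated by all \<open>[x, x]\<close> and all Jacobi expressions.\<close>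

inductive_set lie_ideal :: "nat \<Rightarrow> (rtree \<Rightarrow>\<^sub>0 int) set" for m where
  zero: "0 \<in> lie_ideal m"
| diff: "x \<in> lie_ideal m \<Longrightarrow> y \<in> lie_ideal m \<Longrightarrow> x - y \<in> lie_ideal m"
| left: "x \<in> carrier (free_alg m) \<Longrightarrow> y \<in> lie_ideal m \<Longrightarrow> br x y \<in> lie_ideal m"
| right: "x \<in> lie_ideal m \<Longrightarrow> y \<in> carrier (free_alg m) \<Longrightarrow> br x y \<in> lie_ideal m"
| alternating: "x \<in> carrier (free_alg m) \<Longrightarrow> br x x \<in> lie_ideal m"
| jacobi: "x \<in> carrier (free_alg m) \<Longrightarrow> y \<in> carrier (free_alg m) \<Longrightarrow> z \<in> carrier (free_alg m) \<Longrightarrow>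
    br x (br y z) + br y (br z x) + br z (br x y) \<in> lie_ideal m"

definition free_lie :: "nat \<Rightarrow> (rtree \<Rightarrow>\<^sub>0 int) set monoid" where
  "free_lie m = free_alg m Mod lie_ideal m"

definition lie_class :: "nat \<Rightarrow> (rtree \<Rightarrow>\<^sub>0 int) \<Rightarrow> (rtree \<Rightarrow>\<^sub>0 int) set" where
  "lie_class m x = lie_ideal m #>\<^bsub>free_alg m\<^esub> x"

definition lie_bracket ::
  "nat \<Rightarrow> (rtree \<Rightarrow>\<^sub>0 int) set \<Rightarrow> (rtree \<Rightarrow>\<^sub>0 int) set \<Rightarrow> (rtree \<Rightarrow>\<^sub>0 int) set" where
  "lie_bracket m X Y = (\<Union>x\<in>X. \<Union>y\<in>Y. lie_class m (br x y))"

text \<open>The degree \<open>n\<close> part; a bracket of degree \<open>n\<close> is a rooted tree of order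
  \<open>n - 1\<close>.\<close>

definition L_deg :: "nat \<Rightarrow> nat \<Rightarrow> (rtree \<Rightarrow>\<^sub>0 int) set monoid" where
  "L_deg m n = free_lie m
     \<lparr>carrier := lie_class m ` carrier (free_Abelian_group {J \<in> rtrees m. order_rt J + 1 = n})\<rparr>"

definition D_deg :: "nat \<Rightarrow> nat \<Rightarrow> ((rtree \<Rightarrow>\<^sub>0 int) set \<times> (rtree \<Rightarrow>\<^sub>0 int) set \<Rightarrow>\<^sub>0 int) set monoid" where
  "D_deg m n = (let T = tensor (L_deg m 1) (L_deg m (n + 1)) in
     T\<lparr>carrier := kernel T (L_deg m (n + 2))
          (coset_ext (L_deg m (n + 2)) (\<lambda>(X, Y). lie_bracket m X Y))\<rparr>)"


section \<open>The twisted tree groups\<close>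

datatype generator = Tree "pretree set" | Twisted rtree

text \<open>For even \<open>N\<close>, the generators of order \<open>N\<close>: isomorphism classes of trees
  of order \<open>N\<close> and twisted trees \<open>J\<^sup>\<infinity>\<close> with \<open>J\<close> of order
  \<open>N / 2\<close>.\<close>

definition generators :: "nat \<Rightarrow> nat \<Rightarrow> generator set" where
  "generators m N = {Tree (iso_class m G) | G. G \<in> trees m N} \<union>
     {Twisted J | J. J \<in> rtrees m \<and> 2 * order_rt J = N}"

definition as_rels :: "nat \<Rightarrow> nat \<Rightarrow> (generator \<Rightarrow>\<^sub>0 int) set" where
  "as_rels m N = {frag_of (Tree (iso_class m G)) + frag_of (Tree (iso_class m (reverse_at v G))) | G v.
     G \<in> trees m N \<and> v \<in> trivalent G}"

text \<open>Trees that are identical except for one rooted subtree are the inner products of these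
  subtrees with a common rooted tree \<open>K\<close>.\<close>

definition ihx_rels :: "nat \<Rightarrow> nat \<Rightarrow> (generator \<Rightarrow>\<^sub>0 int) set" where
  "ihx_rels m N =
     {frag_of (Tree (inner_prod m (Br (Br A B) C) K)) -
      frag_of (Tree (inner_prod m (Br A (Br B C)) K)) +
      frag_of (Tree (inner_prod m (Br B (Br A C)) K)) | A B C K.
      {A, B, C, K} \<subseteq> rtrees m \<and> order_rt (Br (Br A B) C) + order_rt K = N}"

definition twisted_rels :: "nat \<Rightarrow> nat \<Rightarrow> (generator \<Rightarrow>\<^sub>0 int) set" where
  "twisted_rels m N =
     {frag_of (Twisted J') - frag_of (Twisted J) | J J' r.
        J \<in> rtrees m \<and> 2 * order_rt J = N \<and> odd r \<and> reorient r J J'} \<union>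
     {frag_of (Twisted I) - frag_of (Twisted H) - frag_of (Twisted X) +
        frag_of (Tree (inner_prod m H X)) | I H X.
        I \<in> rtrees m \<and> 2 * order_rt I = N \<and> ihx_rooted I H X} \<union>
     {frag_cmul 2 (frag_of (Twisted J)) - frag_of (Tree (inner_prod m J J)) | J.
        J \<in> rtrees m \<and> 2 * order_rt J = N}"

definition T_inf_rels :: "nat \<Rightarrow> nat \<Rightarrow> (generator \<Rightarrow>\<^sub>0 int) set" where
  "T_inf_rels m N = generate (free_Abelian_group (generators m N))
     (as_rels m N \<union> ihx_rels m N \<union> twisted_rels m N)"

text \<open>This is \<open>\<T>\<^sup>\<infinity>\<^sub>N\<close> for even \<open>N\<close> only.\<close>

definition T_inf :: "nat \<Rightarrow> nat \<Rightarrow> (generator \<Rightarrow>\<^sub>0 int) set monoid" where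
  "T_inf m N = free_Abelian_group (generators m N) Mod T_inf_rels m N"

definition T_inf_class :: "nat \<Rightarrow> nat \<Rightarrow> generator \<Rightarrow> (generator \<Rightarrow>\<^sub>0 int) set" where
  "T_inf_class m N t = T_inf_rels m N #>\<^bsub>free_Abelian_group (generators m N)\<^esub> frag_of t"


section \<open>The homomorphism \<open>\<eta>\<close>\<close>

text \<open>The formal sum of the pairs \<open>(\<ell>(v), T\<^sub>v(t))\<close>; it does not depend on the
  representative of the isomorphism class. For an \<open>\<infinity>\<close>-tree its coefficients, which
  are even, are halved.\<close>

definition eta_sum :: "pretree \<Rightarrow> (nat \<times> rtree \<Rightarrow>\<^sub>0 int)" where
  "eta_sum G = (\<Sum>v\<in>univalent G. frag_of (lab G v, rooted_at G v))"

fun eta_formal :: "nat \<Rightarrow> generator \<Rightarrow> (nat \<times> rtree \<Rightarrow>\<^sub>0 int)" where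
  "eta_formal m (Tree t) = the_elem (eta_sum ` t)"
| "eta_formal m (Twisted J) =
     Poly_Mapping.map (\<lambda>c. c div 2) (the_elem (eta_sum ` inner_prod m J J))"

definition eta_gen ::
  "nat \<Rightarrow> nat \<Rightarrow> generator \<Rightarrow> ((rtree \<Rightarrow>\<^sub>0 int) set \<times> (rtree \<Rightarrow>\<^sub>0 int) set \<Rightarrow>\<^sub>0 int) set" where
  "eta_gen m N t = free_ext (tensor (L_deg m 1) (L_deg m (N + 1)))
     (\<lambda>(l, J). pure_tensor (L_deg m 1) (L_deg m (N + 1))
        (lie_class m (frag_of (Leaf l))) (lie_class m (frag_of J)))
     (eta_formal m t)"

definition eta ::
  "nat \<Rightarrow> nat \<Rightarrow> (generator \<Rightarrow>\<^sub>0 int) set \<Rightarrow>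
     ((rtree \<Rightarrow>\<^sub>0 int) set \<times> (rtree \<Rightarrow>\<^sub>0 int) set \<Rightarrow>\<^sub>0 int) set" where
  "eta m N = coset_ext (D_deg m N) (eta_gen m N)"

end

theory Submission
  imports Defs "HOL.Modules" "HOL-Library.Multiset" "HOL-Library.Product_Plus"
begin

text \<open>
  Modulo the elements \<open>(J, J)\<^sup>\<infinity>\<close>, the inner product \<open>\<langle>I, J\<rangle>\<close> is the universal
  invariant symmetric bilinear form \<open>P\<close> on the free Lie ring and \<open>J\<^sup>\<infinity>\<close> is its universal
  quadratic refinement \<open>S\<close>. Inside the free associative ring the target of \<open>\<eta>\<close> consists of the
  rotation invariant elements whose left quotients by letters are Lie elements; there
  \<open>\<langle>I, J\<rangle>\<close> becomes the sum of all rotations of the product \<open>I J\<close>, and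
  \<open>J\<^sup>\<infinity>\<close> half of this sum for \<open>I = J\<close>. The correspondence between the values of \<open>P\<close>,
  \<open>S\<close> and these elements is a bijection, by induction on the number of letters: by Lazard
  elimination of a letter \<open>x\<close>, all brackets but \<open>x\<close> lie in the free Lie ring on the
  \<open>ad\<^sub>x\<^sup>j y\<close> with \<open>y \<noteq> x\<close>, on which \<open>ad\<^sub>x\<close> acts as a derivation \<open>\<delta>\<close>, and invariance makes
  \<open>P\<close> and \<open>S\<close> vanish on the image of \<open>\<delta>\<close>. Hence the \<open>(J, J)\<^sup>\<infinity>\<close> generate the kernel
  of \<open>\<eta>\<close>.

  Sending trees to zero and \<open>J\<^sup>\<infinity>\<close> to \<open>J\<close> maps the twisted tree group to the reduction modulo two
  of the free quasi-Lie ring, where \<open>[J, J]\<close> need not vanish. This takes \<open>(J, J)\<^sup>\<infinity>\<close> to \<open>[J, J]\<close>,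
  and squaring is injective on \<open>\<int>\<^sub>2 \<otimes> L\<close> by the same elimination.
\<close>

section \<open>Additive maps and spans\<close>

text \<open>The classes \<open>(J, J)\<^sup>\<infinity>\<close> have order at most two, so nothing
  can be decided rationally, and the group of values of \<open>P\<close> and \<open>S\<close> is not
  known in advance to be torsion free. The matching of polynomials with values is therefore kept as
  a subgroup of a product, and it has to be shown single valued and everywhere defined at the same
  time: a polynomial with zero remainder modulo \<delta> is \<open>\<delta> q\<close>, and its value
  is 0 only once \<open>q\<close> is known to have a value, one elimination further down. Since
  elimination pulls \<open>P\<close> and \<open>S\<close> back, the induction ranges over all such
  forms.

  The relations of the twisted tree group do not kill trees with a subtree \<open>(A, A)\<close>
  outright. In even order most of this follows: an IHX relation with two equal terms removes the
  inner products, and a quadratic relation with two equal terms removes the \<infinity>-trees,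
  unless \<open>(A, A)\<close> is the whole tree carrying the symbol \<infinity>. That exception is
  the source of the kernel. The index 4k - 2 is twice 2(k - 1) + 1, the order of
  \<open>(J, J)\<close>.\<close>

definition zmul :: "int \<Rightarrow> 'g \<Rightarrow> 'g::ab_group_add" where
  "zmul n g = (if 0 \<le> n then (\<Sum>i<nat n. g) else - (\<Sum>i<nat (- n). g))"

lemma zmul_0 [simp]: "zmul 0 g = 0" and zmul_1 [simp]: "zmul 1 g = g"
  by (simp_all add: zmul_def lessThan_Suc)

lemma zmul_Suc: "zmul (n + 1) g = zmul n g + g"
proof -
  consider k where "n = int k" | k where "n = - int (Suc k)"
    by (metis int_cases)
  then show ?thesis
  proof cases
    case 1
    then have "nat (n + 1) = Suc k" by simp
    with 1 show ?thesis by (simp add: zmul_def)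
  next
    case 2
    then have "nat (- n) = Suc k" "nat (- (n + 1)) = k" by simp_all
    with 2 show ?thesis by (cases k) (auto simp: zmul_def)
  qed
qed

lemma zmul_add: "zmul (m + n) g = zmul m g + zmul n g"
proof (induction n rule: int_induct[where k = 0])
  case (step1 i)
  then show ?case using zmul_Suc[of "m + i" g] zmul_Suc[of i g] by (simp add: algebra_simps)
next
  case (step2 i)
  then show ?case using zmul_Suc[of "m + (i - 1)" g] zmul_Suc[of "i - 1" g]
    by (simp add: algebra_simps)
qed simp

text \<open>The target is an arbitrary type of abelian groups, because polynomials, sums of trees,
  formal sums of generators and the quotient type \<open>tgroup\<close> all occur as
  targets.\<close>

definition lin :: "('a \<Rightarrow> 'g::ab_group_add) \<Rightarrow> ('a \<Rightarrow>\<^sub>0 int) \<Rightarrow> 'g" where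
  "lin f x = (\<Sum>i\<in>Poly_Mapping.keys x. zmul (Poly_Mapping.lookup x i) (f i))"

lemma lin_superset:
  assumes "finite A" "Poly_Mapping.keys x \<subseteq> A"
  shows "lin f x = (\<Sum>i\<in>A. zmul (Poly_Mapping.lookup x i) (f i))"
  unfolding lin_def using assms by (intro sum.mono_neutral_left) (auto simp: in_keys_iff)

lemma lin_0 [simp]: "lin f 0 = 0" and lin_of [simp]: "lin f (frag_of a) = f a"
  by (simp_all add: lin_def)

lemma lin_add: "lin f (x + y) = lin f x + lin f y"
proof -
  let ?A = "Poly_Mapping.keys x \<union> Poly_Mapping.keys y"
  have "lin f (x + y) = (\<Sum>i\<in>?A. zmul (Poly_Mapping.lookup (x + y) i) (f i))"
    by (rule lin_superset) (auto simp: keys_add)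
  also have "\<dots> = lin f x + lin f y"
    by (simp add: lookup_add zmul_add sum.distrib lin_superset[of ?A])
  finally show ?thesis .
qed

lemma additive_lin: "additive (lin f)"
  by (simp add: additive_def lin_add)

lemma additive_compose: "additive f \<Longrightarrow> additive g \<Longrightarrow> additive (\<lambda>x. f (g x))"
  by (simp add: additive_def)

lemma additiveI: "(\<And>x y. f (x + y) = f x + f y) \<Longrightarrow> additive f"
  by (simp add: additive_def)

lemmas lin_diff = additive.diff[OF additive_lin]
  and lin_minus = additive.minus[OF additive_lin]
  and lin_sum = additive.sum[OF additive_lin]

lemma frag_ind [case_names zero one diff]:
  "P 0 \<Longrightarrow> (\<And>a. P (frag_of a)) \<Longrightarrow> (\<And>a b. P a \<Longrightarrow> P b \<Longrightarrow> P (a - b)) \<Longrightarrow> P c"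
  by (rule frag_induction[of c UNIV P]) auto

lemma additive_eqI:
  assumes "additive f" "additive g" "\<And>a. f (frag_of a) = g (frag_of a)"
  shows "f x = g x"
  by (induction x rule: frag_ind)
     (simp_all add: assms additive.zero additive.diff)

lemma additive_eq_lin: "additive f \<Longrightarrow> f x = lin (\<lambda>a. f (frag_of a)) x"
  by (rule additive_eqI) (auto simp: additive_lin)

lemma lin_cong_keys: "(\<And>a. a \<in> Poly_Mapping.keys x \<Longrightarrow> f a = g a) \<Longrightarrow> lin f x = lin g x"
  by (simp add: lin_def)

lemma additive_eq_keys:
  assumes "additive f" "additive g"
    "\<And>a. a \<in> Poly_Mapping.keys x \<Longrightarrow> f (frag_of a) = g (frag_of a)"
  shows "f x = g x"
  unfolding additive_eq_lin[OF assms(1), of x] additive_eq_lin[OF assms(2), of x]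
  by (rule lin_cong_keys) (rule assms(3))

text \<open>Closure under differences alone covers sums and negatives, so that every induction over
  a span has just three cases.\<close>

inductive_set zspan :: "'g::ab_group_add set \<Rightarrow> 'g set" for S where
  zspan_0: "0 \<in> zspan S"
| zspan_base: "s \<in> S \<Longrightarrow> s \<in> zspan S"
| zspan_diff: "a \<in> zspan S \<Longrightarrow> b \<in> zspan S \<Longrightarrow> a - b \<in> zspan S"

lemma zspan_uminus: "a \<in> zspan S \<Longrightarrow> - a \<in> zspan S"
  using zspan_diff[OF zspan_0] by fastforce

lemma zspan_add: "a \<in> zspan S \<Longrightarrow> b \<in> zspan S \<Longrightarrow> a + b \<in> zspan S"
  using zspan_diff[of a S "- b"] zspan_uminus by fastforce

lemma zspan_sum: "(\<And>i. i \<in> A \<Longrightarrow> f i \<in> zspan S) \<Longrightarrow> sum f A \<in> zspan S"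
  by (induction A rule: infinite_finite_induct) (auto intro: zspan_0 zspan_add)

lemma zspan_image:
  assumes "x \<in> zspan S" "additive f" "\<And>s. s \<in> S \<Longrightarrow> f s \<in> zspan T"
  shows "f x \<in> zspan T"
  using assms(1)
  by induction (auto simp: assms additive.zero additive.diff intro: zspan_0 zspan_diff)

lemma zspan_mono: "S \<subseteq> zspan T \<Longrightarrow> zspan S \<subseteq> zspan T"
  using zspan_image[of _ S "\<lambda>x. x" T] by (auto intro: additiveI)

lemma zspan_image2:
  assumes "x \<in> zspan S" "y \<in> zspan T" "\<And>b. additive (\<lambda>a. f a b)" "\<And>a. additive (f a)"
    "\<And>s t. s \<in> S \<Longrightarrow> t \<in> T \<Longrightarrow> f s t \<in> zspan U"
  shows "f x y \<in> zspan U"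
  by (rule zspan_image[OF assms(1,3)], rule zspan_image[OF assms(2,4)], rule assms(5))

lemma zspan_zero_image:
  assumes "x \<in> zspan S" "additive f" "\<And>s. s \<in> S \<Longrightarrow> f s = 0"
  shows "f x = 0"
  using assms(1) by induction (auto simp: assms additive.zero additive.diff)

lemma zmul_zspan: "a \<in> zspan S \<Longrightarrow> zmul n a \<in> zspan S"
  by (auto simp: zmul_def intro!: zspan_sum zspan_uminus)

text \<open>Replaces an element of a span by a formal combination; in this way Lie elements acquire
  representing sums of trees.\<close>

lemma zspan_image_witness:
  assumes "x \<in> zspan (f ` A)"
  obtains u where "Poly_Mapping.keys u \<subseteq> A" "x = lin f u"
proof -
  have "\<exists>u. Poly_Mapping.keys u \<subseteq> A \<and> x = lin f u"
    using assms
  proof induction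
    case zspan_0
    show ?case by (rule exI[of _ 0]) simp
  next
    case (zspan_base s)
    then obtain a where "a \<in> A" "s = f a" by blast
    then show ?case by (intro exI[of _ "frag_of a"]) simp
  next
    case (zspan_diff a b)
    then obtain u v where "Poly_Mapping.keys u \<subseteq> A" "a = lin f u" "Poly_Mapping.keys v \<subseteq> A" "b = lin f v"
      by blast
    then show ?case using keys_diff[of u v] by (intro exI[of _ "u - v"]) (auto simp: lin_diff)
  qed
  then show ?thesis using that by blast
qed

section \<open>The free associative algebra\<close>

text \<open>With concatenation as addition of exponents, the convolution product on
  \<open>nat list \<Rightarrow>\<^sub>0 int\<close> is the multiplication of the free associative
  ring, and its ring laws come from the class instances.\<close>

instantiation list :: (type) monoid_add
begin

definition zero_list_def: "0 = []"

definition plus_list_def: "xs + ys = xs @ ys"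

instance by standard (simp_all add: zero_list_def plus_list_def)

end

type_synonym ncpoly = "nat list \<Rightarrow>\<^sub>0 int"

abbreviation X :: "nat \<Rightarrow> ncpoly" where
  "X a \<equiv> frag_of [a]"

lemma frag_of_mult: "(frag_of u :: ncpoly) * frag_of v = frag_of (u @ v)"
  by (simp add: mult_single plus_list_def)

lemma one_ncpoly: "(1 :: ncpoly) = frag_of []"
  by (simp add: single_one[symmetric] zero_list_def)

lemma frag_of_Cons: "frag_of (a # u) = X a * frag_of u"
  by (simp add: frag_of_mult)

lemma additive_times [intro]: "additive (\<lambda>x. (a::'r::ring) * x)"
  "additive (\<lambda>x. x * (a::'r::ring))"
  by (auto intro: additiveI simp: algebra_simps)

definition comm :: "'r \<Rightarrow> 'r \<Rightarrow> 'r::ring" where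
  "comm a b = a * b - b * a"

lemma comm_add: "comm (a + b) c = comm a c + comm b c" "comm a (b + c) = comm a b + comm a c"
  and comm_diff: "comm (a - b) c = comm a c - comm b c" "comm a (b - c) = comm a b - comm a c"
  and comm_minus: "comm (- a) b = - comm a b" "comm a (- b) = - comm a b"
  and comm_0 [simp]: "comm 0 a = 0" "comm a 0 = 0" "comm a a = 0"
  and comm_anti: "comm a b = - comm b a"
  and comm_jacobi: "comm (comm a b) c = comm a (comm b c) - comm b (comm a c)"
  by (simp_all add: comm_def algebra_simps)

lemma additive_comm [intro]: "additive (\<lambda>x. comm a x)" "additive (\<lambda>x. comm x a)"
  by (auto intro: additiveI simp: comm_add)

section \<open>Lie elements in the free associative ring, graded by the number of letters\<close>

primrec lie :: "rtree \<Rightarrow> ncpoly" where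
  "lie (Leaf a) = X a"
| "lie (Br I J) = comm (lie I) (lie J)"

primrec mlabels :: "rtree \<Rightarrow> nat multiset" where
  "mlabels (Leaf a) = {#a#}"
| "mlabels (Br I J) = mlabels I + mlabels J"

lemma mlabels_nonempty [simp]: "mlabels I \<noteq> {#}"
  by (induction I) auto

lemma size_mlabels: "size (mlabels I) = Suc (order_rt I)"
  by (induction I) auto

text \<open>The degree is the number of leaves, one more than the order. All natural numbers serve
  as letters, since eliminating one letter from a finite alphabet already produces infinitely many
  new ones.\<close>

definition lie_span :: "nat \<Rightarrow> ncpoly set" where
  "lie_span n = zspan (lie ` {I. size (mlabels I) = n})"

definition lie_ring :: "ncpoly set" where
  "lie_ring = zspan (range lie)"

lemma lie_in_span: "size (mlabels I) = n \<Longrightarrow> lie I \<in> lie_span n"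
  by (auto simp: lie_span_def intro: zspan_base)

lemma lie_in_ring: "lie I \<in> lie_ring"
  by (auto simp: lie_ring_def intro: zspan_base)

lemma lie_span_ring: "lie_span n \<subseteq> lie_ring"
  unfolding lie_span_def lie_ring_def by (rule zspan_mono) (auto intro: zspan_base)

lemma lie_span_0 [simp]: "lie_span 0 = {0}"
proof -
  have "x = 0" if "x \<in> zspan (lie ` {})" for x
    using that by induction auto
  then show ?thesis by (auto simp: lie_span_def intro: zspan_0)
qed

lemma comm_lie_span: "a \<in> lie_span i \<Longrightarrow> b \<in> lie_span j \<Longrightarrow> comm a b \<in> lie_span (i + j)"
  unfolding lie_span_def
  by (rule zspan_image2[where f = comm, of a _ b])
     (auto intro!: zspan_base image_eqI[where f = lie, OF lie.simps(2)[symmetric]])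

lemma comm_lie_ring: "a \<in> lie_ring \<Longrightarrow> b \<in> lie_ring \<Longrightarrow> comm a b \<in> lie_ring"
  unfolding lie_ring_def
  by (rule zspan_image2[where f = comm, of a _ b])
     (auto intro!: zspan_base image_eqI[where f = lie, OF lie.simps(2)[symmetric]])

lemmas lie_ring_0 [simp, intro] = zspan_0[of "range lie", folded lie_ring_def]
  and lie_ring_add [intro] = zspan_add[of _ "range lie", folded lie_ring_def]
  and lie_ring_diff [intro] = zspan_diff[of _ "range lie", folded lie_ring_def]
  and lie_ring_uminus [intro] = zspan_uminus[of _ "range lie", folded lie_ring_def]
lemmas lie_span_zero [simp, intro] = zspan_0[of "lie ` {I. size (mlabels I) = n}" for n, folded lie_span_def]
  and lie_span_add [intro] = zspan_add[of _ "lie ` {I. size (mlabels I) = n}" for n, folded lie_span_def]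
  and lie_span_diff [intro] = zspan_diff[of _ "lie ` {I. size (mlabels I) = n}" for n, folded lie_span_def]
  and lie_span_uminus [intro] = zspan_uminus[of _ "lie ` {I. size (mlabels I) = n}" for n, folded lie_span_def]

section \<open>Rotations\<close>

definition rot :: "ncpoly \<Rightarrow> ncpoly" where
  "rot = lin (\<lambda>w. frag_of (rotate1 w))"

lemma additive_rot [intro]: "additive rot"
  by (simp add: rot_def additive_lin)

lemma rot_X [simp]: "rot (X a * b) = b * X a"
  by (rule additive_eqI[where f = "\<lambda>b. rot (X a * b)" and x = b])
     (auto intro: additive_compose additive_rot simp: frag_of_mult, simp add: rot_def)

primrec cycw :: "nat list \<Rightarrow> ncpoly \<Rightarrow> ncpoly" where
  "cycw [] b = 0"
| "cycw (a # u) b = X a * (frag_of u * b) + cycw u (b * X a)"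

text \<open>For words \<open>u, b\<close>, \<open>cyc u b\<close> is the sum of those rotations of \<open>u b\<close>
  that start with a letter of \<open>u\<close>.\<close>

definition cyc :: "ncpoly \<Rightarrow> ncpoly \<Rightarrow> ncpoly" where
  "cyc a b = lin (\<lambda>u. cycw u b) a"

lemma additive_cycw: "additive (cycw u)"
proof (induction u)
  case (Cons a u)
  show ?case
    using additive.add[OF Cons.IH]
    by (intro additiveI) (simp add: distrib_left distrib_right)
qed (auto intro: additiveI)

lemma additive_cyc [intro]: "additive (\<lambda>a. cyc a b)" "additive (cyc a)"
proof -
  show "additive (\<lambda>a. cyc a b)"
    by (simp add: cyc_def additive_lin)
  show "additive (cyc a)"
  proof (rule additiveI)
    fix x y show "cyc a (x + y) = cyc a x + cyc a y"
      by (rule additive_eqI[where x = a])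
         (auto intro!: additiveI simp: cyc_def lin_add additive.add[OF additive_cycw])
  qed
qed

lemmas cyc_simps = additive.add[OF additive_cyc(1)] additive.add[OF additive_cyc(2)]
  additive.diff[OF additive_cyc(1)] additive.diff[OF additive_cyc(2)]
  additive.minus[OF additive_cyc(1)] additive.minus[OF additive_cyc(2)]

lemma cyc_0 [simp]: "cyc 0 b = 0" "cyc a 0 = 0"
  by (simp_all add: additive.zero[OF additive_cyc(1)] additive.zero[OF additive_cyc(2)])

lemma cyc_X [simp]: "cyc (X a) b = X a * b"
  by (simp add: cyc_def one_ncpoly[symmetric])

text \<open>The rotations of \<open>u v b\<close> that start in \<open>u v\<close> split into those
  starting in \<open>u\<close>, for which \<open>v b\<close> is the remaining part, and those
  starting in \<open>v\<close>, for which \<open>u\<close> has been carried behind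
  \<open>b\<close>.\<close>

lemma cyc_mult: "cyc (u * v) b = cyc u (v * b) + cyc v (b * u)"
proof -
  have *: "cycw (u @ v) b = cycw u (frag_of v * b) + cycw v (b * frag_of u)" for u v b
  proof (induction u arbitrary: b)
    case (Cons a u)
    then show ?case
      by (simp add: frag_of_mult[of u v, symmetric] frag_of_Cons[of a u] mult.assoc)
  qed (simp add: one_ncpoly[symmetric])
  show ?thesis
  proof (rule additive_eqI[where x = u])
    fix u show "cyc (frag_of u * v) b = cyc (frag_of u) (v * b) + cyc v (b * frag_of u)"
      by (rule additive_eqI[where x = v])
        (auto intro!: additiveI simp: cyc_simps distrib_left distrib_right frag_of_mult, simp add: cyc_def *)
  qed (auto intro!: additiveI simp: cyc_simps distrib_left distrib_right)
qed

text \<open>The mixed terms of \<open>cyc_mult\<close> combine to commutators. The result is the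
  recursion obeyed by a sum over the leaves of a tree, with \<open>b\<close> standing for the part
  of the tree beyond its root.\<close>

lemma cyc_comm: "cyc (comm u v) b = cyc u (comm v b) + cyc v (comm b u)"
  by (simp add: comm_def cyc_simps cyc_mult algebra_simps)

text \<open>Telescoping: \<open>rot\<close> takes each rotation starting in \<open>u\<close> to the
  next one, so only the first, \<open>u b\<close>, and the one after the last, \<open>b u\<close>,
  remain.\<close>

lemma cyc_rot: "cyc u b - rot (cyc u b) = comm u b"
proof (rule additive_eqI[where x = u])
  fix u show "cyc (frag_of u) b - rot (cyc (frag_of u) b) = comm (frag_of u) b"
  proof (induction u arbitrary: b)
    case Nil
    have "cyc (frag_of []) b = 0" by (simp add: cyc_def)
    then show ?case by (simp add: comm_def one_ncpoly[symmetric] additive.zero[OF additive_rot])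
  next
    case (Cons a u)
    have "cyc (frag_of (a # u)) b = X a * (frag_of u * b) + cyc (frag_of u) (b * X a)"
      by (simp add: cyc_def)
    then show ?case using Cons.IH[of "b * X a"]
      by (simp add: additive.add[OF additive_rot] comm_def frag_of_Cons[of a u] algebra_simps)
  qed
qed (auto intro!: additiveI simp: cyc_simps comm_add additive.add[OF additive_rot])

definition full_cyc :: "ncpoly \<Rightarrow> ncpoly \<Rightarrow> ncpoly" where
  "full_cyc a b = cyc a b + cyc b a"

lemma rot_full_cyc: "rot (full_cyc a b) = full_cyc a b"
proof -
  have "rot (cyc a b) = cyc a b - comm a b" "rot (cyc b a) = cyc b a + comm a b"
    using cyc_rot[of a b] cyc_rot[of b a] comm_anti[of b a] by (simp_all add: algebra_simps)
  then show ?thesis by (simp add: full_cyc_def additive.add[OF additive_rot])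
qed

text \<open>\<open>cyc a a\<close> is half of \<open>full_cyc a a\<close>, and the boundary term
  \<open>comm a a\<close> vanishes. This is how an \<infinity>-tree gets its polynomial without
  denominators.\<close>

lemma rot_cyc_self: "rot (cyc a a) = cyc a a"
  using cyc_rot[of a a] by simp

lemma full_cyc_add: "full_cyc (a + b) c = full_cyc a c + full_cyc b c"
    "full_cyc a (b + c) = full_cyc a b + full_cyc a c"
  and full_cyc_diff: "full_cyc (a - b) c = full_cyc a c - full_cyc b c"
    "full_cyc a (b - c) = full_cyc a b - full_cyc a c"
  and full_cyc_commute: "full_cyc a b = full_cyc b a"
  by (simp_all add: full_cyc_def cyc_simps)

lemma full_cyc_0 [simp]: "full_cyc 0 b = 0" "full_cyc b 0 = 0"
  by (simp_all add: full_cyc_def)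

text \<open>By \<open>cyc_comm\<close> both sides expand to the same sum of three terms, which is
  symmetric under cyclic permutations of \<open>a, b, c\<close>.\<close>

lemma full_cyc_comm: "full_cyc (comm a b) c = full_cyc a (comm b c)"
  by (simp add: full_cyc_def cyc_comm)

lemma full_cyc_alt: "full_cyc a (comm a b) = 0"
  by (simp add: full_cyc_comm[symmetric])

section \<open>Left quotients\<close>

definition ldiv :: "nat \<Rightarrow> ncpoly \<Rightarrow> ncpoly" where
  "ldiv a = lin (\<lambda>w. case w of [] \<Rightarrow> 0 | b # v \<Rightarrow> if a = b then frag_of v else 0)"

lemma additive_ldiv [intro]: "additive (ldiv a)"
  by (simp add: ldiv_def additive_lin)

lemmas ldiv_simps = additive.add[OF additive_ldiv] additive.diff[OF additive_ldiv]
  additive.minus[OF additive_ldiv] additive.zero[OF additive_ldiv] additive.sum[OF additive_ldiv]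

lemma ldiv_X [simp]: "ldiv a (X b * z) = (if a = b then z else 0)"
  by (rule additive_eqI[where x = z])
     (auto intro!: additiveI simp: ldiv_simps distrib_left frag_of_mult, auto simp: ldiv_def)

lemma lookup_ldiv: "Poly_Mapping.lookup (ldiv a z) v = Poly_Mapping.lookup z (a # v)"
proof (induction z rule: frag_ind)
  case (one w)
  then show ?case by (cases w) (auto simp: ldiv_def)
qed (simp_all add: ldiv_simps lookup_minus)

lemma ncpoly_expand:
  assumes "finite A" "Poly_Mapping.lookup z [] = 0" "hd ` Poly_Mapping.keys z \<subseteq> A"
  shows "z = (\<Sum>a\<in>A. X a * ldiv a z)"
proof (rule additive_eq_keys[where x = z and f = "\<lambda>z. z"])
  fix w assume w: "w \<in> Poly_Mapping.keys z"
  then have "w \<noteq> []" using assms(2) by (auto simp: in_keys_iff)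
  then obtain b v where wb: "w = b # v" by (cases w) auto
  then have "b \<in> A" using w assms(3) by force
  have "(\<Sum>a\<in>A. X a * ldiv a (frag_of w)) = (\<Sum>a\<in>A. if a = b then frag_of w else 0)"
    by (rule sum.cong) (auto simp: wb frag_of_Cons[of b v])
  then show "frag_of w = (\<Sum>a\<in>A. X a * ldiv a (frag_of w))"
    using \<open>b \<in> A\<close> assms(1) by simp
qed (auto intro!: additiveI simp: ldiv_simps distrib_left sum.distrib)

lemma ncpoly_eq_0I:
  assumes "Poly_Mapping.lookup z [] = 0" "\<And>a. ldiv a z = 0"
  shows "z = 0"
  using ncpoly_expand[OF _ assms(1), of "hd ` Poly_Mapping.keys z"] assms(2) by simp

lemma lookup_mult_X_Nil [simp]: "Poly_Mapping.lookup (X a * z) [] = 0"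
  by (induction z rule: frag_ind) (auto simp: frag_of_mult lookup_minus right_diff_distrib)

lemma lookup_rot: "Poly_Mapping.lookup (rot z) w = Poly_Mapping.lookup z (if w = [] then [] else last w # butlast w)"
proof (induction z rule: frag_ind)
  case (one u)
  have "(w = rotate1 u) = ((if w = [] then [] else last w # butlast w) = u)"
    by (cases u) (auto simp: append_butlast_last_id)
  then show ?case by (auto simp: rot_def)
qed (simp_all add: rot_def lin_diff lookup_minus)

lemma rot_eq_iter:
  assumes "rot z = z"
  shows "Poly_Mapping.lookup z (rotate n w) = Poly_Mapping.lookup z w"
proof (induction n)
  case (Suc n)
  have "Poly_Mapping.lookup z (rotate1 v) = Poly_Mapping.lookup z v" for v
    using lookup_rot[of z "rotate1 v"] assms by (cases v) auto
  then show ?case using Suc by simp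
qed simp

text \<open>A word containing a letter other than \<open>x\<close> can be rotated to start with that
  letter, and invariance carries its coefficient along. So the quotients by letters other than
  \<open>x\<close> detect everything except powers of \<open>x\<close>.\<close>

lemma rot_invariant_eq_0I:
  assumes "rot z = z" "\<And>a. a \<noteq> x \<Longrightarrow> ldiv a z = 0"
    "\<And>w. w \<in> Poly_Mapping.keys z \<Longrightarrow> \<exists>a\<in>set w. a \<noteq> x"
  shows "z = 0"
proof (rule ccontr)
  assume "z \<noteq> 0"
  then obtain w where w: "w \<in> Poly_Mapping.keys z" by (metis keys_eq_empty ex_in_conv)
  with assms(3) obtain a where "a \<in> set w" "a \<noteq> x" by blast
  then obtain u v where "w = u @ a # v" by (meson split_list)
  then have "rotate (length u) w = a # v @ u" by (simp add: rotate_append)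
  then have "Poly_Mapping.lookup z (a # v @ u) \<noteq> 0"
    using rot_eq_iter[OF assms(1), of "length u" w] w by (simp add: in_keys_iff)
  then show False using assms(2)[OF \<open>a \<noteq> x\<close>] lookup_ldiv[of a z "v @ u"] by simp
qed

text \<open>By \<open>cyc_comm\<close> the bracketing of \<open>I\<close> is moved over to the
  second argument until only letters are left in the first. What follows the leading letter is then
  a bracket.\<close>

lemma cyc_lie_span_ldiv:
  "b \<in> lie_span j \<Longrightarrow> size (mlabels I) + j = Suc n \<Longrightarrow> ldiv a (cyc (lie I) b) \<in> lie_span n"
proof (induction I arbitrary: j b)
  case (Br I J)
  have "comm (lie J) b \<in> lie_span (size (mlabels J) + j)" "comm b (lie I) \<in> lie_span (j + size (mlabels I))"
    using Br.prems by (auto intro: comm_lie_span lie_in_span)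
  then show ?case
    using Br.IH(1)[of "comm (lie J) b" "size (mlabels J) + j"]
      Br.IH(2)[of "comm b (lie I)" "j + size (mlabels I)"] Br.prems
    by (auto simp: cyc_comm ldiv_simps)
qed auto

lemma lookup_cycw_Nil: "Poly_Mapping.lookup (cycw u b) [] = 0"
  by (induction u arbitrary: b) (simp_all add: lookup_add)

lemma lookup_cyc_Nil [simp]: "Poly_Mapping.lookup (cyc a b) [] = 0"
  by (induction a rule: frag_ind) (simp_all add: cyc_simps lookup_minus, simp add: cyc_def lookup_cycw_Nil)

section \<open>Lazard elimination in the free associative algebra\<close>

text \<open>Eliminating the letter \<open>x\<close>: the letters of the new alphabet are codes of pairs
  \<open>(i, j)\<close> and stand for \<open>ad\<^sub>x\<^sup>j y\<close>, where \<open>y\<close> is the \<open>i\<close>-th letter other than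
  \<open>x\<close>. The operator \<open>\<delta>\<close> is the derivation of the new algebra induced by
  \<open>ad\<^sub>x\<close>.\<close>

definition skip :: "nat \<Rightarrow> nat \<Rightarrow> nat" where
  "skip x i = (if i < x then i else Suc i)"

definition unskip :: "nat \<Rightarrow> nat \<Rightarrow> nat" where
  "unskip x a = (if a < x then a else a - 1)"

lemma skip_neq [simp]: "skip x i \<noteq> x" "x \<noteq> skip x i"
  and unskip_skip [simp]: "unskip x (skip x i) = i"
  and skip_unskip [simp]: "a \<noteq> x \<Longrightarrow> skip x (unskip x a) = a"
  and skip_inject [simp]: "skip x i = skip x j \<longleftrightarrow> i = j"
  by (auto simp: skip_def unskip_def)

abbreviation idx :: "nat \<Rightarrow> nat" where "idx c \<equiv> fst (prod_decode c)"
abbreviation pwr :: "nat \<Rightarrow> nat" where "pwr c \<equiv> snd (prod_decode c)"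

definition raise :: "nat \<Rightarrow> nat" where
  "raise c = prod_encode (idx c, Suc (pwr c))"

lemma idx_raise [simp]: "idx (raise c) = idx c" and pwr_raise [simp]: "pwr (raise c) = Suc (pwr c)"
  by (simp_all add: raise_def)

lemma raise_encode [simp]: "raise (prod_encode (i, j)) = prod_encode (i, Suc j)"
  by (simp add: raise_def)

lemma eq_encode: "a = prod_encode (i, j) \<longleftrightarrow> idx a = i \<and> pwr a = j"
proof
  assume "idx a = i \<and> pwr a = j"
  then have "prod_decode a = (i, j)" by (simp add: prod_eq_iff)
  then show "a = prod_encode (i, j)" by (metis prod_decode_inverse)
qed simp

primrec derw :: "nat list \<Rightarrow> ncpoly" where
  "derw [] = 0"
| "derw (c # w) = X (raise c) * frag_of w + X c * derw w"

definition der :: "ncpoly \<Rightarrow> ncpoly" (\<open>\<delta>\<close>) where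
  "\<delta> = lin derw"

lemma additive_der [intro]: "additive \<delta>"
  by (simp add: der_def additive_lin)

lemmas der_simps = additive.add[OF additive_der] additive.diff[OF additive_der]
  additive.minus[OF additive_der] additive.zero[OF additive_der] additive.sum[OF additive_der]

lemma der_X [simp]: "\<delta> (X c) = X (raise c)"
  by (simp add: der_def one_ncpoly[symmetric])

lemma der_mult: "\<delta> (a * b) = \<delta> a * b + a * \<delta> b"
proof -
  have *: "derw (u @ v) = derw u * frag_of v + frag_of u * derw v" for u v
  proof (induction u)
    case (Cons c u)
    then show ?case by (simp add: frag_of_Cons[of c u] frag_of_mult[symmetric] algebra_simps)
  qed (simp add: one_ncpoly[symmetric])
  show ?thesis
  proof (rule additive_eqI[where x = a])
    fix u show "\<delta> (frag_of u * b) = \<delta> (frag_of u) * b + frag_of u * \<delta> b"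
      by (rule additive_eqI[where x = b])
         (auto intro!: additiveI simp: der_simps algebra_simps frag_of_mult, simp add: der_def * algebra_simps)
  qed (auto intro!: additiveI simp: der_simps algebra_simps)
qed

lemma der_comm: "\<delta> (comm a b) = comm (\<delta> a) b + comm a (\<delta> b)"
  by (simp add: comm_def der_simps der_mult algebra_simps)

lemma der_lie_span: "a \<in> lie_span n \<Longrightarrow> \<delta> a \<in> lie_span n"
  unfolding lie_span_def
proof (erule zspan_image)
  fix s assume "s \<in> lie ` {I. size (mlabels I) = n}"
  then obtain I where I: "s = lie I" "size (mlabels I) = n" by blast
  have "\<delta> (lie I) \<in> lie_span (size (mlabels I))"
  proof (induction I)
    case (Leaf c)
    then show ?case using lie_in_span[of "Leaf (raise c)"] by simp
  next
    case (Br I J)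
    then show ?case
      by (auto simp: der_comm intro!: lie_span_add comm_lie_span lie_in_span)
  qed
  with I show "\<delta> s \<in> zspan (lie ` {I. size (mlabels I) = n})" by (simp add: lie_span_def)
qed auto

lemma der_rot: "\<delta> (rot z) = rot (\<delta> z)"
proof (rule additive_eqI[where x = z])
  fix w :: "nat list"
  show "\<delta> (rot (frag_of w)) = rot (\<delta> (frag_of w))"
  proof (cases w)
    case Nil
    then show ?thesis by (simp add: rot_def der_def)
  next
    case (Cons c v)
    then show ?thesis
      by (simp add: frag_of_Cons[of c v] der_mult additive.add[OF additive_rot])
  qed
qed (auto intro!: additiveI simp: der_simps additive.add[OF additive_rot])

lemma der_cyc: "\<delta> (cyc a b) = cyc (\<delta> a) b + cyc a (\<delta> b)"
proof (rule additive_eqI[where x = a])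
  fix u show "\<delta> (cyc (frag_of u) b) = cyc (\<delta> (frag_of u)) b + cyc (frag_of u) (\<delta> b)"
  proof (induction u arbitrary: b)
    case Nil
    have "cyc (frag_of []) b = 0" for b by (simp add: cyc_def)
    then show ?case by (simp add: der_def)
  next
    case (Cons c u)
    then show ?case
      by (simp add: frag_of_Cons[of c u] cyc_mult der_simps der_mult cyc_simps distrib_left distrib_right)
  qed
qed (auto intro!: additiveI simp: der_simps cyc_simps)

text \<open>The letter \<open>a\<close> comes to lead a word of \<open>\<delta> z\<close> in two
  ways: it led a word of \<open>z\<close> and a later letter was raised, or it was itself raised
  from the letter of one power less.\<close>

lemma ldiv_der:
  "ldiv a (\<delta> z) = \<delta> (ldiv a z) + (if pwr a = 0 then 0 else ldiv (prod_encode (idx a, pwr a - 1)) z)"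
proof (rule additive_eqI[where x = z])
  fix w :: "nat list"
  show "ldiv a (\<delta> (frag_of w)) = \<delta> (ldiv a (frag_of w)) +
      (if pwr a = 0 then 0 else ldiv (prod_encode (idx a, pwr a - 1)) (frag_of w))"
  proof (cases w)
    case Nil
    then show ?thesis by (simp add: der_def ldiv_def)
  next
    case (Cons c v)
    have "a = raise c \<longleftrightarrow> pwr a \<noteq> 0 \<and> prod_encode (idx a, pwr a - 1) = c"
      by (auto simp: raise_def eq_encode eq_commute[of _ c])
    with Cons show ?thesis
      by (auto simp: frag_of_Cons[of c v] der_mult ldiv_simps der_simps)
  qed
qed (auto intro!: additiveI simp: der_simps ldiv_simps)

text \<open>Among the leading letters let \<open>c\<close> have the largest power. Then
  \<open>raise c\<close> leads no word of \<open>z\<close>, so by \<open>ldiv_der\<close> the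
  quotient of \<open>\<delta> z\<close> by \<open>raise c\<close> is the nonzero quotient of
  \<open>z\<close> by \<open>c\<close>.\<close>

lemma der_eq_0:
  assumes "\<delta> z = 0" "Poly_Mapping.lookup z [] = 0"
  shows "z = 0"
proof (rule ccontr)
  assume "z \<noteq> 0"
  let ?H = "hd ` Poly_Mapping.keys z"
  have "?H \<noteq> {}" using \<open>z \<noteq> 0\<close> by simp
  have fin: "finite (pwr ` ?H)" by simp
  have "Max (pwr ` ?H) \<in> pwr ` ?H" using Max_in[OF fin] \<open>?H \<noteq> {}\<close> by blast
  then obtain c where "c \<in> ?H" "Max (pwr ` ?H) = pwr c" by (rule imageE)
  then have c: "c \<in> ?H" "\<And>d. d \<in> ?H \<Longrightarrow> pwr d \<le> pwr c"
    using Max_ge[OF fin, OF imageI] by fastforce+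
  have "raise c \<notin> ?H" using c(2)[of "raise c"] by auto
  have "ldiv (raise c) z = 0"
  proof (rule poly_mapping_eqI)
    fix v
    have "raise c # v \<notin> Poly_Mapping.keys z" using \<open>raise c \<notin> ?H\<close> by (metis image_eqI list.sel(1))
    then show "Poly_Mapping.lookup (ldiv (raise c) z) v = Poly_Mapping.lookup 0 v"
      by (simp add: lookup_ldiv in_keys_iff)
  qed
  then have "ldiv c z = 0"
    using ldiv_der[of "raise c" z] assms(1) by (simp add: ldiv_simps der_simps)
  moreover obtain w where w: "w \<in> Poly_Mapping.keys z" "hd w = c" using c(1) by blast
  moreover from this have "w \<noteq> []" using assms(2) by (auto simp: in_keys_iff)
  ultimately show False using lookup_ldiv[of c z "tl w"] by (cases w) (simp_all add: in_keys_iff)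
qed

section \<open>Substituting iterated commutators for the new letters\<close>

primrec adtree :: "nat \<Rightarrow> nat \<Rightarrow> nat \<Rightarrow> rtree" where
  "adtree x i 0 = Leaf (skip x i)"
| "adtree x i (Suc j) = Br (Leaf x) (adtree x i j)"

definition lett :: "nat \<Rightarrow> nat \<Rightarrow> ncpoly" where
  "lett x c = lie (adtree x (idx c) (pwr c))"

lemma lett_raise: "lett x (raise c) = comm (X x) (lett x c)"
  by (simp add: lett_def)

definition subst :: "nat \<Rightarrow> ncpoly \<Rightarrow> ncpoly" (\<open>\<iota>\<close>) where
  "\<iota> x = lin (\<lambda>w. prod_list (map (lett x) w))"

lemma additive_subst [intro]: "additive (\<iota> x)"
  by (simp add: subst_def additive_lin)

lemmas subst_simps = additive.add[OF additive_subst] additive.diff[OF additive_subst]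
  additive.minus[OF additive_subst] additive.zero[OF additive_subst] additive.sum[OF additive_subst]

lemma subst_X [simp]: "\<iota> x (X c) = lett x c"
  by (simp add: subst_def)

lemma subst_mult: "\<iota> x (a * b) = \<iota> x a * \<iota> x b"
proof (rule additive_eqI[where x = a])
  fix u show "\<iota> x (frag_of u * b) = \<iota> x (frag_of u) * \<iota> x b"
    by (rule additive_eqI[where x = b])
       (auto intro!: additiveI simp: subst_simps algebra_simps frag_of_mult, simp add: subst_def)
qed (auto intro!: additiveI simp: subst_simps algebra_simps)

lemma subst_comm: "\<iota> x (comm a b) = comm (\<iota> x a) (\<iota> x b)"
  by (simp add: comm_def subst_simps subst_mult)

lemma subst_one: "\<iota> x (frag_of []) = frag_of []"
  by (simp add: subst_def one_ncpoly)

lemma subst_der: "\<iota> x (\<delta> z) = comm (X x) (\<iota> x z)"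
proof (rule additive_eqI[where x = z])
  fix w show "\<iota> x (\<delta> (frag_of w)) = comm (X x) (\<iota> x (frag_of w))"
  proof (induction w)
    case Nil
    have "\<delta> (frag_of []) = 0" by (simp add: der_def)
    then show ?case by (simp add: subst_simps subst_one) (simp add: comm_def one_ncpoly[symmetric])
  next
    case (Cons c w)
    then show ?case
      by (simp add: frag_of_Cons[of c w] der_mult subst_simps subst_mult lett_raise)
         (simp add: comm_def algebra_simps)
  qed
qed (auto intro!: additiveI simp: subst_simps der_simps comm_add)

text \<open>The associative ring in the old letters acts on polynomials in the new ones:
  \<open>x\<close> acts as \<delta>, any other letter as left multiplication by its copy of power
  0.\<close>

primrec actw :: "nat \<Rightarrow> nat list \<Rightarrow> ncpoly \<Rightarrow> ncpoly" where
  "actw x [] p = p"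
| "actw x (a # v) p = (if a = x then \<delta> (actw x v p) else X (prod_encode (unskip x a, 0)) * actw x v p)"

definition act :: "nat \<Rightarrow> ncpoly \<Rightarrow> ncpoly \<Rightarrow> ncpoly" where
  "act x a p = lin (\<lambda>v. actw x v p) a"

lemma additive_act [intro]: "additive (\<lambda>a. act x a p)" "additive (act x a)"
proof -
  show "additive (\<lambda>a. act x a p)" by (simp add: act_def additive_lin)
  have *: "additive (actw x v)" for v
  proof (induction v)
    case (Cons a v)
    then show ?case
      by (auto intro!: additiveI simp: additive.add der_simps distrib_left)
  qed (auto intro: additiveI)
  show "additive (act x a)"
  proof (rule additiveI)
    fix p q show "act x a (p + q) = act x a p + act x a q"
      by (rule additive_eqI[where x = a])
         (auto intro!: additiveI simp: act_def lin_add additive.add[OF *])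
  qed
qed

lemmas act_simps = additive.add[OF additive_act(1)] additive.add[OF additive_act(2)]
  additive.diff[OF additive_act(1)] additive.diff[OF additive_act(2)]

lemma act_mult: "act x (a * b) p = act x a (act x b p)"
proof -
  have *: "actw x (u @ v) p = actw x u (actw x v p)" for u v
    by (induction u) simp_all
  show ?thesis
  proof (rule additive_eqI[where x = a])
    fix u show "act x (frag_of u * b) p = act x (frag_of u) (act x b p)"
      by (rule additive_eqI[where x = b])
         (auto intro!: additiveI simp: act_simps algebra_simps frag_of_mult, simp add: act_def *)
  qed (auto intro!: additiveI simp: act_simps algebra_simps)
qed

text \<open>By the Leibniz rule the commutator of \<delta> with left multiplication by a letter is
  left multiplication by the raised letter. Hence the iterated commutator substituted for
  \<open>c\<close> acts as multiplication by \<open>c\<close> itself.\<close>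

lemma act_lett: "act x (lett x c) p = X c * p"
proof -
  have "act x (lie (adtree x i j)) p = X (prod_encode (i, j)) * p" for i j
  proof (induction j arbitrary: p)
    case 0
    then show ?case by (simp add: act_def)
  next
    case (Suc j)
    have "act x (X x) q = \<delta> q" for q by (simp add: act_def)
    then show ?case by (simp add: comm_def act_simps act_mult Suc der_mult)
  qed
  then show ?thesis by (simp add: lett_def)
qed

lemma act_subst: "act x (\<iota> x u) p = u * p"
proof (rule additive_eqI[where x = u])
  fix w show "act x (\<iota> x (frag_of w)) p = frag_of w * p"
  proof (induction w)
    case Nil
    then show ?case by (simp add: subst_one act_def) (simp add: one_ncpoly[symmetric])
  next
    case (Cons c w)
    then show ?case by (simp add: frag_of_Cons[of c w] subst_mult act_mult act_lett mult.assoc)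
  qed
qed (auto intro!: additiveI simp: act_simps subst_simps distrib_right)

text \<open>Acting on 1 recovers a polynomial in the new letters from its image, so the subring
  generated by the iterated commutators is free on them.\<close>

definition retract :: "nat \<Rightarrow> ncpoly \<Rightarrow> ncpoly" (\<open>\<kappa>\<close>) where
  "\<kappa> x a = act x a 1"

lemma retract_subst [simp]: "\<kappa> x (\<iota> x u) = u"
  by (simp add: retract_def act_subst)

lemma additive_retract [intro]: "additive (\<kappa> x)"
  using additive_act(1)[of x 1] by (simp add: retract_def[abs_def])

lemma subst_inject: "\<iota> x u = \<iota> x v \<longleftrightarrow> u = v"
  by (metis retract_subst)

lemma subst_eq_0 [simp]: "\<iota> x u = 0 \<longleftrightarrow> u = 0"
  by (metis subst_inject additive.zero[OF additive_subst])

section \<open>Lie elements in terms of the new letters\<close>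

abbreviation nonx :: "nat \<Rightarrow> nat multiset \<Rightarrow> nat" where
  "nonx x M \<equiv> size (filter_mset (\<lambda>a. a \<noteq> x) M)"

text \<open>A bracket with \<open>x\<close> on the left is \<delta>, with \<open>x\<close> on the
  right its negative, and all other brackets can be taken over the new alphabet. Each new letter
  contains exactly one letter other than \<open>x\<close>, whence the degree
  \<open>nonx\<close>.\<close>

lemma lie_eliminate: "I = Leaf x \<or> lie I \<in> \<iota> x ` lie_span (nonx x (mlabels I))"
proof (induction I)
  case (Leaf a)
  have "lie (Leaf a) = \<iota> x (lie (Leaf (prod_encode (unskip x a, 0))))" if "a \<noteq> x"
    using that by (simp add: lett_def)
  then show ?case using lie_in_span[of "Leaf (prod_encode (unskip x a, 0))" 1]
    by (cases "a = x") (simp, fastforce)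
next
  case (Br I J)
  consider (xx) "I = Leaf x" "J = Leaf x"
    | (xJ) v where "I = Leaf x" "v \<in> lie_span (nonx x (mlabels J))" "lie J = \<iota> x v"
    | (Ix) u where "J = Leaf x" "u \<in> lie_span (nonx x (mlabels I))" "lie I = \<iota> x u"
    | (IJ) u v where "u \<in> lie_span (nonx x (mlabels I))" "lie I = \<iota> x u"
        "v \<in> lie_span (nonx x (mlabels J))" "lie J = \<iota> x v"
    using Br.IH by blast
  then show ?case
  proof cases
    case xx
    then show ?thesis by (simp add: additive.zero[OF additive_subst])
  next
    case xJ
    then show ?thesis by (auto simp: subst_der[symmetric] der_lie_span)
  next
    case Ix
    then have "lie (Br I J) = \<iota> x (- \<delta> u)"
      by (simp add: subst_simps subst_der comm_anti[of "\<iota> x u"])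
    then show ?thesis using Ix der_lie_span[of u] by auto
  next
    case IJ
    then show ?thesis by (auto simp: subst_comm[symmetric] comm_lie_span)
  qed
qed

lemma subst_lie_ring: "a \<in> lie_ring \<Longrightarrow> \<iota> x a \<in> lie_ring"
  unfolding lie_ring_def
proof (erule zspan_image)
  fix s assume "s \<in> range lie"
  then obtain I where "s = lie I" by blast
  moreover have "\<iota> x (lie I) \<in> lie_ring"
    by (induction I) (auto simp: lett_def lie_in_ring subst_comm comm_lie_ring)
  ultimately show "\<iota> x s \<in> zspan (range lie)" by (simp add: lie_ring_def)
qed auto

section \<open>Cyclic sums under substitution, and division by \<delta>\<close>

definition subst_cyc :: "nat \<Rightarrow> ncpoly \<Rightarrow> ncpoly" (\<open>\<Psi>\<close>) where
  "\<Psi> x = lin (\<lambda>w. case w of [] \<Rightarrow> 0 | c # v \<Rightarrow> cyc (lett x c) (\<iota> x (frag_of v)))"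

lemma additive_subst_cyc [intro]: "additive (\<Psi> x)"
  by (simp add: subst_cyc_def additive_lin)

lemmas subst_cyc_simps = additive.add[OF additive_subst_cyc] additive.diff[OF additive_subst_cyc]
  additive.zero[OF additive_subst_cyc] additive.sum[OF additive_subst_cyc]

lemma subst_cyc_X: "\<Psi> x (X c * b) = cyc (lett x c) (\<iota> x b)"
  by (rule additive_eqI[where x = b])
     (auto intro!: additiveI simp: subst_cyc_simps cyc_simps subst_simps distrib_left frag_of_mult,
      simp add: subst_cyc_def)

text \<open>Explains the form of \<Psi>: a rotation over the new alphabet that starts with the
  letter \<open>c\<close> stands for all rotations over the old alphabet that start inside the
  commutator substituted for \<open>c\<close>.\<close>

lemma subst_cyc_cyc: "\<Psi> x (cyc u b) = cyc (\<iota> x u) (\<iota> x b)"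
proof (rule additive_eqI[where x = u])
  fix w show "\<Psi> x (cyc (frag_of w) b) = cyc (\<iota> x (frag_of w)) (\<iota> x b)"
  proof (induction w arbitrary: b)
    case Nil
    have "cyc (frag_of []) b = 0" for b by (simp add: cyc_def)
    then show ?case by (simp add: subst_one subst_cyc_simps)
  next
    case (Cons c w)
    then show ?case
      by (simp add: frag_of_Cons[of c w] cyc_mult subst_cyc_simps subst_cyc_X subst_mult)
  qed
qed (auto intro!: additiveI simp: subst_cyc_simps cyc_simps subst_simps)

text \<open>The sign comes from the order in the commutator: \<open>cyc_comm\<close> moves an
  \<open>x\<close> out of the first argument as a bracket from the right on the second.\<close>

definition nder :: "ncpoly \<Rightarrow> ncpoly" where
  "nder z = - \<delta> z"

lemma subst_nder: "\<iota> x (nder b) = comm (\<iota> x b) (X x)"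
  by (simp add: nder_def subst_simps subst_der comm_anti[of "\<iota> x b"])

lemma additive_nder_pow: "additive (nder ^^ j)"
  by (induction j) (auto intro!: additiveI simp: additive.add der_simps nder_def)

lemma nder_pow_Suc: "(nder ^^ Suc j) b = (nder ^^ j) (nder b)"
  by (simp only: funpow_Suc_right o_apply)

lemma nder_lie_span: "b \<in> lie_span n \<Longrightarrow> nder b \<in> lie_span n"
  by (simp add: nder_def der_lie_span lie_span_uminus)

text \<open>Each \<open>x\<close> of the iterated commutator moves over to the second argument. The
  summands this creates start with \<open>x\<close> and are invisible to quotients by other
  letters.\<close>

lemma ldiv_cyc_adtree:
  "ldiv (skip x k) (cyc (lie (adtree x i j)) (\<iota> x b)) = (if k = i then \<iota> x ((nder ^^ j) b) else 0)"
proof (induction j arbitrary: b)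
  case (Suc j)
  show ?case using Suc[of "nder b"]
    by (simp add: cyc_comm ldiv_simps subst_nder nder_pow_Suc del: funpow.simps)
qed auto

text \<open>The coefficient at the letter \<open>(i, 0)\<close> of the remainder in division by
  \<delta>: moving \<open>j\<close> derivations off a leading letter \<open>(i, j)\<close> puts
  \<open>- \<delta>\<close> applied \<open>j\<close> times on the rest of the word.\<close>

definition rem_coeff :: "nat \<Rightarrow> ncpoly \<Rightarrow> ncpoly" (\<open>\<rho>\<close>) where
  "\<rho> i = lin (\<lambda>w. case w of [] \<Rightarrow> 0 | c # v \<Rightarrow> if idx c = i then (nder ^^ pwr c) (frag_of v) else 0)"

lemma additive_rem_coeff [intro]: "additive (\<rho> i)"
  by (simp add: rem_coeff_def additive_lin)

lemmas rem_coeff_simps = additive.add[OF additive_rem_coeff] additive.zero[OF additive_rem_coeff]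

lemma rem_coeff_X: "\<rho> i (X c * b) = (if idx c = i then (nder ^^ pwr c) b else 0)"
  by (rule additive_eqI[where x = b])
     (auto intro!: additiveI simp: rem_coeff_simps distrib_left frag_of_mult additive.add[OF additive_nder_pow],
      auto simp add: rem_coeff_def)

text \<open>Links the two alphabets: the quotients of \<open>\<Psi> x z\<close> by old letters other
  than \<open>x\<close> record exactly the class of \<open>z\<close> modulo the image of
  \<delta>.\<close>

lemma ldiv_subst_cyc: "ldiv (skip x i) (\<Psi> x z) = \<iota> x (\<rho> i z)"
proof (rule additive_eqI[where x = z])
  fix w show "ldiv (skip x i) (\<Psi> x (frag_of w)) = \<iota> x (\<rho> i (frag_of w))"
  proof (cases w)
    case Nil
    then show ?thesis by (simp add: subst_cyc_def rem_coeff_def ldiv_simps subst_simps)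
  next
    case (Cons c v)
    then show ?thesis
      by (auto simp add: frag_of_Cons[of c v] subst_cyc_X rem_coeff_X lett_def ldiv_cyc_adtree subst_simps)
  qed
qed (auto intro!: additiveI simp: ldiv_simps subst_cyc_simps subst_simps rem_coeff_simps)

lemma rem_coeff_der: "\<rho> i (\<delta> z) = 0"
proof (rule additive_eqI[where x = z and g = "\<lambda>z. 0"])
  fix w show "\<rho> i (\<delta> (frag_of w)) = 0"
  proof (cases w)
    case Nil
    then show ?thesis by (simp add: der_def rem_coeff_simps)
  next
    case (Cons c v)
    have "(nder ^^ pwr c) (nder (frag_of v)) + (nder ^^ pwr c) (\<delta> (frag_of v)) = 0"
      by (simp add: additive.add[OF additive_nder_pow, symmetric] additive.zero[OF additive_nder_pow]
          nder_def)
    then show ?thesis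
      by (simp add: Cons frag_of_Cons[of c v] der_mult rem_coeff_simps rem_coeff_X nder_pow_Suc
          del: funpow.simps)
  qed
qed (auto intro!: additiveI simp: rem_coeff_simps der_simps)

text \<open>The quotient from iterated integration by parts,
  \<open>X (raise c) * b = \<delta> (X c * b) + X c * nder b\<close>, continued until the power 0 is
  reached.\<close>

primrec quot_aux :: "nat \<Rightarrow> nat \<Rightarrow> ncpoly \<Rightarrow> ncpoly" where
  "quot_aux i 0 b = 0"
| "quot_aux i (Suc j) b = X (prod_encode (i, j)) * b + quot_aux i j (nder b)"

lemma quot_aux_division:
  "X (prod_encode (i, j)) * b = \<delta> (quot_aux i j b) + X (prod_encode (i, 0)) * (nder ^^ j) b"
proof (induction j arbitrary: b)
  case (Suc j)
  have "X (prod_encode (i, j)) * nder b = - (X (prod_encode (i, j)) * \<delta> b)"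
    by (simp add: nder_def)
  then have "X (prod_encode (i, 0)) * (nder ^^ j) (nder b) =
      - (X (prod_encode (i, j)) * \<delta> b) - \<delta> (quot_aux i j (nder b))"
    using Suc[of "nder b"] by (simp add: eq_diff_eq add.commute)
  then show ?case
    by (simp add: der_simps der_mult nder_pow_Suc del: funpow.simps)
qed (simp add: der_simps)

lemma quot_aux_props:
  "b \<in> lie_span n \<Longrightarrow> ldiv a (quot_aux i j b) \<in> lie_span n"
  "Poly_Mapping.lookup (quot_aux i j b) [] = 0"
  by (induction j arbitrary: b) (auto simp: ldiv_simps lookup_add nder_lie_span)

text \<open>Every term is divided according to its leading letter. The remainder \<open>r\<close>
  has only leading letters of power 0, with coefficients given by \<rho>, so it vanishes. Left
  quotients stay Lie elements because \<open>quot_aux\<close> applies nothing but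
  \<open>nder\<close> to them.\<close>

lemma rem_coeff_eq_0_imp_der:
  assumes z: "Poly_Mapping.lookup z [] = 0" "\<And>a. ldiv a z \<in> lie_span n" and 0: "\<And>i. \<rho> i z = 0"
  obtains q where "z = \<delta> q" "Poly_Mapping.lookup q [] = 0" "\<And>a. ldiv a q \<in> lie_span n"
proof -
  let ?A = "hd ` Poly_Mapping.keys z"
  define q where "q = (\<Sum>c\<in>?A. quot_aux (idx c) (pwr c) (ldiv c z))"
  define r where "r = (\<Sum>c\<in>?A. X (prod_encode (idx c, 0)) * (nder ^^ pwr c) (ldiv c z))"
  have expand: "z = (\<Sum>c\<in>?A. X c * ldiv c z)" by (rule ncpoly_expand) (use z in auto)
  also have "\<dots> = (\<Sum>c\<in>?A. \<delta> (quot_aux (idx c) (pwr c) (ldiv c z)) +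
      X (prod_encode (idx c, 0)) * (nder ^^ pwr c) (ldiv c z))"
    by (rule sum.cong[OF refl]) (metis quot_aux_division prod.collapse prod_decode_inverse)
  also have "\<dots> = \<delta> q + r"
    by (simp add: q_def r_def sum.distrib der_simps)
  finally have zqr: "z = \<delta> q + r" .
  have "ldiv a r = (if pwr a = 0 then \<rho> (idx a) z else 0)" for a
  proof -
    have "(a = prod_encode (idx c, 0)) = (pwr a = 0 \<and> idx c = idx a)" for c
      by (auto simp: eq_encode)
    then have "ldiv a r = (\<Sum>c\<in>?A. if pwr a = 0 \<and> idx c = idx a then (nder ^^ pwr c) (ldiv c z) else 0)"
      unfolding r_def ldiv_simps by (intro sum.cong) simp_all
    also have "\<dots> = (if pwr a = 0 then \<rho> (idx a) (\<Sum>c\<in>?A. X c * ldiv c z) else 0)"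
      by (cases "pwr a = 0") (simp_all add: additive.sum[OF additive_rem_coeff] rem_coeff_X)
    finally show ?thesis by (simp only: expand[symmetric])
  qed
  then have "ldiv a r = 0" for a by (simp add: 0)
  moreover have "Poly_Mapping.lookup r [] = 0" by (simp add: r_def lookup_sum)
  ultimately have "r = 0" by (metis ncpoly_eq_0I)
  then have "z = \<delta> q" using zqr by simp
  moreover have "Poly_Mapping.lookup q [] = 0"
    by (simp add: q_def lookup_sum quot_aux_props)
  moreover have "ldiv a q \<in> lie_span n" for a
    unfolding q_def ldiv_simps lie_span_def
    by (rule zspan_sum) (use quot_aux_props(1) z(2) in \<open>simp add: lie_span_def[symmetric]\<close>)
  ultimately show ?thesis using that by blast
qed

section \<open>Homogeneous components\<close>

definition proj :: "nat multiset \<Rightarrow> ncpoly \<Rightarrow> ncpoly" where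
  "proj M = lin (\<lambda>w. if mset w = M then frag_of w else 0)"

lemma additive_proj [intro]: "additive (proj M)"
  by (simp add: proj_def additive_lin)

lemmas proj_simps = additive.add[OF additive_proj] additive.diff[OF additive_proj]
  additive.zero[OF additive_proj] additive.sum[OF additive_proj]

lemma lookup_proj: "Poly_Mapping.lookup (proj M z) w = (if mset w = M then Poly_Mapping.lookup z w else 0)"
  by (induction z rule: frag_ind) (auto simp: proj_simps lookup_minus, auto simp: proj_def)

lemma proj_id: "(\<And>w. w \<in> Poly_Mapping.keys z \<Longrightarrow> mset w = M) \<Longrightarrow> proj M z = z"
  by (rule poly_mapping_eqI) (auto simp: lookup_proj in_keys_iff)

lemma proj_eq_0: "(\<And>w. w \<in> Poly_Mapping.keys z \<Longrightarrow> mset w \<noteq> M) \<Longrightarrow> proj M z = 0"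
  by (rule poly_mapping_eqI) (auto simp: lookup_proj in_keys_iff)

lemma keys_proj: "w \<in> Poly_Mapping.keys (proj M z) \<Longrightarrow> mset w = M"
  by (auto simp: in_keys_iff lookup_proj split: if_splits)

lemma rot_proj: "rot (proj M z) = proj M (rot z)"
proof (rule poly_mapping_eqI)
  fix w :: "nat list"
  have "w \<noteq> [] \<Longrightarrow> mset (last w # butlast w) = mset w"
    by (metis add.commute append_butlast_last_id mset.simps mset_append union_mset_add_mset_right add_mset_add_single)
  then show "Poly_Mapping.lookup (rot (proj M z)) w = Poly_Mapping.lookup (proj M (rot z)) w"
    by (auto simp: lookup_rot lookup_proj)
qed

lemma ldiv_proj: "ldiv a (proj M z) = (if a \<in># M then proj (M - {#a#}) (ldiv a z) else 0)"
proof (rule poly_mapping_eqI)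
  fix w :: "nat list"
  have "mset (a # w) = M \<longleftrightarrow> a \<in># M \<and> mset w = M - {#a#}" by auto
  then show "Poly_Mapping.lookup (ldiv a (proj M z)) w =
      Poly_Mapping.lookup (if a \<in># M then proj (M - {#a#}) (ldiv a z) else 0) w"
    by (auto simp: lookup_ldiv lookup_proj)
qed

lemma proj_sum:
  assumes "finite F" "mset ` Poly_Mapping.keys z \<subseteq> F"
  shows "z = (\<Sum>M\<in>F. proj M z)"
  by (rule poly_mapping_eqI) (use assms in \<open>force simp: lookup_sum lookup_proj in_keys_iff\<close>)

lemma keys_lie: "w \<in> Poly_Mapping.keys (lie I) \<Longrightarrow> mset w = mlabels I"
proof (induction I arbitrary: w)
  case (Br I J)
  have "w \<in> Poly_Mapping.keys (lie I * lie J) \<union> Poly_Mapping.keys (lie J * lie I)"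
    using Br.prems keys_diff by (fastforce simp: comm_def)
  then show ?case
    using keys_mult[of "lie I" "lie J"] keys_mult[of "lie J" "lie I"] Br.IH
    by (auto simp: plus_list_def dest!: subsetD)
qed simp

lemma keys_cyc:
  assumes "\<And>u. u \<in> Poly_Mapping.keys a \<Longrightarrow> mset u = M" "\<And>u. u \<in> Poly_Mapping.keys b \<Longrightarrow> mset u = M'"
    and "w \<in> Poly_Mapping.keys (cyc a b)"
  shows "mset w = M + M'"
proof -
  have *: "proj (M + M') (cyc (frag_of u) b) = cyc (frag_of u) b" if u: "u \<in> Poly_Mapping.keys a" for u
  proof (rule additive_eq_keys[where x = b])
    fix v assume v: "v \<in> Poly_Mapping.keys b"
    have "w \<in> Poly_Mapping.keys (cycw u (frag_of v)) \<Longrightarrow> mset w = mset u + mset v" for u v w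
    proof (induction u arbitrary: v)
      case (Cons c u)
      have "cycw (c # u) (frag_of v) = frag_of (c # u @ v) + cycw u (frag_of (v @ [c]))"
        by (simp add: frag_of_mult)
      then have "w = c # u @ v \<or> w \<in> Poly_Mapping.keys (cycw u (frag_of (v @ [c])))"
        using Cons.prems keys_add[of "frag_of (c # u @ v)" "cycw u (frag_of (v @ [c]))"] by auto
      then show ?case using Cons.IH by auto
    qed simp
    then show "proj (M + M') (cyc (frag_of u) (frag_of v)) = cyc (frag_of u) (frag_of v)"
      using assms(1)[OF u] assms(2)[OF v] by (intro proj_id) (simp add: cyc_def)
  qed (auto intro!: additiveI simp: proj_simps cyc_simps)
  have "proj (M + M') (cyc a b) = cyc a b"
    by (rule additive_eq_keys[where x = a]) (auto intro!: additiveI * simp: proj_simps cyc_simps)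
  then show ?thesis using assms(3) keys_proj by metis
qed

lemma keys_cyc_lie: "w \<in> Poly_Mapping.keys (cyc (lie I) (lie J)) \<Longrightarrow> mset w = mlabels I + mlabels J"
  by (rule keys_cyc[OF keys_lie keys_lie])

lemma keys_full_cyc_lie:
  "w \<in> Poly_Mapping.keys (full_cyc (lie I) (lie J)) \<Longrightarrow> mset w = mlabels I + mlabels J"
  using keys_add[of "cyc (lie I) (lie J)" "cyc (lie J) (lie I)"] keys_cyc_lie[of w I J] keys_cyc_lie[of w J I]
  by (auto simp: full_cyc_def add.commute)

lemma lie_eliminateE:
  assumes "I \<noteq> Leaf x"
  obtains u where "u \<in> lie_span (nonx x (mlabels I))" "lie I = \<iota> x u"
  using lie_eliminate[of I x] assms by blast

definition lie_mspan :: "nat multiset \<Rightarrow> ncpoly set" where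
  "lie_mspan M = zspan (lie ` {I. mlabels I = M})"

lemma proj_lie_span: "a \<in> lie_span n \<Longrightarrow> proj M a \<in> lie_mspan M"
  unfolding lie_span_def lie_mspan_def
proof (erule zspan_image)
  fix s assume "s \<in> lie ` {I. size (mlabels I) = n}"
  then obtain I where I: "s = lie I" by blast
  show "proj M s \<in> zspan (lie ` {I. mlabels I = M})"
  proof (cases "mlabels I = M")
    case True
    then show ?thesis by (auto simp: I proj_id keys_lie intro: zspan_base)
  next
    case False
    then have "proj M s = 0" by (auto simp: I keys_lie intro: proj_eq_0)
    then show ?thesis by (simp add: zspan_0)
  qed
qed auto

text \<open>The excluded content \<open>{#x#}\<close> belongs to the multiples of the letter
  \<open>x\<close>, which no substitution reaches.\<close>

lemma lie_mspan_eliminate: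
  assumes "a \<in> lie_mspan M" "M \<noteq> {#x#}"
  obtains u where "u \<in> lie_span (nonx x M)" "a = \<iota> x u"
proof -
  have "a \<in> zspan (\<iota> x ` lie_span (nonx x M))"
    using assms(1) unfolding lie_mspan_def
  proof (rule zspan_image[where f = "\<lambda>x. x"])
    fix s assume "s \<in> lie ` {I. mlabels I = M}"
    then obtain I where "s = lie I" "mlabels I = M" by blast
    then show "s \<in> zspan (\<iota> x ` lie_span (nonx x M))"
      using lie_eliminate[of I x] assms(2) by (auto intro!: zspan_base)
  qed (auto intro: additiveI)
  then have "a \<in> \<iota> x ` lie_span (nonx x M)"
  proof induction
    case zspan_0
    show ?case by (rule image_eqI[of _ _ 0]) (auto simp: subst_simps)
  next
    case (zspan_diff a b)
    then obtain u v where "u \<in> lie_span (nonx x M)" "a = \<iota> x u" "v \<in> lie_span (nonx x M)" "b = \<iota> x v"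
      by blast
    then show ?case by (intro image_eqI[of _ _ "u - v"]) (auto simp: subst_simps)
  qed
  then show ?thesis using that by blast
qed

section \<open>Invariant quadratic forms on the Lie ring\<close>

text \<open>\<open>S\<close> is a quadratic refinement of \<open>P\<close>. Both of its axioms are
  kept because halving the diagonal of \<open>P\<close> is not unique in a group that may have
  2-torsion.\<close>

locale inv_form =
  fixes P :: "ncpoly \<Rightarrow> ncpoly \<Rightarrow> 'g::ab_group_add" and S :: "ncpoly \<Rightarrow> 'g"
  assumes P_add: "a \<in> lie_ring \<Longrightarrow> b \<in> lie_ring \<Longrightarrow> c \<in> lie_ring \<Longrightarrow> P (a + b) c = P a c + P b c"
    and P_sym: "a \<in> lie_ring \<Longrightarrow> b \<in> lie_ring \<Longrightarrow> P a b = P b a"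
    and P_inv: "a \<in> lie_ring \<Longrightarrow> b \<in> lie_ring \<Longrightarrow> c \<in> lie_ring \<Longrightarrow> P (comm a b) c = P a (comm b c)"
    and P_alt: "a \<in> lie_ring \<Longrightarrow> b \<in> lie_ring \<Longrightarrow> P a (comm a b) = 0"
    and S_add: "a \<in> lie_ring \<Longrightarrow> b \<in> lie_ring \<Longrightarrow> S (a + b) = S a + S b + P a b"
    and S_two: "a \<in> lie_ring \<Longrightarrow> S a + S a = P a a"
begin

lemma P_0 [simp]: "a \<in> lie_ring \<Longrightarrow> P 0 a = 0" "a \<in> lie_ring \<Longrightarrow> P a 0 = 0"
proof -
  show *: "P 0 a = 0" if "a \<in> lie_ring" for a
    using P_add[OF lie_ring_0 lie_ring_0 that] by simp
  show "P a 0 = 0" if "a \<in> lie_ring"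
    using *[OF that] P_sym[OF that lie_ring_0] by simp
qed

lemma P_minus: "a \<in> lie_ring \<Longrightarrow> b \<in> lie_ring \<Longrightarrow> P (- a) b = - P a b"
    "a \<in> lie_ring \<Longrightarrow> b \<in> lie_ring \<Longrightarrow> P a (- b) = - P a b"
proof -
  show *: "P (- a) b = - P a b" if "a \<in> lie_ring" "b \<in> lie_ring" for a b
    using P_add[OF that(1) lie_ring_uminus[OF that(1)] that(2)] that
    by (simp add: eq_neg_iff_add_eq_0 add.commute)
  show "P a (- b) = - P a b" if "a \<in> lie_ring" "b \<in> lie_ring"
    using *[OF that(2,1)] P_sym[OF that] P_sym[OF that(1) lie_ring_uminus[OF that(2)]] by simp
qed

lemma P_diff: "a \<in> lie_ring \<Longrightarrow> b \<in> lie_ring \<Longrightarrow> c \<in> lie_ring \<Longrightarrow> P (a - b) c = P a c - P b c"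
    "a \<in> lie_ring \<Longrightarrow> b \<in> lie_ring \<Longrightarrow> c \<in> lie_ring \<Longrightarrow> P c (a - b) = P c a - P c b"
proof -
  show *: "P (a - b) c = P a c - P b c" if "a \<in> lie_ring" "b \<in> lie_ring" "c \<in> lie_ring" for a b c
    using P_add[OF that(1) lie_ring_uminus[OF that(2)] that(3)] P_minus(1)[OF that(2,3)] by simp
  show "P c (a - b) = P c a - P c b" if "a \<in> lie_ring" "b \<in> lie_ring" "c \<in> lie_ring"
    using *[OF that] P_sym[OF that(3) lie_ring_diff[OF that(1,2)]] P_sym[OF that(3,1)] P_sym[OF that(3,2)]
    by simp
qed

lemma S_0 [simp]: "S 0 = 0"
  using S_add[OF lie_ring_0 lie_ring_0] by simp

lemma S_minus: "a \<in> lie_ring \<Longrightarrow> S (- a) = S a"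
  using S_add[OF _ lie_ring_uminus, of a a] S_two[of a, symmetric] P_minus(2)[of a a]
  by simp

lemma S_diff: "a \<in> lie_ring \<Longrightarrow> b \<in> lie_ring \<Longrightarrow> S (a - b) = S a + S b - P a b"
  using S_add[OF _ lie_ring_uminus, of a b] S_minus[of b] P_minus(2)[of a b] by simp

end

section \<open>The correspondence between cyclic polynomials and values of the forms\<close>

definition gens ::
  "(ncpoly \<Rightarrow> ncpoly \<Rightarrow> 'g::ab_group_add) \<Rightarrow> (ncpoly \<Rightarrow> 'g) \<Rightarrow> (nat multiset \<Rightarrow> bool) \<Rightarrow> (ncpoly \<times> 'g) set" where
  "gens P S Q = {(full_cyc (lie I) (lie J), P (lie I) (lie J)) | I J. Q (mlabels I + mlabels J)} \<union>
     {(cyc (lie I) (lie I), S (lie I)) | I. Q (mlabels I + mlabels I)}"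

text \<open>Polynomial and value are carried along as one pair, which postpones the question whether
  the value depends only on the polynomial. The predicate \<open>Q\<close> bounds the content,
  either by size or to a single multiset.\<close>

definition graph where "graph P S Q = zspan (gens P S Q)"

abbreviation "deg N \<equiv> \<lambda>M :: nat multiset. size M = N"

lemma graph_mono: "(\<And>M. Q M \<Longrightarrow> Q' M) \<Longrightarrow> graph P S Q \<subseteq> graph P S Q'"
  unfolding graph_def by (rule zspan_mono) (fastforce simp: gens_def intro: zspan_base)

lemma graph_imp_rot: "(z, g) \<in> graph P S Q \<Longrightarrow> rot z = z"
proof -
  assume "(z, g) \<in> graph P S Q"
  then have "rot (fst (z, g)) - fst (z, g) = 0"
    unfolding graph_def
    by (rule zspan_zero_image)
       (auto intro!: additiveI simp: gens_def additive.add[OF additive_rot] rot_full_cyc rot_cyc_self)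
  then show ?thesis by simp
qed

lemma graph_imp_ldiv: "(z, g) \<in> graph P S (deg N) \<Longrightarrow> ldiv a z \<in> lie_span (N - 1)"
proof -
  assume "(z, g) \<in> graph P S (deg N)"
  then have "ldiv a (fst (z, g)) \<in> lie_span (N - 1)"
    unfolding graph_def lie_span_def
  proof (rule zspan_image)
    fix s assume "s \<in> gens P S (deg N)"
    then obtain I J where IJ: "size (mlabels I + mlabels J) = N"
      and s: "fst s = full_cyc (lie I) (lie J) \<or> I = J \<and> fst s = cyc (lie I) (lie I)"
      by (auto simp: gens_def)
    then have "N = Suc (N - 1)" by (metis Suc_pred' mlabels_nonempty multi_self_add_other_not_self
          nonempty_has_size size_mlabels size_union zero_less_Suc add_gr_0)
    then have "ldiv a (cyc (lie I) (lie J)) \<in> lie_span (N - 1)" "ldiv a (cyc (lie J) (lie I)) \<in> lie_span (N - 1)"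
      using IJ by (auto intro!: cyc_lie_span_ldiv lie_in_span simp: add.commute)
    then show "ldiv a (fst s) \<in> zspan (lie ` {I. size (mlabels I) = N - 1})"
      using s by (auto simp: full_cyc_def ldiv_simps lie_span_def[symmetric])
  qed (auto intro!: additiveI simp: ldiv_simps)
  then show ?thesis by simp
qed

lemma graph_imp_lookup: "(z, g) \<in> graph P S Q \<Longrightarrow> Poly_Mapping.lookup z [] = 0"
proof -
  assume "(z, g) \<in> graph P S Q"
  then have "Poly_Mapping.lookup (fst (z, g)) [] = 0"
    unfolding graph_def
    by (rule zspan_zero_image) (auto intro!: additiveI simp: gens_def full_cyc_def lookup_add)
  then show ?thesis by simp
qed

context inv_form
begin

lemma graph_P:
  assumes "a \<in> lie_span i" "b \<in> lie_span j" "i + j = N"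
  shows "(full_cyc a b, P a b) \<in> graph P S (deg N)"
proof -
  have *: "b \<in> lie_ring \<and> (full_cyc (lie I) b, P (lie I) b) \<in> graph P S (deg N)"
    if "size (mlabels I) = i" for I
    using assms(2) unfolding lie_span_def
  proof induction
    case zspan_0
    have "(0, 0) \<in> graph P S (deg N)" by (metis graph_def zspan.zspan_0 zero_prod_def)
    then show ?case by (simp add: lie_in_ring)
  next
    case (zspan_base s)
    then obtain J where "s = lie J" "size (mlabels J) = j" by blast
    then have "(full_cyc (lie I) s, P (lie I) s) \<in> gens P S (deg N)"
      using that assms(3) by (auto simp: gens_def)
    then show ?case using \<open>s = lie J\<close> by (auto simp: graph_def lie_in_ring intro: zspan.zspan_base)
  next
    case (zspan_diff b c)
    then show ?case
      using zspan.zspan_diff[of "(full_cyc (lie I) b, P (lie I) b)" "gens P S (deg N)"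
          "(full_cyc (lie I) c, P (lie I) c)"]
      by (auto simp: P_diff full_cyc_diff graph_def lie_in_ring)
  qed
  then have b: "b \<in> lie_ring" using assms(2) lie_span_ring by blast
  have "a \<in> lie_ring \<and> (full_cyc a b, P a b) \<in> graph P S (deg N)"
    using assms(1) unfolding lie_span_def
  proof induction
    case zspan_0
    have "(0, 0) \<in> graph P S (deg N)" by (metis graph_def zspan.zspan_0 zero_prod_def)
    then show ?case using b by simp
  next
    case (zspan_base s)
    then show ?case using * by (auto simp: lie_in_ring)
  next
    case (zspan_diff a c)
    then show ?case
      using zspan.zspan_diff[of "(full_cyc a b, P a b)" "gens P S (deg N)" "(full_cyc c b, P c b)"] b
      by (auto simp: P_diff full_cyc_diff graph_def)
  qed
  then show ?thesis by blast
qed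

lemma graph_S:
  assumes "a \<in> lie_span i" "i + i = N"
  shows "(cyc a a, S a) \<in> graph P S (deg N)"
proof -
  have "a \<in> lie_span i \<and> (cyc a a, S a) \<in> graph P S (deg N)"
    using assms(1) unfolding lie_span_def
  proof induction
    case zspan_0
    have "(0, 0) \<in> graph P S (deg N)" by (metis graph_def zspan.zspan_0 zero_prod_def)
    then show ?case by (simp add: zspan.zspan_0)
  next
    case (zspan_base s)
    then have "(cyc s s, S s) \<in> gens P S (deg N)" using assms(2) by (auto simp: gens_def)
    then show ?case using zspan_base by (auto simp: graph_def intro: zspan.zspan_base)
  next
    case (zspan_diff a b)
    then have ab: "a \<in> lie_span i" "b \<in> lie_span i" by (simp_all add: lie_span_def)
    have "cyc (a - b) (a - b) = cyc a a + cyc b b - full_cyc a b"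
      by (simp add: cyc_simps full_cyc_def algebra_simps)
    moreover have "(cyc a a, S a) + (cyc b b, S b) - (full_cyc a b, P a b) \<in> graph P S (deg N)"
      using zspan_diff.IH graph_P[OF ab assms(2)] unfolding graph_def
      by (auto intro!: zspan.zspan_diff zspan_add simp del: add_Pair)
    moreover have "a \<in> lie_ring" "b \<in> lie_ring" using ab lie_span_ring by blast+
    ultimately show ?case
      using S_diff[of a b] zspan.zspan_diff[OF ab[unfolded lie_span_def]] by (simp add: lie_span_def)
  qed
  then show ?thesis by blast
qed

lemma inv_form_subst: "inv_form (\<lambda>a b. P (\<iota> x a) (\<iota> x b)) (\<lambda>a. S (\<iota> x a))"
  by unfold_locales
     (simp_all add: subst_simps subst_comm subst_lie_ring P_add P_inv P_alt S_add S_two,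
      simp add: P_sym subst_lie_ring)

text \<open>Invariance under bracketing with \<open>x\<close>, infinitesimally: the derivative of
  \<open>P a b\<close> is \<open>P [x, a] b + P a [x, b] = 0\<close>, and that of \<open>S a\<close>
  is \<open>P [x, a] a = 0\<close>. On the new alphabet this bracketing is \<delta>.\<close>

lemma graph_der:
  assumes "(z, g) \<in> graph (\<lambda>a b. P (\<iota> x a) (\<iota> x b)) (\<lambda>a. S (\<iota> x a)) (deg N)"
  shows "(\<delta> z, 0) \<in> graph (\<lambda>a b. P (\<iota> x a) (\<iota> x b)) (\<lambda>a. S (\<iota> x a)) (deg N)"
    (is "_ \<in> ?G")
proof -
  interpret W: inv_form "\<lambda>a b. P (\<iota> x a) (\<iota> x b)" "\<lambda>a. S (\<iota> x a)" by (rule inv_form_subst)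
  have x: "X x \<in> lie_ring" using lie_in_ring[of "Leaf x"] by simp
  have "(\<delta> (fst (z, g)), 0 :: 'g) \<in> zspan (gens (\<lambda>a b. P (\<iota> x a) (\<iota> x b)) (\<lambda>a. S (\<iota> x a)) (deg N))"
    using assms unfolding graph_def
  proof (rule zspan_image)
    fix s assume "s \<in> gens (\<lambda>a b. P (\<iota> x a) (\<iota> x b)) (\<lambda>a. S (\<iota> x a)) (deg N)"
    then consider (P) I J where "fst s = full_cyc (lie I) (lie J)" "size (mlabels I + mlabels J) = N"
      | (S) I where "fst s = cyc (lie I) (lie I)" "size (mlabels I + mlabels I) = N"
      by (auto simp: gens_def)
    then have "(\<delta> (fst s), 0) \<in> ?G"
    proof cases
      case P
      define a b where "a = \<iota> x (lie I)" and "b = \<iota> x (lie J)"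
      have L: "a \<in> lie_ring" "b \<in> lie_ring" by (simp_all add: a_def b_def subst_lie_ring lie_in_ring)
      have "P (comm (X x) a) b = P (comm a b) (X x)"
        using P_inv[of "X x" a b] P_sym[of "X x"] L x by (simp add: comm_lie_ring)
      also have "\<dots> = - P a (comm (X x) b)"
        using P_inv[of a b "X x"] L x by (simp add: comm_anti[of b] P_minus comm_lie_ring)
      finally have "P (\<iota> x (\<delta> (lie I))) b + P a (\<iota> x (\<delta> (lie J))) = 0"
        by (simp add: a_def b_def subst_der)
      moreover have "\<delta> (fst s) = full_cyc (\<delta> (lie I)) (lie J) + full_cyc (lie I) (\<delta> (lie J))"
        by (simp add: P full_cyc_def der_simps der_cyc)
      moreover have "(full_cyc (\<delta> (lie I)) (lie J), P (\<iota> x (\<delta> (lie I))) b) \<in> ?G"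
        "(full_cyc (lie I) (\<delta> (lie J)), P a (\<iota> x (\<delta> (lie J)))) \<in> ?G"
        unfolding a_def b_def
        using P(2) by (intro W.graph_P[of _ "size (mlabels I)" _ "size (mlabels J)"];
                       simp add: der_lie_span lie_in_span)+
      ultimately show ?thesis unfolding graph_def using zspan_add by fastforce
    next
      case S
      define a where "a = \<iota> x (lie I)"
      have L: "a \<in> lie_ring" by (simp add: a_def subst_lie_ring lie_in_ring)
      have "P (\<iota> x (\<delta> (lie I))) a = P a (comm (X x) a)"
        using L x by (simp add: a_def subst_der P_sym comm_lie_ring)
      also have "\<dots> = 0" using P_alt[of a "X x"] L x by (simp add: comm_anti[of "X x"] P_minus comm_lie_ring)
      finally have "P (\<iota> x (\<delta> (lie I))) a = 0" .
      moreover have "\<delta> (fst s) = full_cyc (\<delta> (lie I)) (lie I)"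
        by (simp add: S full_cyc_def der_cyc)
      moreover have "(full_cyc (\<delta> (lie I)) (lie I), P (\<iota> x (\<delta> (lie I))) a) \<in> ?G"
        unfolding a_def
        using S(2) by (intro W.graph_P[of _ "size (mlabels I)" _ "size (mlabels I)"];
                       simp add: der_lie_span lie_in_span)
      ultimately show ?thesis by simp
    qed
    then show "(\<delta> (fst s), 0) \<in> zspan (gens (\<lambda>a b. P (\<iota> x a) (\<iota> x b)) (\<lambda>a. S (\<iota> x a)) (deg N))"
      by (simp add: graph_def)
  qed (auto intro!: additiveI simp: der_simps)
  then show ?thesis by (simp add: graph_def)
qed

text \<open>Factors other than the letter \<open>x\<close> are rewritten by
  \<open>lie_eliminate\<close>. A factor \<open>x\<close> is absorbed by invariance,
  \<open>P x [a, b] = P [x, a] b\<close>; if \<open>a\<close> or \<open>b\<close> is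
  \<open>x\<close> again, polynomial and value both vanish. Size at least 3 rules out two bare
  letters, where there is no bracket to absorb \<open>x\<close>.\<close>

lemma graph_eliminate:
  assumes "(z, g) \<in> graph P S (\<lambda>M'. M' = M)" "size M \<ge> 3"
  obtains c where "(c, g) \<in> graph (\<lambda>a b. P (\<iota> x a) (\<iota> x b)) (\<lambda>a. S (\<iota> x a)) (deg (nonx x M))"
    "z = \<Psi> x c"
proof -
  define G where "G = graph (\<lambda>a b. P (\<iota> x a) (\<iota> x b)) (\<lambda>a. S (\<iota> x a)) (deg (nonx x M))"
  interpret W: inv_form "\<lambda>a b. P (\<iota> x a) (\<iota> x b)" "\<lambda>a. S (\<iota> x a)" by (rule inv_form_subst)
  have x: "X x \<in> lie_ring" using lie_in_ring[of "Leaf x"] by simp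
  let ?R = "\<lambda>s. \<exists>c. (c, snd s) \<in> G \<and> fst s = \<Psi> x c"
  have R0: "?R (0, 0)" by (rule exI[of _ 0])
      (auto simp: G_def graph_def subst_cyc_simps zero_prod_def[symmetric] intro: zspan_0)
  have RP: "?R (full_cyc (\<iota> x u) (\<iota> x v), P (\<iota> x u) (\<iota> x v))"
    if "u \<in> lie_span i" "v \<in> lie_span j" "i + j = nonx x M" for u v i j
    using W.graph_P[OF that]
    by (intro exI[of _ "full_cyc u v"]) (auto simp: G_def full_cyc_def subst_cyc_simps subst_cyc_cyc)
  have leaf: "?R (full_cyc (X x) (lie J), P (X x) (lie J))" if J: "add_mset x (mlabels J) = M" for J
  proof (cases J)
    case (Leaf a)
    then show ?thesis using assms(2) J by auto
  next
    case (Br J1 J2)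
    have L: "lie J1 \<in> lie_ring" "lie J2 \<in> lie_ring" by (simp_all add: lie_in_ring)
    show ?thesis
    proof (cases "J1 = Leaf x \<or> J2 = Leaf x")
      case True
      have 1: "full_cyc (X x) (comm (X x) a) = 0" "P (X x) (comm (X x) a) = 0" if "a \<in> lie_ring" for a
        using that P_alt[OF x] by (simp_all add: full_cyc_alt)
      have 2: "full_cyc (X x) (comm a (X x)) = 0" "P (X x) (comm a (X x)) = 0" if "a \<in> lie_ring" for a
      proof -
        have "comm (X x) a \<in> lie_ring" using that x by (rule_tac comm_lie_ring)
        then show "full_cyc (X x) (comm a (X x)) = 0" "P (X x) (comm a (X x)) = 0"
          unfolding comm_anti[of a "X x"]
          using 1[OF that] P_minus(2)[OF x, of "comm (X x) a"] full_cyc_diff(2)[of "X x" 0 "comm (X x) a"]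
          by simp_all
      qed
      have "full_cyc (X x) (lie J) = 0 \<and> P (X x) (lie J) = 0"
        using True
      proof
        assume "J1 = Leaf x"
        then show ?thesis using 1[OF L(2)] by (simp add: Br)
      next
        assume "J2 = Leaf x"
        then show ?thesis using 2[OF L(1)] by (simp add: Br)
      qed
      then show ?thesis using R0 by simp
    next
      case False
      then have "J1 \<noteq> Leaf x" "J2 \<noteq> Leaf x" by simp_all
      obtain u where u: "u \<in> lie_span (nonx x (mlabels J1))" "lie J1 = \<iota> x u"
        using \<open>J1 \<noteq> Leaf x\<close> by (rule lie_eliminateE)
      obtain v where v: "v \<in> lie_span (nonx x (mlabels J2))" "lie J2 = \<iota> x v"
        using \<open>J2 \<noteq> Leaf x\<close> by (rule lie_eliminateE)
      note uv = u v
      have "full_cyc (X x) (lie J) = full_cyc (\<iota> x (\<delta> u)) (\<iota> x v)"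
        "P (X x) (lie J) = P (\<iota> x (\<delta> u)) (\<iota> x v)"
        using uv L P_inv[OF x, of "lie J1" "lie J2"]
        by (simp_all add: Br subst_der full_cyc_comm)
      then show ?thesis
        using RP[OF der_lie_span[OF uv(1)] uv(3)] J by (auto simp: Br)
    qed
  qed
  have "?R (z, g)"
    using assms(1) unfolding graph_def
  proof induction
    case zspan_0
    show ?case using R0 by (simp add: zero_prod_def)
  next
    case (zspan_base s)
    then consider (P) I J where "s = (full_cyc (lie I) (lie J), P (lie I) (lie J))" "mlabels I + mlabels J = M"
      | (S) I where "s = (cyc (lie I) (lie I), S (lie I))" "mlabels I + mlabels I = M"
      by (auto simp: gens_def)
    then show ?case
    proof cases
      case P
      show ?thesis
      proof (cases "I = Leaf x \<or> J = Leaf x")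
        case True
        then show ?thesis
        proof
          assume "I = Leaf x"
          then show ?thesis using leaf[of J] P by simp
        next
          assume "J = Leaf x"
          then show ?thesis using leaf[of I] P P_sym[OF x, of "lie I"]
            by (simp add: full_cyc_commute lie_in_ring)
        qed
      next
        case False
        then have "I \<noteq> Leaf x" "J \<noteq> Leaf x" by simp_all
        obtain u where u: "u \<in> lie_span (nonx x (mlabels I))" "lie I = \<iota> x u"
          using \<open>I \<noteq> Leaf x\<close> by (rule lie_eliminateE)
        obtain v where v: "v \<in> lie_span (nonx x (mlabels J))" "lie J = \<iota> x v"
          using \<open>J \<noteq> Leaf x\<close> by (rule lie_eliminateE)
        have "nonx x (mlabels I) + nonx x (mlabels J) = nonx x M"
          by (simp add: P(2)[symmetric])
        then show ?thesis using RP[OF u(1) v(1)] P(1) u(2) v(2) by simp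
      qed
    next
      case S
      then have "I \<noteq> Leaf x" using assms(2) by auto
      then obtain u where u: "u \<in> lie_span (nonx x (mlabels I))" "lie I = \<iota> x u"
        by (rule lie_eliminateE)
      then have "(cyc u u, S (\<iota> x u)) \<in> G" unfolding G_def
        by (rule_tac W.graph_S) (use S in auto)
      then show ?thesis using S u by (auto simp: subst_cyc_cyc)
    qed
  next
    case (zspan_diff a b)
    then obtain c d where "(c, snd a) \<in> G" "fst a = \<Psi> x c" "(d, snd b) \<in> G" "fst b = \<Psi> x d" by blast
    then have "(c, snd a) - (d, snd b) \<in> G" "fst (a - b) = \<Psi> x (c - d)"
      by (auto simp: G_def graph_def subst_cyc_simps intro: zspan.zspan_diff simp del: diff_Pair)
    then show ?case by auto
  qed
  then show ?thesis using that by (auto simp: G_def)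
qed

lemma graph_components:
  assumes "(z, g) \<in> graph P S (deg N)"
  obtains F h where "finite F" "\<And>M. size M = N \<Longrightarrow> (proj M z, h M) \<in> graph P S (\<lambda>M'. M' = M)"
    "g = sum h F" "\<And>M. M \<in> F \<Longrightarrow> size M = N"
proof -
  \<comment> \<open>The clause that \<open>h\<close> vanishes off \<open>F\<close> allows two such
    families to be summed over the union of their index sets.\<close>
  have "\<exists>F h. finite F \<and> (\<forall>M. size M = N \<longrightarrow> (proj M (fst p), h M) \<in> graph P S (\<lambda>M'. M' = M)) \<and>
      snd p = sum h F \<and> (\<forall>M. M \<notin> F \<longrightarrow> h M = 0) \<and> (\<forall>M\<in>F. size M = N)"
    if "p \<in> zspan (gens P S (deg N))" for p
    using that
  proof induction
    case zspan_0
    have "(0, 0) \<in> graph P S (\<lambda>M'. M' = M)" for M by (metis graph_def zspan.zspan_0 zero_prod_def)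
    then show ?case by (intro exI[of _ "{}"] exI[of _ "\<lambda>_. 0"]) (auto simp: proj_simps)
  next
    case (zspan_base s)
    then obtain I J where IJ: "size (mlabels I + mlabels J) = N"
      and s: "s = (full_cyc (lie I) (lie J), P (lie I) (lie J)) \<or> I = J \<and> s = (cyc (lie I) (lie I), S (lie I))"
      by (auto simp: gens_def)
    define M0 where "M0 = mlabels I + mlabels J"
    have keys: "w \<in> Poly_Mapping.keys (fst s) \<Longrightarrow> mset w = M0" for w
      using s keys_cyc_lie[of w I I] keys_full_cyc_lie[of w I J] by (auto simp: M0_def)
    have "s \<in> gens P S (\<lambda>M'. M' = M0)" using s by (auto simp: gens_def M0_def)
    then have s0: "(fst s, snd s) \<in> graph P S (\<lambda>M'. M' = M0)" by (simp add: graph_def zspan.zspan_base)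
    have 0: "(0, 0) \<in> graph P S (\<lambda>M'. M' = M)" for M by (metis graph_def zspan.zspan_0 zero_prod_def)
    have "(proj M (fst s), if M = M0 then snd s else 0) \<in> graph P S (\<lambda>M'. M' = M)" for M
    proof (cases "M = M0")
      case True
      then show ?thesis using s0 keys by (simp add: proj_id)
    next
      case False
      then have "proj M (fst s) = 0" using keys by (intro proj_eq_0) auto
      then show ?thesis using False 0 by simp
    qed
    then show ?case using IJ
      by (intro exI[of _ "{M0}"] exI[of _ "\<lambda>M. if M = M0 then snd s else 0"]) (auto simp: M0_def)
  next
    case (zspan_diff a b)
    from zspan_diff.IH obtain F h F' h' where *:
      "finite F" "\<forall>M. size M = N \<longrightarrow> (proj M (fst a), h M) \<in> graph P S (\<lambda>M'. M' = M)"
      "snd a = sum h F" "\<forall>M. M \<notin> F \<longrightarrow> h M = 0" "\<forall>M\<in>F. size M = N"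
      "finite F'" "\<forall>M. size M = N \<longrightarrow> (proj M (fst b), h' M) \<in> graph P S (\<lambda>M'. M' = M)"
      "snd b = sum h' F'" "\<forall>M. M \<notin> F' \<longrightarrow> h' M = 0" "\<forall>M\<in>F'. size M = N"
      by blast
    have "sum h F = sum h (F \<union> F')" "sum h' F' = sum h' (F \<union> F')"
      using * by (auto intro!: sum.mono_neutral_left)
    moreover have "(proj M (fst (a - b)), h M - h' M) \<in> graph P S (\<lambda>M'. M' = M)" if "size M = N" for M
    proof -
      have "(proj M (fst a), h M) - (proj M (fst b), h' M) \<in> graph P S (\<lambda>M'. M' = M)"
        using * that unfolding graph_def by (intro zspan.zspan_diff) auto
      then show ?thesis by (simp add: proj_simps)
    qed
    ultimately show ?case using *
      by (intro exI[of _ "F \<union> F'"] exI[of _ "\<lambda>M. h M - h' M"]) (auto simp: sum_subtractf)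
  qed
  from this[OF assms[unfolded graph_def]] obtain F h where
    "finite F" "\<And>M. size M = N \<Longrightarrow> (proj M z, h M) \<in> graph P S (\<lambda>M'. M' = M)"
    "g = sum h F" "\<And>M. M \<in> F \<Longrightarrow> size M = N"
    by fastforce
  then show ?thesis by (rule that)
qed

text \<open>The base case: only pairs of letters contribute, and for equal letters the pair coming
  from \<open>P\<close> is twice the pair coming from \<open>S\<close> in both coordinates. One
  coefficient therefore determines the value.\<close>

lemma graph_deg_2:
  assumes "(z, g) \<in> graph P S (\<lambda>M'. M' = {#a, b#})"
  shows "g = zmul (Poly_Mapping.lookup z [a, b]) (if a = b then S (X a) else P (X a) (X b))"
proof -
  let ?G = "if a = b then S (X a) else P (X a) (X b)"
  have X: "X c \<in> lie_ring" for c using lie_in_ring[of "Leaf c"] by simp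
  have leaf: "\<exists>c. I = Leaf c" if "size (mlabels I) \<le> 1" for I
    using that by (cases I) (auto simp: size_mlabels)
  have "snd (z, g) - zmul (Poly_Mapping.lookup (fst (z, g)) [a, b]) ?G = 0"
    using assms unfolding graph_def
  proof (rule zspan_zero_image)
    show "additive (\<lambda>p. snd p - zmul (Poly_Mapping.lookup (fst p) [a, b]) ?G)"
      by (auto intro!: additiveI simp: lookup_add zmul_add)
    fix s assume "s \<in> gens P S (\<lambda>M'. M' = {#a, b#})"
    then obtain I J where s: "s = (full_cyc (lie I) (lie J), P (lie I) (lie J)) \<or>
        I = J \<and> s = (cyc (lie I) (lie I), S (lie I))" and IJ: "mlabels I + mlabels J = {#a, b#}"
      by (auto simp: gens_def)
    have "size (mlabels I) + size (mlabels J) = 2" using arg_cong[OF IJ, of size] by simp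
    then have "size (mlabels I) \<le> 1" "size (mlabels J) \<le> 1"
      by (simp_all add: size_mlabels)
    then obtain c d where cd: "I = Leaf c" "J = Leaf d" using leaf by blast
    then have "c = a \<and> d = b \<or> c = b \<and> d = a"
      using IJ by (auto simp: add_eq_conv_ex)
    moreover have "zmul 2 (S (X a)) = P (X a) (X a)"
      using zmul_add[of 1 1 "S (X a)"] S_two[OF X[of a]] by simp
    ultimately show "snd s - zmul (Poly_Mapping.lookup (fst s) [a, b]) ?G = 0"
      using s P_sym[OF X X, of a b]
      by (auto simp: cd full_cyc_def frag_of_mult lookup_add lookup_single)
  qed
  then show ?thesis by simp
qed

end

section \<open>The correspondence is a bijection: induction by elimination\<close>

lemma zmul_Pair: "zmul n (a, b) = (zmul n a, zmul n b)"
proof -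
  have "(\<Sum>i<k. (a, b)) = (\<Sum>i<k. a, \<Sum>i<k. b)" for k :: nat
    by (induction k) (simp_all add: zero_prod_def)
  then show ?thesis by (simp add: zmul_def)
qed

lemma lookup_zmul: "Poly_Mapping.lookup (zmul n z) w = n * Poly_Mapping.lookup z w"
proof -
  have "Poly_Mapping.lookup (\<Sum>i<k. z) w = int k * Poly_Mapping.lookup z w" for k :: nat
    by (simp add: lookup_sum)
  then show ?thesis by (auto simp: zmul_def)
qed

text \<open>The target of \<eta> seen inside the associative ring: a tensor of letters with Lie
  elements, on which invariance under rotation says that the bracket vanishes. \<open>N\<close>
  counts the letters of a word.\<close>

definition cyc_inv :: "nat \<Rightarrow> ncpoly set" where
  "cyc_inv N = {z. Poly_Mapping.lookup z [] = 0 \<and> rot z = z \<and> (\<forall>a. ldiv a z \<in> lie_span (N - 1))}"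

text \<open>In degree at least 2 the spanning elements are brackets, and \<open>[a, b]\<close> is
  \<open>cyc a b\<close> minus its rotation, where \<open>cyc a b\<close> has Lie elements as left
  quotients.\<close>

lemma lie_span_decompose:
  assumes "u \<in> lie_span r" "r \<ge> 2"
  obtains e where "Poly_Mapping.lookup e [] = 0" "\<And>a. ldiv a e \<in> lie_span (r - 1)" "e - rot e = u"
proof -
  have "\<exists>e. Poly_Mapping.lookup e [] = 0 \<and> (\<forall>a. ldiv a e \<in> lie_span (r - 1)) \<and> e - rot e = u"
    using assms(1) unfolding lie_span_def[of r]
  proof induction
    case zspan_0
    show ?case by (rule exI[of _ 0]) (simp add: ldiv_simps additive.zero[OF additive_rot])
  next
    case (zspan_base s)
    then obtain I where I: "s = lie I" "size (mlabels I) = r" by blast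
    then obtain A B where "I = Br A B" using assms(2) by (cases I) auto
    with I have "s = comm (lie A) (lie B)" "size (mlabels A) + size (mlabels B) = Suc (r - 1)"
      using assms(2) by auto
    then show ?case
      using cyc_lie_span_ldiv[OF lie_in_span[OF refl]] cyc_rot
      by (intro exI[of _ "cyc (lie A) (lie B)"]) auto
  next
    case (zspan_diff a b)
    then obtain e f where "Poly_Mapping.lookup e [] = 0" "\<forall>a. ldiv a e \<in> lie_span (r - 1)" "e - rot e = a"
      "Poly_Mapping.lookup f [] = 0" "\<forall>a. ldiv a f \<in> lie_span (r - 1)" "f - rot f = b" by blast
    then show ?case
      by (intro exI[of _ "e - f"])
         (auto simp: lookup_minus ldiv_simps additive.diff[OF additive_rot])
  qed
  then show ?thesis using that by blast
qed

primrec tsubst :: "nat \<Rightarrow> rtree \<Rightarrow> rtree" where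
  "tsubst x (Leaf c) = adtree x (idx c) (pwr c)"
| "tsubst x (Br I J) = Br (tsubst x I) (tsubst x J)"

lemma subst_lie: "\<iota> x (lie I) = lie (tsubst x I)"
  by (induction I) (simp_all add: subst_comm lett_def)

text \<open>The way back to the old alphabet, without control of the value. The projection is needed
  since the degree over the new alphabet does not fix the number of letters
  \<open>x\<close>.\<close>

lemma graph_subst_cyc:
  assumes "(c, g) \<in> graph (\<lambda>a b. P (\<iota> x a) (\<iota> x b)) (\<lambda>a. S (\<iota> x a)) Q"
  shows "\<exists>h. (proj M (\<Psi> x c), h) \<in> graph P S (\<lambda>M'. M' = M)"
  using assms unfolding graph_def
proof (induction "(c, g)" arbitrary: c g)
  case zspan_0
  then show ?case using zspan.zspan_0[of "gens P S (\<lambda>M'. M' = M)"]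
    by (auto simp: zero_prod_def subst_cyc_simps proj_simps)
next
  case zspan_base
  then obtain I J where "c = full_cyc (lie I) (lie J) \<or> I = J \<and> c = cyc (lie I) (lie I)"
    by (auto simp: gens_def)
  then obtain s where s: "s \<in> gens P S (\<lambda>M'. M' = mlabels (tsubst x I) + mlabels (tsubst x J))"
    "fst s = \<Psi> x c" and keys: "\<And>w. w \<in> Poly_Mapping.keys (fst s) \<Longrightarrow> mset w = mlabels (tsubst x I) + mlabels (tsubst x J)"
  proof
    assume "c = full_cyc (lie I) (lie J)"
    then show ?thesis
      using that[of "(full_cyc (lie (tsubst x I)) (lie (tsubst x J)), P (lie (tsubst x I)) (lie (tsubst x J)))"]
        keys_full_cyc_lie
      by (auto simp: gens_def full_cyc_def subst_cyc_simps subst_cyc_cyc subst_lie)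
  next
    assume "I = J \<and> c = cyc (lie I) (lie I)"
    then show ?thesis
      using that[of "(cyc (lie (tsubst x I)) (lie (tsubst x I)), S (lie (tsubst x I)))"] keys_cyc_lie
      by (auto simp: gens_def subst_cyc_cyc subst_lie)
  qed
  show ?case
  proof (cases "M = mlabels (tsubst x I) + mlabels (tsubst x J)")
    case True
    then have "proj M (\<Psi> x c) = fst s" using s(2) keys by (simp add: proj_id)
    then show ?thesis using s(1) True by (metis prod.collapse zspan.zspan_base)
  next
    case False
    then have "proj M (\<Psi> x c) = 0" using s(2) keys by (intro proj_eq_0) auto
    then show ?thesis using zspan.zspan_0[of "gens P S (\<lambda>M'. M' = M)"] by (auto simp: zero_prod_def)
  qed
next
  case (zspan_diff a b)
  then obtain h k where "(proj M (\<Psi> x (fst a)), h) \<in> zspan (gens P S (\<lambda>M'. M' = M))"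
    "(proj M (\<Psi> x (fst b)), k) \<in> zspan (gens P S (\<lambda>M'. M' = M))"
    by (metis prod.collapse)
  then have "(proj M (\<Psi> x (fst a)), h) - (proj M (\<Psi> x (fst b)), k) \<in> zspan (gens P S (\<lambda>M'. M' = M))"
    by (rule zspan.zspan_diff)
  moreover have "c = fst a - fst b" using zspan_diff.hyps(5) by (metis fst_conv fst_diff)
  ultimately show ?case by (auto simp: subst_cyc_simps proj_simps)
qed

text \<open>Quantified over all forms, since elimination replaces \<open>P\<close> and
  \<open>S\<close> by their pullbacks; the type argument fixes the group of values throughout the
  induction.\<close>

definition graph_inj :: "'g::ab_group_add itself \<Rightarrow> nat \<Rightarrow> bool" where
  "graph_inj _ N \<longleftrightarrow> (\<forall>(P :: ncpoly \<Rightarrow> ncpoly \<Rightarrow> 'g) S g. inv_form P S \<longrightarrow> (0, g) \<in> graph P S (deg N) \<longrightarrow> g = 0)"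

definition graph_surj :: "'g::ab_group_add itself \<Rightarrow> nat \<Rightarrow> bool" where
  "graph_surj _ N \<longleftrightarrow> (\<forall>(P :: ncpoly \<Rightarrow> ncpoly \<Rightarrow> 'g) S z. inv_form P S \<longrightarrow> z \<in> cyc_inv N \<longrightarrow>
     (\<exists>g. (z, g) \<in> graph P S (deg N)))"

text \<open>Elimination gives a pair \<open>(c, g)\<close> with \<open>\<Psi> x c = 0\<close>, so
  \<open>c = \<delta> q\<close>. As \<delta> commutes with rotation and is injective,
  \<open>q\<close> is rotation invariant again. By surjectivity in lower degree \<open>q\<close> has
  a value, hence \<open>\<delta> q\<close> has the value 0, and subtracting leaves
  \<open>(0, g)\<close> in lower degree.\<close>

lemma graph_inj_step:
  fixes P :: "ncpoly \<Rightarrow> ncpoly \<Rightarrow> 'g::ab_group_add"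
  assumes PS: "inv_form P S" and M: "size M \<ge> 3"
    and IH: "graph_inj TYPE('g) (nonx x M)" "graph_surj TYPE('g) (nonx x M)"
    and g: "(0, g) \<in> graph P S (\<lambda>M'. M' = M)"
  shows "g = 0"
proof -
  interpret inv_form P S by fact
  define P' S' where "P' = (\<lambda>a b. P (\<iota> x a) (\<iota> x b))" and "S' = (\<lambda>a. S (\<iota> x a))"
  have PS': "inv_form P' S'" unfolding P'_def S'_def by (rule inv_form_subst)
  define r where "r = nonx x M"
  obtain c where c: "(c, g) \<in> graph P' S' (deg r)" "\<Psi> x c = 0"
    by (rule graph_eliminate[OF g M, of x]) (simp add: P'_def S'_def r_def)
  have "\<rho> i c = 0" for i
    using ldiv_subst_cyc[of x i c] c(2) by (simp add: ldiv_simps)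
  then obtain q where q: "c = \<delta> q" "Poly_Mapping.lookup q [] = 0" "\<And>a. ldiv a q \<in> lie_span (r - 1)"
    using rem_coeff_eq_0_imp_der[of c "r - 1"] graph_imp_lookup[OF c(1)] graph_imp_ldiv[OF c(1)] by blast
  have "\<delta> (q - rot q) = 0"
    using graph_imp_rot[OF c(1)] q(1) by (simp add: der_simps der_rot)
  then have "rot q = q"
    using der_eq_0[of "q - rot q"] q(2) by (simp add: lookup_minus lookup_rot)
  with q have "q \<in> cyc_inv r" by (simp add: cyc_inv_def)
  then obtain h where "(q, h) \<in> graph P' S' (deg r)"
    using IH(2) PS' unfolding graph_surj_def r_def by blast
  then have "(c, 0) \<in> graph P' S' (deg r)"
    using graph_der q(1) unfolding P'_def S'_def by simp
  then have "(c, g) - (c, 0) \<in> graph P' S' (deg r)"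
    using c(1) unfolding graph_def by (rule_tac zspan.zspan_diff)
  then show ?thesis using IH(1) PS' unfolding graph_inj_def r_def by simp
qed

text \<open>The quotients of \<open>z\<close> by letters other than \<open>x\<close> determine
  \<open>z\<close>. They are assembled to a polynomial \<open>T\<close> over the new alphabet, whose
  failure to be rotation invariant is \<delta> of the quotient by \<open>x\<close>. Adding
  \<open>\<delta> e\<close> repairs this without affecting remainders, so \<Psi> of the sum has the
  required quotients.\<close>

lemma graph_surj_step:
  fixes P :: "ncpoly \<Rightarrow> ncpoly \<Rightarrow> 'g::ab_group_add"
  assumes PS: "inv_form P S" and M: "size M \<ge> 3" "x \<in># M"
    and IH: "graph_surj TYPE('g) (nonx x M)"
    and z: "rot z = z" "\<And>a. a \<in># M \<Longrightarrow> ldiv a z \<in> lie_mspan (M - {#a#})"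
      "\<And>w. w \<in> Poly_Mapping.keys z \<Longrightarrow> mset w = M"
  shows "\<exists>g. (z, g) \<in> graph P S (\<lambda>M'. M' = M)"
proof -
  interpret inv_form P S by fact
  define P' S' where "P' = (\<lambda>a b. P (\<iota> x a) (\<iota> x b))" and "S' = (\<lambda>a. S (\<iota> x a))"
  have PS': "inv_form P' S'" unfolding P'_def S'_def by (rule inv_form_subst)
  define r where "r = nonx x M"
  have projz: "proj M z = z" using z(3) by (rule proj_id)
  have "M \<noteq> {#}" using M(2) by auto
  then have z0: "Poly_Mapping.lookup z [] = 0" using z(3)[of "[]"] by (auto simp: in_keys_iff)
  have ldiv0: "ldiv a z = 0" if "a \<notin># M" for a
    using ldiv_proj[of a M z] projz that by simp
  have el: "\<exists>u. u \<in> lie_span (nonx x (M - {#a#})) \<and> ldiv a z = \<iota> x u" for a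
  proof (cases "a \<in># M")
    case True
    have "M - {#a#} \<noteq> {#x#}"
    proof
      assume "M - {#a#} = {#x#}"
      then have "M = {#a, x#}" using True by (metis insert_DiffM)
      then show False using M by simp
    qed
    then show ?thesis using lie_mspan_eliminate[OF z(2)[OF True]] by blast
  next
    case False
    then show ?thesis using ldiv0 by (intro exI[of _ 0]) (auto simp: subst_simps)
  qed
  have "nonx x (M - {#a#}) = r - 1" if "a \<in># M" "a \<noteq> x" for a
    using that by (simp add: r_def size_Diff_singleton)
  then have el1: "\<exists>u. u \<in> lie_span (r - 1) \<and> ldiv a z = \<iota> x u" if "a \<noteq> x" for a
    using that el[of a] ldiv0[of a] by (cases "a \<in># M") (auto intro!: exI[of _ 0] simp: subst_simps)
  obtain ux where ux: "ux \<in> lie_span r" "ldiv x z = \<iota> x ux"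
    using el[of x] by (auto simp: r_def)
  show ?thesis
  proof (cases "r \<ge> 2")
    \<comment> \<open>With fewer than two letters other than \<open>x\<close> the quotients that
      matter lie in degree 0: those by other letters if \<open>r = 1\<close>, the one by
      \<open>x\<close> if \<open>r = 0\<close>.\<close>
    case False
    have "z = 0"
    proof (cases "r = 1")
      case True
      have "ldiv a z = 0" if "a \<noteq> x" for a using el1[OF that] True by (auto simp: subst_simps)
      moreover have "\<exists>a\<in>set w. a \<noteq> x" if "w \<in> Poly_Mapping.keys z" for w
      proof (rule ccontr)
        assume "\<not> (\<exists>a\<in>set w. a \<noteq> x)"
        then have "filter_mset (\<lambda>a. a \<noteq> x) (mset w) = {#}" by auto
        then show False using z(3)[OF that] True by (metis r_def size_empty zero_neq_one)
      qed
      ultimately show ?thesis using rot_invariant_eq_0I[OF z(1)] by blast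
    next
      case r: False
      then have "r = 0" using False by simp
      then have "a = x" if "a \<in># M" for a using that by (auto simp: r_def)
      then have "ldiv a z = 0" for a
        using ldiv0[of a] ux \<open>r = 0\<close> by (cases "a \<in># M") (auto simp: subst_simps)
      then show ?thesis using ncpoly_eq_0I[OF z0] by blast
    qed
    then show ?thesis using zspan.zspan_0[of "gens P S (\<lambda>M'. M' = M)"]
      by (auto simp: graph_def zero_prod_def)
  next
    case r: True
    obtain e where e: "Poly_Mapping.lookup e [] = 0" "\<And>a. ldiv a e \<in> lie_span (r - 1)" "e - rot e = ux"
      using lie_span_decompose[OF ux(1) r] by blast
    define H where "H = hd ` Poly_Mapping.keys z - {x}"
    have fin: "finite H" by (simp add: H_def)
    have expand: "z = X x * ldiv x z + (\<Sum>a\<in>H. X a * ldiv a z)"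
    proof -
      have "z = (\<Sum>a\<in>insert x H. X a * ldiv a z)"
        by (rule ncpoly_expand) (use fin z0 in \<open>auto simp: H_def\<close>)
      also have "\<dots> = X x * ldiv x z + (\<Sum>a\<in>H. X a * ldiv a z)"
        using fin by (subst sum.insert) (auto simp: H_def)
      finally show ?thesis .
    qed
    have inH: "a \<in> H" if a: "a \<noteq> x" "ldiv a z \<noteq> 0" for a
    proof -
      obtain w where "Poly_Mapping.lookup (ldiv a z) w \<noteq> 0"
        using a(2) by (metis lookup_zero poly_mapping_eqI)
      then have "a # w \<in> Poly_Mapping.keys z" by (simp add: lookup_ldiv in_keys_iff)
      then show ?thesis using a(1) by (force simp: H_def)
    qed
    define T where "T = (\<Sum>a\<in>H. X (prod_encode (unskip x a, 0)) * \<kappa> x (ldiv a z))"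
    have \<kappa>: "\<kappa> x (ldiv a z) \<in> lie_span (r - 1)" "\<iota> x (\<kappa> x (ldiv a z)) = ldiv a z" if "a \<noteq> x" for a
      using el1[OF that] by auto
    have ldivT: "ldiv b T \<in> lie_span (r - 1)" for b
      unfolding T_def ldiv_simps lie_span_def
      by (rule zspan_sum) (use \<kappa>(1) in \<open>auto simp: H_def lie_span_def[symmetric]\<close>)
    define c where "c = T + \<delta> e"
    have "ldiv b c \<in> lie_span (r - 1)" for b
      by (auto simp: c_def ldiv_simps ldiv_der intro!: lie_span_add ldivT der_lie_span e(2)
          simp del: One_nat_def)
    moreover have "Poly_Mapping.lookup c [] = 0"
    proof -
      have "Poly_Mapping.lookup (\<delta> e) [] = 0"
      proof (induction e rule: frag_ind)
        case (one w)
        then show ?case by (cases w) (simp_all add: der_def lookup_add frag_of_mult)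
      qed (simp_all add: der_simps lookup_minus)
      then show ?thesis by (simp add: c_def T_def lookup_add lookup_sum)
    qed
    moreover have "rot c = c"
    proof -
      \<comment> \<open>The first sum is \<open>z\<close> and the second is
        \<open>rot z = z\<close>, each up to its term with the quotient by \<open>x\<close>; what
        remains is a commutator with \<open>x\<close>, which is \<delta> over the new
        alphabet.\<close>
      have "\<iota> x (T - rot T) = (\<Sum>a\<in>H. X a * ldiv a z) - (\<Sum>a\<in>H. ldiv a z * X a)"
      proof -
        have "\<iota> x T = (\<Sum>a\<in>H. X a * ldiv a z)"
          unfolding T_def subst_simps by (rule sum.cong) (auto simp: H_def subst_mult \<kappa> lett_def)
        moreover have "\<iota> x (rot T) = (\<Sum>a\<in>H. ldiv a z * X a)"
          unfolding T_def additive.sum[OF additive_rot] subst_simps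
          by (rule sum.cong) (auto simp: H_def subst_mult \<kappa> lett_def)
        ultimately show ?thesis by (simp add: subst_simps)
      qed
      also have "(\<Sum>a\<in>H. X a * ldiv a z) = z - X x * ldiv x z"
        by (simp only: eq_diff_eq add.commute[of _ "X x * ldiv x z"] expand[symmetric])
      also have "(\<Sum>a\<in>H. ldiv a z * X a) = z - ldiv x z * X x"
      proof -
        have "rot z = ldiv x z * X x + (\<Sum>a\<in>H. ldiv a z * X a)"
          by (rule trans[OF arg_cong[OF expand, of rot]])
             (simp add: additive.add[OF additive_rot] additive.sum[OF additive_rot])
        then show ?thesis by (simp add: z(1) eq_diff_eq add.commute)
      qed
      also have "(z - X x * ldiv x z) - (z - ldiv x z * X x) = - \<iota> x (\<delta> ux)"
        by (simp add: ux subst_der comm_def)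
      finally have "T - rot T = - \<delta> ux"
        using subst_inject[of x "T - rot T" "- \<delta> ux"] by (simp add: subst_simps)
      moreover have "\<delta> e - rot (\<delta> e) = \<delta> ux"
        using e(3) by (simp add: der_rot[symmetric] der_simps[symmetric])
      moreover have "c - rot c = (T - rot T) + (\<delta> e - rot (\<delta> e))"
        by (simp add: c_def additive.add[OF additive_rot])
      ultimately show ?thesis by simp
    qed
    ultimately have "c \<in> cyc_inv r" by (simp add: cyc_inv_def)
    then obtain g where "(c, g) \<in> graph P' S' (deg r)"
      using IH PS' unfolding graph_surj_def r_def by blast
    then obtain h where h: "(proj M (\<Psi> x c), h) \<in> graph P S (\<lambda>M'. M' = M)"
      using graph_subst_cyc unfolding P'_def S'_def by blast
    have "\<rho> i c = \<kappa> x (ldiv (skip x i) z)" for i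
    proof -
      have "\<rho> i c = (\<Sum>a\<in>H. if a = skip x i then \<kappa> x (ldiv a z) else 0)"
        unfolding c_def T_def rem_coeff_simps rem_coeff_der additive.sum[OF additive_rem_coeff] add_0_right
      proof (rule sum.cong[OF refl])
        fix a assume "a \<in> H"
        then have "unskip x a = i \<longleftrightarrow> a = skip x i" by (auto simp: H_def)
        then show "\<rho> i (X (prod_encode (unskip x a, 0)) * \<kappa> x (ldiv a z)) =
            (if a = skip x i then \<kappa> x (ldiv a z) else 0)"
          by (simp add: rem_coeff_X)
      qed
      also have "\<dots> = \<kappa> x (ldiv (skip x i) z)"
        using fin inH[of "skip x i"]
        by (cases "ldiv (skip x i) z = 0") (auto simp: sum.delta additive.zero[OF additive_retract])
      finally show ?thesis .
    qed
    then have "ldiv a (\<Psi> x c) = ldiv a z" if "a \<noteq> x" for a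
      using ldiv_subst_cyc[of x "unskip x a" c] that \<kappa>(2)[of a] by simp
    then have "ldiv a (proj M (\<Psi> x c)) = ldiv a (proj M z)" if "a \<noteq> x" for a
      using that by (simp add: ldiv_proj)
    then have "ldiv a (z - proj M (\<Psi> x c)) = 0" if "a \<noteq> x" for a
      using that projz by (simp add: ldiv_simps)
    moreover have "\<exists>a\<in>set w. a \<noteq> x" if "w \<in> Poly_Mapping.keys (z - proj M (\<Psi> x c))" for w
    proof (rule ccontr)
      assume "\<not> (\<exists>a\<in>set w. a \<noteq> x)"
      then have "filter_mset (\<lambda>a. a \<noteq> x) (mset w) = {#}" by auto
      moreover have "mset w = M"
        using that keys_diff[of z "proj M (\<Psi> x c)"] z(3) keys_proj by blast
      ultimately have "r = 0" by (metis r_def size_empty)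
      then show False using r by simp
    qed
    moreover have "rot (z - proj M (\<Psi> x c)) = z - proj M (\<Psi> x c)"
      using z(1) graph_imp_rot[OF h] by (simp add: additive.diff[OF additive_rot])
    ultimately have "z - proj M (\<Psi> x c) = 0" by (rule_tac rot_invariant_eq_0I) blast+
    then show ?thesis using h by auto
  qed
qed

text \<open>Any letter of the content may be eliminated, since removing its occurrences already
  lowers the degree. Contents of size 2 are treated by hand because there a letter \<open>x\<close>
  cannot be absorbed into a bracket.\<close>

theorem graph_inj_surj: "graph_inj TYPE('g::ab_group_add) N \<and> graph_surj TYPE('g) N"
proof (induction N rule: less_induct)
  case (less N)
  have size2: "size (mlabels I + mlabels J) \<ge> 2" for I J by (simp add: size_mlabels)
  have IH: "graph_inj TYPE('g) (nonx x M)" "graph_surj TYPE('g) (nonx x M)"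
    if "size M = N" "x \<in># M" for x M
  proof -
    have "filter_mset (\<lambda>a. \<not> a \<noteq> x) M \<noteq> {#}" using that(2) by auto
    then have "size (filter_mset (\<lambda>a. \<not> a \<noteq> x) M) \<noteq> 0" by (metis size_eq_0_iff_empty)
    moreover have "size M = nonx x M + size (filter_mset (\<lambda>a. \<not> a \<noteq> x) M)"
      by (rule trans[OF arg_cong[OF multiset_partition, of size] size_union])
    ultimately have "nonx x M < N" using that(1) by linarith
    then show "graph_inj TYPE('g) (nonx x M)" "graph_surj TYPE('g) (nonx x M)" using less by blast+
  qed
  have pair: "\<exists>a b. M = {#a, b#}" if M: "size M = 2" for M :: "nat multiset"
  proof -
    obtain a N where "M = add_mset a N"
      using size_eq_Suc_imp_eq_union[of M 1] M by auto
    then have "size N = 1" using M by simp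
    then show ?thesis using \<open>M = add_mset a N\<close> size_1_singleton_mset by blast
  qed
  have inj: "g = 0" if PS: "inv_form P S" and g: "(0, g) \<in> graph P S (deg N)" for P :: "ncpoly \<Rightarrow> ncpoly \<Rightarrow> 'g" and S g
  proof -
    interpret inv_form P S by fact
    obtain F h where Fh: "finite F" "\<And>M. size M = N \<Longrightarrow> (proj M 0, h M) \<in> graph P S (\<lambda>M'. M' = M)"
      "g = sum h F" "\<And>M. M \<in> F \<Longrightarrow> size M = N"
      by (rule graph_components[OF g]) blast
    have "h M = 0" if "M \<in> F" for M
    proof -
      have M: "(0, h M) \<in> graph P S (\<lambda>M'. M' = M)" "size M = N"
        using Fh that by (auto simp: proj_simps)
      consider "N < 2" | "N = 2" | "N \<ge> 3" by linarith
      then show ?thesis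
      proof cases
        case 1
        have "mlabels I + mlabels J \<noteq> M" for I J using size2[of I J] 1 M(2) by auto
        then have "gens P S (\<lambda>M'. M' = M) = {}" by (simp add: gens_def)
        then have "snd (0 :: ncpoly, h M) = 0"
          using M(1) unfolding graph_def by (rule_tac zspan_zero_image) (auto intro: additiveI)
        then show ?thesis by simp
      next
        case 2
        then obtain a b where "M = {#a, b#}" using pair M(2) by blast
        then show ?thesis using graph_deg_2[of 0 "h M" a b] M(1) by simp
      next
        case 3
        then have "M \<noteq> {#}" using M(2) by auto
        then obtain x where "x \<in># M" by (rule multiset_nonemptyE)
        then show ?thesis using graph_inj_step[OF PS _ _ _ M(1)] IH[OF M(2)] 3 M(2) by blast
      qed
    qed
    then show ?thesis using Fh(3) by simp
  qed
  have surj: "\<exists>g. (z, g) \<in> graph P S (deg N)" if PS: "inv_form P S" and z: "z \<in> cyc_inv N"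
    for P :: "ncpoly \<Rightarrow> ncpoly \<Rightarrow> 'g" and S z
  proof (cases "N < 2")
    case True
    then have "ldiv a z = 0" for a using z by (cases N) (auto simp: cyc_inv_def)
    then have "z = 0" using z ncpoly_eq_0I[of z] by (simp add: cyc_inv_def)
    then show ?thesis using zspan.zspan_0[of "gens P S (deg N)"] by (auto simp: graph_def zero_prod_def)
  next
    case N: False
    interpret inv_form P S by fact
    have "\<exists>g. (proj M z, g) \<in> graph P S (\<lambda>M'. M' = M)" if M: "size M = N" for M
    proof -
      have ld: "ldiv a (proj M z) \<in> lie_mspan (M - {#a#})" if "a \<in># M" for a
        using z that proj_lie_span[of "ldiv a z" "N - 1"] by (simp add: ldiv_proj cyc_inv_def)
      have rot: "rot (proj M z) = proj M z"
        using z by (simp add: rot_proj cyc_inv_def)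
      show ?thesis
      proof (cases "N = 2")
        case False
        then have "size M \<ge> 3" using N M by linarith
        then have "M \<noteq> {#}" by auto
        then obtain x where "x \<in># M" by (rule multiset_nonemptyE)
        then show ?thesis
          by (intro graph_surj_step[OF PS \<open>size M \<ge> 3\<close> \<open>x \<in># M\<close> IH(2)[OF M \<open>x \<in># M\<close>] rot ld keys_proj])
      next
        case True
        then obtain a b where ab: "M = {#a, b#}" using pair M by blast
        \<comment> \<open>Invariance makes the coefficients at \<open>[a, b]\<close> and
          \<open>[b, a]\<close> agree, so this component of \<open>z\<close> is an integral multiple
          of one generating pair.\<close>
        define n where "n = Poly_Mapping.lookup (proj M z) [a, b]"
        define s where "s = (if a = b then (cyc (X a) (X a), S (X a)) else (full_cyc (X a) (X b), P (X a) (X b)))"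
        have "s \<in> gens P S (\<lambda>M'. M' = M)"
        proof (cases "a = b")
          case True
          then show ?thesis unfolding gens_def s_def ab
            by (intro UnI2 CollectI exI[of _ "Leaf a"]) simp
        next
          case False
          then show ?thesis unfolding gens_def s_def ab
            by (intro UnI1 CollectI exI[of _ "Leaf a"] exI[of _ "Leaf b"]) simp
        qed
        then have "zmul n s \<in> graph P S (\<lambda>M'. M' = M)"
          unfolding graph_def by (intro zmul_zspan zspan.zspan_base)
        moreover have "fst (zmul n s) = proj M z"
        proof -
          have swap: "Poly_Mapping.lookup (proj M z) [b, a] = n"
            using rot_eq_iter[OF rot, of 1 "[a, b]"] by (simp add: n_def)
          have fs: "fst (zmul n s) = zmul n (fst s)" by (metis fst_conv prod.collapse zmul_Pair)
          have fst_s: "Poly_Mapping.lookup (fst s) w = (if w = [a, b] \<or> w = [b, a] then 1 else 0)" for w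
            by (auto simp: s_def full_cyc_def frag_of_mult lookup_add)
          show ?thesis
          proof (rule poly_mapping_eqI)
            fix w
            have "mset w \<noteq> M" if "\<not> (w = [a, b] \<or> w = [b, a])"
            proof
              assume "mset w = M"
              then have "length w = 2" using M True by (metis size_mset)
              then obtain c d where "w = [c, d]"
                by (metis length_0_conv length_Suc_conv numeral_2_eq_2)
              then show False using that \<open>mset w = M\<close> by (auto simp: ab add_eq_conv_ex)
            qed
            then have "\<not> (w = [a, b] \<or> w = [b, a]) \<Longrightarrow> Poly_Mapping.lookup (proj M z) w = 0"
              by (simp add: lookup_proj)
            moreover have "w = [a, b] \<or> w = [b, a] \<Longrightarrow> Poly_Mapping.lookup (proj M z) w = n"
              using swap n_def by metis
            ultimately show "Poly_Mapping.lookup (fst (zmul n s)) w = Poly_Mapping.lookup (proj M z) w"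
              unfolding fs lookup_zmul fst_s by (cases "w = [a, b] \<or> w = [b, a]") simp_all
          qed
        qed
        ultimately show ?thesis by (metis prod.collapse)
      qed
    qed
    moreover define h where "h M = (SOME g. (proj M z, g) \<in> graph P S (\<lambda>M'. M' = M))" for M
    ultimately have h: "(proj M z, h M) \<in> graph P S (\<lambda>M'. M' = M)" if "size M = N" for M
      using someI_ex[of "\<lambda>g. (proj M z, g) \<in> graph P S (\<lambda>M'. M' = M)"] that by simp
    define F where "F = mset ` Poly_Mapping.keys z"
    have F: "size M = N" if "M \<in> F" for M
    proof -
      from that obtain w where w: "w \<in> Poly_Mapping.keys z" "M = mset w" by (auto simp: F_def)
      then obtain a v where av: "w = a # v" using z by (cases w) (auto simp: cyc_inv_def in_keys_iff)
      then have v: "Poly_Mapping.lookup (ldiv a z) v \<noteq> 0" using w by (simp add: lookup_ldiv in_keys_iff)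
      have "ldiv a z \<in> lie_span (N - 1)" using z by (simp add: cyc_inv_def)
      then have "Poly_Mapping.lookup (ldiv a z) v = 0" if "length v \<noteq> N - 1"
        unfolding lie_span_def
      proof (rule zspan_zero_image)
        fix s assume "s \<in> lie ` {I. size (mlabels I) = N - 1}"
        then obtain I where I: "s = lie I" "size (mlabels I) = N - 1" by blast
        have "mset v \<noteq> mlabels I" using I(2) that by (metis size_mset)
        then show "Poly_Mapping.lookup s v = 0" using keys_lie[of v I] by (auto simp: I in_keys_iff)
      qed (auto intro!: additiveI simp: lookup_add)
      then have "length v = N - 1" using v by blast
      then show ?thesis using w av N by auto
    qed
    define p where "p = (\<Sum>M\<in>F. (proj M z, h M))"
    have "p \<in> graph P S (deg N)"
      unfolding graph_def p_def
    proof (rule zspan_sum)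
      fix M assume "M \<in> F"
      then show "(proj M z, h M) \<in> zspan (gens P S (deg N))"
        using graph_mono[of "\<lambda>M'. M' = M" "deg N" P S] h[OF F] F by (auto simp: graph_def)
    qed
    moreover have "z = fst p"
      unfolding p_def fst_sum fst_conv by (rule proj_sum) (simp_all add: F_def)
    ultimately show ?thesis by (cases p) auto
  qed
  show ?case unfolding graph_inj_def graph_surj_def
    by (intro conjI allI impI) (rule inj, assumption+, rule surj, assumption+)
qed

section \<open>Presentations of the free Lie ring and the free quasi-Lie ring\<close>

type_synonym treesum = "rtree \<Rightarrow>\<^sub>0 int"

lemma diff_plus_diff: "(a - b) + (c - d) = (a + c) - (b + d)" for a b c d :: "'g::ab_group_add"
  by simp

lemma additive_zspan: "additive f \<Longrightarrow> (\<And>I. f (frag_of I) \<in> zspan R) \<Longrightarrow> f u \<in> zspan R"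
  by (induction u rule: frag_ind) (simp_all add: additive.zero additive.diff zspan_0 zspan_diff)

lemma additive_br [intro]: "additive (\<lambda>u. br u v)" "additive (br u)"
proof -
  show "additive (\<lambda>u. br u v)" by (auto intro!: additiveI simp: br_def frag_extend_add)
  show "additive (br u)"
  proof (rule additiveI)
    fix v w show "br u (v + w) = br u v + br u w"
      by (rule additive_eqI[where x = u])
         (auto intro!: additiveI simp: br_def frag_extend_add)
  qed
qed

lemmas br_simps = additive.add[OF additive_br(1)] additive.add[OF additive_br(2)]
  additive.diff[OF additive_br(1)] additive.diff[OF additive_br(2)]
  additive.minus[OF additive_br(1)] additive.minus[OF additive_br(2)]
  additive.zero[OF additive_br(1)] additive.zero[OF additive_br(2)]

lemma br_of [simp]: "br (frag_of I) (frag_of J) = frag_of (Br I J)"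
  by (simp add: br_def)

inductive flip1 :: "rtree \<Rightarrow> rtree \<Rightarrow> bool" where
  flip1_root: "flip1 (Br I J) (Br J I)"
| flip1_left: "flip1 I I' \<Longrightarrow> flip1 (Br I J) (Br I' J)"
| flip1_right: "flip1 J J' \<Longrightarrow> flip1 (Br I J) (Br I J')"

inductive sqr :: "rtree \<Rightarrow> bool" where
  sqr_root: "sqr (Br I I)"
| sqr_left: "sqr I \<Longrightarrow> sqr (Br I J)"
| sqr_right: "sqr J \<Longrightarrow> sqr (Br I J)"

text \<open>The relations shared by Lie and quasi-Lie rings. They are imposed at every depth of a
  tree, so that their span is an ideal without being closed under brackets by definition.\<close>

definition as_ihx :: "treesum set" where
  "as_ihx = {frag_of I + frag_of I' | I I'. flip1 I I'} \<union>
     {frag_of I - frag_of H + frag_of Z | I H Z. ihx_rooted I H Z}"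

definition lie_rels :: "treesum set" where
  "lie_rels = as_ihx \<union> {frag_of I | I. sqr I}"

definition quasi_rels :: "treesum set" where
  "quasi_rels = as_ihx \<union> {frag_of I + frag_of I | I. True}"

lemma as_ihx_subset: "as_ihx \<subseteq> lie_rels" "as_ihx \<subseteq> quasi_rels"
  by (auto simp: lie_rels_def quasi_rels_def)

lemma flip1_labels: "flip1 I I' \<Longrightarrow> mlabels I' = mlabels I"
  by (induction rule: flip1.induct) auto

lemma ihx_labels: "ihx_rooted I H Z \<Longrightarrow> mlabels H = mlabels I \<and> mlabels Z = mlabels I"
  by (induction rule: ihx_rooted.induct) auto

lemma rels_br_of:
  assumes "s \<in> R" "R \<in> {as_ihx, lie_rels, quasi_rels}"
  shows "br s (frag_of J) \<in> R" "br (frag_of J) s \<in> R"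
proof -
  have ai: "br s (frag_of J) \<in> as_ihx \<and> br (frag_of J) s \<in> as_ihx" if "s \<in> as_ihx" for s
  proof -
    from that consider I I' where "flip1 I I'" "s = frag_of I + frag_of I'"
      | I H Z where "ihx_rooted I H Z" "s = frag_of I - frag_of H + frag_of Z"
      by (auto simp: as_ihx_def)
    then show ?thesis
    proof cases
      case 1
      then show ?thesis
        unfolding as_ihx_def using flip1_left[OF 1(1), of J] flip1_right[OF 1(1), of J]
        by (auto simp: br_simps)
    next
      case 2
      then show ?thesis
        unfolding as_ihx_def using ihx_rooted.intros(2,3)[OF 2(1), of J]
        by (simp add: br_simps) blast
    qed
  qed
  have sq: "br s (frag_of J) \<in> {frag_of I | I. sqr I} \<and> br (frag_of J) s \<in> {frag_of I | I. sqr I}"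
    if "s \<in> {frag_of I | I. sqr I}" for s
    using that by (auto intro: sqr_left sqr_right)
  have dbl: "br s (frag_of J) \<in> {frag_of I + frag_of I | I. True} \<and> br (frag_of J) s \<in> {frag_of I + frag_of I | I. True}"
    if "s \<in> {frag_of I + frag_of I | I. True}" for s
    using that by (auto simp: br_simps)
  consider "R = as_ihx" | "R = lie_rels" | "R = quasi_rels" using assms(2) by blast
  then have "br s (frag_of J) \<in> R \<and> br (frag_of J) s \<in> R"
  proof cases
    case 1
    then show ?thesis using assms(1) ai by blast
  next
    case 2
    then show ?thesis using assms(1) ai[of s] sq[of s]
      unfolding lie_rels_def by blast
  next
    case 3
    then show ?thesis using assms(1) ai[of s] dbl[of s]
      unfolding quasi_rels_def by blast
  qed
  then show "br s (frag_of J) \<in> R" "br (frag_of J) s \<in> R" by blast+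
qed

lemma zspan_br:
  assumes "u \<in> zspan R" "R \<in> {as_ihx, lie_rels, quasi_rels}"
  shows "br u v \<in> zspan R" "br v u \<in> zspan R"
proof -
  have 1: "br u (frag_of J) \<in> zspan R" "br (frag_of J) u \<in> zspan R" for J
    by (rule zspan_image[OF assms(1)]; use rels_br_of[OF _ assms(2)] in \<open>auto intro: zspan_base\<close>)+
  show "br u v \<in> zspan R" "br v u \<in> zspan R"
    by (induction v rule: frag_ind) (simp_all add: br_simps zspan_0 zspan_diff 1)
qed

lemma as_ihx_br:
  assumes "as_ihx \<subseteq> R"
  shows "br u v + br v u \<in> zspan R"
    and "br (br u v) w - br u (br v w) + br v (br u w) \<in> zspan R"
proof -
  have "frag_of (Br I J) + frag_of (Br J I) \<in> zspan R" for I J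
    using assms by (auto simp: as_ihx_def intro!: zspan_base flip1_root)
  then have "br (frag_of I) v + br v (frag_of I) \<in> zspan R" for I
    by (induction v rule: frag_ind) (auto simp: br_simps diff_plus_diff intro: zspan_0 zspan_diff)
  then show "br u v + br v u \<in> zspan R"
    by (induction u rule: frag_ind) (auto simp: br_simps diff_plus_diff intro: zspan_0 zspan_diff)
  let ?J = "\<lambda>u v w. br (br u v) w - br u (br v w) + br v (br u w)"
  have "frag_of (Br (Br I J) K) - frag_of (Br I (Br J K)) + frag_of (Br J (Br I K)) \<in> as_ihx" for I J K
    unfolding as_ihx_def using ihx_rooted.intros(1) by blast
  then have 1: "?J (frag_of I) (frag_of J) (frag_of K) \<in> zspan R" for I J K
    by (auto intro!: zspan_base subsetD[OF assms])
  have 2: "?J (frag_of I) (frag_of J) w \<in> zspan R" for I J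
    by (rule additive_zspan[where u = w]) (use 1 in \<open>auto intro!: additiveI simp: br_simps\<close>)
  have 3: "?J (frag_of I) v w \<in> zspan R" for I
    by (rule additive_zspan[where u = v]) (use 2 in \<open>auto intro!: additiveI simp: br_simps\<close>)
  show "?J u v w \<in> zspan R"
    by (rule additive_zspan[where u = u]) (use 3 in \<open>auto intro!: additiveI simp: br_simps\<close>)
qed

section \<open>Evaluation of sums of trees in the associative ring\<close>

abbreviation liesum :: "treesum \<Rightarrow> ncpoly" where
  "liesum \<equiv> lin lie"

lemma liesum_br: "liesum (br u v) = comm (liesum u) (liesum v)"
proof (rule additive_eqI[where x = u])
  fix I show "liesum (br (frag_of I) v) = comm (liesum (frag_of I)) (liesum v)"
    by (rule additive_eqI[where x = v]) (auto intro!: additiveI simp: br_simps lin_add comm_add)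
qed (auto intro!: additiveI simp: br_simps lin_add comm_add)

lemma lie_flip1: "flip1 I I' \<Longrightarrow> lie I' = - lie I"
  by (induction rule: flip1.induct) (simp_all add: comm_minus, simp add: comm_def)

lemma lie_ihx: "ihx_rooted I H Z \<Longrightarrow> lie I = lie H - lie Z"
  by (induction rule: ihx_rooted.induct) (simp_all add: comm_jacobi comm_diff)

lemma lie_sqr: "sqr I \<Longrightarrow> lie I = 0"
  by (induction rule: sqr.induct) simp_all

lemma liesum_rels: "u \<in> zspan lie_rels \<Longrightarrow> liesum u = 0"
  by (erule zspan_zero_image)
     (auto simp: additive_lin lie_rels_def as_ihx_def lin_add lin_diff lie_flip1 lie_ihx lie_sqr)

definition filt :: "nat multiset \<Rightarrow> treesum \<Rightarrow> treesum" where
  "filt M = lin (\<lambda>I. if mlabels I = M then frag_of I else 0)"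

lemma additive_filt [intro]: "additive (filt M)"
  by (simp add: filt_def additive_lin)

lemma lookup_filt: "Poly_Mapping.lookup (filt M u) I = (if mlabels I = M then Poly_Mapping.lookup u I else 0)"
  by (induction u rule: frag_ind) (auto simp: filt_def lin_diff lookup_minus)

lemma keys_filt: "I \<in> Poly_Mapping.keys (filt M u) \<longleftrightarrow> I \<in> Poly_Mapping.keys u \<and> mlabels I = M"
  by (auto simp: in_keys_iff lookup_filt split: if_splits)

lemma filt_sum: "u = (\<Sum>M\<in>mlabels ` Poly_Mapping.keys u. filt M u)"
  by (rule poly_mapping_eqI) (force simp: lookup_sum lookup_filt in_keys_iff)

lemma liesum_filt: "liesum (filt M u) = proj M (liesum u)"
proof (rule additive_eqI[where x = u])
  fix I
  have "mlabels I \<noteq> M \<Longrightarrow> proj M (lie I) = 0" by (rule proj_eq_0) (auto dest: keys_lie)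
  moreover have "mlabels I = M \<Longrightarrow> proj M (lie I) = lie I" by (rule proj_id) (auto dest: keys_lie)
  ultimately show "liesum (filt M (frag_of I)) = proj M (liesum (frag_of I))"
    by (simp add: filt_def)
qed (auto intro!: additiveI simp: filt_def lin_add proj_simps)

subsection \<open>Lazard elimination for trees\<close>

abbreviation tsubsts :: "nat \<Rightarrow> treesum \<Rightarrow> treesum" where
  "tsubsts x \<equiv> lin (\<lambda>I. frag_of (tsubst x I))"

lemma tsubsts_br: "tsubsts x (br u v) = br (tsubsts x u) (tsubsts x v)"
proof (rule additive_eqI[where x = u])
  fix I show "tsubsts x (br (frag_of I) v) = br (tsubsts x (frag_of I)) (tsubsts x v)"
    by (rule additive_eqI[where x = v]) (auto intro!: additiveI simp: br_simps lin_add)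
qed (auto intro!: additiveI simp: br_simps lin_add)

lemma liesum_tsubsts: "liesum (tsubsts x u) = \<iota> x (liesum u)"
  by (rule additive_eqI[where x = u]) (auto intro!: additiveI simp: lin_add subst_simps subst_lie)

lemma flip1_tsubst: "flip1 I I' \<Longrightarrow> flip1 (tsubst x I) (tsubst x I')"
  by (induction rule: flip1.induct) (auto intro: flip1.intros)

lemma sqr_tsubst: "sqr I \<Longrightarrow> sqr (tsubst x I)"
  by (induction rule: sqr.induct) (auto intro: sqr.intros)

lemma ihx_tsubst: "ihx_rooted I H Z \<Longrightarrow> ihx_rooted (tsubst x I) (tsubst x H) (tsubst x Z)"
  by (induction rule: ihx_rooted.induct) (auto intro: ihx_rooted.intros)

lemma tsubsts_rels:
  "u \<in> zspan lie_rels \<Longrightarrow> tsubsts x u \<in> zspan lie_rels"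
  "u \<in> zspan quasi_rels \<Longrightarrow> tsubsts x u \<in> zspan quasi_rels"
proof -
  have *: "tsubsts x s \<in> as_ihx" if "s \<in> as_ihx" for s
    using that unfolding as_ihx_def
    by (auto simp: lin_add lin_diff; blast intro: flip1_tsubst ihx_tsubst)
  show "u \<in> zspan lie_rels \<Longrightarrow> tsubsts x u \<in> zspan lie_rels"
    by (erule zspan_image)
       (use * in \<open>auto simp: additive_lin lie_rels_def intro!: zspan_base sqr_tsubst\<close>)
  show "u \<in> zspan quasi_rels \<Longrightarrow> tsubsts x u \<in> zspan quasi_rels"
    by (erule zspan_image)
       (use * in \<open>auto simp: additive_lin quasi_rels_def lin_add intro!: zspan_base\<close>)
qed

primrec tder :: "rtree \<Rightarrow> treesum" where
  "tder (Leaf c) = frag_of (Leaf (raise c))"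
| "tder (Br I J) = br (tder I) (frag_of J) + br (frag_of I) (tder J)"

abbreviation tders :: "treesum \<Rightarrow> treesum" where
  "tders \<equiv> lin tder"

lemma tders_br: "tders (br u v) = br (tders u) v + br u (tders v)"
proof (rule additive_eqI[where x = u])
  fix I show "tders (br (frag_of I) v) = br (tders (frag_of I)) v + br (frag_of I) (tders v)"
    by (rule additive_eqI[where x = v]) (auto intro!: additiveI simp: br_simps lin_add)
qed (auto intro!: additiveI simp: br_simps lin_add)

lemma keys_br:
  assumes "\<And>I. I \<in> Poly_Mapping.keys u \<Longrightarrow> f I" "\<And>J. J \<in> Poly_Mapping.keys v \<Longrightarrow> g J"
    "K \<in> Poly_Mapping.keys (br u v)"
  shows "\<exists>I J. K = Br I J \<and> f I \<and> g J"
proof -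
  obtain I where I: "I \<in> Poly_Mapping.keys u" "K \<in> Poly_Mapping.keys (frag_extend (\<lambda>J. frag_of (Br I J)) v)"
    using subsetD[OF keys_frag_extend assms(3)[unfolded br_def]] by auto
  then obtain J where "J \<in> Poly_Mapping.keys v" "K = Br I J"
    using keys_frag_extend[of "\<lambda>J. frag_of (Br I J)" v] by auto
  then show ?thesis using assms(1,2) I(1) by blast
qed

lemma keys_tder: "J \<in> Poly_Mapping.keys (tder I) \<Longrightarrow> size (mlabels J) = size (mlabels I)"
proof (induction I arbitrary: J)
  case (Br A B)
  have "J \<in> Poly_Mapping.keys (br (tder A) (frag_of B)) \<or> J \<in> Poly_Mapping.keys (br (frag_of A) (tder B))"
    using Br.prems keys_add by fastforce
  then show ?case
  proof
    assume "J \<in> Poly_Mapping.keys (br (tder A) (frag_of B))"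
    from keys_br[where f = "\<lambda>I. size (mlabels I) = size (mlabels A)" and g = "\<lambda>I. I = B", OF Br.IH(1) _ this]
    show ?thesis by auto
  next
    assume "J \<in> Poly_Mapping.keys (br (frag_of A) (tder B))"
    from keys_br[where f = "\<lambda>I. I = A" and g = "\<lambda>I. size (mlabels I) = size (mlabels B)", OF _ Br.IH(2) this]
    show ?thesis by auto
  qed
qed simp

lemma keys_lin:
  fixes f :: "'a \<Rightarrow> 'b \<Rightarrow>\<^sub>0 int"
  shows "K \<in> Poly_Mapping.keys (lin f u) \<Longrightarrow> \<exists>I\<in>Poly_Mapping.keys u. K \<in> Poly_Mapping.keys (f I)"
proof -
  have "lin f u = frag_extend f u"
    by (rule additive_eqI) (auto intro!: additiveI simp: lin_add frag_extend_add)
  then show "K \<in> Poly_Mapping.keys (lin f u) \<Longrightarrow> ?thesis" using keys_frag_extend[of f u] by auto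
qed

definition sized :: "nat \<Rightarrow> treesum set" where
  "sized n = {u. \<forall>I\<in>Poly_Mapping.keys u. size (mlabels I) = n}"

lemma sized_diff: "u \<in> sized n \<Longrightarrow> v \<in> sized n \<Longrightarrow> u - v \<in> sized n"
  and sized_minus: "u \<in> sized n \<Longrightarrow> - u \<in> sized n" and sized_0: "0 \<in> sized n"
  and sized_tders: "u \<in> sized n \<Longrightarrow> tders u \<in> sized n"
  and sized_br: "u \<in> sized i \<Longrightarrow> v \<in> sized j \<Longrightarrow> br u v \<in> sized (i + j)"
proof -
  show "u \<in> sized n \<Longrightarrow> v \<in> sized n \<Longrightarrow> u - v \<in> sized n"
    using keys_diff[of u v] by (auto simp: sized_def)
  show "u \<in> sized n \<Longrightarrow> - u \<in> sized n" "0 \<in> sized n" by (simp_all add: sized_def)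
  show "u \<in> sized n \<Longrightarrow> tders u \<in> sized n"
    by (auto simp: sized_def dest!: keys_lin keys_tder)
  show "u \<in> sized i \<Longrightarrow> v \<in> sized j \<Longrightarrow> br u v \<in> sized (i + j)"
    using keys_br[where f = "\<lambda>I. size (mlabels I) = i" and g = "\<lambda>I. size (mlabels I) = j", of u v]
    by (fastforce simp: sized_def)
qed

text \<open>For trees the rule \<open>subst_der\<close> holds only modulo relations: carrying
  \<open>x\<close> into a bracket takes one IHX relation for every vertex passed.\<close>

lemma tsubsts_tders:
  assumes "as_ihx \<subseteq> R" "R \<in> {lie_rels, quasi_rels}"
  shows "br (frag_of (Leaf x)) (tsubsts x u) - tsubsts x (tders u) \<in> zspan R"
proof -
  let ?x = "frag_of (Leaf x)"
  have R: "R \<in> {as_ihx, lie_rels, quasi_rels}" using assms(2) by blast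
  have *: "br ?x (tsubsts x (frag_of I)) - tsubsts x (tders (frag_of I)) \<in> zspan R" for I
  proof (induction I)
    case (Leaf c)
    then show ?case by (simp add: zspan_0)
  next
    case (Br I J)
    define a b where "a = frag_of (tsubst x I)" and "b = frag_of (tsubst x J)"
    have "br ?x (br a b) - tsubsts x (tders (br (frag_of I) (frag_of J))) =
        br (br ?x a - tsubsts x (tders (frag_of I))) b + br a (br ?x b - tsubsts x (tders (frag_of J)))
        - (br (br ?x a) b - br ?x (br a b) + br a (br ?x b))"
      by (simp add: a_def b_def tders_br tsubsts_br lin_add br_simps algebra_simps del: br_of)
    also have "\<dots> \<in> zspan R"
    proof (rule zspan_diff[OF zspan_add])
      show "br (br ?x a - tsubsts x (tders (frag_of I))) b \<in> zspan R"
        using zspan_br(1)[OF Br.IH(1) R, of b] by (simp add: a_def)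
      show "br a (br ?x b - tsubsts x (tders (frag_of J))) \<in> zspan R"
        using zspan_br(2)[OF Br.IH(2) R, of a] by (simp add: b_def)
    qed (rule as_ihx_br(2)[OF assms(1)])
    finally show ?case by (simp add: a_def b_def)
  qed
  show ?thesis
  proof (induction u rule: frag_ind)
    case (diff a b)
    have "br ?x (tsubsts x (a - b)) - tsubsts x (tders (a - b)) =
      (br ?x (tsubsts x a) - tsubsts x (tders a)) - (br ?x (tsubsts x b) - tsubsts x (tders b))"
      by (simp add: lin_diff br_simps)
    then show ?case using diff by (simp add: zspan_diff)
  qed (use * in \<open>auto simp: br_simps intro: zspan_0\<close>)
qed

text \<open>The counterpart of \<open>lie_eliminate\<close> for the presented ring. It cannot be
  deduced in the associative ring, since it will serve to show that evaluation there is
  injective.\<close>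

lemma tree_eliminate:
  "I = Leaf x \<or> (\<exists>u\<in>sized (nonx x (mlabels I)). frag_of I - tsubsts x u \<in> zspan lie_rels)"
proof (induction I)
  case (Leaf a)
  show ?case
  proof (cases "a = x")
    case False
    then have "frag_of (Leaf a) - tsubsts x (frag_of (Leaf (prod_encode (unskip x a, 0)))) = 0" by simp
    then have "frag_of (Leaf a) - tsubsts x (frag_of (Leaf (prod_encode (unskip x a, 0)))) \<in> zspan lie_rels"
      by (metis zspan_0)
    moreover have "frag_of (Leaf (prod_encode (unskip x a, 0))) \<in> sized (nonx x (mlabels (Leaf a)))"
      using False by (simp add: sized_def)
    ultimately show ?thesis by blast
  qed simp
next
  case (Br I J)
  let ?x = "frag_of (Leaf x)"
  have ideal: "u \<in> zspan lie_rels \<Longrightarrow> br u v \<in> zspan lie_rels" "u \<in> zspan lie_rels \<Longrightarrow> br v u \<in> zspan lie_rels"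
    for u v by (rule zspan_br; simp)+
  have der: "br ?x (tsubsts x v) - tsubsts x (tders v) \<in> zspan lie_rels" for v
    using as_ihx_subset by (intro tsubsts_tders) auto
  have der': "br ?x (frag_of K) - tsubsts x (tders v) \<in> zspan lie_rels" if "frag_of K - tsubsts x v \<in> zspan lie_rels" for K v
    using zspan_add[OF ideal(2)[OF that, of ?x] der[of v]] by (simp add: br_simps del: br_of)
  consider (xx) "I = Leaf x" "J = Leaf x"
    | (xJ) v where "I = Leaf x" "v \<in> sized (nonx x (mlabels J))" "frag_of J - tsubsts x v \<in> zspan lie_rels"
    | (Ix) u where "J = Leaf x" "u \<in> sized (nonx x (mlabels I))" "frag_of I - tsubsts x u \<in> zspan lie_rels"
    | (IJ) u v where "u \<in> sized (nonx x (mlabels I))" "frag_of I - tsubsts x u \<in> zspan lie_rels"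
        "v \<in> sized (nonx x (mlabels J))" "frag_of J - tsubsts x v \<in> zspan lie_rels"
    using Br.IH by blast
  then show ?case
  proof cases
    case xx
    then have "frag_of (Br I J) - tsubsts x 0 \<in> zspan lie_rels"
      by (auto simp: lie_rels_def intro!: zspan_base sqr_root)
    then show ?thesis using sized_0 by blast
  next
    case xJ
    then show ?thesis using der'[of J v]
      by (intro disjI2 bexI[of _ "tders v"]) (auto simp: sized_tders)
  next
    case Ix
    have "br (frag_of I) ?x + br ?x (frag_of I) \<in> zspan lie_rels" by (rule as_ihx_br(1)[OF as_ihx_subset(1)])
    then have "(br (frag_of I) ?x + br ?x (frag_of I)) - (br ?x (frag_of I) - tsubsts x (tders u)) \<in> zspan lie_rels"
      using der'[OF Ix(3)] by (rule zspan_diff)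
    then have "frag_of (Br I J) - tsubsts x (- tders u) \<in> zspan lie_rels"
      by (simp add: Ix(1) lin_minus)
    moreover have "- tders u \<in> sized (nonx x (mlabels (Br I J)))"
      using Ix(1,2) by (simp add: sized_minus sized_tders)
    ultimately show ?thesis by blast
  next
    case IJ
    have "br (frag_of I - tsubsts x u) (frag_of J) + br (tsubsts x u) (frag_of J - tsubsts x v) \<in> zspan lie_rels"
      using IJ by (intro zspan_add ideal)
    then have "frag_of (Br I J) - tsubsts x (br u v) \<in> zspan lie_rels"
      by (simp add: br_simps tsubsts_br)
    moreover have "br u v \<in> sized (nonx x (mlabels (Br I J)))" using IJ sized_br by simp
    ultimately show ?thesis by blast
  qed
qed

lemma treesum_eliminate:
  assumes "\<And>I. I \<in> Poly_Mapping.keys u \<Longrightarrow> mlabels I = M" "M \<noteq> {#x#}"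
  obtains v where "v \<in> sized (nonx x M)" "u - tsubsts x v \<in> zspan lie_rels"
proof -
  have "\<exists>v\<in>sized (nonx x M). u - tsubsts x v \<in> zspan lie_rels"
  proof (rule frag_induction[where c = u and S = "{I. mlabels I = M}"])
    show "\<exists>v\<in>sized (nonx x M). 0 - tsubsts x v \<in> zspan lie_rels"
      by (rule bexI[of _ 0]) (auto simp: sized_0 zspan_0)
    fix I assume "I \<in> {I. mlabels I = M}"
    then show "\<exists>v\<in>sized (nonx x M). frag_of I - tsubsts x v \<in> zspan lie_rels"
      using tree_eliminate[of I x] assms(2) by auto
  next
    fix a b assume "\<exists>v\<in>sized (nonx x M). a - tsubsts x v \<in> zspan lie_rels"
      "\<exists>v\<in>sized (nonx x M). b - tsubsts x v \<in> zspan lie_rels"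
    then obtain v w where v: "v \<in> sized (nonx x M)" "a - tsubsts x v \<in> zspan lie_rels"
      and w: "w \<in> sized (nonx x M)" "b - tsubsts x w \<in> zspan lie_rels" by blast
    have "(a - b) - tsubsts x (v - w) = (a - tsubsts x v) - (b - tsubsts x w)"
      by (simp add: lin_diff)
    also have "\<dots> \<in> zspan lie_rels" by (rule zspan_diff[OF v(2) w(2)])
    finally show "\<exists>v\<in>sized (nonx x M). (a - b) - tsubsts x v \<in> zspan lie_rels"
      using sized_diff[OF v(1) w(1)] by blast
  qed (use assms(1) in auto)
  then show ?thesis using that by blast
qed

lemma nonx_less: "x \<in># M \<Longrightarrow> nonx x M < size M"
proof -
  assume "x \<in># M"
  then have "filter_mset (\<lambda>a. \<not> a \<noteq> x) M \<noteq> {#}" by auto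
  then have "size (filter_mset (\<lambda>a. \<not> a \<noteq> x) M) \<noteq> 0" by (metis size_eq_0_iff_empty)
  moreover have "size M = nonx x M + size (filter_mset (\<lambda>a. \<not> a \<noteq> x) M)"
    by (rule trans[OF arg_cong[OF multiset_partition, of size] size_union])
  ultimately show ?thesis by linarith
qed

lemma filt_zspanI:
  assumes "\<And>M. M \<in> mlabels ` Poly_Mapping.keys u \<Longrightarrow> filt M u \<in> zspan R"
  shows "u \<in> zspan R"
  by (subst filt_sum) (rule zspan_sum, rule assms)

lemma filt_leaf:
  assumes "size M = 1"
  obtains a where "M = {#a#}" "filt M u = zmul (Poly_Mapping.lookup u (Leaf a)) (frag_of (Leaf a))"
proof -
  obtain a where a: "M = {#a#}" using assms size_1_singleton_mset by blast
  have "mlabels I = {#a#} \<longleftrightarrow> I = Leaf a" for I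
    by (cases I) (auto simp: union_is_single)
  then have "filt M u = zmul (Poly_Mapping.lookup u (Leaf a)) (frag_of (Leaf a))"
    by (intro poly_mapping_eqI) (auto simp: a lookup_filt lookup_zmul)
  then show ?thesis using that a by blast
qed

text \<open>The presented Lie ring embeds in the free associative ring, over the integers.
  Elimination lowers the degree and \<iota> is injective, so the induction needs neither a basis nor
  division.\<close>

theorem liesum_eq_0_sized: "u \<in> sized N \<Longrightarrow> liesum u = 0 \<Longrightarrow> u \<in> zspan lie_rels"
proof (induction N arbitrary: u rule: less_induct)
  case (less N)
  show ?case
  proof (rule filt_zspanI)
    fix M assume "M \<in> mlabels ` Poly_Mapping.keys u"
    then have M: "size M = N" "M \<noteq> {#}" using less.prems(1) by (auto simp: sized_def)
    have 0: "liesum (filt M u) = 0" using less.prems(2) by (simp add: liesum_filt proj_simps)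
    show "filt M u \<in> zspan lie_rels"
    proof (cases "size M = 1")
      case True
      then obtain a where a: "filt M u = zmul (Poly_Mapping.lookup u (Leaf a)) (frag_of (Leaf a))"
        using filt_leaf by metis
      have "liesum (zmul n v) = zmul n (liesum v)" for n v
        by (simp add: zmul_def lin_sum lin_minus)
      then have "zmul (Poly_Mapping.lookup u (Leaf a)) (X a) = 0" using a 0 by simp
      then have "Poly_Mapping.lookup u (Leaf a) = 0"
        using lookup_zmul[of "Poly_Mapping.lookup u (Leaf a)" "X a" "[a]"] by simp
      then show ?thesis using a by (simp add: zspan_0)
    next
      case False
      obtain x where x: "x \<in># M" using M(2) by (rule multiset_nonemptyE)
      have "M \<noteq> {#x#}" using False by auto
      then obtain v where v: "v \<in> sized (nonx x M)" "filt M u - tsubsts x v \<in> zspan lie_rels"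
        using treesum_eliminate[of "filt M u" M x] keys_filt by metis
      have "\<iota> x (liesum v) = 0"
        using liesum_rels[OF v(2)] 0 by (simp add: lin_diff liesum_tsubsts)
      then have "v \<in> zspan lie_rels"
        using less.IH[OF _ v(1)] nonx_less[OF x] M(1) by simp
      then show ?thesis using zspan_add[OF v(2) tsubsts_rels(1), of v x] by simp
    qed
  qed
qed

subsection \<open>Squares in the free quasi-Lie ring modulo two\<close>

abbreviation "QR \<equiv> zspan quasi_rels"

lemma double_QR: "u + u \<in> QR"
proof (induction u rule: frag_ind)
  case (diff a b)
  then show ?case using zspan_diff by (fastforce simp: diff_plus_diff)
qed (auto simp: quasi_rels_def intro: zspan_0 zspan_base)

abbreviation sqs :: "treesum \<Rightarrow> treesum" where
  "sqs \<equiv> lin (\<lambda>I. frag_of (Br I I))"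

text \<open>Squaring is additive modulo \<open>QR\<close>: the mixed terms cancel by antisymmetry,
  and signs do not matter modulo two.\<close>

lemma sqs_br: "sqs u - br u u \<in> QR"
proof (induction u rule: frag_ind)
  case (diff a b)
  have "sqs (a - b) - br (a - b) (a - b) =
      (sqs a - br a a) - (sqs b - br b b) + (br a b + br b a) - (br b b + br b b)"
    by (simp add: lin_diff br_simps algebra_simps)
  also have "\<dots> \<in> QR"
    by (rule zspan_diff[OF zspan_add[OF zspan_diff[OF diff] as_ihx_br(1)[OF as_ihx_subset(2)]] double_QR])
  finally show ?case .
qed (auto simp: br_simps intro: zspan_0)

lemma QR_br: "u \<in> QR \<Longrightarrow> br u v \<in> QR" "u \<in> QR \<Longrightarrow> br v u \<in> QR"
  by (rule zspan_br; simp)+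

lemma sqs_QR: "u \<in> QR \<Longrightarrow> sqs u \<in> QR"
  using zspan_add[OF sqs_br[of u] QR_br(1), of u u] by simp

text \<open>The IHX relation for \<open>A, A, J\<close> has two equal terms of opposite sign.
  Squares are thus central, but need not vanish.\<close>

lemma br_square_QR: "frag_of (Br (Br A A) J) \<in> QR"
  using as_ihx_br(2)[OF as_ihx_subset(2), of "frag_of A" "frag_of A" "frag_of J"] by simp

lemma sqr_QR: "sqr I \<Longrightarrow> (\<exists>A. I = Br A A) \<or> frag_of I \<in> QR"
proof (induction rule: sqr.induct)
  case (sqr_left I J)
  then show ?case
    using QR_br(1)[of "frag_of I" "frag_of J"] br_square_QR by auto
next
  case (sqr_right J I)
  have "frag_of (Br I J) \<in> QR" if "J = Br A A" for A
    using zspan_diff[OF as_ihx_br(1)[OF as_ihx_subset(2), of "frag_of I" "frag_of J"], of "frag_of (Br J I)"]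
      br_square_QR that by simp
  then show ?case using sqr_right QR_br(2)[of "frag_of J" "frag_of I"] by auto
qed blast

text \<open>Hence squaring descends to the free Lie ring. For the additional relation
  \<open>[A, A] = 0\<close> the square is \<open>[[A, A], [A, A]]\<close>, which vanishes because
  squares are central.\<close>

lemma sqs_rels: "u \<in> zspan lie_rels \<Longrightarrow> sqs u \<in> QR"
proof (erule zspan_image)
  fix s assume "s \<in> lie_rels"
  then consider "s \<in> as_ihx" | I where "sqr I" "s = frag_of I" by (auto simp: lie_rels_def)
  then show "sqs s \<in> QR"
  proof cases
    case 1
    then show ?thesis using as_ihx_subset by (auto intro: sqs_QR zspan_base)
  next
    case 2
    then show ?thesis
      using sqr_QR[OF 2(1)] br_square_QR QR_br(1)[of "frag_of I" "frag_of I"] by auto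
  qed
qed (rule additive_lin)

text \<open>The retraction of the free quasi-Lie ring onto the subring generated by the
  \<open>ad\<^sub>x\<^sup>j y\<close>; \<open>[x, x]\<close> is sent to zero.\<close>

primrec tret :: "nat \<Rightarrow> rtree \<Rightarrow> treesum" where
  "tret x (Leaf a) = (if a = x then 0 else frag_of (Leaf (prod_encode (unskip x a, 0))))"
| "tret x (Br I J) = (if I = Leaf x then tders (tret x J) else if J = Leaf x then - tders (tret x I)
     else br (tret x I) (tret x J))"

lemma tret_tsubst: "tret x (tsubst x I) = frag_of I"
proof -
  have *: "tsubst x I \<noteq> Leaf x" for I
    by (cases I) (auto, metis adtree.simps nat.exhaust rtree.distinct(1) rtree.inject(1) skip_neq(1))
  have "tret x (adtree x i j) = frag_of (Leaf (prod_encode (i, j)))" for i j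
    by (induction j) simp_all
  then show ?thesis by (induction I) (simp_all add: *)
qed

lemma flip1_QR: "flip1 I I' \<Longrightarrow> frag_of I + frag_of I' \<in> QR"
  and ihx_QR: "ihx_rooted I H Z \<Longrightarrow> frag_of I - frag_of H + frag_of Z \<in> QR"
  unfolding quasi_rels_def as_ihx_def by (rule zspan_base, blast)+

lemma tders_QR: "u \<in> QR \<Longrightarrow> tders u \<in> QR"
proof (erule zspan_image)
  have flip: "tders (frag_of I + frag_of I') \<in> QR" if "flip1 I I'" for I I'
    using that
  proof induction
    case (flip1_root I J)
    have "tders (br (frag_of I) (frag_of J) + br (frag_of J) (frag_of I)) =
        (br (tders (frag_of I)) (frag_of J) + br (frag_of J) (tders (frag_of I))) +
        (br (frag_of I) (tders (frag_of J)) + br (tders (frag_of J)) (frag_of I))"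
      unfolding lin_add tders_br by (simp add: algebra_simps)
    also have "\<dots> \<in> QR" by (intro zspan_add as_ihx_br as_ihx_subset)
    finally show ?case by simp
  next
    case (flip1_left I I' J)
    have "frag_of I + frag_of I' \<in> QR"
      using flip1_left by (simp add: flip1_QR)
    then have "tders (br (frag_of I + frag_of I') (frag_of J)) \<in> QR"
      unfolding tders_br using flip1_left.IH by (rule_tac zspan_add[OF QR_br(1) QR_br(1)])
    then show ?case by (simp add: br_simps)
  next
    case (flip1_right J J' I)
    have "frag_of J + frag_of J' \<in> QR"
      using flip1_right by (simp add: flip1_QR)
    then have "tders (br (frag_of I) (frag_of J + frag_of J')) \<in> QR"
      unfolding tders_br using flip1_right.IH by (rule_tac zspan_add[OF QR_br(2) QR_br(2)])
    then show ?case by (simp add: br_simps)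
  qed
  have ihx: "tders (frag_of I - frag_of H + frag_of Z) \<in> QR" if "ihx_rooted I H Z" for I H Z
    using that
  proof induction
    case (1 A B C)
    define a b c where abc: "a = frag_of A" "b = frag_of B" "c = frag_of C"
    let ?J = "\<lambda>u v w. br (br u v) w - br u (br v w) + br v (br u w)"
    have "tders (?J a b c) = ?J (tders a) b c + ?J a (tders b) c + ?J a b (tders c)"
      by (simp add: lin_add lin_diff tders_br br_simps algebra_simps)
    also have "\<dots> \<in> QR" by (intro zspan_add as_ihx_br as_ihx_subset)
    finally show ?case by (simp add: abc)
  next
    case (2 I H Z K)
    have "frag_of I - frag_of H + frag_of Z \<in> QR"
      using 2 by (simp add: ihx_QR)
    then have "tders (br (frag_of I - frag_of H + frag_of Z) (frag_of K)) \<in> QR"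
      unfolding tders_br using "2.IH" by (rule_tac zspan_add[OF QR_br(1) QR_br(1)])
    then show ?case by (simp add: br_simps)
  next
    case (3 I H Z K)
    have "frag_of I - frag_of H + frag_of Z \<in> QR"
      using 3 by (simp add: ihx_QR)
    then have "tders (br (frag_of K) (frag_of I - frag_of H + frag_of Z)) \<in> QR"
      unfolding tders_br using "3.IH" by (rule_tac zspan_add[OF QR_br(2) QR_br(2)])
    then show ?case by (simp add: br_simps)
  qed
  fix s assume "s \<in> quasi_rels"
  then show "tders s \<in> QR"
    using flip ihx double_QR by (auto simp: quasi_rels_def as_ihx_def lin_add)
qed (rule additive_lin)

lemma flip1_not_leaf: "flip1 I I' \<Longrightarrow> I \<noteq> Leaf a \<and> I' \<noteq> Leaf a"
  and ihx_not_leaf: "ihx_rooted I H Z \<Longrightarrow> I \<noteq> Leaf a \<and> H \<noteq> Leaf a \<and> Z \<noteq> Leaf a"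
  by (auto elim: flip1.cases ihx_rooted.cases)

lemma tret_QR: "u \<in> QR \<Longrightarrow> lin (tret x) u \<in> QR"
proof (erule zspan_image)
  have flip: "tret x I + tret x I' \<in> QR" if "flip1 I I'" for I I'
    using that
  proof induction
    case (flip1_root I J)
    then show ?case using as_ihx_br(1)[OF as_ihx_subset(2)] by (auto intro: zspan_0)
  next
    case (flip1_left I I' J)
    have "br (tret x I + tret x I') (tret x J) \<in> QR" "- tders (tret x I + tret x I') \<in> QR"
      "I \<noteq> Leaf x" "I' \<noteq> Leaf x"
      using flip1_left flip1_not_leaf by (auto intro: QR_br tders_QR zspan_uminus)
    then show ?case by (auto simp: br_simps lin_add)
  next
    case (flip1_right J J' I)
    have "br (tret x I) (tret x J + tret x J') \<in> QR" "tders (tret x J + tret x J') \<in> QR"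
      "J \<noteq> Leaf x" "J' \<noteq> Leaf x"
      using flip1_right flip1_not_leaf by (auto intro: QR_br tders_QR)
    then show ?case by (auto simp: br_simps lin_add)
  qed
  have ihx: "tret x I - tret x H + tret x Z \<in> QR" if "ihx_rooted I H Z" for I H Z
    using that
  proof induction
    case (1 A B C)
    define a b c where abc: "a = tret x A" "b = tret x B" "c = tret x C"
    \<comment> \<open>The first relation serves when none of the three arguments is
      \<open>x\<close>. The second is what remains when only \<open>C\<close> is \<open>x\<close>.
      In all other cases the terms cancel, by the Leibniz rule for \<open>tders\<close>.\<close>
    have "br (br a b) c - br a (br b c) + br b (br a c) \<in> QR" "- (br (tders a) b + br b (tders a)) \<in> QR"
      by (intro zspan_uminus as_ihx_br as_ihx_subset)+
    then show ?case
      by (cases "A = Leaf x"; cases "B = Leaf x"; cases "C = Leaf x")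
         (simp_all add: abc[symmetric] tders_br br_simps lin_minus zspan_0)
  next
    case (2 I H Z K)
    have "br (tret x I - tret x H + tret x Z) (tret x K) \<in> QR" "- tders (tret x I - tret x H + tret x Z) \<in> QR"
      "I \<noteq> Leaf x" "H \<noteq> Leaf x" "Z \<noteq> Leaf x"
      using 2 ihx_not_leaf by (auto intro: QR_br tders_QR zspan_uminus)
    then show ?case by (auto simp: br_simps lin_add lin_diff)
  next
    case (3 I H Z K)
    have "br (tret x K) (tret x I - tret x H + tret x Z) \<in> QR" "tders (tret x I - tret x H + tret x Z) \<in> QR"
      "I \<noteq> Leaf x" "H \<noteq> Leaf x" "Z \<noteq> Leaf x"
      using 3 ihx_not_leaf by (auto intro: QR_br tders_QR)
    then show ?case by (auto simp: br_simps lin_add lin_diff)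
  qed
  fix s assume "s \<in> quasi_rels"
  then show "lin (tret x) s \<in> QR"
    using flip ihx double_QR by (auto simp: quasi_rels_def as_ihx_def lin_add lin_diff)
qed (rule additive_lin)

text \<open>Trees in an IHX relation have at least three leaves, and reversing \<open>[a, a]\<close>
  returns it, so every relation involves this tree an even number of times. This is what keeps the
  square of a letter nonzero.\<close>

lemma lookup_QR_even: "u \<in> QR \<Longrightarrow> even (Poly_Mapping.lookup u (Br (Leaf a) (Leaf a)))"
proof (induction rule: zspan.induct)
  case (zspan_base s)
  have fl: "I = Br (Leaf a) (Leaf a) \<longleftrightarrow> I' = Br (Leaf a) (Leaf a)" if "flip1 I I'" for I I'
    using that by (auto elim!: flip1.cases[of "Br _ _"] flip1.cases[of _ "Br _ _"] dest: flip1_not_leaf)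
  have ih: "Br (Leaf a) (Leaf a) \<notin> {I, H, Z}" if "ihx_rooted I H Z" for I H Z
    using that by (auto elim!: ihx_rooted.cases dest: ihx_not_leaf)
  consider I I' where "flip1 I I'" "s = frag_of I + frag_of I'"
    | I H Z where "ihx_rooted I H Z" "s = frag_of I - frag_of H + frag_of Z"
    | I where "s = frag_of I + frag_of I"
    using zspan_base by (auto simp: quasi_rels_def as_ihx_def)
  then show ?case
  proof cases
    case (1 I I')
    then show ?thesis using fl[OF 1(1)] by (auto simp: lookup_add)
  next
    case (2 I H Z)
    then show ?thesis using ih[OF 2(1)] by (simp add: lookup_add lookup_minus)
  qed (simp add: lookup_add)
qed (auto simp: lookup_minus)

text \<open>Injectivity of squaring on the Lie ring modulo two. After elimination the retraction
  \<open>tret\<close> turns the hypothesis on \<open>tsubsts x v\<close> into the same one on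
  \<open>v\<close>, in lower degree; for a multiple of a letter the coefficient has to be
  even.\<close>

theorem sqs_QR_imp:
  "u \<in> sized N \<Longrightarrow> sqs u \<in> QR \<Longrightarrow> u \<in> zspan (lie_rels \<union> {frag_of I + frag_of I | I. True})"
proof (induction N arbitrary: u rule: less_induct)
  case (less N)
  let ?R = "lie_rels \<union> {frag_of I + frag_of I | I. True}"
  have mono: "zspan lie_rels \<subseteq> zspan ?R" by (rule zspan_mono) (auto intro: zspan_base)
  show ?case
  proof (rule filt_zspanI)
    fix M assume "M \<in> mlabels ` Poly_Mapping.keys u"
    then have M: "size M = N" "M \<noteq> {#}" using less.prems(1) by (auto simp: sized_def)
    \<comment> \<open>A multiset is determined by its double, so squaring does not mix homogeneous
      components.\<close>
    have "sqs (filt M u) = filt (M + M) (sqs u)"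
    proof (rule additive_eqI[where x = u])
      fix I
      have "mlabels I + mlabels I = M + M \<longleftrightarrow> mlabels I = M"
        by (simp add: multiset_eq_iff mult_2[symmetric])
      then show "sqs (filt M (frag_of I)) = filt (M + M) (sqs (frag_of I))"
        by (simp add: filt_def)
    qed (auto intro!: additiveI simp: filt_def lin_add)
    also have "filt (M + M) (sqs u) \<in> QR"
      using less.prems(2)
    proof (rule zspan_image)
      fix s assume "s \<in> quasi_rels"
      have "filt (M + M) s = s \<or> filt (M + M) s = 0"
      proof -
        from \<open>s \<in> quasi_rels\<close> consider I I' where "flip1 I I'" "s = frag_of I + frag_of I'"
          | I H Z where "ihx_rooted I H Z" "s = frag_of I - frag_of H + frag_of Z"
          | I where "s = frag_of I + frag_of I"
          by (auto simp: quasi_rels_def as_ihx_def)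
        then show ?thesis
        proof cases
          case 1
          then show ?thesis using flip1_labels[OF 1(1)] by (simp add: filt_def lin_add)
        next
          case 2
          then show ?thesis using ihx_labels[OF 2(1)] by (simp add: filt_def lin_add lin_diff)
        qed (simp add: filt_def lin_add)
      qed
      then show "filt (M + M) s \<in> QR"
        using \<open>s \<in> quasi_rels\<close> by (auto intro: zspan_0 zspan_base)
    qed auto
    finally have sq: "sqs (filt M u) \<in> QR" .
    show "filt M u \<in> zspan ?R"
    proof (cases "size M = 1")
      case True
      then obtain a where a: "filt M u = zmul (Poly_Mapping.lookup u (Leaf a)) (frag_of (Leaf a))"
        using filt_leaf by metis
      have "sqs (zmul n v) = zmul n (sqs v)" for n v
        by (simp add: zmul_def lin_sum lin_minus)
      then have "even (Poly_Mapping.lookup u (Leaf a))"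
        using lookup_QR_even[OF sq, of a] a by (simp add: lookup_zmul)
      then obtain k where k: "Poly_Mapping.lookup u (Leaf a) = 2 * k" by (rule evenE)
      have "filt M u = zmul k (frag_of (Leaf a) + frag_of (Leaf a))"
        unfolding a k by (rule poly_mapping_eqI) (simp add: lookup_zmul lookup_add)
      also have "\<dots> \<in> zspan ?R" by (intro zmul_zspan zspan_base) blast
      finally show ?thesis .
    next
      case False
      obtain x where x: "x \<in># M" using M(2) by (rule multiset_nonemptyE)
      have "M \<noteq> {#x#}" using False by auto
      then obtain v where v: "v \<in> sized (nonx x M)" "filt M u - tsubsts x v \<in> zspan lie_rels"
        using treesum_eliminate[of "filt M u" M x] keys_filt by metis
      have "sqs (tsubsts x v) \<in> QR"
        using zspan_diff[OF sq sqs_rels[OF v(2)]] by (simp add: lin_diff)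
      then have "lin (tret x) (sqs (tsubsts x v)) \<in> QR" by (rule tret_QR)
      moreover have "lin (tret x) (sqs (tsubsts x v)) = sqs v"
      proof (rule additive_eqI[where x = v])
        fix I
        have "lin (tret x) (sqs (tsubsts x (frag_of I))) = tret x (tsubst x (Br I I))" by simp
        then show "lin (tret x) (sqs (tsubsts x (frag_of I))) = sqs (frag_of I)"
          unfolding tret_tsubst by simp
      qed (auto intro!: additiveI simp: lin_add)
      ultimately have "v \<in> zspan ?R"
        using less.IH[OF _ v(1)] nonx_less[OF x] M(1) by simp
      then have "tsubsts x v \<in> zspan ?R"
      proof (rule zspan_image)
        fix s assume "s \<in> ?R"
        then consider "s \<in> lie_rels" | I where "s = frag_of I + frag_of I" by blast
        then show "tsubsts x s \<in> zspan ?R"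
        proof cases
          case 1
          then show ?thesis using mono tsubsts_rels(1)[OF zspan_base] by blast
        next
          case 2
          then have "tsubsts x s = frag_of (tsubst x I) + frag_of (tsubst x I)" by (simp add: lin_add)
          also have "\<dots> \<in> zspan ?R" by (rule zspan_base) blast
          finally show ?thesis .
        qed
      qed (rule additive_lin)
      with subsetD[OF mono v(2)] have "(filt M u - tsubsts x v) + tsubsts x v \<in> zspan ?R"
        by (rule zspan_add)
      then show ?thesis by simp
    qed
  qed
qed

section \<open>The presented group of trees\<close>

text \<open>\<open>Inner I J\<close> and \<open>Infty J\<close> stand for \<open>\<langle>I, J\<rangle>\<close> and
  \<open>J\<^sup>\<infinity>\<close>; unlike in \<open>T_inf\<close>, trees with a subtree \<open>(A, A)\<close> are zero.\<close>

datatype pgen = Inner rtree rtree | Infty rtree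

inductive_set tree_rels :: "(pgen \<Rightarrow>\<^sub>0 int) set" where
  sym: "frag_of (Inner I J) - frag_of (Inner J I) \<in> tree_rels"
| inv: "frag_of (Inner (Br I J) L) - frag_of (Inner I (Br J L)) \<in> tree_rels"
| anti: "frag_of (Inner (Br I J) L) + frag_of (Inner (Br J I) L) \<in> tree_rels"
| ihx: "frag_of (Inner (Br (Br A B) C) D) - frag_of (Inner (Br A (Br B C)) D) +
    frag_of (Inner (Br B (Br A C)) D) \<in> tree_rels"
| square: "frag_of (Inner (Br I I) J) \<in> tree_rels"
| two: "frag_of (Infty J) + frag_of (Infty J) - frag_of (Inner J J) \<in> tree_rels"
| flip: "flip1 J J' \<Longrightarrow> frag_of (Infty J') - frag_of (Infty J) \<in> tree_rels"
| quad: "ihx_rooted I H Z \<Longrightarrow>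
    frag_of (Infty I) - frag_of (Infty H) - frag_of (Infty Z) + frag_of (Inner H Z) \<in> tree_rels"
| sqr: "sqr I \<Longrightarrow> frag_of (Infty I) \<in> tree_rels"

\<comment> \<open>A type of its own, so that it can be the group of values in
  \<open>inv_form\<close>.\<close>
quotient_type tgroup = "pgen \<Rightarrow>\<^sub>0 int" / "\<lambda>u v. u - v \<in> zspan tree_rels"
proof (rule equivpI)
  show "reflp (\<lambda>u v. u - v \<in> zspan tree_rels)" by (simp add: reflp_def zspan_0)
  show "symp (\<lambda>u v. u - v \<in> zspan tree_rels)"
    by (rule sympI, drule zspan_uminus) simp
  show "transp (\<lambda>u v. u - v \<in> zspan tree_rels)"
    by (rule transpI, drule (1) zspan_add) simp
qed

instantiation tgroup :: ab_group_add
begin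

lift_definition zero_tgroup :: tgroup is 0 .

lift_definition plus_tgroup :: "tgroup \<Rightarrow> tgroup \<Rightarrow> tgroup" is "(+)"
  by (drule (1) zspan_add) (simp add: diff_plus_diff)

lift_definition uminus_tgroup :: "tgroup \<Rightarrow> tgroup" is uminus
  by (drule zspan_uminus) (simp add: algebra_simps)

lift_definition minus_tgroup :: "tgroup \<Rightarrow> tgroup \<Rightarrow> tgroup" is "(-)"
proof -
  fix a b c d :: "pgen \<Rightarrow>\<^sub>0 int"
  assume "a - b \<in> zspan tree_rels" "c - d \<in> zspan tree_rels"
  then have "(a - b) - (c - d) \<in> zspan tree_rels" by (rule zspan_diff)
  then show "a - c - (b - d) \<in> zspan tree_rels" by (simp add: algebra_simps)
qed

instance
proof
  fix a b c :: tgroup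
  have "\<exists>u. a = abs_tgroup u" for a by (induction a rule: tgroup.abs_induct) blast
  then obtain u v w where [simp]: "a = abs_tgroup u" "b = abs_tgroup v" "c = abs_tgroup w" by metis
  show "a + b + c = a + (b + c)" "a + b = b + a" "0 + a = a" "- a + a = 0" "a - b = a + - b"
    by (simp_all add: zero_tgroup_def plus_tgroup.abs_eq uminus_tgroup.abs_eq minus_tgroup.abs_eq algebra_simps)
qed

end

definition cls :: "(pgen \<Rightarrow>\<^sub>0 int) \<Rightarrow> tgroup" where
  "cls = abs_tgroup"

lemma additive_cls: "additive cls"
  by (rule additiveI) (simp add: cls_def plus_tgroup.abs_eq)

lemma cls_eq_0: "cls u = 0 \<longleftrightarrow> u \<in> zspan tree_rels"
  by (simp add: cls_def zero_tgroup_def tgroup.abs_eq_iff)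

abbreviation inner :: "rtree \<Rightarrow> rtree \<Rightarrow> tgroup" where "inner I J \<equiv> cls (frag_of (Inner I J))"
abbreviation infty :: "rtree \<Rightarrow> tgroup" where "infty I \<equiv> cls (frag_of (Infty I))"

lemma cls_rels: "u \<in> tree_rels \<Longrightarrow> cls u = 0"
  by (simp add: cls_eq_0 zspan_base)

lemmas cls_simps = additive.add[OF additive_cls] additive.diff[OF additive_cls]

lemma inner_sym: "inner I J = inner J I"
  and inner_inv: "inner (Br I J) L = inner I (Br J L)"
  and inner_anti: "inner (Br I J) L = - inner (Br J I) L"
  and inner_ihx: "inner (Br (Br A B) C) D - inner (Br A (Br B C)) D + inner (Br B (Br A C)) D = 0"
  and inner_sqr: "inner (Br I I) J = 0"
  and infty_two: "infty J + infty J = inner J J"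
  and infty_flip1: "flip1 J J' \<Longrightarrow> infty J' = infty J"
  and infty_ihx: "ihx_rooted I H Z \<Longrightarrow> infty I = infty H + infty Z - inner H Z"
  and infty_sqr: "sqr I \<Longrightarrow> infty I = 0"
  using tree_rels.intros[THEN cls_rels]
  by (simp_all add: cls_simps eq_neg_iff_add_eq_0 algebra_simps)

lemma inner_right: "inner (Br K I) J = - inner I (Br K J)"
  by (subst inner_anti) (simp only: inner_inv)

lemma inner_flip1: "flip1 I I' \<Longrightarrow> inner I J + inner I' J = 0"
proof (induction arbitrary: J rule: flip1.induct)
  case (flip1_root A B)
  then show ?case by (simp add: inner_anti[of A B])
next
  case (flip1_left I I' K)
  then show ?case by (simp add: inner_inv)
next
  case (flip1_right I I' K)
  then show ?case by (simp add: inner_right add_eq_0_iff)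
qed

lemma inner_ihx_rooted: "ihx_rooted I H Z \<Longrightarrow> inner I J - inner H J + inner Z J = 0"
proof (induction arbitrary: J rule: ihx_rooted.induct)
  case (1 A B C)
  then show ?case by (rule inner_ihx)
next
  case (2 I H X K)
  then show ?case by (simp add: inner_inv)
next
  case (3 I H Z K)
  have "- (inner I (Br K J) - inner H (Br K J) + inner Z (Br K J)) = 0" using 3 by simp
  then show ?case unfolding inner_right by (simp only: minus_add_distrib minus_diff_eq) (simp add: algebra_simps)
qed

lemma inner_sqr_tree: "sqr I \<Longrightarrow> inner I J = 0"
proof (induction arbitrary: J rule: sqr.induct)
  case (sqr_right K I)
  then show ?case by (simp only: inner_right) simp
qed (simp add: inner_sqr, simp add: inner_inv)

section \<open>The bilinear and the quadratic extension to sums of trees\<close>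

definition inners :: "treesum \<Rightarrow> treesum \<Rightarrow> tgroup" where
  "inners u v = lin (\<lambda>I. lin (inner I) v) u"

instance rtree :: countable by countable_datatype

text \<open>A bilinear form whose symmetrization is \<open>inners\<close>, built from an arbitrary
  enumeration of the trees. On the diagonal it yields the quadratic function with prescribed values
  \<open>infty I\<close> on trees and polarization \<open>inners\<close>; no division by two is
  involved.\<close>

definition infs_bilin :: "treesum \<Rightarrow> treesum \<Rightarrow> tgroup" where
  "infs_bilin u v = lin (\<lambda>I. lin (\<lambda>J. if I = J then infty I else if to_nat I < to_nat J then inner I J else 0) v) u"

lemma additive_bilin:
  fixes f :: "rtree \<Rightarrow> rtree \<Rightarrow> 'g::ab_group_add"
  shows "additive (\<lambda>u. lin (\<lambda>I. lin (f I) v) u)" "additive (\<lambda>v. lin (\<lambda>I. lin (f I) v) u)"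
proof -
  show "additive (\<lambda>u. lin (\<lambda>I. lin (f I) v) u)" by (rule additive_lin)
  show "additive (\<lambda>v. lin (\<lambda>I. lin (f I) v) u)"
  proof (rule additiveI)
    fix v w show "lin (\<lambda>I. lin (f I) (v + w)) u = lin (\<lambda>I. lin (f I) v) u + lin (\<lambda>I. lin (f I) w) u"
      by (rule additive_eqI[where x = u]) (auto intro!: additiveI simp: lin_add)
  qed
qed

lemma inners_of [simp]: "inners (frag_of I) (frag_of J) = inner I J"
  and infs_bilin_of: "infs_bilin (frag_of I) (frag_of J) =
    (if I = J then infty I else if to_nat I < to_nat J then inner I J else 0)"
  by (simp_all add: inners_def infs_bilin_def)

lemma additive_inners: "additive (\<lambda>u. inners u v)" "additive (inners u)"
  and additive_infs_bilin: "additive (\<lambda>u. infs_bilin u v)" "additive (infs_bilin u)"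
  by (simp_all add: inners_def[abs_def] infs_bilin_def[abs_def] additive_bilin)

lemmas inners_simps = additive.add[OF additive_inners(1)] additive.add[OF additive_inners(2)]
  additive.diff[OF additive_inners(1)] additive.diff[OF additive_inners(2)]
  additive.zero[OF additive_inners(1)] additive.zero[OF additive_inners(2)]
lemmas infs_bilin_simps = additive.add[OF additive_infs_bilin(1)] additive.add[OF additive_infs_bilin(2)]
  additive.diff[OF additive_infs_bilin(1)] additive.diff[OF additive_infs_bilin(2)]
  additive.zero[OF additive_infs_bilin(1)] additive.zero[OF additive_infs_bilin(2)]

lemma biadditive_eqI:
  assumes "\<And>v. additive (\<lambda>u. f u v)" "\<And>u. additive (f u)" "\<And>v. additive (\<lambda>u. g u v)" "\<And>u. additive (g u)"
    "\<And>I J. f (frag_of I) (frag_of J) = g (frag_of I) (frag_of J)"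
  shows "f u v = g u v"
proof (rule additive_eqI[where x = u])
  fix I show "f (frag_of I) v = g (frag_of I) v"
    by (rule additive_eqI[where x = v]) (use assms in auto)
qed (use assms in auto)

lemma inners_sym: "inners u v = inners v u"
  by (rule biadditive_eqI[where f = inners and g = "\<lambda>u v. inners v u"])
     (auto simp: additive_inners inner_sym)

lemma inners_inv: "inners (br u v) w = inners u (br v w)"
proof (rule additive_eqI[where x = u])
  fix I show "inners (br (frag_of I) v) w = inners (frag_of I) (br v w)"
    by (rule biadditive_eqI[where f = "\<lambda>v w. inners (br (frag_of I) v) w" and g = "\<lambda>v w. inners (frag_of I) (br v w)"])
       (auto intro!: additiveI simp: inners_simps br_simps inner_inv)
qed (auto intro!: additiveI simp: inners_simps br_simps)

definition infs :: "treesum \<Rightarrow> tgroup" where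
  "infs u = infs_bilin u u"

lemma infs_of [simp]: "infs (frag_of I) = infty I"
  by (simp add: infs_def infs_bilin_of)

lemma infs_bilin_sym: "infs_bilin u v + infs_bilin v u = inners u v"
  by (rule biadditive_eqI[where f = "\<lambda>u v. infs_bilin u v + infs_bilin v u"])
     (auto intro!: additiveI simp: infs_bilin_simps additive_inners infs_bilin_of infty_two inner_sym)

lemma infs_add: "infs (u + v) = infs u + infs v + inners u v"
  by (simp add: infs_def infs_bilin_simps infs_bilin_sym[of u v, symmetric])

lemma infs_two: "infs u + infs u = inners u u"
  by (simp add: infs_def infs_bilin_sym)

lemma infs_minus: "infs (- u) = infs u"
  by (simp add: infs_def additive.minus[OF additive_infs_bilin(1)] additive.minus[OF additive_infs_bilin(2)])

lemma infs_diff: "infs (u - v) = infs u + infs v - inners u v"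
  using infs_add[of u "- v"] infs_minus[of v] additive.minus[OF additive_inners(2), of u v] by simp

lemma inners_lie_rels: "l \<in> zspan lie_rels \<Longrightarrow> inners l v = 0"
proof (erule zspan_zero_image)
  fix s assume s: "s \<in> lie_rels"
  have "inners s (frag_of J) = 0" for J
  proof -
    from s consider I I' where "flip1 I I'" "s = frag_of I + frag_of I'"
      | I H Z where "ihx_rooted I H Z" "s = frag_of I - frag_of H + frag_of Z"
      | I where "sqr I" "s = frag_of I"
      by (auto simp: lie_rels_def as_ihx_def)
    then show ?thesis
      by cases (simp_all add: inners_simps inner_flip1 inner_ihx_rooted inner_sqr_tree)
  qed
  then show "inners s v = 0"
    by (induction v rule: frag_ind) (simp_all add: inners_simps)
qed (rule additive_inners)

text \<open>A quadratic function vanishes on a span if it vanishes on the generators and these are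
  orthogonal to everything. On the generators the twisted relations say just this, for example
  \<open>2 * infty I - inner I I = 0\<close> for a reversal.\<close>

lemma infs_lie_rels: "l \<in> zspan lie_rels \<Longrightarrow> infs l = 0"
proof (induction rule: zspan.induct)
  case zspan_0
  show ?case by (simp add: infs_def infs_bilin_simps)
next
  case (zspan_base s)
  then consider I I' where "flip1 I I'" "s = frag_of I + frag_of I'"
    | I H Z where "ihx_rooted I H Z" "s = frag_of I - frag_of H + frag_of Z"
    | I where "sqr I" "s = frag_of I"
    by (auto simp: lie_rels_def as_ihx_def)
  then show ?case
  proof cases
    case 1
    have "inner I I' = - inner I I"
      using inner_flip1[OF 1(1), of I] inner_sym[of I I'] by (simp add: eq_neg_iff_add_eq_0 add.commute)
    then show ?thesis
      using 1(2) infty_flip1[OF 1(1)] infty_two[of I] by (simp add: infs_add)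
  next
    case 2
    have I: "inner I J = inner H J - inner Z J" for J
      using inner_ihx_rooted[OF 2(1), of J] by (simp add: algebra_simps)
    have "infs s = infty I + infty H - inner I H + infty Z + (inner I Z - inner H Z)"
      by (simp add: 2(2) infs_add infs_diff inners_simps)
    also have "\<dots> = infty I + infty H + infty Z - inner H H + inner H Z + inner Z H - inner Z Z - inner H Z"
      by (simp add: I)
    also have "\<dots> = 0"
      unfolding infty_ihx[OF 2(1)] infty_two[symmetric] inner_sym[of Z H] by (simp add: algebra_simps)
    finally show ?thesis .
  next
    case 3
    then show ?thesis by (simp add: infty_sqr)
  qed
next
  case (zspan_diff a b)
  then show ?case by (simp add: infs_diff inners_lie_rels)
qed

section \<open>Descent of the forms to Lie polynomials\<close>

lemma liesum_eq_0: "liesum u = 0 \<Longrightarrow> u \<in> zspan lie_rels"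
proof (rule filt_zspanI)
  fix M assume u: "liesum u = 0"
  have "filt M u \<in> sized (size M)" by (auto simp: sized_def keys_filt)
  moreover have "liesum (filt M u) = 0" by (simp add: liesum_filt u proj_simps)
  ultimately show "filt M u \<in> zspan lie_rels" by (rule liesum_eq_0_sized)
qed

text \<open>Any preimage will do: two of them differ by Lie relations, which \<open>inners\<close>
  and \<open>infs\<close> do not see.\<close>

definition lift_lie :: "ncpoly \<Rightarrow> treesum" where
  "lift_lie a = (SOME u. liesum u = a)"

definition inner_lie :: "ncpoly \<Rightarrow> ncpoly \<Rightarrow> tgroup" where
  "inner_lie a b = inners (lift_lie a) (lift_lie b)"

definition inf_lie :: "ncpoly \<Rightarrow> tgroup" where
  "inf_lie a = infs (lift_lie a)"

lemma lift_lie_diff: "lift_lie (liesum u) - u \<in> zspan lie_rels"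
  using someI[of "\<lambda>v. liesum v = liesum u" u] by (simp add: lift_lie_def liesum_eq_0 lin_diff)

lemma inner_lie: "inner_lie (liesum u) (liesum v) = inners u v"
proof -
  have "inners (lift_lie (liesum u)) w = inners u w" for u w
    using inners_lie_rels[OF lift_lie_diff] by (simp add: inners_simps)
  then show ?thesis unfolding inner_lie_def by (metis inners_sym)
qed

lemma inf_lie: "inf_lie (liesum u) = infs u"
proof -
  define l where "l = lift_lie (liesum u) - u"
  have "l \<in> zspan lie_rels" unfolding l_def by (rule lift_lie_diff)
  then have "infs (u + l) = infs u"
    using infs_add[of u l] infs_lie_rels[of l] inners_lie_rels[of l u] inners_sym[of u l] by simp
  then show ?thesis by (simp add: inf_lie_def l_def)
qed

interpretation tree_form: inv_form inner_lie inf_lie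
proof
  have lie: "\<exists>u. a = liesum u" if "a \<in> lie_ring" for a
    using that unfolding lie_ring_def by (rule zspan_image_witness) blast
  fix a b c assume "a \<in> lie_ring" "b \<in> lie_ring" "c \<in> lie_ring"
  then obtain u v w where [simp]: "a = liesum u" "b = liesum v" "c = liesum w" using lie by metis
  show "inner_lie (a + b) c = inner_lie a c + inner_lie b c"
    using inner_lie[of "u + v" w] by (simp add: lin_add inner_lie inners_simps)
  show "inner_lie (comm a b) c = inner_lie a (comm b c)"
    using inner_lie[of "br u v" w] inner_lie[of u "br v w"] by (simp add: liesum_br inners_inv)
next
  have lie: "\<exists>u. a = liesum u" if "a \<in> lie_ring" for a
    using that unfolding lie_ring_def by (rule zspan_image_witness) blast
  fix a b assume "a \<in> lie_ring" "b \<in> lie_ring"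
  then obtain u v where [simp]: "a = liesum u" "b = liesum v" using lie by metis
  show "inner_lie a b = inner_lie b a" by (simp add: inner_lie inners_sym)
  show "inf_lie (a + b) = inf_lie a + inf_lie b + inner_lie a b"
    using inf_lie[of "u + v"] by (simp add: lin_add inf_lie inner_lie infs_add)
  have "inners (br u u) v = 0"
    by (rule inners_lie_rels, rule liesum_eq_0) (simp add: liesum_br)
  then show "inner_lie a (comm a b) = 0"
    using inner_lie[of u "br u v"] by (simp add: liesum_br inners_inv)
next
  fix a assume "a \<in> lie_ring"
  then obtain u where "a = liesum u"
    unfolding lie_ring_def by (rule zspan_image_witness) blast
  then show "inf_lie a + inf_lie a = inner_lie a a" by (simp add: inf_lie inner_lie infs_two)
qed

definition pgen_size :: "pgen \<Rightarrow> nat" where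
  "pgen_size g = (case g of Inner I J \<Rightarrow> size (mlabels I) + size (mlabels J) | Infty I \<Rightarrow> size (mlabels I) + size (mlabels I))"

definition pgen_cyc :: "pgen \<Rightarrow> ncpoly" where
  "pgen_cyc g = (case g of Inner I J \<Rightarrow> full_cyc (lie I) (lie J) | Infty I \<Rightarrow> cyc (lie I) (lie I))"

text \<open>The class of \<open>t\<close> is the value that the form on trees attaches to the
  polynomial of \<open>t\<close>. As the graph is single valued, the zero polynomial forces the zero
  class.\<close>

theorem lin_pgen_cyc_eq_0:
  assumes "\<And>g. g \<in> Poly_Mapping.keys t \<Longrightarrow> pgen_size g = N" and "lin pgen_cyc t = 0"
  shows "t \<in> zspan tree_rels"
proof -
  have "(lin pgen_cyc t, cls t) \<in> graph inner_lie inf_lie (deg N)"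
    unfolding graph_def
  proof (rule frag_induction[where c = t and S = "{g. pgen_size g = N}"])
    show "(lin pgen_cyc 0, cls 0) \<in> zspan (gens inner_lie inf_lie (deg N))"
      by (simp add: additive.zero[OF additive_cls] zero_prod_def[symmetric] zspan_0)
    fix g assume g: "g \<in> {g. pgen_size g = N}"
    show "(lin pgen_cyc (frag_of g), cls (frag_of g)) \<in> zspan (gens inner_lie inf_lie (deg N))"
    proof (cases g)
      case (Inner I J)
      have "inner_lie (lie I) (lie J) = inner I J" using inner_lie[of "frag_of I" "frag_of J"] by simp
      then show ?thesis using g Inner
        by (intro zspan_base) (force simp: gens_def pgen_size_def pgen_cyc_def)
    next
      case (Infty I)
      have "inf_lie (lie I) = infty I" using inf_lie[of "frag_of I"] by simp
      then show ?thesis using g Infty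
        by (intro zspan_base) (force simp: gens_def pgen_size_def pgen_cyc_def)
    qed
  next
    fix a b assume "(lin pgen_cyc a, cls a) \<in> zspan (gens inner_lie inf_lie (deg N))"
      "(lin pgen_cyc b, cls b) \<in> zspan (gens inner_lie inf_lie (deg N))"
    from zspan_diff[OF this] show "(lin pgen_cyc (a - b), cls (a - b)) \<in> zspan (gens inner_lie inf_lie (deg N))"
      by (simp add: lin_diff cls_simps)
  qed (use assms(1) in auto)
  then have "cls t = 0"
    using graph_inj_surj[of N, where 'g = tgroup] tree_form.inv_form_axioms assms(2)
    unfolding graph_inj_def by auto
  then show ?thesis by (simp add: cls_eq_0)
qed

section \<open>Unrooted trees as inner products\<close>

subsection \<open>Walks without backtracking\<close>

fun nb :: "pretree \<Rightarrow> nat list \<Rightarrow> bool" where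
  "nb G [] = True"
| "nb G [u] = True"
| "nb G [u, v] = ((u, v) \<in> adj G)"
| "nb G (u # v # w # p) = ((u, v) \<in> adj G \<and> u \<noteq> w \<and> nb G (v # w # p))"

lemma nb_append: "nb G (p @ u # v # q) \<longleftrightarrow> nb G (p @ [u, v]) \<and> nb G (u # v # q)"
proof (induction p)
  case Nil
  show ?case by (cases q) auto
next
  case (Cons a p)
  show ?case
  proof (cases p)
    case Nil
    then show ?thesis by (cases q) auto
  next
    case (Cons b p')
    then show ?thesis using Cons.IH by (cases p') auto
  qed
qed

lemma nb_tl: "nb G (u # p) \<Longrightarrow> nb G p"
  by (cases p; cases "tl p") auto

lemma nb_prefix: "nb G (p @ q) \<Longrightarrow> nb G p"
proof (induction p)
  case (Cons a p)
  then show ?case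
    by (cases p; cases "tl p"; cases q) (auto, (metis append_Cons nb.simps(4) neq_Nil_conv nb.simps(3))?)
qed simp

lemma nb_adj: "nb G (u # v # p) \<Longrightarrow> (u, v) \<in> adj G"
  by (cases p) auto

lemma nb_successively: "nb G p \<Longrightarrow> successively (\<lambda>u v. (u, v) \<in> adj G) p"
  by (induction G p rule: nb.induct) auto

text \<open>The component of \<open>w\<close> after the edge from \<open>u\<close> to
  \<open>w\<close> is cut, described by end points of walks, so that it splits along the first step
  after \<open>w\<close>.\<close>

definition side :: "pretree \<Rightarrow> nat \<Rightarrow> nat \<Rightarrow> nat set" where
  "side G u w = {last (w # p) | p. nb G (u # w # p)}"

lemma univalent_trivalent: "v \<in> univalent G \<Longrightarrow> v \<notin> trivalent G"
  by (simp add: univalent_def trivalent_def)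

lemma branch_adj: "branch G u w I \<Longrightarrow> (u, w) \<in> adj G"
  by (induction rule: branch.induct) auto

lemma branch_unique: "branch G u w I \<Longrightarrow> branch G u w J \<Longrightarrow> I = J"
proof (induction arbitrary: J rule: branch.induct)
  case (1 u w)
  from 1(3,2) show ?case by cases (auto dest: univalent_trivalent)
next
  case (2 u w A B)
  from 2(7,2) show ?case by cases (auto dest: univalent_trivalent 2(5,6))
qed

section \<open>Sides of edges and the rooted trees on them\<close>

locale ptree =
  fixes m :: nat and G :: pretree
  assumes tree: "is_tree m G"
begin

lemma adj_sym: "(u, v) \<in> adj G \<Longrightarrow> (v, u) \<in> adj G"
  using tree unfolding is_tree_def by (meson symD)

lemma adj_neq: "(u, v) \<in> adj G \<Longrightarrow> u \<noteq> v"
  using tree unfolding is_tree_def irrefl_def by blast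

lemma adj_verts: "(u, v) \<in> adj G \<Longrightarrow> u \<in> verts G" "(u, v) \<in> adj G \<Longrightarrow> v \<in> verts G"
  using tree unfolding is_tree_def by blast+

lemma finite_verts: "finite (verts G)"
  using tree unfolding is_tree_def by blast

lemma no_cycle: "\<not> is_cycle G p"
  using tree unfolding is_tree_def by blast

lemma connected: "u \<in> verts G \<Longrightarrow> v \<in> verts G \<Longrightarrow> (u, v) \<in> (adj G)\<^sup>*"
  using tree unfolding is_tree_def by blast

lemma verts_cases: "v \<in> verts G \<Longrightarrow> v \<in> univalent G \<or> v \<in> trivalent G"
  using tree unfolding is_tree_def by blast

lemma lab: "v \<in> univalent G \<Longrightarrow> lab G v \<in> {1..m}"
  using tree unfolding is_tree_def by blast

lemma nxt: "v \<in> trivalent G \<Longrightarrow> u \<in> nbrs G v \<Longrightarrow>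
    nxt G v u \<in> nbrs G v \<and> nxt G v u \<noteq> u \<and> nxt G v (nxt G v (nxt G v u)) = u"
  using tree unfolding is_tree_def by blast

lemma nb_rev: "nb G p \<Longrightarrow> nb G (rev p)"
proof (induction p)
  case (Cons u p)
  then have IH: "nb G (rev p)" by (auto dest: nb_tl)
  show ?case
  proof (cases p)
    case (Cons v q)
    have uv: "(v, u) \<in> adj G" using nb_adj[of G u v q] Cons.prems Cons adj_sym by simp
    show ?thesis
    proof (cases q)
      case Nil
      then show ?thesis using Cons uv by simp
    next
      case (Cons w r)
      then have "u \<noteq> w" "(w, v) \<in> adj G"
        using Cons.prems \<open>p = v # q\<close> nb_adj[of G v w r] adj_sym by auto
      then show ?thesis
        using IH uv nb_append[of G "rev r" w v "[u]"] Cons \<open>p = v # q\<close> by auto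
    qed
  qed simp
qed simp

text \<open>A first return to \<open>a\<close> closes a cycle; it has length at least three because
  there are no loops and no backtracking.\<close>

lemma nb_distinct: "nb G p \<Longrightarrow> distinct p"
proof (induction p)
  case (Cons a p)
  have "distinct p" using Cons.IH nb_tl[OF Cons.prems] .
  moreover have "a \<notin> set p"
  proof
    assume "a \<in> set p"
    then obtain xs ys where p: "p = xs @ a # ys" "a \<notin> set xs" by (meson split_list_first)
    then have "xs \<noteq> []" using Cons.prems nb_adj[of G a a ys] adj_neq[of a a] by auto
    have "length xs \<noteq> 1"
    proof
      assume "length xs = 1"
      then obtain b where "xs = [b]" by (metis One_nat_def length_0_conv length_Suc_conv)
      then show False using Cons.prems p by simp
    qed
    then have "length xs \<ge> 2" using \<open>xs \<noteq> []\<close> by (cases xs) (auto simp: Suc_le_eq)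
    obtain zs z where z: "xs = zs @ [z]" using \<open>xs \<noteq> []\<close> by (meson rev_exhaust)
    have "nb G (z # a # ys)" using Cons.prems p(1) z nb_append[of G "a # zs" z a ys] by simp
    then have "(last (a # xs), hd (a # xs)) \<in> adj G" using z nb_adj by auto
    moreover have "successively (\<lambda>u v. (u, v) \<in> adj G) (a # xs)"
      using nb_prefix[of G "a # xs" "a # ys"] Cons.prems p(1) by (auto intro: nb_successively)
    ultimately have "is_cycle G (a # xs)"
      using \<open>distinct p\<close> p \<open>length xs \<ge> 2\<close> by (simp add: is_cycle_def)
    then show False using no_cycle by blast
  qed
  ultimately show ?case by simp
qed simp

lemma nb_verts: "nb G (u # v # p) \<Longrightarrow> set (u # v # p) \<subseteq> verts G"
proof (induction p arbitrary: u v)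
  case Nil
  then show ?case using adj_verts by auto
next
  case (Cons w p)
  have "set (v # w # p) \<subseteq> verts G" using Cons.IH nb_tl[OF Cons.prems] .
  moreover have "u \<in> verts G" using adj_verts(1) nb_adj[OF Cons.prems] .
  ultimately show ?case by simp
qed

lemma sideI: "nb G (u # w # p) \<Longrightarrow> last (w # p) \<in> side G u w"
  unfolding side_def by blast

lemma sideE:
  assumes "v \<in> side G u w"
  obtains p where "nb G (u # w # p)" "v = last (w # p)"
  using assms unfolding side_def by blast

lemma side_self: "(u, w) \<in> adj G \<Longrightarrow> w \<in> side G u w"
  using sideI[of u w "[]"] by simp

lemma side_verts: "side G u w \<subseteq> verts G"
proof
  fix v assume "v \<in> side G u w"
  then obtain p where p: "nb G (u # w # p)" "v = last (w # p)" by (rule sideE)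
  then have "v \<in> set (u # w # p)" using last_in_set[of "w # p"] by simp
  then show "v \<in> verts G" using nb_verts[OF p(1)] by blast
qed

lemma finite_side: "finite (side G u w)"
  using side_verts finite_verts by (rule finite_subset)

lemma side_not_root: "u \<notin> side G u w"
proof
  assume "u \<in> side G u w"
  then obtain p where "nb G (u # w # p)" "u = last (w # p)" by (rule sideE)
  then show False using nb_distinct[of "u # w # p"] last_in_set[of "w # p"] by auto
qed

lemma side_disjoint:
  assumes "a \<noteq> b" "(w, a) \<in> adj G" "(w, b) \<in> adj G"
  shows "side G w a \<inter> side G w b = {}"
proof (rule ccontr)
  assume "side G w a \<inter> side G w b \<noteq> {}"
  then obtain p q where p: "nb G (w # a # p)" and q: "nb G (w # b # q)" and eq: "last (a # p) = last (b # q)"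
    unfolding side_def by blast
  have "nb G (rev q @ [b, w])" using nb_rev[OF q] by simp
  moreover have "nb G (b # w # a # p)" using assms(1) p adj_sym[OF assms(3)] by simp
  ultimately have "nb G (rev q @ b # w # a # p)" using nb_append by blast
  then have "distinct (rev q @ b # w # a # p)" by (rule nb_distinct)
  then have "set (b # q) \<inter> set (a # p) = {}" by auto
  then show False using eq last_in_set[of "a # p"] last_in_set[of "b # q"] by auto
qed

lemma side_opposite: "(u, w) \<in> adj G \<Longrightarrow> side G u w \<inter> side G w u = {}"
proof (rule ccontr)
  assume uw: "(u, w) \<in> adj G" and "side G u w \<inter> side G w u \<noteq> {}"
  then obtain p q where p: "nb G (u # w # p)" and q: "nb G (w # u # q)" and eq: "last (w # p) = last (u # q)"
    unfolding side_def by blast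
  have "nb G (rev q @ [u, w])" using nb_rev[OF q] by simp
  then have "nb G (rev q @ u # w # p)" using nb_append p by blast
  then have "distinct (rev q @ u # w # p)" by (rule nb_distinct)
  then have "set (u # q) \<inter> set (w # p) = {}" by auto
  then show False using eq last_in_set[of "w # p"] last_in_set[of "u # q"] by auto
qed

lemma side_step:
  assumes "v \<in> side G u w" "(v, v') \<in> adj G"
  shows "v' \<in> insert u (side G u w)"
proof -
  obtain p where p: "nb G (u # w # p)" "v = last (w # p)" using assms(1) by (rule sideE)
  show ?thesis
  proof (cases p rule: rev_cases)
    case Nil
    then show ?thesis
      using p assms(2) sideI[of u w "[v']"] by (cases "v' = u") auto
  next
    case (snoc p' y)
    obtain zs x where x: "w # p' = zs @ [x]" by (cases "w # p'" rule: rev_cases) auto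
    have v: "v = y" using p snoc by simp
    show ?thesis
    proof (cases "v' = x")
      case True
      then have "v' = last (w # p')" using x by simp
      then show ?thesis using nb_prefix[of G "u # w # p'" "[y]"] p(1) snoc sideI by auto
    next
      case False
      have "u # w # p = (u # zs) @ x # y # []" using x snoc by simp
      then have "nb G ((u # zs) @ [x, y])" using p(1) by metis
      moreover have "nb G [x, y, v']" using False assms(2) v nb_append[of G "u # zs" x y "[]"] calculation by auto
      ultimately have "nb G ((u # zs) @ x # y # [v'])" using nb_append by blast
      then have "nb G (u # w # p @ [v'])" using x snoc by (metis append.assoc append_Cons append_Nil)
      then show ?thesis using sideI by fastforce
    qed
  qed
qed

lemma side_union: "(u, w) \<in> adj G \<Longrightarrow> side G u w \<union> side G w u = verts G"
proof
  assume uw: "(u, w) \<in> adj G"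
  show "side G u w \<union> side G w u \<subseteq> verts G" using side_verts by blast
  show "verts G \<subseteq> side G u w \<union> side G w u"
  proof
    fix v assume "v \<in> verts G"
    then have "(w, v) \<in> (adj G)\<^sup>*" using connected adj_verts(2)[OF uw] by blast
    then show "v \<in> side G u w \<union> side G w u"
    proof induction
      case base
      then show ?case using side_self uw by blast
    next
      case (step y z)
      then show ?case
        using side_step side_self uw adj_sym by blast
    qed
  qed
qed

lemma nbrs_univalent: "(u, w) \<in> adj G \<Longrightarrow> w \<in> univalent G \<Longrightarrow> nbrs G w = {u}"
proof -
  assume uw: "(u, w) \<in> adj G" and w: "w \<in> univalent G"
  then have "u \<in> nbrs G w" using adj_sym by (simp add: nbrs_def)
  moreover have "card (nbrs G w) = 1" using w by (simp add: univalent_def)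
  then obtain x where "nbrs G w = {x}" by (rule card_1_singletonE)
  ultimately show "nbrs G w = {u}" by simp
qed

lemma side_univalent:
  assumes "(u, w) \<in> adj G" "w \<in> univalent G"
  shows "side G u w = {w}"
proof -
  have p: "p = []" if "nb G (u # w # p)" for p
  proof (cases p)
    case (Cons x q)
    then have "x \<in> nbrs G w" "u \<noteq> x" using that nb_adj[of G w x q] by (auto simp: nbrs_def)
    then show ?thesis using nbrs_univalent[OF assms] by simp
  qed simp
  have "side G u w \<subseteq> {w}"
  proof
    fix v assume "v \<in> side G u w"
    then obtain q where "nb G (u # w # q)" "v = last (w # q)" by (rule sideE)
    then show "v \<in> {w}" using p[of q] by simp
  qed
  then show ?thesis using side_self[OF assms(1)] by blast
qed

lemma trivalent_nbrs:
  assumes "(u, w) \<in> adj G" "w \<in> trivalent G"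
  shows "nbrs G w = {u, nxt G w u, nxt G w (nxt G w u)}"
    "u \<noteq> nxt G w u" "u \<noteq> nxt G w (nxt G w u)" "nxt G w u \<noteq> nxt G w (nxt G w u)"
    "nxt G w (nxt G w (nxt G w u)) = u"
    "(w, nxt G w u) \<in> adj G" "(w, nxt G w (nxt G w u)) \<in> adj G"
proof -
  let ?a = "nxt G w u" let ?b = "nxt G w ?a"
  have u: "u \<in> nbrs G w" using adj_sym[OF assms(1)] by (simp add: nbrs_def)
  have a: "?a \<in> nbrs G w" "?a \<noteq> u" "nxt G w ?b = u" using nxt[OF assms(2) u] by auto
  have b: "?b \<in> nbrs G w" "?b \<noteq> ?a" using nxt[OF assms(2) a(1)] by auto
  have c: "nxt G w ?b \<noteq> ?b" using nxt[OF assms(2) b(1)] by auto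
  have 3: "card (nbrs G w) = 3" using assms(2) by (simp add: trivalent_def)
  have "finite (nbrs G w)" using 3 by (simp add: card_ge_0_finite)
  moreover have "card {u, ?a, ?b} = 3" using a b c by auto
  ultimately show "nbrs G w = {u, ?a, ?b}"
    using u a b 3 by (metis card_subset_eq empty_subsetI insert_subset)
  show "u \<noteq> ?a" "u \<noteq> ?b" "?a \<noteq> ?b" "nxt G w ?b = u" using a b c by auto
  show "(w, ?a) \<in> adj G" "(w, ?b) \<in> adj G" using a b by (auto simp: nbrs_def)
qed

lemma side_trivalent:
  assumes "(u, w) \<in> adj G" "w \<in> trivalent G"
  defines "a \<equiv> nxt G w u"
  defines "b \<equiv> nxt G w a"
  shows "side G u w = insert w (side G w a \<union> side G w b)"
    "side G w a \<inter> side G w b = {}" "w \<notin> side G w a" "w \<notin> side G w b"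
proof -
  note t = trivalent_nbrs[OF assms(1,2), folded a_def, folded b_def]
  show "side G u w = insert w (side G w a \<union> side G w b)"
  proof (intro subset_antisym subsetI)
    fix v assume "v \<in> side G u w"
    then obtain p where p: "nb G (u # w # p)" "v = last (w # p)" by (rule sideE)
    show "v \<in> insert w (side G w a \<union> side G w b)"
    proof (cases p)
      case (Cons x q)
      then have "x \<in> nbrs G w" "x \<noteq> u" "nb G (w # x # q)" using p(1) nb_adj[of G w x q] by (auto simp: nbrs_def)
      then show ?thesis using p(2) Cons t(1) sideI[of w x q] by auto
    qed (use p in simp)
  next
    fix v assume v: "v \<in> insert w (side G w a \<union> side G w b)"
    have ext: "v \<in> side G u w" if "nb G (w # x # q)" "v = last (x # q)" "x \<noteq> u" for x q
      using sideI[of u w "x # q"] that assms(1) by simp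
    consider "v = w" | x where "v \<in> side G w x" "x \<noteq> u" using v t(2,3) by blast
    then show "v \<in> side G u w"
    proof cases
      case 1
      then show ?thesis using side_self[OF assms(1)] by simp
    next
      case (2 x)
      from 2(1) obtain q where "nb G (w # x # q)" "v = last (x # q)" by (rule sideE)
      then show ?thesis using ext 2(2) by blast
    qed
  qed
  show "side G w a \<inter> side G w b = {}" using side_disjoint[OF t(4,6,7)] .
  show "w \<notin> side G w a" "w \<notin> side G w b" by (rule side_not_root)+
qed

text \<open>The recursion into a branch terminates because walks without backtracking visit distinct
  vertices. For this reason the walk \<open>p\<close> leading up to the edge is carried
  along.\<close>

lemma branch_exists: "nb G (p @ [u, w]) \<Longrightarrow> \<exists>I. branch G u w I"
proof (induction "card (verts G) - length p" arbitrary: p u w rule: less_induct)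
  case less
  have uw: "(u, w) \<in> adj G" using less.prems nb_append[of G p u w "[]"] by simp
  show ?case
  proof (cases "w \<in> univalent G")
    case True
    then show ?thesis using uw branch.intros(1) by blast
  next
    case False
    then have tri: "w \<in> trivalent G" using verts_cases adj_verts(2)[OF uw] by blast
    note t = trivalent_nbrs[OF uw tri]
    have "set (p @ [u, w]) \<subseteq> verts G"
    proof (cases p)
      case Nil
      then show ?thesis using nb_verts[of u w "[]"] less.prems by simp
    next
      case (Cons x q)
      show ?thesis
      proof (cases q)
        case Nil
        then show ?thesis using nb_verts[of x u "[w]"] less.prems Cons by simp
      next
        case (Cons y r)
        then show ?thesis using nb_verts[of x y "r @ [u, w]"] less.prems \<open>p = x # q\<close> by simp
      qed
    qed
    then have "length (p @ [u, w]) \<le> card (verts G)"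
      using nb_distinct[OF less.prems] card_mono[OF finite_verts] distinct_card by metis
    then have lt: "card (verts G) - length (p @ [u]) < card (verts G) - length p" by simp
    have "\<exists>I. branch G w x I" if "(w, x) \<in> adj G" "u \<noteq> x" for x
    proof (rule less.hyps[OF lt])
      show "nb G ((p @ [u]) @ [w, x])"
        using nb_append[of G p u w "[x]"] less.prems that uw by simp
    qed
    then obtain I J where "branch G w (nxt G w u) I" "branch G w (nxt G w (nxt G w u)) J"
      using t by metis
    then show ?thesis using branch.intros(2)[OF uw tri] by blast
  qed
qed

lemma branch_ex: "(u, w) \<in> adj G \<Longrightarrow> \<exists>I. branch G u w I"
  using branch_exists[of "[]"] by simp

lemma branch_rtrees: "branch G u w I \<Longrightarrow> I \<in> rtrees m"
  by (induction rule: branch.induct) (use lab in \<open>auto simp: rtrees_def\<close>)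

lemma branch_side_trivalent: "branch G u w I \<Longrightarrow> card (trivalent G \<inter> side G u w) = order_rt I"
proof (induction rule: branch.induct)
  case (1 u w)
  then show ?case using univalent_trivalent by (simp add: side_univalent)
next
  case (2 u w I J)
  note s = side_trivalent[OF 2(1,2)]
  have "trivalent G \<inter> side G u w = insert w ((trivalent G \<inter> side G w (nxt G w u)) \<union>
      (trivalent G \<inter> side G w (nxt G w (nxt G w u))))"
    using s(1) 2(2) by auto
  also have "card \<dots> = Suc (order_rt I + order_rt J)"
    using s finite_side 2(5,6) by (subst card_insert_disjoint) (auto simp: card_Un_disjoint Int_Un_distrib intro!: card_Un_disjoint[THEN trans])
  finally show ?case by simp
qed

end

text \<open>The contribution to \<eta> of the leaves of the first tree, when the second one is what
  lies beyond its root. The orders \<open>J, K\<close> and \<open>K, I\<close> are the cyclic order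
  of root edge, \<open>I\<close>, \<open>J\<close> read off from \<open>I\<close> and from
  \<open>J\<close>.\<close>

primrec eta_rooted :: "rtree \<Rightarrow> rtree \<Rightarrow> (nat \<times> rtree \<Rightarrow>\<^sub>0 int)" where
  "eta_rooted (Leaf a) K = frag_of (a, K)"
| "eta_rooted (Br I J) K = eta_rooted I (Br J K) + eta_rooted J (Br K I)"

context ptree
begin

lemma rooted_at_eq: "branch G w u K \<Longrightarrow> w \<in> univalent G \<Longrightarrow> rooted_at G w = K"
  unfolding rooted_at_def
proof (rule the_equality)
  assume w: "branch G w u K" "w \<in> univalent G"
  then show "\<exists>u. branch G w u K" by blast
  fix T assume "\<exists>v. branch G w v T"
  then obtain v where v: "branch G w v T" by blast
  have "nbrs G w = {u}" using nbrs_univalent[OF adj_sym[OF branch_adj[OF w(1)]] w(2)] .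
  then have "v = u" using branch_adj[OF v] by (auto simp: nbrs_def)
  then show "T = K" using branch_unique v w(1) by blast
qed

lemma branch_eta:
  "branch G u w I \<Longrightarrow> branch G w u K \<Longrightarrow>
    (\<Sum>v\<in>univalent G \<inter> side G u w. frag_of (lab G v, rooted_at G v)) = eta_rooted I K"
proof (induction arbitrary: K rule: branch.induct)
  case (1 u w)
  then have "univalent G \<inter> side G u w = {w}" by (simp add: side_univalent)
  then show ?case using rooted_at_eq[OF 1(3,2)] by simp
next
  case (2 u w I J)
  let ?a = "nxt G w u" and ?b = "nxt G w (nxt G w u)"
  note s = side_trivalent[OF 2(1,2)]
  note t = trivalent_nbrs[OF 2(1,2)]
  have "w \<notin> univalent G" using 2(2) univalent_trivalent by blast
  then have "univalent G \<inter> side G u w = (univalent G \<inter> side G w ?a) \<union> (univalent G \<inter> side G w ?b)"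
    using s(1) by auto
  moreover have "(univalent G \<inter> side G w ?a) \<inter> (univalent G \<inter> side G w ?b) = {}" using s(2) by blast
  moreover have "branch G ?a w (Br J K)"
    using branch.intros(2)[OF adj_sym[OF t(6)] 2(2), of J K] 2(4,7) t(5) by simp
  moreover have "branch G ?b w (Br K I)"
    using branch.intros(2)[OF adj_sym[OF t(7)] 2(2), of K I] 2(3,7) t(5) by simp
  ultimately show ?case
    using 2(5)[of "Br J K"] 2(6)[of "Br K I"] finite_side by (simp add: sum.union_disjoint)
qed

end

lemma inner_prod_sym: "inner_prod m I J = inner_prod m J I"
  by (auto simp: inner_prod_def)

lemma inner_prod_eta:
  assumes "G \<in> inner_prod m I J"
  shows "eta_sum G = eta_rooted I J + eta_rooted J I"
proof -
  obtain u w where uw: "is_tree m G" "branch G w u I" "branch G u w J"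
    using assms by (auto simp: inner_prod_def)
  interpret ptree m G by unfold_locales (rule uw)
  have adj: "(w, u) \<in> adj G" using branch_adj uw by blast
  have "univalent G = (univalent G \<inter> side G w u) \<union> (univalent G \<inter> side G u w)"
    using side_union[OF adj] by (auto simp: univalent_def)
  then have "eta_sum G = (\<Sum>v\<in>(univalent G \<inter> side G w u) \<union> (univalent G \<inter> side G u w). frag_of (lab G v, rooted_at G v))"
    by (simp add: eta_sum_def)
  also have "\<dots> = eta_rooted I J + eta_rooted J I"
    using side_opposite[OF adj] finite_side branch_eta[OF uw(2,3)] branch_eta[OF uw(3,2)]
    by (subst sum.union_disjoint) auto
  finally show ?thesis .
qed

lemma inner_prod_rtrees: "G \<in> inner_prod m I J \<Longrightarrow> I \<in> rtrees m \<and> J \<in> rtrees m"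
  using ptree.branch_rtrees by (fastforce simp: inner_prod_def ptree_def)

lemma inner_prod_trees: "G \<in> inner_prod m I J \<Longrightarrow> G \<in> trees m (order_rt I + order_rt J)"
proof -
  assume "G \<in> inner_prod m I J"
  then obtain u w where uw: "is_tree m G" "branch G w u I" "branch G u w J"
    by (auto simp: inner_prod_def)
  interpret ptree m G by unfold_locales (rule uw)
  have adj: "(w, u) \<in> adj G" using branch_adj uw by blast
  have "trivalent G = (trivalent G \<inter> side G w u) \<union> (trivalent G \<inter> side G u w)"
    using side_union[OF adj] by (auto simp: trivalent_def)
  then have "card (trivalent G) = card ((trivalent G \<inter> side G w u) \<union> (trivalent G \<inter> side G u w))" by simp
  also have "\<dots> = order_rt I + order_rt J"
    using side_opposite[OF adj] finite_side branch_side_trivalent[OF uw(2)] branch_side_trivalent[OF uw(3)]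
    by (subst card_Un_disjoint) auto
  finally show ?thesis using uw(1) by (simp add: trees_def)
qed

lemma trees_inner_prod:
  assumes "G \<in> trees m N"
  obtains I J where "G \<in> inner_prod m I J"
proof -
  interpret ptree m G using assms by (simp add: ptree_def trees_def)
  obtain v where "v \<in> verts G" using tree unfolding is_tree_def by blast
  then have "card (nbrs G v) \<noteq> 0" using verts_cases[of v] by (auto simp: univalent_def trivalent_def)
  then obtain u where "u \<in> nbrs G v" by (metis card.empty ex_in_conv)
  then have "(v, u) \<in> adj G" by (simp add: nbrs_def)
  then obtain I J where "branch G v u I" "branch G u v J" using branch_ex adj_sym by metis
  then show ?thesis using tree that[of I J] by (auto simp: inner_prod_def)
qed

text \<open>Both sides describe three branches \<open>A, B, C\<close> in cyclic order around one
  vertex, cut at different edges of that vertex.\<close>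

lemma inner_prod_inv: "inner_prod m (Br A B) C = inner_prod m A (Br B C)"
proof -
  have 1: "inner_prod m (Br A B) C \<subseteq> inner_prod m A (Br B C)" for A B C
  proof
    fix G assume "G \<in> inner_prod m (Br A B) C"
    then obtain u w where uw: "is_tree m G" "branch G w u (Br A B)" "branch G u w C"
      by (auto simp: inner_prod_def)
    interpret ptree m G by unfold_locales (rule uw)
    from uw(2) have b: "(w, u) \<in> adj G" "u \<in> trivalent G" "branch G u (nxt G u w) A"
      "branch G u (nxt G u (nxt G u w)) B" by (auto elim: branch.cases)
    note t = trivalent_nbrs[OF b(1,2)]
    have "branch G (nxt G u w) u (Br B C)"
      using branch.intros(2)[OF adj_sym[OF t(6)] b(2), of B C] b(4) uw(3) t(5) by simp
    then show "G \<in> inner_prod m A (Br B C)" using uw(1) b(3) by (auto simp: inner_prod_def)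
  qed
  have 2: "inner_prod m A (Br B C) \<subseteq> inner_prod m (Br A B) C" for A B C
  proof
    fix G assume "G \<in> inner_prod m A (Br B C)"
    then obtain u w where uw: "is_tree m G" "branch G w u A" "branch G u w (Br B C)"
      by (auto simp: inner_prod_def)
    interpret ptree m G by unfold_locales (rule uw)
    from uw(3) have b: "(u, w) \<in> adj G" "w \<in> trivalent G" "branch G w (nxt G w u) B"
      "branch G w (nxt G w (nxt G w u)) C" by (auto elim: branch.cases)
    note t = trivalent_nbrs[OF b(1,2)]
    have "branch G (nxt G w (nxt G w u)) w (Br A B)"
      using branch.intros(2)[OF adj_sym[OF t(7)] b(2), of A B] b(3) uw(2) t(5) by simp
    then show "G \<in> inner_prod m (Br A B) C" using uw(1) b(4) by (auto simp: inner_prod_def)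
  qed
  show ?thesis using 1 2 by blast
qed

subsection \<open>Uniqueness of the inner product\<close>

text \<open>Preserving adjacency in one direction suffices, since equal valences make the map
  bijective on neighbours.\<close>

lemma tree_isoI:
  assumes G: "is_tree m G" and H: "is_tree m H" and f: "bij_betw f (verts G) (verts H)"
    and adj: "\<And>u v. (u, v) \<in> adj G \<Longrightarrow> (f u, f v) \<in> adj H"
    and uni: "\<And>v. v \<in> univalent G \<Longrightarrow> f v \<in> univalent H \<and> lab H (f v) = lab G v"
    and tri: "\<And>v. v \<in> trivalent G \<Longrightarrow> f v \<in> trivalent H"
    and nx: "\<And>v u. v \<in> trivalent G \<Longrightarrow> u \<in> nbrs G v \<Longrightarrow> f (nxt G v u) = nxt H (f v) (f u)"
  shows "tree_iso G H"
proof -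
  interpret G: ptree m G by unfold_locales (rule G)
  interpret H: ptree m H by unfold_locales (rule H)
  have "f ` nbrs G v = nbrs H (f v)" if v: "v \<in> verts G" for v
  proof (rule card_subset_eq)
    have "nbrs H (f v) \<subseteq> verts H" using H.adj_verts by (auto simp: nbrs_def)
    then show "finite (nbrs H (f v))" using H.finite_verts finite_subset by blast
    show "f ` nbrs G v \<subseteq> nbrs H (f v)" using adj by (auto simp: nbrs_def)
    have "nbrs G v \<subseteq> verts G" using G.adj_verts by (auto simp: nbrs_def)
    then have "card (f ` nbrs G v) = card (nbrs G v)"
      using f by (intro card_image) (meson bij_betw_imp_inj_on inj_on_subset)
    also have "\<dots> = card (nbrs H (f v))"
      using G.verts_cases[OF v]
    proof
      assume "v \<in> univalent G"
      then show ?thesis using uni[of v] by (simp add: univalent_def)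
    next
      assume "v \<in> trivalent G"
      then show ?thesis using tri[of v] by (simp add: trivalent_def)
    qed
    finally show "card (f ` nbrs G v) = card (nbrs H (f v))" .
  qed
  then have "(u, v) \<in> adj G" if "(f u, f v) \<in> adj H" "u \<in> verts G" "v \<in> verts G" for u v
  proof -
    from that have "f v \<in> f ` nbrs G u"
      using \<open>\<And>v. v \<in> verts G \<Longrightarrow> f ` nbrs G v = nbrs H (f v)\<close> by (auto simp: nbrs_def)
    then obtain v' where "f v = f v'" "(u, v') \<in> adj G" by (auto simp: nbrs_def)
    then show ?thesis using f that(3) G.adj_verts by (metis bij_betw_imp_inj_on inj_onD)
  qed
  then show ?thesis unfolding tree_iso_def using f adj uni nx by blast
qed

text \<open>The conditions for an isomorphism at the vertices of \<open>S\<close> alone, but with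
  all edges at them, including those that leave \<open>S\<close>. In this form they pass to
  unions.\<close>

definition local_iso :: "pretree \<Rightarrow> pretree \<Rightarrow> (nat \<Rightarrow> nat) \<Rightarrow> nat set \<Rightarrow> bool" where
  "local_iso G H f S \<longleftrightarrow> (\<forall>v\<in>S. \<forall>x\<in>nbrs G v. (f v, f x) \<in> adj H) \<and>
     (\<forall>v\<in>S \<inter> univalent G. f v \<in> univalent H \<and> lab H (f v) = lab G v) \<and>
     (\<forall>v\<in>S \<inter> trivalent G. f v \<in> trivalent H \<and>
       (\<forall>x\<in>nbrs G v. f (nxt G v x) = nxt H (f v) (f x)))"

lemma local_iso_Un: "local_iso G H f S \<Longrightarrow> local_iso G H f T \<Longrightarrow> local_iso G H f (S \<union> T)"
  unfolding local_iso_def by blast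

lemma (in ptree) local_iso_cong:
  assumes "local_iso G H k S" "\<And>v. v \<in> insert w S \<Longrightarrow> h v = k v"
    "\<And>v x. v \<in> S \<Longrightarrow> x \<in> nbrs G v \<Longrightarrow> x \<in> insert w S"
  shows "local_iso G H h S"
proof -
  have "h v = k v" "h x = k x" if "v \<in> S" "x \<in> nbrs G v" for v x
    using assms(2,3) that by blast+
  moreover have "nxt G v x \<in> nbrs G v" if "v \<in> trivalent G" "x \<in> nbrs G v" for v x
    using nxt[OF that] by blast
  ultimately show ?thesis
    using assms(1,2) unfolding local_iso_def by (intro conjI ballI) (metis IntE insertCI)+
qed

text \<open>The map is also prescribed at \<open>u\<close>, which lies outside the side but is a
  neighbour of \<open>w\<close>: this agreement is what lets maps of adjacent branches be
  glued.\<close>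

lemma branch_iso:
  assumes G: "ptree m G" and H: "ptree m H"
  shows "branch G u w I \<Longrightarrow> branch H u' w' I \<Longrightarrow>
    \<exists>f. bij_betw f (side G u w) (side H u' w') \<and> f w = w' \<and> f u = u' \<and>
      local_iso G H f (side G u w)"
proof (induction arbitrary: u' w' rule: branch.induct)
  case (1 u w)
  interpret G: ptree m G by fact
  interpret H: ptree m H by fact
  from 1(3) have H1: "(u', w') \<in> adj H" "w' \<in> univalent H" "lab H w' = lab G w"
    by (auto elim: branch.cases)
  have s: "side G u w = {w}" "side H u' w' = {w'}" "nbrs G w = {u}"
    using 1(1,2) H1 G.side_univalent H.side_univalent G.nbrs_univalent by blast+
  show ?case
    using s H1 G.adj_neq[OF 1(1)] H.adj_sym univalent_trivalent[OF 1(2)]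
    by (intro exI[of _ "\<lambda>v. if v = w then w' else u'"]) (auto simp: bij_betw_def local_iso_def)
next
  case (2 u w A B)
  interpret G: ptree m G by fact
  interpret H: ptree m H by fact
  let ?a = "nxt G w u" and ?b = "nxt G w (nxt G w u)"
  let ?a' = "nxt H w' u'" and ?b' = "nxt H w' (nxt H w' u')"
  from 2(7) have H2: "(u', w') \<in> adj H" "w' \<in> trivalent H" "branch H w' ?a' A" "branch H w' ?b' B"
    by (auto elim: branch.cases)
  note sG = G.side_trivalent[OF 2(1,2)] and sH = H.side_trivalent[OF H2(1,2)]
  note tG = G.trivalent_nbrs[OF 2(1,2)] and tH = H.trivalent_nbrs[OF H2(1,2)]
  have uG: "u \<notin> side G u w" by (rule G.side_not_root)
  obtain f where f: "bij_betw f (side G w ?a) (side H w' ?a')" "f ?a = ?a'" "f w = w'" "local_iso G H f (side G w ?a)"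
    using 2(5)[OF H2(3)] by blast
  obtain g where g: "bij_betw g (side G w ?b) (side H w' ?b')" "g ?b = ?b'" "g w = w'" "local_iso G H g (side G w ?b)"
    using 2(6)[OF H2(4)] by blast
  define h where "h v = (if v = w then w' else if v \<in> side G w ?a then f v else if v \<in> side G w ?b then g v else u')" for v
  have hf: "h v = f v" if "v \<in> insert w (side G w ?a)" for v
    using that f(3) by (auto simp: h_def)
  have hg: "h v = g v" if "v \<in> insert w (side G w ?b)" for v
    using that g(3) sG(2,4) by (auto simp: h_def)
  have "u \<noteq> w" using G.adj_neq[OF 2(1)] .
  then have hu: "h u = u'" using uG sG(1) by (auto simp: h_def)
  have hw: "h w = w'" by (simp add: h_def)
  have ha: "h ?a = ?a'" using hf[of ?a] f(2) G.side_self[OF tG(6)] by simp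
  have hb: "h ?b = ?b'" using hg[of ?b] g(2) G.side_self[OF tG(7)] by simp
  have nbrs_side: "x \<in> insert w (side G w y)" if "v \<in> side G w y" "x \<in> nbrs G v" for v x y
    using G.side_step[OF that(1)] that(2) by (simp add: nbrs_def)
  have Pa: "local_iso G H h (side G w ?a)" by (rule G.local_iso_cong[OF f(4) hf nbrs_side])
  have Pb: "local_iso G H h (side G w ?b)" by (rule G.local_iso_cong[OF g(4) hg nbrs_side])
  have Pw: "local_iso G H h {w}"
    using 2(2) H2(2) tG tH hu hw ha hb H.adj_sym[OF H2(1)] univalent_trivalent[of w G]
    by (auto simp: local_iso_def)
  have "bij_betw h (side G w ?a) (side H w' ?a')" using f(1) hf by (subst bij_betw_cong[of _ h f]) auto
  moreover have "bij_betw h (side G w ?b) (side H w' ?b')" using g(1) hg by (subst bij_betw_cong[of _ h g]) auto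
  ultimately have "bij_betw h (side G w ?a \<union> side G w ?b) (side H w' ?a' \<union> side H w' ?b')"
    using sH(2) by (rule bij_betw_combine)
  moreover have "bij_betw h {w} {w'}" by (simp add: bij_betw_def hw)
  ultimately have "bij_betw h (side G w ?a \<union> side G w ?b \<union> {w}) (side H w' ?a' \<union> side H w' ?b' \<union> {w'})"
    by (rule bij_betw_combine) (use sH(3,4) in auto)
  then have "bij_betw h (side G u w) (side H u' w')" using sG(1) sH(1) by simp
  moreover have "local_iso G H h (side G u w)" unfolding sG(1) using local_iso_Un[OF Pw local_iso_Un[OF Pa Pb]] by simp
  ultimately show ?case using hu hw by (intro exI[of _ h]) blast
qed

lemma inner_prod_iso:
  assumes "G \<in> inner_prod m I J" "H \<in> inner_prod m I J"
  shows "tree_iso G H"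
proof -
  obtain u w where G: "is_tree m G" "branch G w u I" "branch G u w J"
    using assms(1) by (auto simp: inner_prod_def)
  obtain u' w' where H: "is_tree m H" "branch H w' u' I" "branch H u' w' J"
    using assms(2) by (auto simp: inner_prod_def)
  have GH: "ptree m G" "ptree m H" using G H by (simp_all add: ptree_def)
  interpret G: ptree m G by fact
  interpret H: ptree m H by fact
  obtain f where f: "bij_betw f (side G w u) (side H w' u')" "f u = u'" "f w = w'" "local_iso G H f (side G w u)"
    using branch_iso[OF GH G(2) H(2)] by blast
  obtain g where g: "bij_betw g (side G u w) (side H u' w')" "g w = w'" "g u = u'" "local_iso G H g (side G u w)"
    using branch_iso[OF GH G(3) H(3)] by blast
  have adj: "(w, u) \<in> adj G" "(w', u') \<in> adj H" using G H branch_adj by blast+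
  define h where "h v = (if v \<in> side G w u then f v else g v)" for v
  have opp: "side G w u \<inter> side G u w = {}" using G.side_opposite[OF adj(1)] .
  have hf: "h v = f v" if "v \<in> insert w (side G w u)" for v
    using that opp f(3) g(2) G.side_self[OF G.adj_sym[OF adj(1)]] by (auto simp: h_def)
  have hg: "h v = g v" if "v \<in> insert u (side G u w)" for v
    using that opp f(2) g(3) G.side_self[OF adj(1)] by (auto simp: h_def)
  have nbrs_side: "x \<in> insert z (side G z y)" if "v \<in> side G z y" "x \<in> nbrs G v" for v x y z
    using G.side_step[OF that(1)] that(2) by (simp add: nbrs_def)
  have Pf: "local_iso G H h (side G w u)" by (rule G.local_iso_cong[OF f(4) hf nbrs_side])
  have Pg: "local_iso G H h (side G u w)" by (rule G.local_iso_cong[OF g(4) hg nbrs_side])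
  have V: "verts G = side G w u \<union> side G u w" "verts H = side H w' u' \<union> side H u' w'"
    using G.side_union[OF adj(1)] H.side_union[OF adj(2)] by simp_all
  have P: "local_iso G H h (verts G)" unfolding V(1) by (rule local_iso_Un[OF Pf Pg])
  have "bij_betw h (side G w u) (side H w' u')" using f(1) hf by (subst bij_betw_cong[of _ h f]) auto
  moreover have "bij_betw h (side G u w) (side H u' w')" using g(1) hg by (subst bij_betw_cong[of _ h g]) auto
  ultimately have bij: "bij_betw h (verts G) (verts H)"
    unfolding V using H.side_opposite[OF adj(2)] by (rule bij_betw_combine)
  have UT: "univalent G \<subseteq> verts G" "trivalent G \<subseteq> verts G" by (auto simp: univalent_def trivalent_def)
  show ?thesis
  proof (rule tree_isoI[OF G(1) H(1) bij])
    show "(h u, h v) \<in> adj H" if "(u, v) \<in> adj G" for u v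
      using P that G.adj_verts(1)[OF that] by (simp add: nbrs_def local_iso_def)
  qed (use P UT in \<open>unfold local_iso_def, blast\<close>)+
qed

lemma branch_tree_iso:
  assumes f: "\<forall>u\<in>verts G. \<forall>v\<in>verts G. (u, v) \<in> adj G \<longleftrightarrow> (f u, f v) \<in> adj H"
      "\<forall>v\<in>trivalent G. \<forall>u\<in>nbrs G v. f (nxt G v u) = nxt H (f v) (f u)"
      "\<forall>v\<in>univalent G. lab H (f v) = lab G v" "bij_betw f (verts G) (verts H)"
    and G: "is_tree m G" and H: "is_tree m H"
  shows "branch G u w I \<Longrightarrow> branch H (f u) (f w) I"
proof -
  interpret G: ptree m G by unfold_locales (rule G)
  interpret H: ptree m H by unfold_locales (rule H)
  have nbrs: "nbrs H (f v) = f ` nbrs G v" if "v \<in> verts G" for v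
  proof (intro subset_antisym subsetI)
    fix y assume "y \<in> nbrs H (f v)"
    then have y: "(f v, y) \<in> adj H" by (simp add: nbrs_def)
    have "y \<in> f ` verts G" using H.adj_verts(2)[OF y] f(4) by (simp add: bij_betw_def)
    then obtain x where x: "x \<in> verts G" "y = f x" by blast
    then have "(v, x) \<in> adj G" using f(1) that y by blast
    then show "y \<in> f ` nbrs G v" using x(2) by (simp add: nbrs_def)
  next
    fix y assume "y \<in> f ` nbrs G v"
    then obtain x where x: "(v, x) \<in> adj G" "y = f x" by (auto simp: nbrs_def)
    then have "(f v, f x) \<in> adj H" using f(1) that G.adj_verts(2)[OF x(1)] by blast
    then show "y \<in> nbrs H (f v)" using x(2) by (simp add: nbrs_def)
  qed
  have "card (nbrs H (f v)) = card (nbrs G v) \<and> f v \<in> verts H" if "v \<in> verts G" for v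
  proof -
    have "nbrs G v \<subseteq> verts G" using G.adj_verts by (auto simp: nbrs_def)
    then have "card (f ` nbrs G v) = card (nbrs G v)"
      using f(4) by (intro card_image) (meson bij_betw_imp_inj_on inj_on_subset)
    then show ?thesis using nbrs[OF that] f(4) that by (simp add: bij_betwE)
  qed
  then have UT: "v \<in> univalent G \<Longrightarrow> f v \<in> univalent H" "v \<in> trivalent G \<Longrightarrow> f v \<in> trivalent H" for v
    by (simp_all add: univalent_def trivalent_def)
  show "branch G u w I \<Longrightarrow> branch H (f u) (f w) I"
  proof (induction rule: branch.induct)
    case (1 u w)
    have "(f u, f w) \<in> adj H" using f(1) 1(1) G.adj_verts[OF 1(1)] by blast
    then show ?case using branch.intros(1)[of "f u" "f w" H] UT(1)[OF 1(2)] f(3) 1(2) by simp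
  next
    case (2 u w I J)
    have adj: "(f u, f w) \<in> adj H" using f(1) 2(1) G.adj_verts[OF 2(1)] by blast
    note t = G.trivalent_nbrs[OF 2(1,2)]
    have "f (nxt G w u) = nxt H (f w) (f u)" using f(2) 2(2) t(1) by blast
    moreover have "f (nxt G w (nxt G w u)) = nxt H (f w) (f (nxt G w u))" using f(2) 2(2) t(1) by blast
    ultimately show ?case using branch.intros(2)[OF adj UT(2)[OF 2(2)]] 2(5,6) by simp
  qed
qed

text \<open>Turns the isomorphism classes among the generators into inner products, so that
  relations can be compared on rooted trees.\<close>

lemma iso_class_inner_prod:
  assumes "G \<in> inner_prod m I J"
  shows "iso_class m G = inner_prod m I J"
proof (intro subset_antisym subsetI)
  fix H assume "H \<in> iso_class m G"
  then have H: "is_tree m H" "tree_iso G H" by (auto simp: iso_class_def)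
  then obtain f where f: "\<forall>u\<in>verts G. \<forall>v\<in>verts G. (u, v) \<in> adj G \<longleftrightarrow> (f u, f v) \<in> adj H"
      "\<forall>v\<in>trivalent G. \<forall>u\<in>nbrs G v. f (nxt G v u) = nxt H (f v) (f u)"
      "\<forall>v\<in>univalent G. lab H (f v) = lab G v" "bij_betw f (verts G) (verts H)"
    by (auto simp: tree_iso_def)
  from assms obtain u w where "is_tree m G" "branch G w u I" "branch G u w J"
    by (auto simp: inner_prod_def)
  then have "branch H (f w) (f u) I" "branch H (f u) (f w) J"
    using branch_tree_iso[OF f _ H(1)] by blast+
  then show "H \<in> inner_prod m I J" using H(1) by (auto simp: inner_prod_def)
next
  fix H assume "H \<in> inner_prod m I J"
  then show "H \<in> iso_class m G"
    using inner_prod_iso[OF assms] by (auto simp: iso_class_def inner_prod_def)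
qed

subsection \<open>Reversing a cyclic order\<close>

lemma reverse_at_simps [simp]:
  "verts (reverse_at v G) = verts G" "adj (reverse_at v G) = adj G" "lab (reverse_at v G) = lab G"
  "nxt (reverse_at v G) x = (if x = v then \<lambda>u. nxt G v (nxt G v u) else nxt G x)"
  "nbrs (reverse_at v G) = nbrs G" "univalent (reverse_at v G) = univalent G"
  "trivalent (reverse_at v G) = trivalent G" "is_cycle (reverse_at v G) = is_cycle G"
  by (simp_all add: reverse_at_def nbrs_def[abs_def] univalent_def trivalent_def is_cycle_def[abs_def])

context ptree
begin

lemma reverse_is_tree:
  assumes v: "v \<in> trivalent G"
  shows "is_tree m (reverse_at v G)"
proof -
  have "nxt G v (nxt G v u) \<in> nbrs G v \<and> nxt G v (nxt G v u) \<noteq> u \<and>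
      nxt G v (nxt G v (nxt G v (nxt G v (nxt G v (nxt G v u))))) = u" if u: "u \<in> nbrs G v" for u
    using nxt[OF v u] nxt[OF v, of "nxt G v u"] by metis
  then have "\<forall>x\<in>trivalent G. \<forall>u\<in>nbrs G x.
      nxt (reverse_at v G) x u \<in> nbrs G x \<and> nxt (reverse_at v G) x u \<noteq> u \<and>
      nxt (reverse_at v G) x (nxt (reverse_at v G) x (nxt (reverse_at v G) x u)) = u"
    using nxt by simp
  then show ?thesis
    using tree[unfolded is_tree_def] unfolding is_tree_def reverse_at_simps(1-3,5-8) by blast
qed

lemma branch_reverse: "branch G u w I \<Longrightarrow> v \<notin> side G u w \<Longrightarrow> branch (reverse_at v G) u w I"
proof (induction rule: branch.induct)
  case (1 u w)
  then show ?case using branch.intros(1)[of u w "reverse_at v G"] by simp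
next
  case (2 u w I J)
  note s = side_trivalent[OF 2(1,2)]
  have "w \<noteq> v" using 2(7) s(1) by blast
  then show ?case
    using branch.intros(2)[of u w "reverse_at v G" I J] 2 s(1) by simp
qed

text \<open>Cutting next to the reversed vertex \<open>u\<close> leaves its branches untouched, as
  none of them contains \<open>u\<close>; only the order of the two children changes.\<close>

lemma reverse_inner_prod:
  assumes "branch G w u (Br A B)" "branch G u w C"
  shows "reverse_at u G \<in> inner_prod m (Br B A) C"
proof -
  from assms(1) have b: "(w, u) \<in> adj G" "u \<in> trivalent G" "branch G u (nxt G u w) A"
    "branch G u (nxt G u (nxt G u w)) B" by (auto elim: branch.cases)
  note t = trivalent_nbrs[OF b(1,2)]
  have away: "branch (reverse_at u G) u x K" if "branch G u x K" for x K
    using branch_reverse[OF that] side_not_root by blast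
  have "branch (reverse_at u G) w u (Br B A)"
    using branch.intros(2)[of w u "reverse_at u G" B A] b(1,2) away[OF b(3)] away[OF b(4)] t(5) by simp
  then show ?thesis
    using away[OF assms(2)] reverse_is_tree[OF b(2)] by (auto simp: inner_prod_def)
qed

end

lemma reverse_at_inner_prod:
  assumes "G \<in> trees m N" "v \<in> trivalent G"
  obtains A B C where "G \<in> inner_prod m (Br A B) C" "reverse_at v G \<in> inner_prod m (Br B A) C"
proof -
  interpret ptree m G using assms by (simp add: ptree_def trees_def)
  have "card (nbrs G v) \<noteq> 0" using assms(2) by (simp add: trivalent_def)
  then obtain w where "w \<in> nbrs G v" by (metis card.empty ex_in_conv)
  then have vw: "(v, w) \<in> adj G" by (simp add: nbrs_def)
  obtain C where C: "branch G v w C" using branch_ex[OF vw] by blast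
  obtain I where I: "branch G w v I" using branch_ex[OF adj_sym[OF vw]] by blast
  from I assms(2) obtain A B where "I = Br A B" by cases (auto dest: univalent_trivalent)
  then show ?thesis
    using that[of A B C] reverse_inner_prod[of w v A B C] I C tree by (auto simp: inner_prod_def)
qed

lemma inner_prod_reverse_at:
  assumes "G \<in> inner_prod m (Br A B) C"
  obtains v where "v \<in> trivalent G" "reverse_at v G \<in> inner_prod m (Br B A) C"
proof -
  obtain u w where uw: "is_tree m G" "branch G w u (Br A B)" "branch G u w C"
    using assms by (auto simp: inner_prod_def)
  interpret ptree m G by unfold_locales (rule uw)
  have "u \<in> trivalent G" using uw(2) by (auto elim: branch.cases)
  then show ?thesis using that reverse_inner_prod[OF uw(2,3)] by blast
qed

subsection \<open>Existence of the inner product\<close>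

text \<open>The vertices of the canonical representative are the addresses of the subtrees of
  \<open>I\<close> and \<open>J\<close>, with the path to the root read from left to right; the two addresses of
  length one are joined by the edge in which the roots are glued.\<close>

primrec addr :: "rtree \<Rightarrow> rtree \<Rightarrow> bool list \<Rightarrow> rtree option" where
  "addr I J [] = None"
| "addr I J (b # p) = (if p = [] then Some (if b then J else I)
     else (case addr I J p of Some (Br A B) \<Rightarrow> Some (if b then B else A) | _ \<Rightarrow> None))"

text \<open>The two addresses of length one are made parents of each other; this encodes the edge
  arising from the glued roots.\<close>

definition par :: "bool list \<Rightarrow> bool list" where
  "par p = (if tl p = [] then [\<not> hd p] else tl p)"

definition canon :: "rtree \<Rightarrow> rtree \<Rightarrow> pretree" where
  "canon I J = \<lparr>verts = to_nat ` dom (addr I J),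
     adj = {(to_nat p, to_nat q) | p q. p \<in> dom (addr I J) \<and> q \<in> dom (addr I J) \<and> (par p = q \<or> par q = p)},
     nxt = (\<lambda>v u. let p = from_nat v; q = from_nat u in
       to_nat (if q = par p then False # p else if q = False # p then True # p else par p)),
     lab = (\<lambda>v. case addr I J (from_nat v) of Some (Leaf a) \<Rightarrow> a | _ \<Rightarrow> 0)\<rparr>"

lemma addr_par: "p \<in> dom (addr I J) \<Longrightarrow> par p \<in> dom (addr I J)"
  by (cases p) (auto simp: par_def split: option.splits rtree.splits if_splits)

lemma addr_length: "addr I J p = Some T \<Longrightarrow> length p + order_rt T \<le> Suc (order_rt I + order_rt J)"
proof (induction p arbitrary: T)
  case (Cons b p)
  show ?case
  proof (cases "p = []")
    case False
    then obtain A B where "addr I J p = Some (Br A B)" "T = (if b then B else A)"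
      using Cons.prems by (auto split: option.splits rtree.splits)
    then show ?thesis using Cons.IH[of "Br A B"] by auto
  qed (use Cons.prems in auto)
qed simp

lemma canon_simps [simp]:
  "verts (canon I J) = to_nat ` dom (addr I J)"
  "(to_nat p, to_nat q) \<in> adj (canon I J) \<longleftrightarrow>
     p \<in> dom (addr I J) \<and> q \<in> dom (addr I J) \<and> (par p = q \<or> par q = p)"
  "nxt (canon I J) (to_nat p) (to_nat q) =
     to_nat (if q = par p then False # p else if q = False # p then True # p else par p)"
  "lab (canon I J) (to_nat p) = (case addr I J p of Some (Leaf a) \<Rightarrow> a | _ \<Rightarrow> 0)"
  by (auto simp: canon_def Let_def)

lemma par_neq [simp]: "p \<noteq> [] \<Longrightarrow> par p \<noteq> p" "p \<noteq> [] \<Longrightarrow> par p \<noteq> b # p" "p \<noteq> [] \<Longrightarrow> par (b # p) = p"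
proof -
  show "p \<noteq> [] \<Longrightarrow> par p \<noteq> p" by (cases p) (auto simp: par_def)
  have "length (par p) \<le> length p" if "p \<noteq> []" using that by (cases p) (auto simp: par_def Suc_le_eq)
  then show "p \<noteq> [] \<Longrightarrow> par p \<noteq> b # p" by fastforce
  show "p \<noteq> [] \<Longrightarrow> par (b # p) = p" by (simp add: par_def)
qed

lemma canon_nbrs:
  assumes "addr I J p = Some T"
  shows "nbrs (canon I J) (to_nat p) =
    (case T of Leaf a \<Rightarrow> {to_nat (par p)} | Br A B \<Rightarrow> {to_nat (par p), to_nat (False # p), to_nat (True # p)})"
proof -
  have p: "p \<noteq> []" using assms by auto
  have *: "q = par p \<or> (\<exists>b. q = b # p)" if "par q = p" "q \<in> dom (addr I J)" for q
    using that by (cases q) (auto simp: par_def split: if_splits)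
  have ch: "b # p \<in> dom (addr I J) \<longleftrightarrow> (\<exists>A B. T = Br A B)" for b
    using assms p by (auto split: rtree.splits)
  have dom: "p \<in> dom (addr I J)" using assms by auto
  have "nbrs (canon I J) (to_nat p) = to_nat ` {q \<in> dom (addr I J). par p = q \<or> par q = p}"
    using dom by (auto simp: nbrs_def canon_def)
  also have "{q \<in> dom (addr I J). par p = q \<or> par q = p} =
      (case T of Leaf a \<Rightarrow> {par p} | Br A B \<Rightarrow> {par p, False # p, True # p})"
  proof (cases T)
    case (Leaf a)
    have "b # p \<notin> dom (addr I J)" for b using ch Leaf by simp
    then have "q = par p" if "q \<in> dom (addr I J)" "par p = q \<or> par q = p" for q
      using that *[of q] by metis
    then have "{q \<in> dom (addr I J). par p = q \<or> par q = p} = {par p}"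
      using addr_par[OF dom] by blast
    then show ?thesis by (simp add: Leaf)
  next
    case (Br A B)
    then have "False # p \<in> dom (addr I J)" "True # p \<in> dom (addr I J)" using ch by blast+
    then have sub: "{par p, False # p, True # p} \<subseteq> {q \<in> dom (addr I J). par p = q \<or> par q = p}"
      using addr_par[OF dom] par_neq(3)[OF p] by simp
    have "q \<in> {par p, False # p, True # p}" if q: "q \<in> dom (addr I J)" "par p = q \<or> par q = p" for q
    proof -
      consider "q = par p" | b where "q = b # p" using q *[of q] by metis
      then show ?thesis by cases simp_all
    qed
    then have "{q \<in> dom (addr I J). par p = q \<or> par q = p} \<subseteq> {par p, False # p, True # p}" by blast
    from subset_antisym[OF this sub]
    have "{q \<in> dom (addr I J). par p = q \<or> par q = p} = {par p, False # p, True # p}" .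
    then show ?thesis by (simp add: Br)
  qed
  finally show ?thesis by (cases T) auto
qed

lemma canon_valence:
  assumes "addr I J p = Some T"
  shows "to_nat p \<in> univalent (canon I J) \<longleftrightarrow> (\<exists>a. T = Leaf a)"
    "to_nat p \<in> trivalent (canon I J) \<longleftrightarrow> (\<exists>A B. T = Br A B)"
proof -
  have p: "p \<noteq> []" using assms by auto
  have "card (nbrs (canon I J) (to_nat p)) = (case T of Leaf a \<Rightarrow> 1 | Br A B \<Rightarrow> 3)"
    unfolding canon_nbrs[OF assms] using par_neq(2)[OF p] by (cases T) simp_all
  moreover have "to_nat p \<in> verts (canon I J)" using assms by auto
  ultimately have "to_nat p \<in> univalent (canon I J) \<longleftrightarrow> (case T of Leaf a \<Rightarrow> 1 | Br A B \<Rightarrow> 3) = (1::nat)"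
    "to_nat p \<in> trivalent (canon I J) \<longleftrightarrow> (case T of Leaf a \<Rightarrow> 1 | Br A B \<Rightarrow> 3) = (3::nat)"
    unfolding univalent_def trivalent_def by simp_all
  then show "to_nat p \<in> univalent (canon I J) \<longleftrightarrow> (\<exists>a. T = Leaf a)"
    "to_nat p \<in> trivalent (canon I J) \<longleftrightarrow> (\<exists>A B. T = Br A B)"
    by (cases T; simp)+
qed

lemma successively_rotate:
  assumes "successively P (xs @ v # ys)" "P (last (xs @ v # ys)) (hd (xs @ v # ys))"
  shows "successively P ((v # ys) @ xs) \<and> P (last ((v # ys) @ xs)) v"
  using assms by (cases "xs = []") (simp_all del: append_Cons add: successively_append_iff)

text \<open>A vertex of the cycle with longest address can only be joined to its parent within the
  cycle, so its two neighbours there would coincide.\<close>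

lemma canon_no_cycle: "\<not> is_cycle (canon I J) c"
proof
  assume c: "is_cycle (canon I J) c"
  define d where "d v = length (from_nat v :: bool list)" for v
  have "c \<noteq> []" using c by (auto simp: is_cycle_def)
  then have "Max (d ` set c) \<in> d ` set c" by (intro Max_in) auto
  then obtain v where v: "v \<in> set c" "\<And>x. x \<in> set c \<Longrightarrow> d x \<le> d v"
    by (metis (no_types, lifting) List.finite_set Max_ge finite_imageI image_iff)
  then obtain xs ys where c_eq: "c = xs @ v # ys" by (meson split_list)
  define r where "r = ys @ xs"
  have len: "length r \<ge> 2" "distinct (v # r)"
    using c by (auto simp: is_cycle_def c_eq r_def)
  have "successively (\<lambda>u v. (u, v) \<in> adj (canon I J)) (v # r) \<and> (last (v # r), v) \<in> adj (canon I J)"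
    using c successively_rotate[of "\<lambda>u v. (u, v) \<in> adj (canon I J)" xs v ys]
    by (simp add: is_cycle_def c_eq r_def)
  then have "(v, hd r) \<in> adj (canon I J)" "(last r, v) \<in> adj (canon I J)" "hd r \<noteq> last r"
    using len by (cases r; cases "tl r"; auto simp: successively_Cons)+
  have par: "x = to_nat (par (from_nat v))" if "(v, x) \<in> adj (canon I J) \<or> (x, v) \<in> adj (canon I J)" "x \<in> set c" for x
  proof -
    from that(1) obtain p q where pq: "v = to_nat p" "x = to_nat q" "par p = q \<or> par q = p" "p \<in> dom (addr I J)" "q \<in> dom (addr I J)"
      by (auto simp: canon_def)
    have "length q \<le> length p" using v(2)[OF that(2)] pq by (simp add: d_def)
    then have "par p = q" using pq(3-5) by (cases q) (auto simp: par_def split: if_splits)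
    then show ?thesis using pq by simp
  qed
  have "r \<noteq> []" using len by auto
  then have "hd r \<in> set c" "last r \<in> set c" by (auto simp: c_eq r_def hd_append last_append)
  then show False using par \<open>(v, hd r) \<in> _\<close> \<open>(last r, v) \<in> _\<close> \<open>hd r \<noteq> last r\<close> by metis
qed

lemma canon_connected: "p \<in> dom (addr I J) \<Longrightarrow> (to_nat p, to_nat [True]) \<in> (adj (canon I J))\<^sup>*"
proof (induction p)
  case (Cons b p)
  show ?case
  proof (cases "p = []")
    case True
    then show ?thesis by (cases b) (auto simp: par_def intro!: r_into_rtrancl)
  next
    case False
    then have "p \<in> dom (addr I J)" using Cons.prems by (auto split: option.splits)
    moreover have "(to_nat (b # p), to_nat p) \<in> adj (canon I J)"
      using calculation Cons.prems False by simp
    ultimately show ?thesis using Cons.IH by (meson converse_rtrancl_into_rtrancl)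
  qed
qed (simp add: domIff)

lemma labels_addr: "addr I J p = Some T \<Longrightarrow> labels T \<subseteq> labels I \<union> labels J"
proof (induction p arbitrary: T)
  case (Cons b p)
  then show ?case by (auto split: if_splits option.splits rtree.splits)
qed simp

lemma canon_tree:
  assumes "I \<in> rtrees m" "J \<in> rtrees m"
  shows "is_tree m (canon I J)"
  unfolding is_tree_def
proof (intro conjI ballI)
  have "dom (addr I J) \<subseteq> {p. set p \<subseteq> UNIV \<and> length p \<le> Suc (order_rt I + order_rt J)}"
    using addr_length by fastforce
  then show "finite (verts (canon I J))"
    using finite_lists_length_le[of "UNIV :: bool set"] finite_subset by fastforce
  have "[True] \<in> dom (addr I J)" by auto
  then show "verts (canon I J) \<noteq> {}" by auto
  show "adj (canon I J) \<subseteq> verts (canon I J) \<times> verts (canon I J)" by (auto simp: canon_def)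
  show sym: "sym (adj (canon I J))" by (auto simp: canon_def sym_def)
  show "irrefl (adj (canon I J))"
    by (auto simp: canon_def irrefl_def) (metis addr.simps(1) option.distinct(1) par_neq(1))+
  show "(u, v) \<in> (adj (canon I J))\<^sup>*" if "u \<in> verts (canon I J)" "v \<in> verts (canon I J)" for u v
  proof -
    have "(u, to_nat [True]) \<in> (adj (canon I J))\<^sup>*" "(v, to_nat [True]) \<in> (adj (canon I J))\<^sup>*"
      using that canon_connected by auto
    then show ?thesis using sym by (meson rtrancl_trans sym_rtrancl symD)
  qed
  show "\<nexists>p. is_cycle (canon I J) p" using canon_no_cycle by blast
  show "verts (canon I J) = univalent (canon I J) \<union> trivalent (canon I J)"
  proof
    show "univalent (canon I J) \<union> trivalent (canon I J) \<subseteq> verts (canon I J)"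
      by (auto simp: univalent_def trivalent_def)
    show "verts (canon I J) \<subseteq> univalent (canon I J) \<union> trivalent (canon I J)"
    proof
      fix v assume "v \<in> verts (canon I J)"
      then obtain p T where "v = to_nat p" "addr I J p = Some T" by auto
      then show "v \<in> univalent (canon I J) \<union> trivalent (canon I J)"
        using canon_valence[of I J p T] by (cases T) auto
    qed
  qed
  fix v u assume v: "v \<in> trivalent (canon I J)" and u: "u \<in> nbrs (canon I J) v"
  then obtain p T where pT: "v = to_nat p" "addr I J p = Some T" by (auto simp: trivalent_def)
  then obtain A B where "T = Br A B" using canon_valence(2) v by blast
  then have n: "nbrs (canon I J) v = {to_nat (par p), to_nat (False # p), to_nat (True # p)}"
    using canon_nbrs[OF pT(2)] pT(1) by simp
  have "p \<noteq> []" using pT(2) by auto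
  then have p: "par p \<noteq> b # p" "b # p \<noteq> par p" for b using par_neq(2)[of p b] by metis+
  show "nxt (canon I J) v u \<in> nbrs (canon I J) v" "nxt (canon I J) v u \<noteq> u"
    "nxt (canon I J) v (nxt (canon I J) v (nxt (canon I J) v u)) = u"
    using u p unfolding n by (auto simp: pT(1))
next
  fix v assume "v \<in> univalent (canon I J)"
  moreover from this obtain p T where pT: "v = to_nat p" "addr I J p = Some T" by (auto simp: univalent_def)
  ultimately obtain a where "T = Leaf a" using canon_valence(1) by blast
  then show "lab (canon I J) v \<in> {1..m}"
    using labels_addr[OF pT(2)] assms pT by (auto simp: rtrees_def)
qed

lemma canon_branch: "addr I J p = Some T \<Longrightarrow> branch (canon I J) (to_nat (par p)) (to_nat p) T"
proof (induction T arbitrary: p)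
  case (Leaf a)
  have "(to_nat (par p), to_nat p) \<in> adj (canon I J)" using Leaf addr_par[of p I J] by auto
  moreover have "to_nat p \<in> univalent (canon I J)" using canon_valence(1)[OF Leaf] by blast
  ultimately show ?case using branch.intros(1) Leaf by fastforce
next
  case (Br A B)
  have p: "p \<noteq> []" using Br.prems by auto
  have "(to_nat (par p), to_nat p) \<in> adj (canon I J)" using Br.prems addr_par[of p I J] by auto
  moreover have "to_nat p \<in> trivalent (canon I J)" using canon_valence(2)[OF Br.prems] by blast
  moreover have "branch (canon I J) (to_nat p) (to_nat (False # p)) A"
    using Br.IH(1)[of "False # p"] Br.prems p by simp
  moreover have "branch (canon I J) (to_nat p) (to_nat (True # p)) B"
    using Br.IH(2)[of "True # p"] Br.prems p by simp
  moreover have "False # p \<noteq> par p" using par_neq(2)[OF p, of False] by metis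
  ultimately show ?case using branch.intros(2)[of "to_nat (par p)" "to_nat p" "canon I J" A B] by simp
qed

lemma inner_prod_nonempty:
  assumes "I \<in> rtrees m" "J \<in> rtrees m"
  shows "canon I J \<in> inner_prod m I J"
proof -
  have "branch (canon I J) (to_nat [True]) (to_nat [False]) I"
    "branch (canon I J) (to_nat [False]) (to_nat [True]) J"
    using canon_branch[of I J "[False]" I] canon_branch[of I J "[True]" J] by (auto simp: par_def)
  then show ?thesis using canon_tree[OF assms] by (auto simp: inner_prod_def)
qed

section \<open>Quotients of free abelian groups\<close>

definition zsub :: "'g::ab_group_add set \<Rightarrow> bool" where
  "zsub M \<longleftrightarrow> 0 \<in> M \<and> (\<forall>a\<in>M. \<forall>b\<in>M. a - b \<in> M)"

lemma zsubD: "zsub M \<Longrightarrow> 0 \<in> M" "zsub M \<Longrightarrow> a \<in> M \<Longrightarrow> b \<in> M \<Longrightarrow> a - b \<in> M"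
  "zsub M \<Longrightarrow> a \<in> M \<Longrightarrow> - a \<in> M" "zsub M \<Longrightarrow> a \<in> M \<Longrightarrow> b \<in> M \<Longrightarrow> a + b \<in> M"
proof -
  assume M: "zsub M"
  show 0: "0 \<in> M" and d: "a \<in> M \<Longrightarrow> b \<in> M \<Longrightarrow> a - b \<in> M" for a b
    using M by (auto simp: zsub_def)
  show m: "a \<in> M \<Longrightarrow> - a \<in> M" for a
    using d[OF 0, of a] by simp
  show "a \<in> M \<Longrightarrow> b \<in> M \<Longrightarrow> a + b \<in> M"
    using d[of a "- b"] m[of b] by simp
qed

lemma zsub_zspan: "zsub (zspan R)"
  by (auto simp: zsub_def intro: zspan_0 zspan_diff)

lemma zspan_subset: "zsub M \<Longrightarrow> R \<subseteq> M \<Longrightarrow> zspan R \<subseteq> M"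
proof
  fix x assume "zsub M" "R \<subseteq> M" "x \<in> zspan R"
  from this(3) this(1,2) show "x \<in> M" by induction (auto dest: zsubD)
qed

abbreviation fcar :: "'a set \<Rightarrow> ('a \<Rightarrow>\<^sub>0 int) set" where
  "fcar S \<equiv> {u. Poly_Mapping.keys u \<subseteq> S}"

lemma zsub_fcar: "zsub (fcar S)"
  using keys_diff unfolding zsub_def by fastforce

lemma carrier_free: "carrier (free_Abelian_group S) = fcar S"
  by (auto simp: free_Abelian_group_def)

lemma generate_zspan:
  assumes "H \<subseteq> fcar S"
  shows "generate (free_Abelian_group S) H = zspan H"
proof (intro subset_antisym subsetI)
  fix x assume "x \<in> generate (free_Abelian_group S) H"
  then show "x \<in> zspan H"
  proof induction
    case (inv h)
    moreover from this have "h \<in> fcar S" using assms by blast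
    ultimately show ?case by (simp add: carrier_free zspan_uminus zspan_base)
  qed (auto intro: zspan_0 zspan_base zspan_add)
next
  interpret F: comm_group "free_Abelian_group S" by (rule abelian_free_Abelian_group)
  have sub: "subgroup (generate (free_Abelian_group S) H) (free_Abelian_group S)"
    by (rule F.generate_is_subgroup) (use assms in \<open>simp add: carrier_free\<close>)
  fix x assume "x \<in> zspan H"
  then show "x \<in> generate (free_Abelian_group S) H"
  proof induction
    case zspan_0
    show ?case using generate.one[of "free_Abelian_group S"] by simp
  next
    case (zspan_base s)
    then show ?case by (rule generate.incl)
  next
    case (zspan_diff a b)
    then have "a \<otimes>\<^bsub>free_Abelian_group S\<^esub> inv\<^bsub>free_Abelian_group S\<^esub> b \<in> generate (free_Abelian_group S) H"
      by (intro subgroup.m_closed[OF sub] subgroup.m_inv_closed[OF sub])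
    moreover have "b \<in> carrier (free_Abelian_group S)"
      using subgroup.mem_carrier[OF sub zspan_diff(4)] .
    ultimately show ?case by (simp add: carrier_free)
  qed
qed

lemma mem_coset: "y \<in> M #>\<^bsub>free_Abelian_group S\<^esub> x \<longleftrightarrow> y - x \<in> M"
  by (auto simp: r_coset_def intro!: bexI[of _ "y - x"])

context
  fixes S :: "'a set" and M :: "('a \<Rightarrow>\<^sub>0 int) set"
  assumes M: "zsub M"
begin

lemma coset_self: "x \<in> M #>\<^bsub>free_Abelian_group S\<^esub> x"
  by (simp add: mem_coset zsubD(1)[OF M])

lemma coset_eq_iff:
  "M #>\<^bsub>free_Abelian_group S\<^esub> x = M #>\<^bsub>free_Abelian_group S\<^esub> y \<longleftrightarrow> x - y \<in> M"
proof
  assume "M #>\<^bsub>free_Abelian_group S\<^esub> x = M #>\<^bsub>free_Abelian_group S\<^esub> y"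
  then show "x - y \<in> M" using coset_self[of x] by (simp add: mem_coset)
next
  assume xy: "x - y \<in> M"
  show "M #>\<^bsub>free_Abelian_group S\<^esub> x = M #>\<^bsub>free_Abelian_group S\<^esub> y"
  proof (intro subset_antisym subsetI)
    fix z
    show "z \<in> M #>\<^bsub>free_Abelian_group S\<^esub> y" if z: "z \<in> M #>\<^bsub>free_Abelian_group S\<^esub> x"
      using zsubD(4)[OF M _ xy, of "z - x"] z by (simp add: mem_coset)
    show "z \<in> M #>\<^bsub>free_Abelian_group S\<^esub> x" if z: "z \<in> M #>\<^bsub>free_Abelian_group S\<^esub> y"
      using zsubD(2)[OF M _ xy, of "z - y"] z by (simp add: mem_coset)
  qed
qed

lemma some_coset: "(SOME y. y \<in> M #>\<^bsub>free_Abelian_group S\<^esub> x) - x \<in> M"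
  using someI[of "\<lambda>y. y \<in> M #>\<^bsub>free_Abelian_group S\<^esub> x", OF coset_self] by (simp add: mem_coset)

lemma mult_coset: "(M #>\<^bsub>free_Abelian_group S\<^esub> x) \<otimes>\<^bsub>free_Abelian_group S Mod M\<^esub> (M #>\<^bsub>free_Abelian_group S\<^esub> y) =
    M #>\<^bsub>free_Abelian_group S\<^esub> (x + y)"
proof (intro subset_antisym subsetI)
  fix z assume "z \<in> (M #>\<^bsub>free_Abelian_group S\<^esub> x) \<otimes>\<^bsub>free_Abelian_group S Mod M\<^esub> (M #>\<^bsub>free_Abelian_group S\<^esub> y)"
  then obtain a b where "a - x \<in> M" "b - y \<in> M" "z = a + b"
    by (auto simp: FactGroup_def set_mult_def mem_coset)
  then show "z \<in> M #>\<^bsub>free_Abelian_group S\<^esub> (x + y)"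
    using zsubD(4)[OF M, of "a - x" "b - y"] by (simp add: mem_coset algebra_simps)
next
  fix z assume z: "z \<in> M #>\<^bsub>free_Abelian_group S\<^esub> (x + y)"
  then have "z - y \<in> M #>\<^bsub>free_Abelian_group S\<^esub> x" by (simp add: mem_coset algebra_simps)
  then show "z \<in> (M #>\<^bsub>free_Abelian_group S\<^esub> x) \<otimes>\<^bsub>free_Abelian_group S Mod M\<^esub> (M #>\<^bsub>free_Abelian_group S\<^esub> y)"
    using coset_self[of y] unfolding FactGroup_def set_mult_def
    by simp (metis diff_add_cancel)
qed

lemma one_coset: "\<one>\<^bsub>free_Abelian_group S Mod M\<^esub> = M #>\<^bsub>free_Abelian_group S\<^esub> 0"
  by (auto simp: FactGroup_def mem_coset)

lemma carrier_coset: "carrier (free_Abelian_group S Mod M) = (\<lambda>x. M #>\<^bsub>free_Abelian_group S\<^esub> x) ` fcar S"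
  by (auto simp: FactGroup_def RCOSETS_def carrier_free)

lemma comm_group_coset: "M \<subseteq> fcar S \<Longrightarrow> comm_group (free_Abelian_group S Mod M)"
proof -
  assume sub: "M \<subseteq> fcar S"
  interpret F: comm_group "free_Abelian_group S" by (rule abelian_free_Abelian_group)
  have "subgroup M (free_Abelian_group S)"
    by (rule F.subgroupI) (use sub zsubD[OF M] in \<open>auto simp: carrier_free\<close>)
  then show ?thesis by (rule F.abelian_FactGroup)
qed

end

text \<open>An injective additive map into a type of abelian groups turns products over the carrier
  of \<open>H\<close> into sums.\<close>

locale realized = comm_group H for H :: "('b, 'c) monoid_scheme" (structure) +
  fixes \<theta> :: "'b \<Rightarrow> 'g::ab_group_add"
  assumes \<theta>_mult: "x \<in> carrier H \<Longrightarrow> y \<in> carrier H \<Longrightarrow> \<theta> (x \<otimes> y) = \<theta> x + \<theta> y"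
    and \<theta>_inj: "inj_on \<theta> (carrier H)"
begin

lemma \<theta>_one: "\<theta> \<one> = 0"
  using \<theta>_mult[of \<one> \<one>] by simp

lemma \<theta>_eq_0: "x \<in> carrier H \<Longrightarrow> \<theta> x = 0 \<longleftrightarrow> x = \<one>"
  using inj_onD[OF \<theta>_inj, of x \<one>] \<theta>_one by auto

lemma \<theta>_inv: "x \<in> carrier H \<Longrightarrow> \<theta> (inv x) = - \<theta> x"
  using \<theta>_mult[of x "inv x"] by (simp add: \<theta>_one eq_neg_iff_add_eq_0 add.commute)

lemma \<theta>_pow_nat: "x \<in> carrier H \<Longrightarrow> \<theta> (x [^] (n::nat)) = (\<Sum>i<n. \<theta> x)"
  by (induction n) (simp_all add: \<theta>_one \<theta>_mult lessThan_Suc add.commute)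

lemma \<theta>_pow: "x \<in> carrier H \<Longrightarrow> \<theta> (x [^] (n::int)) = zmul n (\<theta> x)"
proof (cases n rule: int_cases2)
  case (nonneg k)
  then show "x \<in> carrier H \<Longrightarrow> ?thesis" by (simp add: int_pow_int zmul_def \<theta>_pow_nat)
next
  case (nonpos k)
  then show "x \<in> carrier H \<Longrightarrow> ?thesis"
    by (cases "k = 0") (simp_all add: int_pow_neg_int zmul_def \<theta>_inv \<theta>_pow_nat \<theta>_one)
qed

lemma \<theta>_finprod: "finite A \<Longrightarrow> h \<in> A \<rightarrow> carrier H \<Longrightarrow> \<theta> (finprod H h A) = (\<Sum>a\<in>A. \<theta> (h a))"
  by (induction A rule: finite_induct) (simp_all add: \<theta>_one \<theta>_mult Pi_def)

lemma free_ext_closed: "(\<And>a. a \<in> Poly_Mapping.keys x \<Longrightarrow> g a \<in> carrier H) \<Longrightarrow> free_ext H g x \<in> carrier H"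
  unfolding free_ext_def by (auto intro!: finprod_closed)

lemma \<theta>_free_ext: "(\<And>a. a \<in> Poly_Mapping.keys x \<Longrightarrow> g a \<in> carrier H) \<Longrightarrow>
    \<theta> (free_ext H g x) = lin (\<lambda>a. \<theta> (g a)) x"
  unfolding free_ext_def lin_def by (subst \<theta>_finprod) (auto simp: \<theta>_pow)

text \<open>The extension is constant on a coset, which makes \<open>the_elem\<close> meaningful:
  after applying the injective map \<theta> this is an additive statement and follows from vanishing
  on \<open>M\<close>.\<close>

lemma coset_ext:
  assumes M: "zsub M" "M \<subseteq> fcar S" and g: "\<And>a. a \<in> S \<Longrightarrow> g a \<in> carrier H"
    and 0: "\<And>u. u \<in> M \<Longrightarrow> lin (\<lambda>a. \<theta> (g a)) u = 0" and x: "x \<in> fcar S"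
  shows "coset_ext H g (M #>\<^bsub>free_Abelian_group S\<^esub> x) \<in> carrier H"
    and "\<theta> (coset_ext H g (M #>\<^bsub>free_Abelian_group S\<^esub> x)) = lin (\<lambda>a. \<theta> (g a)) x"
proof -
  have fe: "free_ext H g y \<in> carrier H" "\<theta> (free_ext H g y) = lin (\<lambda>a. \<theta> (g a)) y"
    if "y \<in> fcar S" for y
    using that g free_ext_closed[of y g] \<theta>_free_ext[of y g] by blast+
  have "free_ext H g y = free_ext H g x" if y: "y \<in> M #>\<^bsub>free_Abelian_group S\<^esub> x" for y
  proof (rule inj_onD[OF \<theta>_inj])
    from y have yx: "y - x \<in> M" by (simp add: mem_coset)
    then have "y \<in> fcar S" using M(2) x zsubD(4)[OF zsub_fcar, of "y - x" S x] by auto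
    note y = fe[OF this] and x = fe[OF x]
    show "\<theta> (free_ext H g y) = \<theta> (free_ext H g x)"
      using 0[OF yx] unfolding x(2) y(2) by (simp add: lin_diff)
    show "free_ext H g y \<in> carrier H" "free_ext H g x \<in> carrier H" by (rule y x)+
  qed
  then have "free_ext H g ` (M #>\<^bsub>free_Abelian_group S\<^esub> x) = {free_ext H g x}"
    using coset_self[OF M(1), of x S] by blast
  then have "coset_ext H g (M #>\<^bsub>free_Abelian_group S\<^esub> x) = free_ext H g x"
    by (simp add: coset_ext_def)
  then show "coset_ext H g (M #>\<^bsub>free_Abelian_group S\<^esub> x) \<in> carrier H"
    and "\<theta> (coset_ext H g (M #>\<^bsub>free_Abelian_group S\<^esub> x)) = lin (\<lambda>a. \<theta> (g a)) x"
    using fe[OF x] by simp_all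
qed

lemma realized_subgroup:
  assumes "zsub Q" and C: "C = {x \<in> carrier H. \<theta> x \<in> Q}"
  shows "realized (H\<lparr>carrier := C\<rparr>) \<theta>"
proof -
  have "subgroup C H"
    by (rule subgroupI) (use zsubD[OF assms(1)] in \<open>auto simp: C \<theta>_one \<theta>_inv \<theta>_mult\<close>)
  then have "comm_group (H\<lparr>carrier := C\<rparr>)"
    by (intro group.group_comm_groupI subgroup.subgroup_is_group is_group) (auto simp: C m_comm)
  then show ?thesis
    unfolding realized_def realized_axioms_def
    using \<theta>_inj by (auto simp: \<theta>_mult C inj_on_def)
qed

end

definition coset_val :: "('a \<Rightarrow> 'g) \<Rightarrow> 'a set \<Rightarrow> 'g" where
  "coset_val f A = f (SOME x. x \<in> A)"

lemma coset_val:
  assumes "zsub M" "additive f" "\<And>u. u \<in> M \<Longrightarrow> f u = 0"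
  shows "coset_val f (M #>\<^bsub>free_Abelian_group S\<^esub> x) = f x"
  using assms(3)[OF some_coset[OF assms(1), of S x]]
  by (simp add: coset_val_def additive.diff[OF assms(2)])

text \<open>A quotient by the kernel of an additive map is realized by that map. Together with
  \<open>realized_subgroup\<close> this yields the realizations of the Lie groups, the tensor
  product and the target of \<eta>.\<close>

lemma realized_quotient:
  assumes M: "zsub M" and f: "additive f" and ker: "M = {u \<in> fcar S. f u = 0}"
  shows "realized (free_Abelian_group S Mod M) (coset_val f)"
proof -
  have val: "coset_val f (M #>\<^bsub>free_Abelian_group S\<^esub> x) = f x" for x
    using M f by (rule coset_val) (simp add: ker)
  interpret comm_group "free_Abelian_group S Mod M"
    by (rule comm_group_coset[OF M]) (auto simp: ker)
  show ?thesis
  proof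
    show "inj_on (coset_val f) (carrier (free_Abelian_group S Mod M))"
    proof (rule inj_onI)
      fix A B assume "A \<in> carrier (free_Abelian_group S Mod M)" "B \<in> carrier (free_Abelian_group S Mod M)"
        "coset_val f A = coset_val f B"
      then obtain x y where "x \<in> fcar S" "y \<in> fcar S" "f x = f y"
        "A = M #>\<^bsub>free_Abelian_group S\<^esub> x" "B = M #>\<^bsub>free_Abelian_group S\<^esub> y"
        by (auto simp: carrier_coset[OF M] val)
      moreover from this have "x - y \<in> M"
        using zsubD(2)[OF zsub_fcar, of x S y] by (simp add: ker additive.diff[OF f])
      ultimately show "A = B" by (simp add: coset_eq_iff[OF M])
    qed
  qed (auto simp: carrier_coset[OF M] mult_coset[OF M] val additive.add[OF f] simp del: mult_FactGroup)
qed

section \<open>The free Lie ring\<close>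

lemma labels_mlabels: "labels I = set_mset (mlabels I)"
  by (induction I) auto

lemma order_mlabels: "order_rt I = size (mlabels I) - 1"
  by (simp add: size_mlabels)

lemma mlabels_rtrees: "mlabels I = mlabels J \<Longrightarrow> I \<in> rtrees m \<longleftrightarrow> J \<in> rtrees m"
  by (simp add: rtrees_def labels_mlabels)

lemma Br_rtrees [simp]: "Br I J \<in> rtrees m \<longleftrightarrow> I \<in> rtrees m \<and> J \<in> rtrees m"
  by (simp add: rtrees_def)

lemma zsub_lie_ideal: "zsub (lie_ideal m)"
  by (simp add: zsub_def lie_ideal.zero lie_ideal.diff)

lemma fcar_br:
  assumes "u \<in> fcar (rtrees m)" "v \<in> fcar (rtrees m)"
  shows "br u v \<in> fcar (rtrees m)"
proof -
  have "\<exists>I J. K = Br I J \<and> I \<in> rtrees m \<and> J \<in> rtrees m" if "K \<in> Poly_Mapping.keys (br u v)" for K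
    by (rule keys_br[OF _ _ that]) (use assms in auto)
  then show ?thesis by fastforce
qed

lemma frag_of_fcar [simp]: "frag_of a \<in> fcar S \<longleftrightarrow> a \<in> S"
  by auto

lemma lie_ideal_flip1: "flip1 I I' \<Longrightarrow> I \<in> rtrees m \<Longrightarrow> frag_of I + frag_of I' \<in> lie_ideal m"
proof (induction rule: flip1.induct)
  case (flip1_root I J)
  let ?a = "frag_of I" and ?b = "frag_of J"
  have c: "?a \<in> carrier (free_alg m)" "?b \<in> carrier (free_alg m)" "?a + ?b \<in> carrier (free_alg m)"
    using flip1_root zsubD(4)[OF zsub_fcar, of ?a "rtrees m" ?b] unfolding carrier_free by auto
  have "br (?a + ?b) (?a + ?b) - br ?a ?a - br ?b ?b \<in> lie_ideal m"
    by (intro lie_ideal.diff lie_ideal.alternating c)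
  then show ?case by (simp add: br_simps algebra_simps)
next
  case (flip1_left I I' J)
  have "br (frag_of I + frag_of I') (frag_of J) \<in> lie_ideal m"
    using flip1_left by (intro lie_ideal.right) (auto simp: carrier_free)
  then show ?case by (simp add: br_simps)
next
  case (flip1_right J J' I)
  have "br (frag_of I) (frag_of J + frag_of J') \<in> lie_ideal m"
    using flip1_right by (intro lie_ideal.left) (auto simp: carrier_free)
  then show ?case by (simp add: br_simps)
qed

lemma lie_ideal_ihx: "ihx_rooted I H Z \<Longrightarrow> I \<in> rtrees m \<Longrightarrow> frag_of I - frag_of H + frag_of Z \<in> lie_ideal m"
proof (induction rule: ihx_rooted.induct)
  case (1 A B C)
  let ?a = "frag_of A" and ?b = "frag_of B" and ?c = "frag_of C"
  have "br ?a (br ?b ?c) + br ?b (br ?c ?a) + br ?c (br ?a ?b) \<in> lie_ideal m"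
    using 1 by (intro lie_ideal.jacobi) (auto simp: carrier_free)
  moreover have "frag_of (Br (Br A B) C) + frag_of (Br C (Br A B)) \<in> lie_ideal m"
    "frag_of (Br B (Br A C)) + frag_of (Br B (Br C A)) \<in> lie_ideal m"
    using 1 by (auto intro!: lie_ideal_flip1 flip1.intros)
  ultimately have "(frag_of (Br (Br A B) C) + frag_of (Br C (Br A B))) +
      (frag_of (Br B (Br A C)) + frag_of (Br B (Br C A))) -
      (br ?a (br ?b ?c) + br ?b (br ?c ?a) + br ?c (br ?a ?b)) \<in> lie_ideal m"
    by (meson zsubD(2,4)[OF zsub_lie_ideal])
  then show ?case by (simp add: algebra_simps)
next
  case (2 I H Z K)
  have "br (frag_of I - frag_of H + frag_of Z) (frag_of K) \<in> lie_ideal m"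
    using 2 by (intro lie_ideal.right) (auto simp: carrier_free)
  then show ?case by (simp add: br_simps)
next
  case (3 I H Z K)
  have "br (frag_of K) (frag_of I - frag_of H + frag_of Z) \<in> lie_ideal m"
    using 3 by (intro lie_ideal.left) (auto simp: carrier_free)
  then show ?case by (simp add: br_simps)
qed

lemma lie_ideal_sqr: "sqr I \<Longrightarrow> I \<in> rtrees m \<Longrightarrow> frag_of I \<in> lie_ideal m"
proof (induction rule: sqr.induct)
  case (sqr_root I)
  have "br (frag_of I) (frag_of I) \<in> lie_ideal m"
    using sqr_root by (intro lie_ideal.alternating) (auto simp: carrier_free)
  then show ?case by simp
next
  case (sqr_left I J)
  have "br (frag_of I) (frag_of J) \<in> lie_ideal m"
    using sqr_left by (intro lie_ideal.right) (auto simp: carrier_free)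
  then show ?case by simp
next
  case (sqr_right J I)
  have "br (frag_of I) (frag_of J) \<in> lie_ideal m"
    using sqr_right by (intro lie_ideal.left) (auto simp: carrier_free)
  then show ?case by simp
qed

text \<open>Commutators satisfy the Lie axioms, which is one inclusion; the other comes from
  \<open>liesum_eq_0\<close>. Relations found there may carry any labels, and \<open>res\<close>
  discards those outside \<open>{1..m}\<close>. Being homogeneous, each relation is kept or dropped
  as a whole.\<close>

lemma lie_ideal_eq: "lie_ideal m = {u \<in> fcar (rtrees m). liesum u = 0}"
proof (intro subset_antisym subsetI)
  fix u assume "u \<in> lie_ideal m"
  then have "u \<in> fcar (rtrees m) \<and> liesum u = 0"
  proof induction
    case (diff x y)
    then show ?case using zsubD(2)[OF zsub_fcar, of x "rtrees m" y] by (auto simp: lin_diff)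
  next
    case (left x y)
    then show ?case using fcar_br[of x m y] by (auto simp: carrier_free liesum_br)
  next
    case (right x y)
    then show ?case using fcar_br[of x m y] by (auto simp: carrier_free liesum_br)
  next
    case (alternating x)
    then show ?case using fcar_br[of x m x] by (auto simp: carrier_free liesum_br)
  next
    case (jacobi x y z)
    have "br x (br y z) + br y (br z x) + br z (br x y) \<in> fcar (rtrees m)"
      using jacobi unfolding carrier_free by (intro zsubD(4)[OF zsub_fcar] fcar_br)
    then show ?case by (auto simp: liesum_br lin_add comm_def algebra_simps)
  qed auto
  then show "u \<in> {u \<in> fcar (rtrees m). liesum u = 0}" by simp
next
  fix u assume u: "u \<in> {u \<in> fcar (rtrees m). liesum u = 0}"
  define res where "res = lin (\<lambda>I. if I \<in> rtrees m then frag_of I else 0)"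
  have res: "additive res" "\<And>I. res (frag_of I) = (if I \<in> rtrees m then frag_of I else 0)"
    by (simp_all add: res_def additive_lin)
  have "res s \<in> zspan (lie_ideal m)" if "s \<in> lie_rels" for s
  proof -
    note res_simps = additive.add[OF res(1)] additive.diff[OF res(1)] res(2)
    from that consider (flip) I I' where "flip1 I I'" "s = frag_of I + frag_of I'"
      | (ihx) I H Z where "ihx_rooted I H Z" "s = frag_of I - frag_of H + frag_of Z"
      | (sqr) I where "sqr I" "s = frag_of I"
      by (auto simp: lie_rels_def as_ihx_def)
    then have "res s \<in> lie_ideal m"
    proof cases
      case flip
      then show ?thesis
        using mlabels_rtrees[OF flip1_labels[OF flip(1)], of m] lie_ideal_flip1[OF flip(1), of m]
        by (auto simp: res_simps lie_ideal.zero)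
    next
      case ihx
      then show ?thesis
        using ihx_labels[OF ihx(1)] mlabels_rtrees[of H I m] mlabels_rtrees[of Z I m]
          lie_ideal_ihx[OF ihx(1), of m]
        by (auto simp: res_simps lie_ideal.zero)
    next
      case sqr
      then show ?thesis using lie_ideal_sqr[OF sqr(1), of m] by (auto simp: res_simps lie_ideal.zero)
    qed
    then show ?thesis by (rule zspan_base)
  qed
  then have "res u \<in> zspan (lie_ideal m)"
    using u by (intro zspan_image[OF liesum_eq_0[of u] res(1)]) auto
  moreover have "res u = u"
    by (rule additive_eq_keys[of res "\<lambda>u. u"]) (use u res in \<open>auto intro: additiveI\<close>)
  ultimately show "u \<in> lie_ideal m"
    using zspan_subset[OF zsub_lie_ideal, of "lie_ideal m" m] by auto
qed

abbreviation deg_trees :: "nat \<Rightarrow> nat \<Rightarrow> rtree set" where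
  "deg_trees m n \<equiv> {J \<in> rtrees m. order_rt J + 1 = n}"

abbreviation lie_val :: "treesum set \<Rightarrow> ncpoly" where
  "lie_val \<equiv> coset_val liesum"

lemma lie_val_class [simp]: "lie_val (lie_class m x) = liesum x"
  unfolding lie_class_def by (rule coset_val[OF zsub_lie_ideal]) (auto simp: lie_ideal_eq additive_lin)

lemma lie_class_eq_iff: "lie_class m x = lie_class m y \<longleftrightarrow> x - y \<in> lie_ideal m"
  unfolding lie_class_def by (rule coset_eq_iff[OF zsub_lie_ideal])

lemma carrier_L_deg: "carrier (L_deg m n) = lie_class m ` fcar (deg_trees m n)"
  by (simp add: L_deg_def carrier_free)

lemma mult_L_deg: "lie_class m x \<otimes>\<^bsub>L_deg m n\<^esub> lie_class m y = lie_class m (x + y)"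
  using mult_coset[OF zsub_lie_ideal, of "rtrees m" m x y]
  by (simp add: L_deg_def free_lie_def lie_class_def)

lemma one_L_deg: "\<one>\<^bsub>L_deg m n\<^esub> = lie_class m 0"
  using one_coset[OF zsub_lie_ideal, of "rtrees m" m]
  by (simp add: L_deg_def free_lie_def lie_class_def)

lemma zsub_image: "zsub Q \<Longrightarrow> additive f \<Longrightarrow> zsub (f ` Q)"
  by (auto simp: zsub_def additive.diff[symmetric] intro!: image_eqI[of 0 f 0] dest: additive.zero)

lemma realized_L_deg: "realized (L_deg m n) lie_val"
proof -
  have free: "realized (free_lie m) lie_val"
    unfolding free_lie_def by (rule realized_quotient[OF zsub_lie_ideal additive_lin lie_ideal_eq])
  have car: "carrier (free_lie m) = lie_class m ` fcar (rtrees m)"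
    by (simp add: free_lie_def carrier_coset[OF zsub_lie_ideal] lie_class_def)
  have "lie_class m ` fcar (deg_trees m n) =
    {x \<in> carrier (free_lie m). lie_val x \<in> liesum ` fcar (deg_trees m n)}"
  proof (intro subset_antisym subsetI)
    fix x assume "x \<in> {x \<in> carrier (free_lie m). lie_val x \<in> liesum ` fcar (deg_trees m n)}"
    then obtain u v where u: "u \<in> fcar (rtrees m)" "x = lie_class m u"
      and v: "v \<in> fcar (deg_trees m n)" "liesum u = liesum v"
      by (auto simp: car)
    then have "u - v \<in> lie_ideal m"
      using zsubD(2)[OF zsub_fcar, of u "rtrees m" v] by (auto simp: lie_ideal_eq lin_diff)
    then have "x = lie_class m v" using u by (simp add: lie_class_eq_iff)
    then show "x \<in> lie_class m ` fcar (deg_trees m n)" using v by blast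
  qed (auto simp: car)
  then show ?thesis
    unfolding L_deg_def carrier_free
    by (rule realized.realized_subgroup[OF free zsub_image[OF zsub_fcar additive_lin]])
qed

lemma lie_bracket_class:
  assumes "x \<in> fcar (rtrees m)" "y \<in> fcar (rtrees m)"
  shows "lie_bracket m (lie_class m x) (lie_class m y) = lie_class m (br x y)"
proof -
  have "lie_class m (br x' y') = lie_class m (br x y)"
    if x': "x' \<in> lie_class m x" and y': "y' \<in> lie_class m y" for x' y'
  proof -
    from x' y' have d: "x' - x \<in> lie_ideal m" "y' - y \<in> lie_ideal m"
      by (simp_all add: lie_class_def mem_coset)
    then have y'c: "y' \<in> fcar (rtrees m)"
      using zsubD(4)[OF zsub_fcar, of "y' - y" "rtrees m" y] assms by (auto simp: lie_ideal_eq)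
    have "br (x' - x) y' + br x (y' - y) \<in> lie_ideal m"
      using d y'c assms by (intro zsubD(4)[OF zsub_lie_ideal] lie_ideal.left lie_ideal.right) (auto simp: carrier_free)
    then show ?thesis by (simp add: lie_class_eq_iff br_simps)
  qed
  moreover have "x \<in> lie_class m x" "y \<in> lie_class m y"
    unfolding lie_class_def by (rule coset_self[OF zsub_lie_ideal])+
  ultimately show ?thesis unfolding lie_bracket_def by blast
qed

section \<open>Tensor products\<close>

lemma fcar_induct [consumes 1, case_names zero one diff]:
  assumes "u \<in> fcar T" "P 0" "\<And>a. a \<in> T \<Longrightarrow> P (frag_of a)"
    "\<And>u v. u \<in> fcar T \<Longrightarrow> v \<in> fcar T \<Longrightarrow> P u \<Longrightarrow> P v \<Longrightarrow> P (u - v)"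
  shows "P u"
proof -
  have "u \<in> fcar T \<and> P u"
    using assms(1) unfolding mem_Collect_eq
    by (rule frag_induction)
      (use assms(2-4) zsubD(2)[OF zsub_fcar, of _ T] in auto)
  then show ?thesis by simp
qed

locale tensor_pair = A: comm_group A + B: comm_group B
  for A :: "('a, 'c) monoid_scheme" and B :: "('b, 'd) monoid_scheme"
begin

abbreviation "R \<equiv> tensor_rels A B"

abbreviation "S \<equiv> carrier A \<times> carrier B"

definition "relsA = {frag_of (a \<otimes>\<^bsub>A\<^esub> a', b) - frag_of (a, b) - frag_of (a', b) | a a' b.
         a \<in> carrier A \<and> a' \<in> carrier A \<and> b \<in> carrier B}"

definition "relsB = {frag_of (a, b \<otimes>\<^bsub>B\<^esub> b') - frag_of (a, b) - frag_of (a, b') | a b b'.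
         a \<in> carrier A \<and> b \<in> carrier B \<and> b' \<in> carrier B}"

lemma rels_fcar: "relsA \<union> relsB \<subseteq> fcar S"
proof
  fix s assume "s \<in> relsA \<union> relsB"
  then obtain x y z where "s = frag_of x - frag_of y - frag_of z" "{x, y, z} \<subseteq> S"
    unfolding relsA_def relsB_def by auto
  then show "s \<in> fcar S"
    using zsubD(2)[OF zsub_fcar, of _ S] by auto
qed

lemma R_zspan: "R = zspan (relsA \<union> relsB)"
  using generate_zspan[OF rels_fcar] by (simp add: tensor_rels_def relsA_def relsB_def)

lemma zsub_R: "zsub R"
  unfolding R_zspan by (rule zsub_zspan)

lemma R_fcar: "R \<subseteq> fcar S"
  unfolding R_zspan by (rule zspan_subset[OF zsub_fcar rels_fcar])

lemma R_left: "a \<in> carrier A \<Longrightarrow> a' \<in> carrier A \<Longrightarrow> b \<in> carrier B \<Longrightarrow>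
    frag_of (a \<otimes>\<^bsub>A\<^esub> a', b) - frag_of (a, b) - frag_of (a', b) \<in> R"
  unfolding R_zspan by (rule zspan_base) (auto simp: relsA_def)

lemma R_right: "a \<in> carrier A \<Longrightarrow> b \<in> carrier B \<Longrightarrow> b' \<in> carrier B \<Longrightarrow>
    frag_of (a, b \<otimes>\<^bsub>B\<^esub> b') - frag_of (a, b) - frag_of (a, b') \<in> R"
  unfolding R_zspan by (rule zspan_base) (auto simp: relsB_def)

lemma R_one_left: "b \<in> carrier B \<Longrightarrow> frag_of (\<one>\<^bsub>A\<^esub>, b) \<in> R"
  using zsubD(3)[OF zsub_R R_left[of "\<one>\<^bsub>A\<^esub>" "\<one>\<^bsub>A\<^esub>" b]] by simp

lemma R_one_right: "a \<in> carrier A \<Longrightarrow> frag_of (a, \<one>\<^bsub>B\<^esub>) \<in> R"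
  using zsubD(3)[OF zsub_R R_right[of a "\<one>\<^bsub>B\<^esub>" "\<one>\<^bsub>B\<^esub>"]] by simp

lemma R_diff_right:
  assumes "a \<in> carrier A" "b \<in> carrier B" "b' \<in> carrier B"
  shows "frag_of (a, b) - frag_of (a, b') - frag_of (a, b \<otimes>\<^bsub>B\<^esub> inv\<^bsub>B\<^esub> b') \<in> R"
proof -
  have "(b \<otimes>\<^bsub>B\<^esub> inv\<^bsub>B\<^esub> b') \<otimes>\<^bsub>B\<^esub> b' = b"
    using assms by (simp add: B.m_assoc)
  then show ?thesis
    using R_right[of a "b \<otimes>\<^bsub>B\<^esub> inv\<^bsub>B\<^esub> b'" b'] assms by (simp add: algebra_simps)
qed

lemma carrier_tensor: "carrier (tensor A B) = (\<lambda>x. R #>\<^bsub>free_Abelian_group S\<^esub> x) ` fcar S"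
  unfolding tensor_def by (rule carrier_coset[OF zsub_R])

text \<open>It is enough to normalize pure tensors, because the coefficients of a difference can be
  taken family member by family member. The family consists of the letters in one application, of
  the single element 1 in the other.\<close>

lemma normal_form:
  assumes E: "finite E" "x ` E \<subseteq> carrier A"
    and gen: "\<And>a b. a \<in> carrier A \<Longrightarrow> b \<in> carrier B \<Longrightarrow>
      \<exists>Y \<in> E \<rightarrow> carrier B. frag_of (a, b) - (\<Sum>e\<in>E. frag_of (x e, Y e)) \<in> R"
    and u: "u \<in> fcar S"
  shows "\<exists>Y \<in> E \<rightarrow> carrier B. u - (\<Sum>e\<in>E. frag_of (x e, Y e)) \<in> R"
  using u
proof (induction rule: fcar_induct)
  case zero
  have "- (\<Sum>e\<in>E. frag_of (x e, \<one>\<^bsub>B\<^esub>)) \<in> R"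
    using E(2) unfolding R_zspan
    by (intro zspan_uminus zspan_sum) (auto simp: R_zspan[symmetric] intro: R_one_right)
  then show ?case by (intro bexI[of _ "\<lambda>_. \<one>\<^bsub>B\<^esub>"]) auto
next
  case (one a)
  then show ?case using gen by (cases a) auto
next
  case (diff u v)
  then obtain Y Z where Y: "Y \<in> E \<rightarrow> carrier B" "u - (\<Sum>e\<in>E. frag_of (x e, Y e)) \<in> R"
    and Z: "Z \<in> E \<rightarrow> carrier B" "v - (\<Sum>e\<in>E. frag_of (x e, Z e)) \<in> R" by blast
  have "(\<Sum>e\<in>E. frag_of (x e, Y e) - frag_of (x e, Z e) - frag_of (x e, Y e \<otimes>\<^bsub>B\<^esub> inv\<^bsub>B\<^esub> Z e)) \<in> R"
    using E(2) Y Z unfolding R_zspan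
    by (intro zspan_sum) (auto simp: R_zspan[symmetric] Pi_def intro!: R_diff_right)
  from zsubD(4)[OF zsub_R zsubD(2)[OF zsub_R Y(2) Z(2)] this]
  have "u - v - (\<Sum>e\<in>E. frag_of (x e, Y e \<otimes>\<^bsub>B\<^esub> inv\<^bsub>B\<^esub> Z e)) \<in> R"
    by (simp add: sum_subtractf sum.distrib algebra_simps)
  then show ?case using Y Z by (intro bexI[of _ "\<lambda>e. Y e \<otimes>\<^bsub>B\<^esub> inv\<^bsub>B\<^esub> Z e"]) auto
qed

end

lemma deg_trees_1: "deg_trees m 1 = Leaf ` {1..m}"
proof (intro subset_antisym subsetI)
  fix I assume "I \<in> deg_trees m 1"
  then show "I \<in> Leaf ` {1..m}" by (cases I) (auto simp: rtrees_def)
qed (auto simp: rtrees_def)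

lemma lead_letter_unique:
  assumes "finite E" "(\<Sum>a\<in>E. X a * f a) = 0" "a \<in> E"
  shows "f a = 0"
proof -
  have "ldiv a (\<Sum>a\<in>E. X a * f a) = (\<Sum>b\<in>E. ldiv a (X b * f b))"
    using assms(1) by (induction E rule: finite_induct) (simp_all add: ldiv_def lin_add)
  also have "\<dots> = f a"
    using assms(1,3) by (simp add: ldiv_X)
  finally show ?thesis by (simp add: assms(2) ldiv_def)
qed

context
  fixes m n :: nat
begin

interpretation A: realized "L_deg m 1" lie_val by (rule realized_L_deg)
interpretation B: realized "L_deg m n" lie_val by (rule realized_L_deg)
interpretation tensor_pair "L_deg m 1" "L_deg m n" ..

abbreviation "pair_val \<equiv> lin (\<lambda>(U, V). lie_val U * lie_val V)"

lemma letter_normal_form: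
  assumes "U \<in> carrier (L_deg m 1)" "V \<in> carrier (L_deg m n)"
  shows "\<exists>Y \<in> {1..m} \<rightarrow> carrier (L_deg m n).
    frag_of (U, V) - (\<Sum>a\<in>{1..m}. frag_of (lie_class m (frag_of (Leaf a)), Y a)) \<in> R"
proof -
  let ?x = "\<lambda>a. lie_class m (frag_of (Leaf a))"
  have xA: "?x a \<in> carrier (L_deg m 1)" if "a \<in> {1..m}" for a
    using that by (auto simp: carrier_L_deg rtrees_def)
  obtain u where u: "u \<in> fcar (deg_trees m 1)" "U = lie_class m u"
    using assms(1) by (auto simp: carrier_L_deg)
  have "\<exists>Y \<in> {1..m} \<rightarrow> carrier (L_deg m n).
    frag_of (lie_class m u, V) - (\<Sum>a\<in>{1..m}. frag_of (?x a, Y a)) \<in> R"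
    using u(1)
  proof (induction rule: fcar_induct)
    case zero
    have "frag_of (lie_class m 0, V) - (\<Sum>a\<in>{1..m}. frag_of (?x a, \<one>\<^bsub>L_deg m n\<^esub>)) \<in> R"
      using R_one_left[OF assms(2)] xA unfolding one_L_deg[where m = m and n = 1, symmetric]
      by (intro zsubD(2)[OF zsub_R] zspan_sum[where S = "relsA \<union> relsB", folded R_zspan] R_one_right) auto
    then show ?case by (intro bexI[of _ "\<lambda>_. \<one>\<^bsub>L_deg m n\<^esub>"]) auto
  next
    case (one I)
    then obtain c where c: "c \<in> {1..m}" "I = Leaf c" unfolding deg_trees_1 by blast
    let ?Y = "\<lambda>a. if a = c then V else \<one>\<^bsub>L_deg m n\<^esub>"
    have "(\<Sum>a\<in>{1..m}. frag_of (?x a, ?Y a)) =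
      frag_of (?x c, V) + (\<Sum>a\<in>{1..m} - {c}. frag_of (?x a, \<one>\<^bsub>L_deg m n\<^esub>))"
      using c by (subst sum.remove[of _ c]) (auto intro!: arg_cong2[of _ _ _ _ "(+)"] sum.cong)
    moreover have "- (\<Sum>a\<in>{1..m} - {c}. frag_of (?x a, \<one>\<^bsub>L_deg m n\<^esub>)) \<in> R"
      using xA by (intro zsubD(3)[OF zsub_R] zspan_sum[where S = "relsA \<union> relsB", folded R_zspan] R_one_right) auto
    ultimately have "frag_of (lie_class m (frag_of I), V) - (\<Sum>a\<in>{1..m}. frag_of (?x a, ?Y a)) \<in> R"
      using c by simp
    then show ?case using assms(2) by (intro bexI[of _ ?Y]) auto
  next
    case (diff u v)
    then obtain Y Z where Y: "Y \<in> {1..m} \<rightarrow> carrier (L_deg m n)"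
        "frag_of (lie_class m u, V) - (\<Sum>a\<in>{1..m}. frag_of (?x a, Y a)) \<in> R"
      and Z: "Z \<in> {1..m} \<rightarrow> carrier (L_deg m n)"
        "frag_of (lie_class m v, V) - (\<Sum>a\<in>{1..m}. frag_of (?x a, Z a)) \<in> R" by blast
    let ?W = "\<lambda>a. Y a \<otimes>\<^bsub>L_deg m n\<^esub> inv\<^bsub>L_deg m n\<^esub> Z a"
    have "(\<Sum>a\<in>{1..m}. frag_of (?x a, Y a) - frag_of (?x a, Z a) - frag_of (?x a, ?W a)) \<in> R"
      using xA Y Z by (intro zspan_sum[where S = "relsA \<union> relsB", folded R_zspan] R_diff_right) auto
    moreover have "frag_of (lie_class m (u - v + v), V) - frag_of (lie_class m (u - v), V) - frag_of (lie_class m v, V) \<in> R"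
      unfolding mult_L_deg[where m = m and n = 1 and x = "u - v" and y = v, symmetric]
      using diff(1,2) zsubD(2)[OF zsub_fcar, of u "deg_trees m 1" v] assms(2)
      by (intro R_left) (auto simp: carrier_L_deg)
    ultimately have "(frag_of (lie_class m u, V) - (\<Sum>a\<in>{1..m}. frag_of (?x a, Y a))) -
        (frag_of (lie_class m v, V) - (\<Sum>a\<in>{1..m}. frag_of (?x a, Z a))) +
        (\<Sum>a\<in>{1..m}. frag_of (?x a, Y a) - frag_of (?x a, Z a) - frag_of (?x a, ?W a)) -
        (frag_of (lie_class m (u - v + v), V) - frag_of (lie_class m (u - v), V) - frag_of (lie_class m v, V)) \<in> R"
      using Y(2) Z(2) by (meson zsubD(2,4)[OF zsub_R])
    then have "frag_of (lie_class m (u - v), V) - (\<Sum>a\<in>{1..m}. frag_of (?x a, ?W a)) \<in> R"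
      by (simp add: sum_subtractf sum.distrib algebra_simps)
    then show ?case using Y Z by (intro bexI[of _ ?W]) auto
  qed
  then show ?thesis using u(2) by simp
qed

lemma pair_val_R:
  assumes "u \<in> R"
  shows "pair_val u = 0"
proof -
  have "pair_val s = 0" if "s \<in> relsA \<union> relsB" for s
    using that unfolding relsA_def relsB_def
    by (auto simp: lin_diff A.\<theta>_mult B.\<theta>_mult distrib_left distrib_right simp del: One_nat_def)
  then show ?thesis
    by (rule zspan_zero_image[OF assms[unfolded R_zspan] additive_lin])
qed

text \<open>Elements of degree one are combinations of letters, so a tensor is normalized to one Lie
  element per letter. Products with different leading letters are independent in the associative
  ring, hence a zero value forces all these Lie elements to vanish.\<close>

lemma tensor_rels_eq: "tensor_rels (L_deg m 1) (L_deg m n) =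
    {u \<in> fcar (carrier (L_deg m 1) \<times> carrier (L_deg m n)). pair_val u = 0}"
proof (intro subset_antisym subsetI)
  fix u assume u: "u \<in> R"
  then show "u \<in> {u \<in> fcar S. pair_val u = 0}" using R_fcar pair_val_R by blast
next
  fix u assume u: "u \<in> {u \<in> fcar S. pair_val u = 0}"
  let ?x = "\<lambda>a. lie_class m (frag_of (Leaf a))"
  have xA: "?x a \<in> carrier (L_deg m 1)" if "a \<in> {1..m}" for a
    using that by (auto simp: carrier_L_deg rtrees_def)
  have "\<exists>Y \<in> {1..m} \<rightarrow> carrier (L_deg m n). u - (\<Sum>a\<in>{1..m}. frag_of (?x a, Y a)) \<in> R"
    by (rule normal_form) (use letter_normal_form u xA in blast)+
  then obtain Y where Y: "Y \<in> {1..m} \<rightarrow> carrier (L_deg m n)" "u - (\<Sum>a\<in>{1..m}. frag_of (?x a, Y a)) \<in> R"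
    by blast
  have "pair_val (u - (\<Sum>a\<in>{1..m}. frag_of (?x a, Y a))) = 0"
    by (rule pair_val_R[OF Y(2)])
  then have "(\<Sum>a\<in>{1..m}. X a * lie_val (Y a)) = 0"
    using u by (simp add: lin_diff lin_sum)
  then have "lie_val (Y a) = 0" if "a \<in> {1..m}" for a
    using lead_letter_unique[of "{1..m}" "\<lambda>a. lie_val (Y a)" a] that by simp
  then have "frag_of (?x a, Y a) \<in> R" if "a \<in> {1..m}" for a
    using that Y(1) xA[of a] B.\<theta>_eq_0[of "Y a"] R_one_right[of "?x a"] by (simp add: Pi_def del: One_nat_def)
  then have "(\<Sum>a\<in>{1..m}. frag_of (?x a, Y a)) \<in> R"
    by (intro zspan_sum[where S = "relsA \<union> relsB", folded R_zspan]) auto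
  from zsubD(4)[OF zsub_R Y(2) this] show "u \<in> R" by simp
qed

lemma realized_tensor: "realized (tensor (L_deg m 1) (L_deg m n)) (coset_val pair_val)"
  unfolding tensor_def
  by (rule realized_quotient[OF zsub_R additive_lin tensor_rels_eq])

end

section \<open>The target of \<open>\<eta>\<close>\<close>

abbreviation "tens m n \<equiv> tensor (L_deg m 1) (L_deg m n)"

abbreviation "tval \<equiv> coset_val pair_val"

context
  fixes m n :: nat
begin

interpretation A: realized "L_deg m 1" lie_val by (rule realized_L_deg)
interpretation B: realized "L_deg m n" lie_val by (rule realized_L_deg)
interpretation tensor_pair "L_deg m 1" "L_deg m n" ..

lemma tval_class: "tval (R #>\<^bsub>free_Abelian_group S\<^esub> x) = pair_val x"
  by (rule coset_val[OF zsub_R additive_lin pair_val_R])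

lemma pure_tensor_letter:
  assumes "l \<in> {1..m}" "J \<in> deg_trees m n"
  shows "pure_tensor (L_deg m 1) (L_deg m n) (lie_class m (frag_of (Leaf l))) (lie_class m (frag_of J)) \<in> carrier (tens m n)"
    (is "?P \<in> _")
    and "tval (pure_tensor (L_deg m 1) (L_deg m n) (lie_class m (frag_of (Leaf l))) (lie_class m (frag_of J))) = X l * lie J"
proof -
  have "frag_of (lie_class m (frag_of (Leaf l)), lie_class m (frag_of J)) \<in> fcar S"
    unfolding frag_of_fcar carrier_L_deg using assms by (auto simp: rtrees_def)
  then show "?P \<in> carrier (tens m n)"
    unfolding pure_tensor_def carrier_tensor by blast
  show "tval ?P = X l * lie J"
    unfolding pure_tensor_def tval_class by simp
qed

lemma rot_letters: "x \<in> fcar (deg_trees m 1) \<Longrightarrow> rot (liesum x * c) = c * liesum x"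
proof (induction rule: fcar_induct)
  case (one I)
  then obtain a where "I = Leaf a" unfolding deg_trees_1 by blast
  then show ?case by simp
next
  case (diff u v)
  then show ?case by (simp add: lin_diff left_diff_distrib right_diff_distrib additive.diff[OF additive_rot])
qed (simp add: additive.zero[OF additive_rot])

lemma lie_bracket_letter:
  assumes "U \<in> carrier (L_deg m 1)" "V \<in> carrier (L_deg m n)"
  shows "lie_bracket m U V \<in> carrier (L_deg m (n + 1))"
    and "lie_val (lie_bracket m U V) = lie_val U * lie_val V - rot (lie_val U * lie_val V)"
proof -
  obtain u v where u: "u \<in> fcar (deg_trees m 1)" "U = lie_class m u"
    and v: "v \<in> fcar (deg_trees m n)" "V = lie_class m v"
    using assms by (auto simp: carrier_L_deg simp del: One_nat_def)
  then have eq: "lie_bracket m U V = lie_class m (br u v)"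
    by (simp only: u v) (rule lie_bracket_class; use u(1) v(1) in blast)
  have "K \<in> deg_trees m (n + 1)" if "K \<in> Poly_Mapping.keys (br u v)" for K
  proof -
    have "\<exists>I J. K = Br I J \<and> I \<in> deg_trees m 1 \<and> J \<in> deg_trees m n"
      by (rule keys_br[OF _ _ that]) (use u v in blast)+
    then show ?thesis by auto
  qed
  then show "lie_bracket m U V \<in> carrier (L_deg m (n + 1))"
    unfolding eq carrier_L_deg by blast
  show "lie_val (lie_bracket m U V) = lie_val U * lie_val V - rot (lie_val U * lie_val V)"
    using rot_letters[OF u(1)] by (simp only: eq) (simp add: u(2) v(2) liesum_br comm_def)
qed

lemma bracket_map:
  assumes "W \<in> carrier (tens m n)"
  shows "coset_ext (L_deg m (n + 1)) (\<lambda>(U, V). lie_bracket m U V) W \<in> carrier (L_deg m (n + 1))"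
    and "lie_val (coset_ext (L_deg m (n + 1)) (\<lambda>(U, V). lie_bracket m U V) W) = tval W - rot (tval W)"
proof -
  interpret L: realized "L_deg m (n + 1)" lie_val by (rule realized_L_deg)
  let ?g = "\<lambda>(U, V). lie_bracket m U V"
  obtain x where x: "x \<in> fcar S" "W = R #>\<^bsub>free_Abelian_group S\<^esub> x"
    using assms unfolding carrier_tensor by blast
  have val: "lin (\<lambda>p. lie_val (?g p)) y = pair_val y - rot (pair_val y)" if "y \<in> fcar S" for y
  proof -
    have "lin (\<lambda>p. lie_val (?g p)) y = (\<lambda>y. pair_val y - rot (pair_val y)) y"
    proof (rule additive_eq_keys[OF additive_lin])
      show "additive (\<lambda>y. pair_val y - rot (pair_val y))"
        by (rule additiveI) (simp add: lin_add additive.add[OF additive_rot])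
      fix p assume "p \<in> Poly_Mapping.keys y"
      then have "p \<in> S" using that by blast
      then show "lin (\<lambda>p. lie_val (?g p)) (frag_of p) = pair_val (frag_of p) - rot (pair_val (frag_of p))"
        using lie_bracket_letter(2) by auto
    qed
    then show ?thesis .
  qed
  have g: "?g p \<in> carrier (L_deg m (n + 1))" if "p \<in> S" for p
    using that lie_bracket_letter(1) by auto
  have 0: "lin (\<lambda>p. lie_val (?g p)) y = 0" if "y \<in> R" for y
    using val[of y] pair_val_R[OF that] that R_fcar additive.zero[OF additive_rot] by auto
  show "coset_ext (L_deg m (n + 1)) ?g W \<in> carrier (L_deg m (n + 1))"
    unfolding x(2) by (rule L.coset_ext(1)[OF zsub_R R_fcar g 0 x(1)])
  show "lie_val (coset_ext (L_deg m (n + 1)) ?g W) = tval W - rot (tval W)"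
    unfolding x(2) tval_class val[OF x(1), symmetric]
    by (rule L.coset_ext(2)[OF zsub_R R_fcar g 0 x(1)])
qed

end

text \<open>With a letter in the first factor, the bracket is the product minus its rotation. The
  bracket map thus becomes \<open>w - rot w\<close> on values.\<close>

lemma D_deg_eq: "D_deg m N = (tens m (N + 1))\<lparr>carrier := {W \<in> carrier (tens m (N + 1)). tval W \<in> {w. rot w = w}}\<rparr>"
proof -
  interpret L: realized "L_deg m (N + 1 + 1)" lie_val by (rule realized_L_deg)
  have "coset_ext (L_deg m (N + 1 + 1)) (\<lambda>(U, V). lie_bracket m U V) W = \<one>\<^bsub>L_deg m (N + 1 + 1)\<^esub> \<longleftrightarrow> rot (tval W) = tval W"
    if "W \<in> carrier (tens m (N + 1))" for W
    unfolding L.\<theta>_eq_0[OF bracket_map(1)[OF that], symmetric] bracket_map(2)[OF that] by auto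
  then have "kernel (tens m (N + 1)) (L_deg m (N + 1 + 1)) (coset_ext (L_deg m (N + 1 + 1)) (\<lambda>(U, V). lie_bracket m U V)) =
      {W \<in> carrier (tens m (N + 1)). tval W \<in> {w. rot w = w}}"
    unfolding kernel_def by blast
  then show ?thesis by (simp add: D_deg_def Let_def)
qed

lemma realized_D_deg: "realized (D_deg m N) tval"
  unfolding D_deg_eq
  by (rule realized.realized_subgroup[OF realized_tensor _ refl])
    (auto simp: zsub_def additive.zero[OF additive_rot] additive.diff[OF additive_rot])

lemma carrier_D_deg: "carrier (D_deg m N) = {W \<in> carrier (tens m (N + 1)). rot (tval W) = tval W}"
  by (simp add: D_deg_eq)

section \<open>The kernel of \<open>\<eta>\<close>\<close>

lemma keys_eta_rooted:
  "p \<in> Poly_Mapping.keys (eta_rooted I K) \<Longrightarrow> I \<in> rtrees m \<Longrightarrow> K \<in> rtrees m \<Longrightarrow>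
    p \<in> {1..m} \<times> deg_trees m (order_rt I + order_rt K + 1)"
proof (induction I arbitrary: K)
  case (Leaf a)
  then show ?case by (auto simp: rtrees_def)
next
  case (Br I J)
  then consider "p \<in> Poly_Mapping.keys (eta_rooted I (Br J K))" | "p \<in> Poly_Mapping.keys (eta_rooted J (Br K I))"
    using keys_add[of "eta_rooted I (Br J K)" "eta_rooted J (Br K I)"] by auto
  then show ?case
  proof cases
    case 1
    then show ?thesis using Br.IH(1)[OF 1] Br.prems by (simp add: algebra_simps)
  next
    case 2
    then show ?thesis using Br.IH(2)[OF 2] Br.prems by (simp add: algebra_simps)
  qed
qed

abbreviation "letter_val \<equiv> lin (\<lambda>(l, J). X l * lie J)"

text \<open>\<open>eta_rooted\<close> and \<open>cyc\<close> on commutators obey the same recursion,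
  \<open>cyc_comm\<close>. This identifies \<eta> with the cyclic sums studied before.\<close>

lemma letter_val_eta_rooted: "letter_val (eta_rooted I K) = cyc (lie I) (lie K)"
  by (induction I arbitrary: K) (simp_all add: lin_add cyc_comm)

lemma eta_formal_Tree:
  assumes "I \<in> rtrees m" "J \<in> rtrees m"
  shows "eta_formal m (Tree (inner_prod m I J)) = eta_rooted I J + eta_rooted J I"
proof -
  have "eta_sum ` inner_prod m I J = {eta_rooted I J + eta_rooted J I}"
    using inner_prod_nonempty[OF assms] inner_prod_eta[of _ m I J] by auto
  then show ?thesis by simp
qed

lemma eta_formal_Twisted:
  assumes "J \<in> rtrees m"
  shows "eta_formal m (Twisted J) = eta_rooted J J"
proof -
  have "the_elem (eta_sum ` inner_prod m J J) = eta_rooted J J + eta_rooted J J"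
    using eta_formal_Tree[OF assms assms] by simp
  then show ?thesis
    by (auto intro!: poly_mapping_eqI simp: Poly_Mapping.map.rep_eq lookup_add when_def)
qed

section \<open>\<eta> on generators and relations\<close>

definition gen_val :: "nat \<Rightarrow> generator \<Rightarrow> ncpoly" where
  "gen_val m t = letter_val (eta_formal m t)"

lemma gen_val_Tree: "I \<in> rtrees m \<Longrightarrow> J \<in> rtrees m \<Longrightarrow> gen_val m (Tree (inner_prod m I J)) = full_cyc (lie I) (lie J)"
  and gen_val_Twisted: "J \<in> rtrees m \<Longrightarrow> gen_val m (Twisted J) = cyc (lie J) (lie J)"
  by (simp_all only: gen_val_def eta_formal_Tree eta_formal_Twisted lin_add letter_val_eta_rooted full_cyc_def)

lemma generators_cases:
  assumes "t \<in> generators m N"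
  obtains (Tree) I J where "I \<in> rtrees m" "J \<in> rtrees m" "order_rt I + order_rt J = N" "t = Tree (inner_prod m I J)"
    | (Twisted) J where "J \<in> rtrees m" "2 * order_rt J = N" "t = Twisted J"
proof -
  consider G where "G \<in> trees m N" "t = Tree (iso_class m G)" | J where "J \<in> rtrees m" "2 * order_rt J = N" "t = Twisted J"
    using assms by (auto simp: generators_def)
  then show ?thesis
  proof cases
    case 1
    obtain I J where G: "G \<in> inner_prod m I J" by (rule trees_inner_prod[OF 1(1)])
    have "order_rt I + order_rt J = N"
      using inner_prod_trees[OF G] 1(1) by (simp add: trees_def)
    then show ?thesis
      using inner_prod_rtrees[OF G] iso_class_inner_prod[OF G] 1(2) by (intro Tree[of I J]) auto
  next
    case 2
    then show ?thesis by (rule Twisted)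
  qed
qed

lemma generators_Tree: "I \<in> rtrees m \<Longrightarrow> J \<in> rtrees m \<Longrightarrow> order_rt I + order_rt J = N \<Longrightarrow>
    Tree (inner_prod m I J) \<in> generators m N"
  using inner_prod_nonempty[of I m J] inner_prod_trees[of "canon I J" m I J] iso_class_inner_prod[of "canon I J" m I J]
  unfolding generators_def by blast

lemma generators_Twisted: "J \<in> rtrees m \<Longrightarrow> 2 * order_rt J = N \<Longrightarrow> Twisted J \<in> generators m N"
  by (simp add: generators_def)

lemma eta_gen:
  assumes "t \<in> generators m N"
  shows "eta_gen m N t \<in> carrier (D_deg m N)" and "tval (eta_gen m N t) = gen_val m t"
proof -
  interpret T: realized "tens m (N + 1)" tval by (rule realized_tensor)
  let ?g = "\<lambda>(l, J). pure_tensor (L_deg m 1) (L_deg m (N + 1)) (lie_class m (frag_of (Leaf l))) (lie_class m (frag_of J))"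
  have keys: "p \<in> {1..m} \<times> deg_trees m (N + 1)" if "p \<in> Poly_Mapping.keys (eta_formal m t)" for p
    using assms
  proof (cases rule: generators_cases)
    case (Tree I J)
    then have "p \<in> Poly_Mapping.keys (eta_rooted I J) \<union> Poly_Mapping.keys (eta_rooted J I)"
      using that keys_add[of "eta_rooted I J" "eta_rooted J I"] by (auto simp: eta_formal_Tree simp del: eta_formal.simps)
    then show ?thesis using Tree keys_eta_rooted[of p I J m] keys_eta_rooted[of p J I m] by (auto simp: add.commute)
  next
    case (Twisted J)
    then show ?thesis using that keys_eta_rooted[of p J J m] by (simp add: eta_formal_Twisted mult_2 del: eta_formal.simps)
  qed
  have g: "?g p \<in> carrier (tens m (N + 1))" "tval (?g p) = (case p of (l, J) \<Rightarrow> X l * lie J)"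
    if pk: "p \<in> Poly_Mapping.keys (eta_formal m t)" for p
  proof -
    obtain l J where p: "p = (l, J)" "l \<in> {1..m}" "J \<in> deg_trees m (N + 1)"
      using keys[OF pk] by blast
    show "?g p \<in> carrier (tens m (N + 1))" "tval (?g p) = (case p of (l, J) \<Rightarrow> X l * lie J)"
      unfolding p(1) prod.case by (rule pure_tensor_letter[OF p(2,3)])+
  qed
  have eq: "eta_gen m N t = free_ext (tens m (N + 1)) ?g (eta_formal m t)"
    by (simp add: eta_gen_def)
  show val: "tval (eta_gen m N t) = gen_val m t"
    unfolding eq gen_val_def
    by (rule trans[OF T.\<theta>_free_ext[OF g(1)]], assumption) (rule lin_cong_keys, rule g(2))
  have "eta_gen m N t \<in> carrier (tens m (N + 1))"
    unfolding eq by (rule T.free_ext_closed[OF g(1)])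
  moreover have "rot (gen_val m t) = gen_val m t"
    using assms
    by (cases rule: generators_cases) (simp_all add: gen_val_Tree gen_val_Twisted rot_full_cyc rot_cyc_self)
  ultimately show "eta_gen m N t \<in> carrier (D_deg m N)"
    by (simp add: carrier_D_deg val)
qed

lemma reorient_lie: "reorient r J J' \<Longrightarrow> mlabels J' = mlabels J \<and> lie J' = (if even r then lie J else - lie J)"
proof (induction rule: reorient.induct)
  case (3 a I I' b J J')
  then show ?case by (auto simp: comm_minus comm_anti[of "lie J" "lie I"])
qed (auto simp: comm_minus)

lemma full_cyc_anti: "full_cyc (comm a b) c + full_cyc (comm b a) c = 0"
  unfolding full_cyc_def comm_anti[of b a] by (simp add: cyc_simps)

definition T_rels :: "nat \<Rightarrow> nat \<Rightarrow> (generator \<Rightarrow>\<^sub>0 int) set" where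
  "T_rels m N = as_rels m N \<union> ihx_rels m N \<union> twisted_rels m N"

text \<open>Removes the graphs from the relations: cutting next to the reversed vertex turns each AS
  relation into one at the root of a factor.\<close>

lemma T_rels_cases:
  assumes "s \<in> T_rels m N"
  obtains (as) A B C where "{A, B, C} \<subseteq> rtrees m" "order_rt (Br A B) + order_rt C = N"
      "s = frag_of (Tree (inner_prod m (Br A B) C)) + frag_of (Tree (inner_prod m (Br B A) C))"
    | (ihx) A B C K where "{A, B, C, K} \<subseteq> rtrees m" "order_rt (Br (Br A B) C) + order_rt K = N"
      "s = frag_of (Tree (inner_prod m (Br (Br A B) C) K)) - frag_of (Tree (inner_prod m (Br A (Br B C)) K)) +
        frag_of (Tree (inner_prod m (Br B (Br A C)) K))"
    | (reorient) J J' r where "J \<in> rtrees m" "2 * order_rt J = N" "odd r" "reorient r J J'"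
      "s = frag_of (Twisted J') - frag_of (Twisted J)"
    | (quad) I H Z where "I \<in> rtrees m" "2 * order_rt I = N" "ihx_rooted I H Z"
      "s = frag_of (Twisted I) - frag_of (Twisted H) - frag_of (Twisted Z) + frag_of (Tree (inner_prod m H Z))"
    | (two) J where "J \<in> rtrees m" "2 * order_rt J = N"
      "s = frag_of (Twisted J) + frag_of (Twisted J) - frag_of (Tree (inner_prod m J J))"
proof -
  consider "s \<in> as_rels m N" | "s \<in> ihx_rels m N" | "s \<in> twisted_rels m N"
    using assms by (auto simp: T_rels_def)
  then show ?thesis
  proof cases
    case 1
    then obtain G v where G: "G \<in> trees m N" "v \<in> trivalent G"
      and s: "s = frag_of (Tree (iso_class m G)) + frag_of (Tree (iso_class m (reverse_at v G)))"
      by (auto simp: as_rels_def)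
    obtain A B C where ABC: "G \<in> inner_prod m (Br A B) C" "reverse_at v G \<in> inner_prod m (Br B A) C"
      by (rule reverse_at_inner_prod[OF G])
    have "order_rt (Br A B) + order_rt C = N"
      using inner_prod_trees[OF ABC(1)] G(1) by (simp add: trees_def)
    then show ?thesis
      using inner_prod_rtrees[OF ABC(1)] s iso_class_inner_prod[OF ABC(1)] iso_class_inner_prod[OF ABC(2)]
      by (intro as[of A B C]) auto
  next
    case 2
    then obtain A B C K where "{A, B, C, K} \<subseteq> rtrees m" "order_rt (Br (Br A B) C) + order_rt K = N"
      "s = frag_of (Tree (inner_prod m (Br (Br A B) C) K)) - frag_of (Tree (inner_prod m (Br A (Br B C)) K)) +
        frag_of (Tree (inner_prod m (Br B (Br A C)) K))"
      unfolding ihx_rels_def mem_Collect_eq by (elim exE conjE)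
    then show ?thesis by (rule ihx)
  next
    case 3
    then consider J J' r where "J \<in> rtrees m" "2 * order_rt J = N" "odd r" "reorient r J J'"
      "s = frag_of (Twisted J') - frag_of (Twisted J)"
    | I H Z where "I \<in> rtrees m" "2 * order_rt I = N" "ihx_rooted I H Z"
      "s = frag_of (Twisted I) - frag_of (Twisted H) - frag_of (Twisted Z) + frag_of (Tree (inner_prod m H Z))"
    | J where "J \<in> rtrees m" "2 * order_rt J = N"
      "s = frag_cmul 2 (frag_of (Twisted J)) - frag_of (Tree (inner_prod m J J))"
      unfolding twisted_rels_def by blast
    then show ?thesis
    proof cases
      case 1
      then show ?thesis by (rule reorient)
    next
      case 2
      then show ?thesis by (rule quad)
    next
      case 3
      have "frag_cmul 2 (frag_of (Twisted J)) = frag_of (Twisted J) + frag_of (Twisted J)"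
        using frag_cmul_distrib[of 1 1 "frag_of (Twisted J)"] by simp
      with 3 show ?thesis by (intro two[of J]) simp_all
    qed
  qed
qed

lemma ihx_rtrees: "ihx_rooted I H Z \<Longrightarrow> I \<in> rtrees m \<Longrightarrow>
    H \<in> rtrees m \<and> Z \<in> rtrees m \<and> order_rt H = order_rt I \<and> order_rt Z = order_rt I"
  using ihx_labels[of I H Z] mlabels_rtrees[of H I m] mlabels_rtrees[of Z I m] by (simp add: order_mlabels)

lemma gen_val_T_rels: "s \<in> T_rels m N \<Longrightarrow> lin (gen_val m) s = 0"
proof (erule T_rels_cases, goal_cases as ihx reorient quad two)
  case (as A B C)
  then show ?case by (simp add: lin_add gen_val_Tree full_cyc_anti)
next
  case (ihx A B C K)
  then show ?case
    using comm_jacobi[of "lie A" "lie B" "lie C"]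
    by (simp add: lin_add lin_diff gen_val_Tree flip: full_cyc_add full_cyc_diff)
next
  case (reorient J J' r)
  have "J' \<in> rtrees m" using reorient_lie[OF reorient(4)] mlabels_rtrees[of J' J m] reorient(1) by simp
  then show ?case
    using reorient reorient_lie[OF reorient(4)] by (simp add: lin_diff gen_val_Twisted cyc_simps)
next
  case (quad I H Z)
  note Z = ihx_rtrees[OF quad(3,1)]
  have "cyc (lie I) (lie I) = cyc (lie H) (lie H) + cyc (lie Z) (lie Z) - full_cyc (lie H) (lie Z)"
    unfolding lie_ihx[OF quad(3)] by (simp add: cyc_simps full_cyc_def)
  then show ?case
    using quad Z by (simp add: lin_add lin_diff gen_val_Twisted gen_val_Tree)
next
  case (two J)
  then show ?case by (simp add: lin_add lin_diff gen_val_Twisted gen_val_Tree full_cyc_def)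
qed

lemma T_rels_fcar: "T_rels m N \<subseteq> fcar (generators m N)"
proof
  note fcar = zsubD(4)[OF zsub_fcar] zsubD(2)[OF zsub_fcar] frag_of_fcar[THEN iffD2] generators_Tree generators_Twisted
  fix s assume "s \<in> T_rels m N"
  then show "s \<in> fcar (generators m N)"
  proof (cases rule: T_rels_cases)
    case (as A B C)
    then show ?thesis unfolding as(3) by (intro fcar) simp_all
  next
    case (ihx A B C K)
    then show ?thesis unfolding ihx(3) by (intro fcar) simp_all
  next
    case (reorient J J' r)
    have "J' \<in> rtrees m" "order_rt J' = order_rt J"
      using reorient_lie[OF reorient(4)] mlabels_rtrees[of J' J m] reorient(1) by (simp_all add: order_mlabels)
    then show ?thesis
      using reorient(1,2) unfolding reorient(5) by (intro fcar) simp_all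
  next
    case (quad I H Z)
    then show ?thesis
      using ihx_rtrees[OF quad(3,1)] unfolding quad(4) by (intro fcar) simp_all
  next
    case (two J)
    then show ?thesis unfolding two(3) by (intro fcar) simp_all
  qed
qed

lemma T_inf_rels_zspan: "T_inf_rels m N = zspan (T_rels m N)"
  using generate_zspan[OF T_rels_fcar] by (simp add: T_inf_rels_def T_rels_def)

lemma zsub_T_inf_rels: "zsub (T_inf_rels m N)"
  by (simp add: T_inf_rels_zspan zsub_zspan)

lemma T_inf_rels_fcar: "T_inf_rels m N \<subseteq> fcar (generators m N)"
  unfolding T_inf_rels_zspan by (rule zspan_subset[OF zsub_fcar T_rels_fcar])

lemma gen_val_T_inf_rels: "u \<in> T_inf_rels m N \<Longrightarrow> lin (gen_val m) u = 0"
  unfolding T_inf_rels_zspan by (erule zspan_zero_image[OF _ additive_lin]) (rule gen_val_T_rels)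

abbreviation tree_coset :: "nat \<Rightarrow> nat \<Rightarrow> (generator \<Rightarrow>\<^sub>0 int) \<Rightarrow> (generator \<Rightarrow>\<^sub>0 int) set" where
  "tree_coset m N t \<equiv> T_inf_rels m N #>\<^bsub>free_Abelian_group (generators m N)\<^esub> t"

text \<open>Through the realization of the target, membership in the kernel becomes the vanishing of
  a polynomial, independently of the chosen representative.\<close>

lemma kernel_eta: "kernel (T_inf m N) (D_deg m N) (eta m N) =
    tree_coset m N ` {t \<in> fcar (generators m N). lin (gen_val m) t = 0}"
proof -
  interpret D: realized "D_deg m N" tval by (rule realized_D_deg)
  have lin: "lin (\<lambda>t. tval (eta_gen m N t)) x = lin (gen_val m) x" if "x \<in> fcar (generators m N)" for x
    using that eta_gen(2)[of _ m N] by (intro lin_cong_keys) blast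
  have 0: "lin (\<lambda>t. tval (eta_gen m N t)) u = 0" if "u \<in> T_inf_rels m N" for u
    using that lin[of u] T_inf_rels_fcar[of m N] gen_val_T_inf_rels[OF that] by auto
  have eta: "eta m N (tree_coset m N x) \<in> carrier (D_deg m N)"
      "tval (eta m N (tree_coset m N x)) = lin (gen_val m) x" if "x \<in> fcar (generators m N)" for x
    unfolding eta_def lin[OF that, symmetric]
    by (rule D.coset_ext[OF zsub_T_inf_rels T_inf_rels_fcar eta_gen(1) 0 that]; assumption)+
  have "kernel (T_inf m N) (D_deg m N) (eta m N) =
      {U \<in> tree_coset m N ` fcar (generators m N). eta m N U = \<one>\<^bsub>D_deg m N\<^esub>}"
    by (simp add: kernel_def T_inf_def carrier_coset[OF zsub_T_inf_rels])
  also have "\<dots> = {U \<in> tree_coset m N ` fcar (generators m N). tval (eta m N U) = 0}"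
    using D.\<theta>_eq_0 eta(1) by blast
  also have "\<dots> = tree_coset m N ` {t \<in> fcar (generators m N). lin (gen_val m) t = 0}"
    using eta(2) by (auto intro: rev_image_eqI)
  finally show ?thesis .
qed

section \<open>Twisted squares\<close>

text \<open>\<open>tree_rels\<close> without \<open>square\<close> and \<open>sqr\<close>, which fail in the twisted
  tree groups.\<close>

inductive_set core_rels :: "(pgen \<Rightarrow>\<^sub>0 int) set" where
  sym: "frag_of (Inner I J) - frag_of (Inner J I) \<in> core_rels"
| inv: "frag_of (Inner (Br I J) L) - frag_of (Inner I (Br J L)) \<in> core_rels"
| anti: "frag_of (Inner (Br I J) L) + frag_of (Inner (Br J I) L) \<in> core_rels"
| ihx: "frag_of (Inner (Br (Br A B) C) D) - frag_of (Inner (Br A (Br B C)) D) +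
    frag_of (Inner (Br B (Br A C)) D) \<in> core_rels"
| two: "frag_of (Infty J) + frag_of (Infty J) - frag_of (Inner J J) \<in> core_rels"
| flip: "flip1 J J' \<Longrightarrow> frag_of (Infty J') - frag_of (Infty J) \<in> core_rels"
| quad: "ihx_rooted I H Z \<Longrightarrow>
    frag_of (Infty I) - frag_of (Infty H) - frag_of (Infty Z) + frag_of (Inner H Z) \<in> core_rels"

abbreviation "CR \<equiv> zspan core_rels"

lemma core_ihx_rooted:
  "ihx_rooted I H Z \<Longrightarrow> frag_of (Inner I J) - frag_of (Inner H J) + frag_of (Inner Z J) \<in> CR"
proof (induction arbitrary: J rule: ihx_rooted.induct)
  case (1 A B C)
  show ?case by (rule zspan_base) (rule core_rels.ihx)
next
  case (2 I H Z K)
  have inv: "frag_of (Inner (Br T K) J) - frag_of (Inner T (Br K J)) \<in> CR" for T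
    by (rule zspan_base) (rule core_rels.inv)
  have "(frag_of (Inner (Br I K) J) - frag_of (Inner I (Br K J))) - (frag_of (Inner (Br H K) J) - frag_of (Inner H (Br K J)))
      + (frag_of (Inner (Br Z K) J) - frag_of (Inner Z (Br K J)))
      + (frag_of (Inner I (Br K J)) - frag_of (Inner H (Br K J)) + frag_of (Inner Z (Br K J))) \<in> CR"
    by (intro zspan_add zspan_diff inv 2)
  then show ?case by (simp add: algebra_simps)
next
  case (3 I H Z K)
  have anti: "frag_of (Inner (Br K T) J) + frag_of (Inner T (Br K J)) \<in> CR" for T
  proof -
    have "(frag_of (Inner (Br K T) J) + frag_of (Inner (Br T K) J)) -
        (frag_of (Inner (Br T K) J) - frag_of (Inner T (Br K J))) \<in> CR"
      by (intro zspan_diff zspan_base core_rels.anti core_rels.inv)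
    then show ?thesis by simp
  qed
  have "(frag_of (Inner (Br K I) J) + frag_of (Inner I (Br K J))) - (frag_of (Inner (Br K H) J) + frag_of (Inner H (Br K J)))
      + (frag_of (Inner (Br K Z) J) + frag_of (Inner Z (Br K J)))
      - (frag_of (Inner I (Br K J)) - frag_of (Inner H (Br K J)) + frag_of (Inner Z (Br K J))) \<in> CR"
    by (intro zspan_add zspan_diff anti 3)
  then show ?case by (simp add: algebra_simps)
qed

text \<open>A tree of even order cut at a square has an IHX relation whose \<open>H\<close> and \<open>X\<close> agree.\<close>

lemma core_square: "frag_of (Inner (Br I I) (Br A B)) \<in> CR"
proof -
  have "(frag_of (Inner (Br (Br I I) A) B) - frag_of (Inner (Br I (Br I A)) B) + frag_of (Inner (Br I (Br I A)) B)) -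
      (frag_of (Inner (Br (Br I I) A) B) - frag_of (Inner (Br I I) (Br A B))) \<in> CR"
    by (intro zspan_diff zspan_base core_rels.ihx core_rels.inv)
  then show ?thesis by simp
qed

lemma core_square_right: "frag_of (Inner (Br A B) (Br I I)) \<in> CR"
  using zspan_add[OF zspan_base[OF core_rels.sym[of "Br A B" "Br I I"]] core_square[of I A B]] by simp

definition degenerate :: "rtree \<Rightarrow> bool" where
  "degenerate I \<longleftrightarrow> (\<exists>I' H. (I' = I \<or> flip1 I I') \<and> ihx_rooted I' H H)"

text \<open>If the last two terms of an IHX triple are both \<open>H\<close>, the quadratic relation
  reads \<open>Infty I' = 2 * Infty H - Inner H H\<close>, and the right side is zero by
  \<open>two\<close>. A reversal does not change \<infinity>-trees.\<close>

lemma core_degenerate: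
  assumes "degenerate I"
  shows "frag_of (Infty I) \<in> CR"
proof -
  obtain I' H where I': "I' = I \<or> flip1 I I'" and H: "ihx_rooted I' H H"
    using assms by (auto simp: degenerate_def)
  have "(frag_of (Infty I') - frag_of (Infty H) - frag_of (Infty H) + frag_of (Inner H H)) +
      (frag_of (Infty H) + frag_of (Infty H) - frag_of (Inner H H)) \<in> CR"
    by (intro zspan_add zspan_base core_rels.quad H core_rels.two)
  then have "frag_of (Infty I') \<in> CR" by simp
  with I' show ?thesis
    using zspan_diff[OF _ zspan_base[OF core_rels.flip[of I I']], of "frag_of (Infty I')"] by auto
qed

lemma degenerate_Br: "degenerate I \<Longrightarrow> degenerate (Br I J)" "degenerate I \<Longrightarrow> degenerate (Br J I)"
  unfolding degenerate_def by (metis ihx_rooted.intros(2) flip1_left) (metis ihx_rooted.intros(3) flip1_right)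

text \<open>For a square strictly below the root, some subtree is \<open>((A, A), K)\<close> up to
  one reversal, and its IHX triple has equal second and third terms. The same cannot be done for a
  square at the root.\<close>

lemma sqr_degenerate: "sqr I \<Longrightarrow> degenerate (Br I J) \<and> degenerate (Br J I)"
proof (induction arbitrary: J rule: sqr.induct)
  case (sqr_root I)
  show ?case unfolding degenerate_def by (metis ihx_rooted.intros(1) flip1_root)
qed (auto intro: degenerate_Br)

lemma core_sqr:
  assumes "sqr I"
  obtains A where "I = Br A A" | "frag_of (Infty I) \<in> CR"
  using assms core_degenerate sqr_degenerate by cases blast+

abbreviation tsq :: "treesum \<Rightarrow> (pgen \<Rightarrow>\<^sub>0 int)" where
  "tsq \<equiv> lin (\<lambda>J. frag_of (Infty (Br J J)))"

text \<open>Twice this \<infinity>-tree is the inner product of \<open>(J, J)\<close> with itself,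
  to which \<open>core_square\<close> applies.\<close>

lemma core_two: "frag_of (Infty (Br J J)) + frag_of (Infty (Br J J)) \<in> CR"
  using zspan_add[OF zspan_base[OF core_rels.two[of "Br J J"]] core_square[of J J J]] by simp

lemma tsq_double: "tsq u + tsq u \<in> CR"
  by (rule additive_zspan[of "\<lambda>u. tsq u + tsq u"])
    (auto intro: additiveI core_two simp: lin_add)

text \<open>The two \<infinity>-trees agree, since reversals leave \<infinity>-trees unchanged, and
  their sum is zero because each has order at most two.\<close>

lemma core_flip1:
  assumes "flip1 I I'"
  shows "frag_of (Infty (Br I I)) + frag_of (Infty (Br I' I')) \<in> CR"
proof -
  have "(frag_of (Infty (Br I I)) + frag_of (Infty (Br I I))) +
      (frag_of (Infty (Br I' I)) - frag_of (Infty (Br I I))) + (frag_of (Infty (Br I' I')) - frag_of (Infty (Br I' I))) \<in> CR"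
    using assms by (intro zspan_add core_two zspan_base core_rels.flip flip1.intros)
  then show ?thesis by simp
qed

text \<open>Expand \<open>((I,I))\<^sup>\<infinity>\<close> bilinearly by the quadratic relation; the mixed terms cancel up to
  inner products with a square.\<close>

lemma core_ihx:
  assumes "ihx_rooted I H Z"
  shows "frag_of (Infty (Br I I)) - frag_of (Infty (Br H H)) + frag_of (Infty (Br Z Z)) \<in> CR"
proof -
  let ?s = "\<lambda>I J. frag_of (Infty (Br I J)) :: pgen \<Rightarrow>\<^sub>0 int"
  let ?i = "\<lambda>A B C D. frag_of (Inner (Br A B) (Br C D)) :: pgen \<Rightarrow>\<^sub>0 int"
  note ihx = ihx_rooted.intros(2,3)[OF assms]
  have q1: "?s I I - ?s H I - ?s Z I + ?i H I Z I \<in> CR"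
    and q2: "?s H I - ?s H H - ?s H Z + ?i H H H Z \<in> CR"
    and q3: "?s Z I - ?s Z H - ?s Z Z + ?i Z H Z Z \<in> CR"
    by (intro zspan_base core_rels.quad ihx)+
  have f: "?s Z H - ?s H Z \<in> CR"
    by (intro zspan_base core_rels.flip flip1_root)
  have t1: "?s H Z + ?s H Z - ?i H Z H Z \<in> CR" and t2: "?s Z Z + ?s Z Z - ?i Z Z Z Z \<in> CR"
    by (intro zspan_base core_rels.two)+
  have w1: "?i H I Z I - ?i H H Z I + ?i H Z Z I \<in> CR"
    by (rule core_ihx_rooted[OF ihx(2)])
  have w2: "?i Z I H Z - ?i Z H H Z + ?i Z Z H Z \<in> CR"
    by (rule core_ihx_rooted[OF ihx(2)])
  have w3: "?i H Z Z I - ?i Z I H Z \<in> CR" and w4: "?i Z H H Z + ?i H Z H Z \<in> CR"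
    by (intro zspan_base core_rels.sym core_rels.anti)+
  have z: "?i H H Z I \<in> CR" "?i Z Z H Z \<in> CR" "?i H H H Z \<in> CR" "?i Z H Z Z \<in> CR" "?i Z Z Z Z \<in> CR"
    by (rule core_square core_square_right)+
  have "(?s I I - ?s H I - ?s Z I + ?i H I Z I) + (?s H I - ?s H H - ?s H Z + ?i H H H Z) +
      (?s Z I - ?s Z H - ?s Z Z + ?i Z H Z Z) + (?s Z H - ?s H Z) + (?s H Z + ?s H Z - ?i H Z H Z) +
      (?s Z Z + ?s Z Z - ?i Z Z Z Z) - (?i H I Z I - ?i H H Z I + ?i H Z Z I) +
      (?i H Z Z I - ?i Z I H Z) + (?i Z I H Z - ?i Z H H Z + ?i Z Z H Z) + (?i Z H H Z + ?i H Z H Z)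
      - ?i H H Z I - ?i Z Z H Z - ?i H H H Z - ?i Z H Z Z + ?i Z Z Z Z \<in> CR"
    by (intro zspan_add zspan_diff q1 q2 q3 f t1 t2 w1 w2 w3 w4 z)
  then show ?thesis by (simp add: algebra_simps)
qed

text \<open>Makes the map of the theorem well defined on Lie elements. For a tree \<open>I\<close>
  containing a square, the square lies strictly below the root of \<open>(I, I)\<close>, so
  \<open>sqr_degenerate\<close> applies.\<close>

lemma tsq_lie_rels:
  assumes "liesum u = 0"
  shows "tsq u \<in> CR"
proof (rule zspan_image[OF liesum_eq_0[OF assms] additive_lin])
  fix s assume "s \<in> lie_rels"
  then consider I I' where "flip1 I I'" "s = frag_of I + frag_of I'"
    | I H Z where "ihx_rooted I H Z" "s = frag_of I - frag_of H + frag_of Z"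
    | I where "sqr I" "s = frag_of I"
    by (auto simp: lie_rels_def as_ihx_def)
  then show "tsq s \<in> CR"
    by cases (simp_all add: lin_add lin_diff core_flip1 core_ihx core_degenerate sqr_degenerate)
qed

section \<open>Isomorphism classes of trees as inner products\<close>

text \<open>Pairs with other labels or another order are sent to 0, which gives a homomorphism on
  all formal sums; homogeneous relations survive or disappear as a whole.\<close>

definition gen_of :: "nat \<Rightarrow> nat \<Rightarrow> pgen \<Rightarrow> (generator \<Rightarrow>\<^sub>0 int)" where
  "gen_of m N g = (case g of
     Inner I J \<Rightarrow> if I \<in> rtrees m \<and> J \<in> rtrees m \<and> order_rt I + order_rt J = N
       then frag_of (Tree (inner_prod m I J)) else 0
   | Infty J \<Rightarrow> if J \<in> rtrees m \<and> 2 * order_rt J = N then frag_of (Twisted J) else 0)"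

lemma gen_of_simps [simp]:
  "gen_of m N (Inner I J) = (if I \<in> rtrees m \<and> J \<in> rtrees m \<and> order_rt I + order_rt J = N
     then frag_of (Tree (inner_prod m I J)) else 0)"
  "gen_of m N (Infty J) = (if J \<in> rtrees m \<and> 2 * order_rt J = N then frag_of (Twisted J) else 0)"
  by (simp_all add: gen_of_def)

lemma reorient_refl: "reorient 0 I I"
  using reorient.intros(2)[of 0 _ _ 0] by (induction I) (auto intro: reorient.intros(1))

lemma flip1_reorient: "flip1 I I' \<Longrightarrow> reorient 1 I I'"
proof (induction rule: flip1.induct)
  case (flip1_root I J)
  show ?case using reorient.intros(3)[OF reorient_refl reorient_refl, of I J] by simp
next
  case (flip1_left I I' J)
  then show ?case using reorient.intros(2)[OF _ reorient_refl, of 1 I I' J] by simp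
next
  case (flip1_right J J' I)
  then show ?case using reorient.intros(2)[OF reorient_refl, of 1 J J' I] by simp
qed

lemma as_T_rels:
  assumes "A \<in> rtrees m" "B \<in> rtrees m" "C \<in> rtrees m" "order_rt (Br A B) + order_rt C = N"
  shows "frag_of (Tree (inner_prod m (Br A B) C)) + frag_of (Tree (inner_prod m (Br B A) C)) \<in> T_rels m N"
proof -
  have G: "canon (Br A B) C \<in> inner_prod m (Br A B) C"
    using assms by (intro inner_prod_nonempty) simp_all
  obtain v where v: "v \<in> trivalent (canon (Br A B) C)" "reverse_at v (canon (Br A B) C) \<in> inner_prod m (Br B A) C"
    by (rule inner_prod_reverse_at[OF G])
  have "canon (Br A B) C \<in> trees m N" using inner_prod_trees[OF G] assms(4) by simp
  then have "frag_of (Tree (iso_class m (canon (Br A B) C))) +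
      frag_of (Tree (iso_class m (reverse_at v (canon (Br A B) C)))) \<in> as_rels m N"
    unfolding as_rels_def using v(1) by blast
  then show ?thesis
    unfolding iso_class_inner_prod[OF G] iso_class_inner_prod[OF v(2)] by (simp add: T_rels_def)
qed

lemma gen_of_core:
  assumes "u \<in> CR"
  shows "lin (gen_of m N) u \<in> T_inf_rels m N"
  unfolding T_inf_rels_zspan
proof (rule zspan_image[OF assms additive_lin])
  fix s assume "s \<in> core_rels"
  then have "lin (gen_of m N) s \<in> insert 0 (T_rels m N)"
  proof cases
    case (sym I J)
    then show ?thesis by (simp add: lin_diff inner_prod_sym[of m I J] conj_ac add.commute)
  next
    case (inv I J L)
    then show ?thesis by (simp add: lin_diff inner_prod_inv conj_ac add_ac)
  next
    case (anti I J L)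
    then show ?thesis using as_T_rels[of I m J L N] by (simp add: lin_add conj_ac add_ac)
  next
    case (ihx A B C D)
    show ?thesis
    proof (cases "{A, B, C, D} \<subseteq> rtrees m \<and> order_rt (Br (Br A B) C) + order_rt D = N")
      case True
      then have "frag_of (Tree (inner_prod m (Br (Br A B) C) D)) - frag_of (Tree (inner_prod m (Br A (Br B C)) D)) +
        frag_of (Tree (inner_prod m (Br B (Br A C)) D)) \<in> T_rels m N"
        unfolding T_rels_def ihx_rels_def by blast
      then show ?thesis using True by (simp add: ihx lin_add lin_diff add_ac)
    next
      case False
      then have "gen_of m N (Inner (Br (Br A B) C) D) = 0" "gen_of m N (Inner (Br A (Br B C)) D) = 0"
        "gen_of m N (Inner (Br B (Br A C)) D) = 0"
        by auto
      then show ?thesis by (simp only: ihx lin_add lin_diff lin_of) simp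
    qed
  next
    case (two J)
    show ?thesis
    proof (cases "J \<in> rtrees m \<and> 2 * order_rt J = N")
      case True
      then have "frag_cmul 2 (frag_of (Twisted J)) - frag_of (Tree (inner_prod m J J)) \<in> T_rels m N"
        unfolding T_rels_def twisted_rels_def by blast
      moreover have "frag_cmul 2 (frag_of (Twisted J)) = frag_of (Twisted J) + frag_of (Twisted J)"
        using frag_cmul_distrib[of 1 1 "frag_of (Twisted J)"] by simp
      ultimately show ?thesis using True by (simp add: two lin_add lin_diff flip: mult_2)
    next
      case False
      then show ?thesis by (auto simp: two lin_add lin_diff)
    qed
  next
    case (flip J J')
    have eq: "J' \<in> rtrees m \<longleftrightarrow> J \<in> rtrees m" "order_rt J' = order_rt J"
      using flip1_labels[OF flip(2)] mlabels_rtrees[of J' J m] by (simp_all add: order_mlabels)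
    show ?thesis
    proof (cases "J \<in> rtrees m \<and> 2 * order_rt J = N")
      case True
      then have "frag_of (Twisted J') - frag_of (Twisted J) \<in> T_rels m N"
        unfolding T_rels_def twisted_rels_def using flip1_reorient[OF flip(2)] odd_one by blast
      then show ?thesis using True eq by (simp add: flip lin_diff)
    next
      case False
      then show ?thesis using eq by (auto simp: flip lin_diff)
    qed
  next
    case (quad I H Z)
    have eq: "H \<in> rtrees m \<longleftrightarrow> I \<in> rtrees m" "order_rt H = order_rt I" "Z \<in> rtrees m \<longleftrightarrow> I \<in> rtrees m" "order_rt Z = order_rt I"
      using ihx_labels[OF quad(2)] mlabels_rtrees[of H I m] mlabels_rtrees[of Z I m] by (simp_all add: order_mlabels)
    show ?thesis
    proof (cases "I \<in> rtrees m \<and> 2 * order_rt I = N")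
      case True
      then have "frag_of (Twisted I) - frag_of (Twisted H) - frag_of (Twisted Z) + frag_of (Tree (inner_prod m H Z)) \<in> T_rels m N"
        unfolding T_rels_def twisted_rels_def using quad(2) by blast
      then show ?thesis using True eq by (simp add: quad lin_diff lin_add flip: mult_2)
    next
      case False
      then show ?thesis using eq by (auto simp: quad lin_diff lin_add)
    qed
  qed
  then show "lin (gen_of m N) s \<in> zspan (T_rels m N)"
    by (elim insertE) (auto intro: zspan_0 zspan_base)
qed

text \<open>Accounts for the relations that \<open>tree_rels\<close> has in excess: in even order
  all of them already hold in the twisted tree group, apart from the vanishing of \<infinity>-trees
  with a square at the root.\<close>

lemma gen_of_tree_rels:
  assumes "s \<in> tree_rels" "even N"
  shows "lin (gen_of m N) s \<in> zspan (T_rels m N \<union> {frag_of (Twisted (Br A A)) | A. A \<in> rtrees m \<and> 2 * order_rt (Br A A) = N})"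
    (is "_ \<in> zspan (_ \<union> ?Q)")
proof -
  have core: "lin (gen_of m N) u \<in> zspan (T_rels m N \<union> ?Q)" if "u \<in> CR" for u
  proof -
    have "T_rels m N \<subseteq> zspan (T_rels m N \<union> ?Q)" using zspan_base by blast
    then show ?thesis
      using gen_of_core[OF that, of m N] zspan_mono unfolding T_inf_rels_zspan by blast
  qed
  have sub: "u \<in> core_rels \<Longrightarrow> u \<in> CR" for u by (rule zspan_base)
  show ?thesis
    using assms(1)
  proof cases
    case (square I J)
    show ?thesis
    proof (cases J)
      \<comment> \<open>Evenness enters here: \<open>(I, I)\<close> has odd order and a leaf has
        order 0, so this inner product does not occur in order \<open>N\<close>.\<close>
      case (Leaf a)
      have "gen_of m N (Inner (Br I I) J) = 0"
        using assms(2) by (auto simp: Leaf)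
      then show ?thesis by (simp only: square lin_of zspan_0)
    next
      case (Br A B)
      show ?thesis unfolding square Br by (rule core[OF core_square])
    qed
  next
    case (sqr I)
    from sqr(2) show ?thesis
    proof (cases rule: core_sqr)
      case (1 A)
      show ?thesis
      proof (cases "A \<in> rtrees m \<and> 2 * order_rt (Br A A) = N")
        case True
        then have "frag_of (Twisted (Br A A)) \<in> zspan (T_rels m N \<union> ?Q)"
          by (intro zspan_base) blast
        then show ?thesis using True by (simp only: sqr 1 lin_of gen_of_simps Br_rtrees simp_thms if_True)
      next
        case False
        then have "gen_of m N (Infty (Br A A)) = 0" by auto
        then show ?thesis by (simp only: sqr 1 lin_of zspan_0)
      qed
    next
      case 2
      show ?thesis unfolding sqr by (rule core[OF 2])
    qed
  next
    case (sym I J)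
    show ?thesis unfolding sym by (intro core sub core_rels.intros)
  next
    case (inv I J L)
    show ?thesis unfolding inv by (intro core sub core_rels.intros)
  next
    case (anti I J L)
    show ?thesis unfolding anti by (intro core sub core_rels.intros)
  next
    case (ihx A B C D)
    show ?thesis unfolding ihx by (intro core sub core_rels.intros)
  next
    case (two J)
    show ?thesis unfolding two by (intro core sub core_rels.intros)
  next
    case (flip J J')
    show ?thesis unfolding flip(1) by (intro core sub core_rels.intros flip(2))
  next
    case (quad I H Z)
    show ?thesis unfolding quad(1) by (intro core sub core_rels.intros quad(2))
  qed
qed

section \<open>The isomorphism\<close>

abbreviation gsq :: "treesum \<Rightarrow> (generator \<Rightarrow>\<^sub>0 int)" where
  "gsq \<equiv> lin (\<lambda>J. frag_of (Twisted (Br J J)))"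

lemma gen_of_tsq:
  assumes "u \<in> fcar (deg_trees m k)" "k \<ge> 1"
  shows "lin (gen_of m (4 * k - 2)) (tsq u) = gsq u"
proof (rule additive_eq_keys[OF additive_compose[OF additive_lin additive_lin] additive_lin])
  fix J assume "J \<in> Poly_Mapping.keys u"
  then have "J \<in> rtrees m" "order_rt J + 1 = k" using assms(1) by auto
  then show "lin (gen_of m (4 * k - 2)) (tsq (frag_of J)) = gsq (frag_of J)" by auto
qed

lemma gsq_fcar:
  assumes "u \<in> fcar (deg_trees m k)" "k \<ge> 1"
  shows "gsq u \<in> fcar (generators m (4 * k - 2))"
proof
  show "Poly_Mapping.keys (gsq u) \<subseteq> generators m (4 * k - 2)"
  proof
    fix t assume "t \<in> Poly_Mapping.keys (gsq u)"
    then obtain J where "J \<in> Poly_Mapping.keys u" "t = Twisted (Br J J)"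
      using keys_lin[of t "\<lambda>J. frag_of (Twisted (Br J J))" u] by auto
    then show "t \<in> generators m (4 * k - 2)"
      using assms by (auto intro!: generators_Twisted)
  qed
qed

lemma gen_val_gsq: "u \<in> fcar (deg_trees m k) \<Longrightarrow> lin (gen_val m) (gsq u) = 0"
proof -
  assume u: "u \<in> fcar (deg_trees m k)"
  have "(\<lambda>u. lin (gen_val m) (gsq u)) u = (\<lambda>_. 0) u"
    by (rule additive_eq_keys[OF additive_compose[OF additive_lin additive_lin]])
      (use u in \<open>auto intro: additiveI simp: gen_val_Twisted\<close>)
  then show ?thesis by simp
qed

abbreviation untwist :: "(generator \<Rightarrow>\<^sub>0 int) \<Rightarrow> treesum" where
  "untwist \<equiv> lin (\<lambda>t. case t of Tree _ \<Rightarrow> 0 | Twisted J \<Rightarrow> frag_of J)"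

lemma reorient_QR: "reorient r J J' \<Longrightarrow> frag_of J' - frag_of J \<in> QR"
proof (induction rule: reorient.induct)
  case (1 l)
  show ?case by (simp add: zspan_0)
next
  case (2 a I I' b J J')
  have "br (frag_of I' - frag_of I) (frag_of J') + br (frag_of I) (frag_of J' - frag_of J) \<in> QR"
    by (intro zspan_add QR_br 2)
  then show ?case by (simp add: br_simps)
next
  case (3 a I I' b J J')
  have "br (frag_of I' - frag_of I) (frag_of J') + br (frag_of I) (frag_of J' - frag_of J)
      + (frag_of (Br I' J') + frag_of (Br J' I')) - (frag_of (Br I' J') + frag_of (Br I' J')) \<in> QR"
    by (intro zspan_add zspan_diff QR_br 3 flip1_QR flip1_root double_QR)
  then show ?case by (simp add: br_simps)
qed

lemma untwist_T_inf_rels: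
  assumes "u \<in> T_inf_rels m N"
  shows "untwist u \<in> QR"
proof (rule zspan_image[OF assms[unfolded T_inf_rels_zspan] additive_lin])
  fix s assume "s \<in> T_rels m N"
  then show "untwist s \<in> QR"
  proof (cases rule: T_rels_cases)
    case (reorient J J' r)
    then show ?thesis by (simp add: lin_diff reorient_QR)
  next
    case (quad I H Z)
    \<comment> \<open>The quadratic relation has the sign of \<open>Z\<close> opposite to IHX; the
      subtracted double corrects it.\<close>
    have "frag_of I - frag_of H + frag_of Z - (frag_of Z + frag_of Z) \<in> QR"
      by (intro zspan_diff ihx_QR quad(3) double_QR)
    then show ?thesis by (simp add: quad lin_diff lin_add)
  next
    case (two J)
    then show ?thesis by (simp add: lin_diff lin_add double_QR)
  qed (simp_all add: lin_diff lin_add zspan_0)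
qed

lemma untwist_gsq: "untwist (gsq u) = sqs u"
  by (rule additive_eqI[OF additive_compose[OF additive_lin additive_lin] additive_lin]) simp

text \<open>A tree of order \<open>N\<close> has \<open>N + 2\<close> leaves. An \<infinity>-tree is
  counted like the inner product of its tree with itself.\<close>

lemma gen_pgen:
  assumes "t \<in> generators m N"
  obtains g where "gen_of m N g = frag_of t" "pgen_size g = N + 2" "pgen_cyc g = gen_val m t"
  using assms
proof (cases rule: generators_cases)
  case (Tree I J)
  then show ?thesis
    by (intro that[of "Inner I J"]) (auto simp: pgen_size_def pgen_cyc_def size_mlabels gen_val_Tree)
next
  case (Twisted J)
  then show ?thesis
    by (intro that[of "Infty J"]) (auto simp: pgen_size_def pgen_cyc_def size_mlabels gen_val_Twisted)
qed

text \<open>The element is lifted to formal pairs, where it is a combination of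
  \<open>tree_rels\<close>, and pushed back with \<open>gen_of\<close>. Only the relations in excess
  leave something behind, and this is collected in \<open>y\<close>.\<close>

lemma gen_val_kernel:
  assumes k: "k \<ge> 1" and t: "t \<in> fcar (generators m (4 * k - 2))" "lin (gen_val m) t = 0"
  obtains y where "y \<in> fcar (deg_trees m k)" "t - gsq y \<in> T_inf_rels m (4 * k - 2)"
proof -
  define N where "N = 4 * k - 2"
  have "\<exists>g. gen_of m N g = frag_of a \<and> pgen_size g = N + 2 \<and> pgen_cyc g = gen_val m a"
    if "a \<in> Poly_Mapping.keys t" for a
    using t(1) that gen_pgen[of a m N] unfolding N_def by blast
  then obtain p where p: "gen_of m N (p a) = frag_of a" "pgen_size (p a) = N + 2" "pgen_cyc (p a) = gen_val m a"
    if "a \<in> Poly_Mapping.keys t" for a by metis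
  let ?p = "lin (\<lambda>a. frag_of (p a))"
  have "lin pgen_cyc (?p t) = lin (gen_val m) t"
    by (rule additive_eq_keys[OF additive_compose[OF additive_lin additive_lin] additive_lin]) (simp add: p)
  moreover have "pgen_size g = N + 2" if "g \<in> Poly_Mapping.keys (?p t)" for g
    using keys_lin[OF that] p(2) by auto
  ultimately have "?p t \<in> zspan tree_rels"
    using t(2) by (intro lin_pgen_cyc_eq_0[of _ "N + 2"]) simp_all
  then have "lin (gen_of m N) (?p t) \<in> zspan (T_rels m N \<union>
      {frag_of (Twisted (Br A A)) | A. A \<in> rtrees m \<and> 2 * order_rt (Br A A) = N})" (is "_ \<in> zspan (_ \<union> ?Q)")
    by (rule zspan_image[OF _ additive_lin gen_of_tree_rels]) (use k in \<open>simp_all add: N_def\<close>)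
  moreover have "lin (gen_of m N) (?p t) = t"
    using additive_eq_keys[OF additive_compose[OF additive_lin additive_lin], of "\<lambda>t. t" t "gen_of m N" "\<lambda>a. frag_of (p a)"]
    by (simp add: p additiveI)
  ultimately have t': "t \<in> zspan (T_rels m N \<union> ?Q)" by simp
  let ?D = "{t. \<exists>y \<in> fcar (deg_trees m k). t - gsq y \<in> T_inf_rels m N}"
  note T = zsub_T_inf_rels[of m N]
  have "T_rels m N \<union> ?Q \<subseteq> ?D"
  proof
    fix s assume "s \<in> T_rels m N \<union> ?Q"
    then consider "s \<in> T_rels m N" | A where "A \<in> rtrees m" "2 * order_rt (Br A A) = N" "s = frag_of (Twisted (Br A A))"
      by blast
    then show "s \<in> ?D"
    proof cases
      case 1
      then show ?thesis by (auto simp: T_inf_rels_zspan zspan_base intro!: exI[of _ 0])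
    next
      case 2
      then show ?thesis
        using k zsubD(1)[OF T] by (auto simp: N_def intro!: exI[of _ "frag_of A"])
    qed
  qed
  moreover have "zsub ?D"
    unfolding zsub_def
  proof (intro conjI ballI)
    show "0 \<in> ?D" using zsubD(1)[OF T] by (auto intro!: exI[of _ 0])
    fix a b assume "a \<in> ?D" "b \<in> ?D"
    then obtain y z where y: "y \<in> fcar (deg_trees m k)" "a - gsq y \<in> T_inf_rels m N"
      and z: "z \<in> fcar (deg_trees m k)" "b - gsq z \<in> T_inf_rels m N" by blast
    have "(a - b) - gsq (y - z) \<in> T_inf_rels m N"
      using zsubD(2)[OF T y(2) z(2)] by (simp add: lin_diff algebra_simps)
    then show "a - b \<in> ?D" using zsubD(2)[OF zsub_fcar y(1) z(1)] by blast
  qed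
  ultimately have "t \<in> ?D" using t' zspan_subset by blast
  then show ?thesis using that unfolding N_def by blast
qed

section \<open>The map on the tensor product with the integers modulo two\<close>

locale twisted_squares =
  fixes m k :: nat
  assumes k: "k \<ge> 1"
begin

abbreviation "N \<equiv> 4 * k - 2"
abbreviation "Z2 \<equiv> integer_mod_group 2"
abbreviation "L \<equiv> L_deg m k"
abbreviation "F \<equiv> fcar (deg_trees m k)"
abbreviation "TR \<equiv> T_inf_rels m N"

sublocale L: realized L lie_val by (rule realized_L_deg)
sublocale Z2: comm_group Z2 by (rule abelian_integer_mod_group)
sublocale tensor_pair Z2 L ..

lemma carrier_Z2: "carrier Z2 = {0, 1}"
  by (auto simp: carrier_integer_mod_group)

lemma one_Z2 [simp]: "1 \<in> carrier Z2"
  by (simp add: carrier_Z2)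

lemma gsq_double: "y \<in> F \<Longrightarrow> gsq y + gsq y \<in> TR"
  using gen_of_core[OF tsq_double[of y], of m N] by (simp add: lin_add gen_of_tsq[OF _ k])

lemma gsq_liesum: "y \<in> F \<Longrightarrow> liesum y = 0 \<Longrightarrow> gsq y \<in> TR"
  using gen_of_core[OF tsq_lie_rels[of y], of m N] by (simp add: gen_of_tsq[OF _ k])

definition lift :: "treesum set \<Rightarrow> treesum" where
  "lift Y = (SOME y. y \<in> F \<and> Y = lie_class m y)"

lemma lift: "Y \<in> carrier L \<Longrightarrow> lift Y \<in> F" "Y \<in> carrier L \<Longrightarrow> lie_val Y = liesum (lift Y)"
proof -
  assume "Y \<in> carrier L"
  then have "\<exists>y. y \<in> F \<and> Y = lie_class m y" by (auto simp: carrier_L_deg)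
  from someI_ex[OF this] have eq: "lift Y \<in> F \<and> Y = lie_class m (lift Y)" unfolding lift_def .
  show "lift Y \<in> F" by (rule eq[THEN conjunct1])
  show "lie_val Y = liesum (lift Y)"
    by (rule trans[OF arg_cong[OF eq[THEN conjunct2], of lie_val] lie_val_class])
qed

text \<open>The lifts are chosen separately for each class, so the tensor relations are respected
  only modulo \<open>TR\<close>.\<close>

definition sqmap :: "(int \<times> treesum set \<Rightarrow>\<^sub>0 int) \<Rightarrow> (generator \<Rightarrow>\<^sub>0 int)" where
  "sqmap = lin (\<lambda>(i, Y). if i = 1 then gsq (lift Y) else 0)"

lemma additive_sqmap: "additive sqmap"
  by (simp add: sqmap_def additive_lin)

lemmas sqmap_diff = additive.diff[OF additive_sqmap]

lemma sqmap_of [simp]: "sqmap (frag_of (i, Y)) = (if i = 1 then gsq (lift Y) else 0)"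
  by (simp add: sqmap_def)

lemma sqmap_class: "y \<in> F \<Longrightarrow> sqmap (frag_of (1, lie_class m y)) - gsq y \<in> TR"
proof -
  assume y: "y \<in> F"
  then have c: "lie_class m y \<in> carrier L" by (auto simp: carrier_L_deg)
  have "gsq (lift (lie_class m y) - y) \<in> TR"
    using lift[OF c] y zsubD(2)[OF zsub_fcar, of _ "deg_trees m k" y]
    by (intro gsq_liesum) (auto simp: lin_diff)
  then show ?thesis by (simp add: lin_diff)
qed

text \<open>In the first factor the only nontrivial relation comes from 1 + 1 = 0 and is met by
  \<open>gsq_double\<close>. In the second factor the chosen lifts fail to be additive by a Lie
  relation, which \<open>gsq_liesum\<close> absorbs.\<close>

lemma sqmap_R:
  assumes "u \<in> R"
  shows "sqmap u \<in> TR"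
proof -
  have "sqmap s \<in> TR" if "s \<in> relsA \<union> relsB" for s
  proof -
    note T = zsub_T_inf_rels[of m N]
    from that consider (A) i j Y where "i \<in> carrier Z2" "j \<in> carrier Z2" "Y \<in> carrier L"
        "s = frag_of (i \<otimes>\<^bsub>Z2\<^esub> j, Y) - frag_of (i, Y) - frag_of (j, Y)"
      | (B) i Y Z where "i \<in> carrier Z2" "Y \<in> carrier L" "Z \<in> carrier L"
        "s = frag_of (i, Y \<otimes>\<^bsub>L\<^esub> Z) - frag_of (i, Y) - frag_of (i, Z)"
      unfolding relsA_def relsB_def by blast
    then show ?thesis
    proof cases
      case A
      have "- (gsq (lift Y) + gsq (lift Y)) \<in> TR"
        by (rule zsubD(3)[OF T gsq_double[OF lift(1)[OF A(3)]]])
      then show ?thesis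
        using A(1,2) zsubD(1)[OF T] unfolding A(4) carrier_Z2 by (auto simp: sqmap_diff mult_integer_mod_group)
    next
      case B
      have YZ: "Y \<otimes>\<^bsub>L\<^esub> Z \<in> carrier L" using B by simp
      have "lift (Y \<otimes>\<^bsub>L\<^esub> Z) - lift Y - lift Z \<in> F"
        by (intro zsubD(2)[OF zsub_fcar] lift B YZ)
      moreover have "liesum (lift (Y \<otimes>\<^bsub>L\<^esub> Z) - lift Y - lift Z) = 0"
        using L.\<theta>_mult[OF B(2,3)] by (simp add: lin_diff lift(2)[OF YZ] lift(2)[OF B(2)] lift(2)[OF B(3)])
      ultimately have "gsq (lift (Y \<otimes>\<^bsub>L\<^esub> Z) - lift Y - lift Z) \<in> TR"
        by (rule gsq_liesum)
      then show ?thesis using zsubD(1)[OF T] by (auto simp: B(4) sqmap_diff lin_diff)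
    qed
  qed
  then have "sqmap u \<in> zspan TR"
    by (intro zspan_image[OF assms[unfolded R_zspan] additive_sqmap] zspan_base)
  then show ?thesis
    using zspan_subset[OF zsub_T_inf_rels, of TR m N] by blast
qed

lemma sqmap_keys:
  assumes "u \<in> fcar S"
  shows "sqmap u \<in> fcar (generators m N)" and "lin (gen_val m) (sqmap u) = 0"
proof -
  have "sqmap u \<in> fcar (generators m N) \<and> lin (gen_val m) (sqmap u) = 0"
    using assms
  proof (induction rule: fcar_induct)
    case zero
    then show ?case using additive.zero[OF additive_sqmap] by simp
  next
    case (one a)
    then obtain i Y where a: "a = (i, Y)" "Y \<in> carrier L" by blast
    show ?case
      using gsq_fcar[OF lift(1)[OF a(2)] k] gen_val_gsq[OF lift(1)[OF a(2)]] by (simp add: a(1))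
  next
    case (diff u v)
    then show ?case
      using zsubD(2)[OF zsub_fcar, of "sqmap u" "generators m N" "sqmap v"] by (simp add: sqmap_diff lin_diff)
  qed
  then show "sqmap u \<in> fcar (generators m N)" "lin (gen_val m) (sqmap u) = 0" by simp_all
qed

lemma Z2_normal_form:
  assumes "u \<in> fcar S"
  obtains Y where "Y \<in> carrier L" "u - frag_of (1, Y) \<in> R"
proof -
  have "\<exists>Y \<in> {()} \<rightarrow> carrier L. u - (\<Sum>e\<in>{()}. frag_of (1, Y e)) \<in> R"
  proof (rule normal_form[OF _ _ _ assms])
    fix a b assume ab: "a \<in> carrier Z2" "b \<in> carrier L"
    show "\<exists>Y \<in> {()} \<rightarrow> carrier L. frag_of (a, b) - (\<Sum>e\<in>{()}. frag_of (1, Y e)) \<in> R"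
    proof (cases "a = 1")
      case True
      then show ?thesis using ab zsubD(1)[OF zsub_R] by (intro bexI[of _ "\<lambda>_. b"]) auto
    next
      case False
      then have "frag_of (a, b) \<in> R" using ab R_one_left[of b] by (auto simp: carrier_Z2)
      then show ?thesis
        using zsubD(2)[OF zsub_R _ R_one_right[OF one_Z2], of "frag_of (a, b)"]
        by (intro bexI[of _ "\<lambda>_. \<one>\<^bsub>L\<^esub>"]) auto
    qed
  qed auto
  then obtain Y where "Y \<in> {()} \<rightarrow> carrier L" "u - frag_of (1, Y ()) \<in> R" by auto
  then show ?thesis by (intro that[of "Y ()"]) auto
qed

lemma R_double: "b \<in> carrier L \<Longrightarrow> frag_of (1, b \<otimes>\<^bsub>L\<^esub> b) \<in> R"
proof -
  assume b: "b \<in> carrier L"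
  have "frag_of (1 \<otimes>\<^bsub>Z2\<^esub> 1, b) \<in> R"
    using R_one_left[OF b] by (simp add: mult_integer_mod_group)
  from zsubD(2)[OF zsub_R zsubD(4)[OF zsub_R this R_right[OF one_Z2 b b]] R_left[OF one_Z2 one_Z2 b]]
  show ?thesis by simp
qed

text \<open>Relations in the given span may have any labels and degrees; \<open>res\<close> cuts
  them down to those of \<open>F\<close>. A double becomes a tensor relation because 1 + 1 = 0 in
  the first factor.\<close>

lemma R_lie_rels:
  assumes "y \<in> F" "y \<in> zspan (lie_rels \<union> {frag_of I + frag_of I | I. True})"
  shows "frag_of (1, lie_class m y) \<in> R"
proof -
  define res where "res = lin (\<lambda>I. if I \<in> deg_trees m k then frag_of I else 0)"
  have res: "additive res" "\<And>I. res (frag_of I) = (if I \<in> deg_trees m k then frag_of I else 0)"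
    by (simp_all add: res_def additive_lin)
  note res_simps = additive.add[OF res(1)] additive.diff[OF res(1)] res(2)
  have resF: "res u \<in> F" for u
    using keys_lin[of _ "\<lambda>I. if I \<in> deg_trees m k then frag_of I else 0" u]
    by (fastforce simp: res_def split: if_splits)
  have car: "lie_class m (res u) \<in> carrier L" for u
    using resF by (auto simp: carrier_L_deg)
  have null: "frag_of (1, lie_class m u) \<in> R" if "u \<in> F" "liesum u = 0" for u
  proof -
    have "lie_class m u = lie_class m 0"
      using that by (auto simp: lie_class_eq_iff lie_ideal_eq)
    then show ?thesis using R_one_right[OF one_Z2] by (simp add: one_L_deg)
  qed
  have main: "frag_of (1, lie_class m (res u)) \<in> R" if "u \<in> zspan (lie_rels \<union> {frag_of I + frag_of I | I. True})" for u
    using that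
  proof induction
    case zspan_0
    show ?case by (rule null) (use resF[of 0] additive.zero[OF res(1)] in simp_all)
  next
    case (zspan_base s)
    have mlab: "I \<in> deg_trees m k \<longleftrightarrow> J \<in> deg_trees m k" if "mlabels I = mlabels J" for I J
      using mlabels_rtrees[OF that, of m] that by (simp add: order_mlabels)
    from zspan_base consider (flip) I I' where "flip1 I I'" "s = frag_of I + frag_of I'"
      | (ihx) I H Z where "ihx_rooted I H Z" "s = frag_of I - frag_of H + frag_of Z"
      | (sqr) I where "sqr I" "s = frag_of I"
      | (two) I where "s = frag_of I + frag_of I"
      by (auto simp: lie_rels_def as_ihx_def)
    then show ?case
    proof cases
      case flip
      then have "liesum (res s) = 0"
        using mlab[OF flip1_labels[OF flip(1)]] by (simp add: res_simps lin_add lie_flip1[OF flip(1)])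
      then show ?thesis by (rule null[OF resF])
    next
      case ihx
      then have "liesum (res s) = 0"
        using mlab[of H I] mlab[of Z I] ihx_labels[OF ihx(1)]
        by (simp add: res_simps lin_add lin_diff lie_ihx[OF ihx(1)])
      then show ?thesis by (rule null[OF resF])
    next
      case sqr
      then have "liesum (res s) = 0" by (simp add: res_simps lie_sqr[OF sqr(1)])
      then show ?thesis by (rule null[OF resF])
    next
      case two
      have "lie_class m (res s) = lie_class m (res (frag_of I)) \<otimes>\<^bsub>L\<^esub> lie_class m (res (frag_of I))"
        by (simp add: two additive.add[OF res(1)] mult_L_deg)
      then show ?thesis using R_double[OF car] by simp
    qed
  next
    case (zspan_diff a b)
    have "lie_class m (res (a - b)) \<otimes>\<^bsub>L\<^esub> lie_class m (res b) = lie_class m (res a)"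
      by (simp add: mult_L_deg additive.diff[OF res(1)])
    with R_right[OF one_Z2 car[of "a - b"] car[of b]]
    have "frag_of (1, lie_class m (res a)) - frag_of (1, lie_class m (res (a - b))) - frag_of (1, lie_class m (res b)) \<in> R"
      by simp
    from zsubD(2)[OF zsub_R zsubD(2)[OF zsub_R zspan_diff(3,4)] this] show ?case by simp
  qed
  have "res y = y"
    by (rule additive_eq_keys[of res "\<lambda>u. u"]) (use assms(1) res in \<open>auto intro: additiveI\<close>)
  with main[OF assms(2)] show ?thesis by simp
qed

text \<open>In normal form the tensor is 1 with some \<open>y\<close>. Applying
  \<open>untwist\<close> to the vanishing of its image puts the square of \<open>y\<close> in
  \<open>QR\<close>, so \<open>y\<close> is zero in the Lie ring modulo two by
  \<open>sqs_QR_imp\<close>.\<close>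

lemma sqmap_inj:
  assumes "u \<in> fcar S" "sqmap u \<in> TR"
  shows "u \<in> R"
proof -
  obtain Y where Y: "Y \<in> carrier L" "u - frag_of (1, Y) \<in> R" by (rule Z2_normal_form[OF assms(1)])
  obtain y where y: "y \<in> F" "Y = lie_class m y" using Y(1) by (auto simp: carrier_L_deg)
  note T = zsub_T_inf_rels[of m N]
  have "sqmap u - sqmap (u - frag_of (1, Y)) - (sqmap (frag_of (1, lie_class m y)) - gsq y) \<in> TR"
    by (intro zsubD(2)[OF T] assms(2) sqmap_R Y(2) sqmap_class y(1))
  then have "gsq y \<in> TR" by (simp add: y(2) sqmap_diff)
  then have "sqs y \<in> QR" using untwist_T_inf_rels[of "gsq y"] by (simp add: untwist_gsq)
  moreover have "y \<in> sized k" using y(1) by (auto simp: sized_def size_mlabels)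
  ultimately have "y \<in> zspan (lie_rels \<union> {frag_of I + frag_of I | I. True})" by (intro sqs_QR_imp)
  then have "frag_of (1, Y) \<in> R" unfolding y(2) by (rule R_lie_rels[OF y(1)])
  from zsubD(4)[OF zsub_R Y(2) this] show ?thesis by simp
qed

definition phi :: "(int \<times> treesum set \<Rightarrow>\<^sub>0 int) set \<Rightarrow> (generator \<Rightarrow>\<^sub>0 int) set" where
  "phi A = tree_coset m N (sqmap (SOME x. x \<in> A))"

lemma phi_coset: "phi (R #>\<^bsub>free_Abelian_group S\<^esub> x) = tree_coset m N (sqmap x)"
  using sqmap_R[OF some_coset[OF zsub_R, of S x]]
  by (simp add: phi_def coset_eq_iff[OF zsub_T_inf_rels] sqmap_diff)

lemma phi_iso: "phi \<in> iso (tensor Z2 L)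
    ((T_inf m N)\<lparr>carrier := kernel (T_inf m N) (D_deg m N) (eta m N)\<rparr>)"
proof -
  have car: "phi (R #>\<^bsub>free_Abelian_group S\<^esub> x) \<in> kernel (T_inf m N) (D_deg m N) (eta m N)" if "x \<in> fcar S" for x
    unfolding kernel_eta phi_coset using sqmap_keys[OF that] by blast
  have "phi \<in> hom (tensor Z2 L) ((T_inf m N)\<lparr>carrier := kernel (T_inf m N) (D_deg m N) (eta m N)\<rparr>)"
  proof (rule homI)
    fix A B assume "A \<in> carrier (tensor Z2 L)" "B \<in> carrier (tensor Z2 L)"
    then obtain x y where A: "A = R #>\<^bsub>free_Abelian_group S\<^esub> x" and B: "B = R #>\<^bsub>free_Abelian_group S\<^esub> y"
      unfolding carrier_tensor by blast
    have "phi (A \<otimes>\<^bsub>tensor Z2 L\<^esub> B) = tree_coset m N (sqmap x + sqmap y)"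
      unfolding A B tensor_def mult_coset[OF zsub_R] phi_coset by (simp only: additive.add[OF additive_sqmap])
    then show "phi (A \<otimes>\<^bsub>tensor Z2 L\<^esub> B) =
        phi A \<otimes>\<^bsub>(T_inf m N)\<lparr>carrier := kernel (T_inf m N) (D_deg m N) (eta m N)\<rparr>\<^esub> phi B"
      using mult_coset[OF zsub_T_inf_rels, of "generators m N" m N "sqmap x" "sqmap y"]
      by (simp add: A B phi_coset T_inf_def del: mult_FactGroup)
  next
    fix A assume "A \<in> carrier (tensor Z2 L)"
    then show "phi A \<in> carrier ((T_inf m N)\<lparr>carrier := kernel (T_inf m N) (D_deg m N) (eta m N)\<rparr>)"
      unfolding carrier_tensor using car by auto
  qed
  moreover have "inj_on phi (carrier (tensor Z2 L))"
  proof (rule inj_onI)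
    fix A B assume "A \<in> carrier (tensor Z2 L)" "B \<in> carrier (tensor Z2 L)" and eq: "phi A = phi B"
    then obtain x y where x: "x \<in> fcar S" "A = R #>\<^bsub>free_Abelian_group S\<^esub> x"
      and y: "y \<in> fcar S" "B = R #>\<^bsub>free_Abelian_group S\<^esub> y"
      unfolding carrier_tensor by blast
    have "sqmap (x - y) \<in> TR"
      using eq by (simp add: x y phi_coset coset_eq_iff[OF zsub_T_inf_rels] sqmap_diff)
    then show "A = B"
      unfolding x y coset_eq_iff[OF zsub_R] by (intro sqmap_inj zsubD(2)[OF zsub_fcar x(1) y(1)])
  qed
  moreover have "kernel (T_inf m N) (D_deg m N) (eta m N) \<subseteq> phi ` carrier (tensor Z2 L)"
  proof
    fix U assume "U \<in> kernel (T_inf m N) (D_deg m N) (eta m N)"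
    then obtain t where t: "t \<in> fcar (generators m N)" "lin (gen_val m) t = 0" "U = tree_coset m N t"
      unfolding kernel_eta by blast
    obtain y where y: "y \<in> F" "t - gsq y \<in> TR" by (rule gen_val_kernel[OF k t(1,2)])
    have "sqmap (frag_of (1, lie_class m y)) - gsq y - (t - gsq y) \<in> TR"
      by (intro zsubD(2)[OF zsub_T_inf_rels] sqmap_class y)
    then have "U = phi (R #>\<^bsub>free_Abelian_group S\<^esub> frag_of (1, lie_class m y))"
      unfolding t(3) phi_coset using coset_eq_iff[OF zsub_T_inf_rels] by fastforce
    moreover have "frag_of (1 :: int, lie_class m y) \<in> fcar S"
      unfolding frag_of_fcar using y(1) by (simp add: carrier_L_deg)
    ultimately show "U \<in> phi ` carrier (tensor Z2 L)" unfolding carrier_tensor by blast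
  qed
  ultimately show ?thesis
    unfolding iso_def bij_betw_def hom_def by auto
qed

lemma phi_pure:
  assumes "J \<in> rtrees m" "order_rt J = k - 1"
  shows "phi (pure_tensor Z2 L 1 (lie_class m (frag_of J))) = T_inf_class m N (Twisted (Br J J))"
  using sqmap_class[of "frag_of J"] assms k
  by (simp add: pure_tensor_def phi_coset T_inf_class_def coset_eq_iff[OF zsub_T_inf_rels])

end

theorem proposition1p14:
  fixes m k :: nat
  assumes "m \<ge> 1" and "k \<ge> 1"
  shows "\<exists>\<phi> \<in> iso (tensor (integer_mod_group 2) (L_deg m k))
                   ((T_inf m (4 * k - 2))
                      \<lparr>carrier := kernel (T_inf m (4 * k - 2)) (D_deg m (4 * k - 2)) (eta m (4 * k - 2))\<rparr>).
           \<forall>J \<in> rtrees m. order_rt J = k - 1 \<longrightarrow>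
             \<phi> (pure_tensor (integer_mod_group 2) (L_deg m k) 1 (lie_class m (frag_of J)))
               = T_inf_class m (4 * k - 2) (Twisted (Br J J))"
proof -
  interpret twisted_squares m k using assms(2) by unfold_locales
  show ?thesis using phi_iso phi_pure by blast
qed

end
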